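(* Let $\Gamma=\langle a_1,\dots,a_n\rangle\subset\mathbb{Q}^*$ be generated by $n\ge1$ elements $a_i\in\mathbb{Q}^*\setminus\{\pm1\}$, and let $S=\prod_pS_p\subset A$ with $S_p=A_p\setminus\bigcup_{i=1}^n\ker\varphi_{p,i}$. Suppose there is no subset $I\subset\{1,\dots,n\}$ of odd cardinality such that $\prod_{i\in I}a_i$ is a square in $\mathbb{Q}^*$. Then $\nu(G\cap S)/\nu(G)=0$ if and only if both of the following hold: (a) the kernel of $w_2:\overline\Gamma_2\to\mu_2$ contains $-3\bmod(\mathbb{Q}^* )^2$; (b) the kernel of every character $\chi:\overline\Gamma_3\to\mu_3$ contains at least one element $a_i\bmod(\mathbb{Q}^* )^3$. Moreover, if none of the $a_i$ is a cube in $\mathbb{Q}^*$, then condition (b) does not hold if $n\le3$, or if the $\mathbb{F}_3$-rank of $\overline\Gamma_3$ is either $1$ or at least $n-1$.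
   Context: Put $\Gamma_\infty=\{x\in\mathbb{C}^*: x^m\in\Gamma$ for some $m\ge1\}$, $\Gamma_{p^\infty}=\{x\in\mathbb{C}^*: x^{p^m}\in\Gamma$ for some $m\ge1\}$, and for a subgroup $\Delta\subset\mathbb{Q}^*$ and prime $p$, $\Delta^{1/p}=\{x\in\mathbb{C}^*:x^p\in\Delta\}$. Let $A=\mathrm{Aut}_{\Gamma_\infty\cap\mathbb{Q}^*}(\Gamma_\infty)$ (group automorphisms fixing $\Gamma_\infty\cap\mathbb{Q}^*$ pointwise), $A_p=\mathrm{Aut}_{\Gamma_{p^\infty}\cap\mathbb{Q}^*}(\Gamma_{p^\infty})$, with $A\cong\prod_pA_p$ via restriction; $G=\mathrm{Gal}(\mathbb{Q}(\Gamma_\infty)/\mathbb{Q})$ is viewed as a subgroup of $A$ by restricting field automorphisms to $\Gamma_\infty$. $\nu_p$ is the Haar measure on $A_p$ with $\nu_p(A_p)=1$, $\nu=\prod_p\nu_p$. With $\Gamma_i=\langle a_i\rangle$, $\varphi_{p,i}:A_p\to\mathrm{Aut}_{\Gamma_i^{1/p}\cap\mathbb{Q}^*}(\Gamma_i^{1/p})$ is the restriction map. $\overline\Gamma_p=\mathrm{im}[\Gamma\to\mathbb{Q}^*/(\mathbb{Q}^* )^p]$; $\mu_k$ is the group of $k$-th roots of unity in $\mathbb{C}^*$; and (under the hypothesis on odd subsets) $w_2:\overline\Gamma_2\to\mu_2$ is the unique homomorphism with $w_2(a_i\bmod(\mathbb{Q}^* )^2)=-1$ for all $i$. *)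

theory Defs
  imports
    "HOL-Probability.Probability"
    "HOL-Algebra.Algebra"
    "HOL-Algebra.Algebraic_Closure_Type"
    "HOL-Number_Theory.Residues"
    "Jordan_Normal_Form.Missing_VectorSpace"
begin

abbreviation CC :: "complex ring" where
  "CC \<equiv> ring_of_type_algebra"

abbreviation Cstar :: "complex monoid" where
  "Cstar \<equiv> mult_of CC"

text \<open>The group of nonzero rationals is regarded as a subgroup of the group of nonzero complex
  numbers throughout, so rational numbers have type \<^typ>\<open>complex\<close>.\<close>

definition Qstar :: "complex set" where
  "Qstar = \<rat> - {0}"

abbreviation Qgroup :: "complex monoid" where
  "Qgroup \<equiv> Cstar\<lparr>carrier := Qstar\<rparr>"

definition Gam :: "nat \<Rightarrow> (nat \<Rightarrow> complex) \<Rightarrow> complex set" where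
  "Gam n a = generate Cstar (a ` {1..n})"


definition rad_inf :: "complex set \<Rightarrow> complex set" where
  "rad_inf \<Delta> = {x \<in> carrier Cstar. \<exists>m\<ge>1. x ^ m \<in> \<Delta>}"

definition rad_pinf :: "nat \<Rightarrow> complex set \<Rightarrow> complex set" where
  "rad_pinf p \<Delta> = {x \<in> carrier Cstar. \<exists>m\<ge>1. x ^ (p ^ m) \<in> \<Delta>}"

definition rad :: "nat \<Rightarrow> complex set \<Rightarrow> complex set" where
  "rad p \<Delta> = {x \<in> carrier Cstar. x ^ p \<in> \<Delta>}"


text \<open>Automorphisms of \<open>H\<close> are extensional functions, i.e. they are undefined outside \<open>H\<close>;
  consequently restricting an automorphism to a subgroup means applying \<^const>\<open>restrict\<close>.\<close>

definition AutQ :: "complex set \<Rightarrow> (complex \<Rightarrow> complex) monoid" where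
  "AutQ H = AutoGroup (Cstar\<lparr>carrier := H\<rparr>)
     \<lparr>carrier := {\<sigma> \<in> auto (Cstar\<lparr>carrier := H\<rparr>). \<forall>x \<in> H \<inter> Qstar. \<sigma> x = x}\<rparr>"

text \<open>The profinite topology on \<^term>\<open>AutQ H\<close>, for \<open>H\<close> a group of radicals, is the topology of
  pointwise convergence on the discrete set \<open>H\<close>.\<close>

definition AutQ_topology :: "complex set \<Rightarrow> (complex \<Rightarrow> complex) topology" where
  "AutQ_topology H =
     subtopology (product_topology (\<lambda>_. discrete_topology H) H) (carrier (AutQ H))"

definition A_group :: "complex set \<Rightarrow> (complex \<Rightarrow> complex) monoid" where
  "A_group \<Gamma> = AutQ (rad_inf \<Gamma>)"

definition Ap_group :: "complex set \<Rightarrow> nat \<Rightarrow> (complex \<Rightarrow> complex) monoid" where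
  "Ap_group \<Gamma> p = AutQ (rad_pinf p \<Gamma>)"

definition Gal_group :: "complex set \<Rightarrow> (complex \<Rightarrow> complex) set" where
  "Gal_group \<Gamma> =
     (let L = CC\<lparr>carrier := generate_field CC (\<rat> \<union> rad_inf \<Gamma>)\<rparr>
      in (\<lambda>\<tau>. restrict \<tau> (rad_inf \<Gamma>)) ` {\<tau> \<in> ring_iso L L. \<forall>x \<in> \<rat>. \<tau> x = x})"


definition borel_of :: "'g topology \<Rightarrow> 'g measure" where
  "borel_of T = sigma (topspace T) {U. openin T U}"

text \<open>Regularity is not listed separately: the groups to which the definition is applied are
  compact and metrizable, and there every finite Borel measure is regular. As they are compact,
  left invariance also is the same as right invariance.\<close>

definition normalized_haar ::
  "('g, 'm) monoid_scheme \<Rightarrow> 'g topology \<Rightarrow> 'g measure \<Rightarrow> bool" where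
  "normalized_haar G T M \<longleftrightarrow>
     sets M = sets (borel_of T) \<and>
     (\<forall>g \<in> carrier G. \<forall>B \<in> sets M. emeasure M (l_coset G g B) = emeasure M B) \<and>
     emeasure M (carrier G) = 1"

definition A_to_prod ::
  "complex set \<Rightarrow> (complex \<Rightarrow> complex) \<Rightarrow> nat \<Rightarrow> complex \<Rightarrow> complex" where
  "A_to_prod \<Gamma> \<sigma> = (\<lambda>p \<in> {p. Factorial_Ring.prime p}. restrict \<sigma> (rad_pinf p \<Gamma>))"

text \<open>The product of the measures \<open>\<nu>p p\<close> over all primes \<open>p\<close>, as a Borel measure on \<open>A\<close>: it is
  carried over from the product of the \<open>A\<^sub>p\<close> by the inverse of the restriction isomorphism.\<close>

definition prod_measure ::
  "complex set \<Rightarrow> (nat \<Rightarrow> (complex \<Rightarrow> complex) measure) \<Rightarrow> (complex \<Rightarrow> complex) measure" where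
  "prod_measure \<Gamma> \<nu>p =
     distr (PiM {p. Factorial_Ring.prime p} \<nu>p) (borel_of (AutQ_topology (rad_inf \<Gamma>)))
       (inv_into (carrier (A_group \<Gamma>)) (A_to_prod \<Gamma>))"


definition phi :: "(nat \<Rightarrow> complex) \<Rightarrow> nat \<Rightarrow> nat \<Rightarrow> (complex \<Rightarrow> complex) \<Rightarrow> complex \<Rightarrow> complex" where
  "phi a p i \<sigma> = restrict \<sigma> (rad p (generate Cstar {a i}))"

definition Sp_set :: "nat \<Rightarrow> (nat \<Rightarrow> complex) \<Rightarrow> nat \<Rightarrow> (complex \<Rightarrow> complex) set" where
  "Sp_set n a p = carrier (Ap_group (Gam n a) p) -
     (\<Union>i\<in>{1..n}. kernel (Ap_group (Gam n a) p) (AutQ (rad p (generate Cstar {a i}))) (phi a p i))"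

definition S_set :: "nat \<Rightarrow> (nat \<Rightarrow> complex) \<Rightarrow> (complex \<Rightarrow> complex) set" where
  "S_set n a = {\<sigma> \<in> carrier (A_group (Gam n a)).
     \<forall>p. Factorial_Ring.prime p \<longrightarrow> restrict \<sigma> (rad_pinf p (Gam n a)) \<in> Sp_set n a p}"


definition powers :: "nat \<Rightarrow> complex set" where
  "powers p = (\<lambda>x. x ^ p) ` Qstar"

definition cls :: "nat \<Rightarrow> complex \<Rightarrow> complex set" where
  "cls p x = r_coset Qgroup (powers p) x"

definition Gbar :: "complex set \<Rightarrow> nat \<Rightarrow> complex set monoid" where
  "Gbar \<Gamma> p = (Qgroup Mod powers p)\<lparr>carrier := cls p ` \<Gamma>\<rparr>"

definition mu :: "nat \<Rightarrow> complex monoid" where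
  "mu k = Cstar\<lparr>carrier := {z. z ^ k = 1}\<rparr>"

text \<open>Characters are determined only on the carrier, so uniqueness of \<open>w2\<close> needs extensionality.
  Existence holds exactly if no product of an odd number of the \<open>a i\<close> is a square.\<close>

definition w2 :: "nat \<Rightarrow> (nat \<Rightarrow> complex) \<Rightarrow> complex set \<Rightarrow> complex" where
  "w2 n a = (THE w. w \<in> hom (Gbar (Gam n a) 2) (mu 2) \<inter> extensional (carrier (Gbar (Gam n a) 2)) \<and>
     (\<forall>i\<in>{1..n}. w (cls 2 (a i)) = -1))"

text \<open>An abelian group of exponent dividing \<open>p\<close>, written multiplicatively, as a vector space over
  the field with \<open>p\<close> elements. The ring fields \<open>mult\<close> and \<open>one\<close> play no role in a module.\<close>

definition Fp_space :: "('g, 'm) monoid_scheme \<Rightarrow> (int, 'g) module" where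
  "Fp_space G = \<lparr>carrier = carrier G, monoid.mult = mult G, one = one G,
     ring.zero = one G, add = mult G, smult = (\<lambda>k x. x [^]\<^bsub>G\<^esub> k)\<rparr>"

definition Fp_rank :: "nat \<Rightarrow> ('g, 'm) monoid_scheme \<Rightarrow> nat" where
  "Fp_rank p G = vectorspace.dim (residue_ring (int p)) (Fp_space G)"

end

theory Submission
  imports
    Defs
    "Jordan_Normal_Form.Char_Poly"
    "HOL-Number_Theory.Number_Theory"
begin

text \<open>An automorphism \<open>\<sigma> \<in> A\<close> lies in \<open>G\<close> if and only if it preserves the linear relations over
  \<open>\<rat>\<close> between elements of \<open>\<Gamma>\<^sub>\<infinity>\<close>. By Kummer theory over the maximal cyclotomic field this only concerns
  square roots of rational numbers, whose images are determined by the action on roots of unity.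

  If \<open>\<sigma> \<in> G \<inter> S\<close>, then \<open>\<sigma>\<close> changes the sign of every \<open>\<surd>a\<^sub>i\<close>, so that (a) forces \<open>\<sigma>\<close> to fix \<open>\<surd>-3\<close> and
  with it the cube roots of unity. Then \<open>\<gamma> \<mapsto> \<sigma>(\<gamma>\<^bsup>1/3\<^esup>) / \<gamma>\<^bsup>1/3\<^esup>\<close> is a character of order dividing 3 that is
  nontrivial on all \<open>a\<^sub>i\<close>, contrary to (b). Hence (a) and (b) imply that \<open>G \<inter> S\<close> is empty.

  Conversely, if (a) or (b) fails, choose a quadratic character \<open>w\<close> of \<open>\<rat>\<^sup>*\<close> with \<open>w(a\<^sub>i) = -1\<close>, and with
  \<open>w(-3) = -1\<close> if (a) fails. For every prime \<open>p\<close> up to a bound \<open>B\<close> there is an element of \<open>S\<^sub>p\<close> whose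
  action on roots of unity sends \<open>\<surd>b\<close> to \<open>w(b) \<surd>b\<close>, and prescribing finitely many values at each of these
  primes forces membership in \<open>G\<close>. This is an open condition of positive measure, and for \<open>p > B\<close> one has
  \<open>\<nu>\<^sub>p(S\<^sub>p) \<ge> 1 - n / (p (p - 1))\<close>, so the product of all the local measures is positive.\<close>

hide_const (open) up_ring.coeff up_ring.monom Divisibility.prime Polynomials.degree Polynomials.lead_coeff
  Module.smult Coset.order

section \<open>Fields and embeddings\<close>

text \<open>Square roots are the only link between different primes: for b in Gamma, sqrt b is a
  radical of 2-power order, yet it lies in a cyclotomic field, so the component at 2 constrains the
  action on roots of unity at odd primes. Fixing one quadratic character w on all of
  \<open>Qstar\<close> decouples the components: at 2 square roots are multiplied by w, and at an
  odd prime p the p-th roots of unity are moved so that sqrt p acquires the sign w(p); no local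
  condition mentions another prime. The prime 3 is special because 1 is the only nonzero square
  modulo 3. For p >= 5 either sign comes from an exponent other than 1, so a p-th root of unity
  moves and S_p is reached; at 3 the value w(-3) = 1 forces the cube roots of unity to be fixed, and
  then only a cubic character of Gamma that is nontrivial on every a_i leads into S_3. Hence the -3
  in (a) and the 3 in (b). Since division by zero gives zero, the quotient would also vanish if
  nu(G) were 0; so positivity of nu(G) is proved together with that of nu(G cap S), from the same
  box of local conditions.\<close>

definition subfld :: "complex set \<Rightarrow> bool" where
  "subfld E \<longleftrightarrow> 1 \<in> E \<and> (\<forall>x\<in>E. \<forall>y\<in>E. x - y \<in> E \<and> x * y \<in> E) \<and> (\<forall>x\<in>E. inverse x \<in> E)"

text \<open>Total functions with values anywhere in \<complex>; nothing is asked off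
  \<open>E\<close>. On a subfield \<open>\<tau> 1 = 1\<close> already forces injectivity, since
  inverses are preserved.\<close>

definition embedding :: "complex set \<Rightarrow> (complex \<Rightarrow> complex) \<Rightarrow> bool" where
  "embedding E \<tau> \<longleftrightarrow> \<tau> 1 = 1 \<and> (\<forall>x\<in>E. \<forall>y\<in>E. \<tau> (x + y) = \<tau> x + \<tau> y \<and> \<tau> (x * y) = \<tau> x * \<tau> y)"

definition alg_over :: "complex set \<Rightarrow> complex \<Rightarrow> bool" where
  "alg_over E z \<longleftrightarrow> (\<exists>f. f \<noteq> 0 \<and> (\<forall>i. coeff f i \<in> E) \<and> poly f z = 0)"

text \<open>Polynomial values only; inverses come for free once \<open>z\<close> is algebraic over
  \<open>E\<close>.\<close>

definition adjoin :: "complex set \<Rightarrow> complex \<Rightarrow> complex set" where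
  "adjoin E z = {poly f z |f. \<forall>i. coeff f i \<in> E}"

context
  fixes E assumes E: "subfld E"
begin

lemma subfld_one: "1 \<in> E" using E by (simp add: subfld_def)
lemma subfld_diff: "x \<in> E \<Longrightarrow> y \<in> E \<Longrightarrow> x - y \<in> E" using E by (simp add: subfld_def)
lemma subfld_mult: "x \<in> E \<Longrightarrow> y \<in> E \<Longrightarrow> x * y \<in> E" using E by (simp add: subfld_def)
lemma subfld_inverse: "x \<in> E \<Longrightarrow> inverse x \<in> E" using E by (simp add: subfld_def)
lemma subfld_zero: "0 \<in> E" using subfld_diff[OF subfld_one subfld_one] by simp
lemma subfld_uminus: "x \<in> E \<Longrightarrow> - x \<in> E" using subfld_diff[OF subfld_zero, of x] by simp
lemma subfld_add: "x \<in> E \<Longrightarrow> y \<in> E \<Longrightarrow> x + y \<in> E"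
  using subfld_diff[of x "-y"] subfld_uminus by simp
lemma subfld_divide: "x \<in> E \<Longrightarrow> y \<in> E \<Longrightarrow> x / y \<in> E"
  using subfld_mult[OF _ subfld_inverse] by (simp add: field_simps)
lemma subfld_sum: "(\<And>i. i \<in> I \<Longrightarrow> f i \<in> E) \<Longrightarrow> (\<Sum>i\<in>I. f i) \<in> E"
  by (induction I rule: infinite_finite_induct) (auto intro: subfld_zero subfld_add)
lemma subfld_power: "x \<in> E \<Longrightarrow> x ^ k \<in> E"
  by (induction k) (auto intro: subfld_one subfld_mult)
lemma subfld_of_nat: "of_nat k \<in> E"
  by (induction k) (auto intro: subfld_zero subfld_one subfld_add)
lemma subfld_of_int: "of_int k \<in> E"
  by (cases k rule: int_cases2) (auto intro: subfld_of_nat subfld_uminus)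
lemma subfld_Rats: "x \<in> \<rat> \<Longrightarrow> x \<in> E"
  by (elim Rats_cases') (auto intro: subfld_divide subfld_of_int)

lemma subfld_coeff_mult:
  "(\<forall>i. coeff f i \<in> E) \<Longrightarrow> (\<forall>i. coeff g i \<in> E) \<Longrightarrow> coeff (f * g) i \<in> E"
  by (auto simp: coeff_mult intro!: subfld_sum subfld_mult)

text \<open>Euclidean division inside \<open>E[X]\<close>; the division of the library would need \<open>E\<close> to be a type.\<close>

lemma subfld_poly_division:
  assumes m: "\<forall>i. coeff m i \<in> E" "lead_coeff m = 1"
  shows "\<forall>i. coeff f i \<in> E \<Longrightarrow> \<exists>q r. (\<forall>i. coeff q i \<in> E) \<and> (\<forall>i. coeff r i \<in> E) \<and>
           f = q * m + r \<and> (r = 0 \<or> degree r < degree m)"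
proof (induction "degree f" arbitrary: f rule: less_induct)
  case less
  show ?case
  proof (cases "f = 0 \<or> degree f < degree m")
    case True
    with less.prems show ?thesis by (intro exI[of _ 0] exI[of _ f]) (auto intro: subfld_zero)
  next
    case False
    define c where "c = monom (lead_coeff f) (degree f - degree m)"
    define g where "g = f - c * m"
    have cE: "\<forall>i. coeff c i \<in> E" using less.prems by (auto simp: c_def intro: subfld_zero)
    have gE: "\<forall>i. coeff g i \<in> E"
      using less.prems cE m by (auto simp: g_def intro!: subfld_diff subfld_coeff_mult)
    have m0: "m \<noteq> 0" using m by auto
    have c0: "c \<noteq> 0" using False by (simp add: c_def monom_eq_0_iff)
    have "degree c = degree f - degree m"
      using False unfolding c_def by (subst degree_monom_eq) auto
    then have dc: "degree (c * m) = degree f"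
      using False m0 c0 by (simp add: degree_mult_eq)
    have lc: "lead_coeff (c * m) = lead_coeff f"
      unfolding c_def lead_coeff_mult lead_coeff_monom using m by simp
    show ?thesis
    proof (cases "g = 0")
      case True
      then have "f = c * m + 0" by (simp add: g_def)
      moreover have "\<forall>i. coeff 0 i \<in> E" by (simp add: subfld_zero)
      ultimately show ?thesis using cE by blast
    next
      case gn: False
      have "coeff g (degree f) = 0" using lc dc by (simp add: g_def)
      moreover have "degree g \<le> degree f" unfolding g_def using dc by (intro degree_diff_le) auto
      ultimately have dg: "degree g < degree f"
        using gn by (metis le_neq_implies_less leading_coeff_0_iff)
      from less.hyps[OF dg gE] obtain q r where qr: "\<forall>i. coeff q i \<in> E" "\<forall>i. coeff r i \<in> E"
        "g = q * m + r" "r = 0 \<or> degree r < degree m" by blast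
      have "f = (q + c) * m + r" using qr(3) by (simp add: g_def algebra_simps)
      moreover have "\<forall>i. coeff (q + c) i \<in> E" using qr(1) cE by (auto intro: subfld_add)
      ultimately show ?thesis using qr(2,4) by blast
    qed
  qed
qed

text \<open>Least degree among the annihilating polynomials, made monic. Divisibility with a
  quotient again over \<open>E\<close> stands in for irreducibility: the remainder of any other
  annihilating polynomial has smaller degree and must vanish.\<close>

lemma minimal_poly_exists:
  assumes "alg_over E z"
  obtains m where "\<forall>i. coeff m i \<in> E" "lead_coeff m = 1" "poly m z = 0"
    "\<And>f. \<forall>i. coeff f i \<in> E \<Longrightarrow> poly f z = 0 \<Longrightarrow> \<exists>q. (\<forall>i. coeff q i \<in> E) \<and> f = q * m"
proof -
  define P where "P f \<longleftrightarrow> f \<noteq> 0 \<and> (\<forall>i. coeff f i \<in> E) \<and> poly f z = 0" for f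
  obtain g where g: "P g" "\<And>f. P f \<Longrightarrow> degree g \<le> degree f"
    using assms ex_has_least_nat[of P _ degree] unfolding alg_over_def P_def by blast
  define m where "m = smult (inverse (lead_coeff g)) g"
  have m: "\<forall>i. coeff m i \<in> E" "lead_coeff m = 1" "poly m z = 0" "degree m = degree g"
    using g(1) by (auto simp: m_def P_def intro: subfld_mult subfld_inverse)
  have "\<exists>q. (\<forall>i. coeff q i \<in> E) \<and> f = q * m" if f: "\<forall>i. coeff f i \<in> E" "poly f z = 0" for f
  proof -
    obtain q r where qr: "\<forall>i. coeff q i \<in> E" "\<forall>i. coeff r i \<in> E" "f = q * m + r"
      "r = 0 \<or> degree r < degree m"
      using subfld_poly_division[OF m(1,2) f(1)] by blast
    have "poly r z = 0" using f(2) m(3) qr(3) by simp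
    then have "r = 0" using g(2)[of r] qr(2,4) m(4) by (force simp: P_def)
    then show ?thesis using qr by auto
  qed
  with m(1-3) show ?thesis using that by blast
qed

lemma adjoin_superset: "E \<subseteq> adjoin E z"
proof
  fix x assume "x \<in> E"
  then show "x \<in> adjoin E z"
    unfolding adjoin_def by (intro CollectI exI[of _ "[:x:]"]) (auto simp: coeff_pCons subfld_zero split: nat.splits)
qed

lemma adjoin_mem: "z \<in> adjoin E z"
  unfolding adjoin_def
  by (intro CollectI exI[of _ "[:0,1:]"]) (auto simp: coeff_pCons subfld_zero subfld_one split: nat.splits)

text \<open>Only inverses need work. Every element is the value of a polynomial of degree below that
  of the minimal polynomial, and the inverse of such a value is found by induction on this
  degree.\<close>

lemma subfld_adjoin:
  assumes "alg_over E z" shows "subfld (adjoin E z)"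
proof -
  obtain m where m: "\<forall>i. coeff m i \<in> E" "lead_coeff m = 1" "poly m z = 0"
    "\<And>f. \<forall>i. coeff f i \<in> E \<Longrightarrow> poly f z = 0 \<Longrightarrow> \<exists>q. (\<forall>i. coeff q i \<in> E) \<and> f = q * m"
    using minimal_poly_exists[OF assms] by blast
  have diff: "x - y \<in> adjoin E z" if "x \<in> adjoin E z" "y \<in> adjoin E z" for x y
  proof -
    from that obtain f g where "x = poly f z" "y = poly g z" "\<forall>i. coeff f i \<in> E" "\<forall>i. coeff g i \<in> E"
      unfolding adjoin_def by blast
    then show ?thesis unfolding adjoin_def
      by (intro CollectI exI[of _ "f - g"]) (auto intro: subfld_diff)
  qed
  have mult: "x * y \<in> adjoin E z" if "x \<in> adjoin E z" "y \<in> adjoin E z" for x y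
  proof -
    from that obtain f g where "x = poly f z" "y = poly g z" "\<forall>i. coeff f i \<in> E" "\<forall>i. coeff g i \<in> E"
      unfolding adjoin_def by blast
    then show ?thesis unfolding adjoin_def
      by (intro CollectI exI[of _ "f * g"]) (auto intro: subfld_coeff_mult)
  qed
  have m0: "m \<noteq> 0" using m(2) by auto
  have small: "r = 0" if r: "\<forall>i. coeff r i \<in> E" "poly r z = 0" "r = 0 \<or> degree r < degree m" for r
  proof (rule ccontr)
    assume "r \<noteq> 0"
    obtain k where "r = k * m" using m(4)[OF r(1,2)] by blast
    with \<open>r \<noteq> 0\<close> have "degree r \<ge> degree m" by (auto simp: degree_mult_eq)
    with r(3) \<open>r \<noteq> 0\<close> show False by simp
  qed
  have inv: "inverse (poly f z) \<in> adjoin E z"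
    if "\<forall>i. coeff f i \<in> E" "f \<noteq> 0" "degree f < degree m" for f
    using that
  proof (induction "degree f" arbitrary: f rule: less_induct)
    case less
    \<comment> \<open>Dividing the minimal polynomial by \<open>f\<close> expresses the inverse of \<open>f(z)\<close> by that of the remainder.\<close>
    define g where "g = smult (inverse (lead_coeff f)) f"
    have fz: "poly f z \<noteq> 0" using small[of f] less.prems by auto
    have g: "\<forall>i. coeff g i \<in> E" "lead_coeff g = 1" "poly g z \<noteq> 0" "degree g = degree f"
      using less.prems fz by (auto simp: g_def intro: subfld_mult subfld_inverse)
    obtain q r where qr: "\<forall>i. coeff q i \<in> E" "\<forall>i. coeff r i \<in> E" "m = q * g + r"
      "r = 0 \<or> degree r < degree g"
      using subfld_poly_division[OF g(1,2) m(1)] by blast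
    have "poly f z = lead_coeff f * poly g z"
      using less.prems by (simp add: g_def)
    then have fl: "inverse (poly f z) = inverse (lead_coeff f) * inverse (poly g z)" by simp
    have lE: "inverse (lead_coeff f) \<in> adjoin E z"
      using less.prems(1) subfld_inverse adjoin_superset by blast
    have "inverse (poly g z) \<in> adjoin E z"
    proof (cases "r = 0")
      case False
      then have "degree r < degree f" using qr(4) g(4) by simp
      then have ir: "inverse (poly r z) \<in> adjoin E z"
        using less.hyps qr(2) False less.prems(3) by simp
      have rz: "poly r z \<noteq> 0"
        using small[of r] False qr(2) \<open>degree r < degree f\<close> less.prems(3) by auto
      have "poly q z * poly g z = - poly r z" using m(3) qr(3) by (simp add: eq_neg_iff_add_eq_0)
      then have "inverse (poly g z) = 0 - poly q z * inverse (poly r z)"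
        using g(3) rz by (simp add: field_simps)
      moreover have "poly q z \<in> adjoin E z" using qr(1) by (auto simp: adjoin_def)
      moreover have "0 \<in> adjoin E z" using adjoin_superset subfld_zero by blast
      ultimately show ?thesis using diff mult ir by metis
    next
      \<comment> \<open>Here \<open>m = q * g\<close> with \<open>q(z) = 0\<close>, so
        \<open>m\<close> divides \<open>q\<close> in turn. Comparing gives \<open>h * g = 1\<close>,
        and the monic \<open>g\<close> can only be 1.\<close>
      case True
      then have "poly q z = 0" using m(3) qr(3) g(3) by simp
      then obtain h where h: "q = h * m" using m(4) qr(1) by blast
      have "m * (h * g - 1) = 0"
        using qr(3) h True by (simp add: algebra_simps)
      then have hg: "h * g = 1" using m0 by simp
      then have "degree g = 0" by (metis degree_1 degree_mult_eq_0 zero_neq_one mult_zero_left mult_zero_right add_is_0 degree_mult_eq)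
      then have "g = 1" using g(2) by (metis degree_eq_zeroE coeff_pCons_0 one_pCons)
      then show ?thesis using adjoin_superset subfld_one by auto
    qed
    then show ?case using fl lE mult by simp
  qed
  have "1 \<in> adjoin E z" using adjoin_superset subfld_one by blast
  moreover have "inverse x \<in> adjoin E z" if x: "x \<in> adjoin E z" for x
  proof (cases "x = 0")
    case True then show ?thesis using adjoin_superset subfld_zero by auto
  next
    case False
    from x obtain f where f: "\<forall>i. coeff f i \<in> E" "x = poly f z" by (auto simp: adjoin_def)
    obtain q r where qr: "\<forall>i. coeff r i \<in> E" "f = q * m + r" "r = 0 \<or> degree r < degree m"
      using subfld_poly_division[OF m(1,2) f(1)] by blast
    have "x = poly r z" using f(2) qr(2) m(3) by simp
    moreover from this have "r \<noteq> 0" using False by auto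
    ultimately show ?thesis using inv[of r] qr False by auto
  qed
  ultimately show ?thesis unfolding subfld_def using diff mult by blast
qed


text \<open>Separability in characteristic zero: if \<open>z\<close> were a double root, the minimal
  polynomial would divide its derivative, whose degree is smaller. So the cofactor of
  \<open>X - z\<close> does not vanish at \<open>z\<close>, and it is not constant because
  \<open>z\<close> is not in \<open>E\<close>; its complex root is the one sought.\<close>

lemma minimal_poly_other_root:
  assumes z: "z \<notin> E" and m: "\<forall>i. coeff m i \<in> E" "lead_coeff m = 1" "poly m z = 0"
    "\<And>f. \<forall>i. coeff f i \<in> E \<Longrightarrow> poly f z = 0 \<Longrightarrow> \<exists>q. (\<forall>i. coeff q i \<in> E) \<and> f = q * m"
  shows "\<exists>w. w \<noteq> z \<and> poly m w = 0"
proof -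
  have m0: "m \<noteq> 0" using m(2) by auto
  have dm: "degree m \<noteq> 0"
  proof
    assume "degree m = 0"
    then obtain c where "m = [:c:]" by (rule degree_eq_zeroE)
    with m(2,3) show False by simp
  qed
  have "poly (pderiv m) z \<noteq> 0"
  proof
    assume "poly (pderiv m) z = 0"
    moreover have "\<forall>i. coeff (pderiv m) i \<in> E"
      using m(1) by (auto simp: coeff_pderiv intro!: subfld_mult subfld_add subfld_one subfld_of_nat)
    ultimately obtain q where "pderiv m = q * m" using m(4) by blast
    moreover have "degree (pderiv m) = degree m - 1" "pderiv m \<noteq> 0"
      using dm by (auto simp: degree_pderiv pderiv_eq_0_iff)
    ultimately show False using dm by (auto simp: degree_mult_eq)
  qed
  moreover obtain q where q: "m = [:-z, 1:] * q" using m(3) by (auto simp: poly_eq_0_iff_dvd)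
  ultimately have qz: "poly q z \<noteq> 0"
    unfolding q pderiv_mult by (auto simp: pderiv_pCons)
  have "degree q \<noteq> 0"
  proof
    assume "degree q = 0"
    then obtain c where "q = [:c:]" by (rule degree_eq_zeroE)
    moreover from this have "c = 1" using m(2) q by (auto split: if_splits)
    ultimately have "m = [:-z, 1:]" using q by simp
    with m(1) have "-z \<in> E" by (metis coeff_pCons_0)
    then show False using subfld_uminus z by fastforce
  qed
  then obtain w where "poly q w = 0"
    using fundamental_theorem_of_algebra[of q] by (auto simp: constant_degree)
  with q qz show ?thesis by (intro exI[of _ w]) auto
qed

context
  fixes \<tau> assumes \<tau>: "embedding E \<tau>"
begin

lemma embedding_one: "\<tau> 1 = 1" using \<tau> by (simp add: embedding_def)
lemma embedding_add: "x \<in> E \<Longrightarrow> y \<in> E \<Longrightarrow> \<tau> (x + y) = \<tau> x + \<tau> y"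
  using \<tau> by (simp add: embedding_def)
lemma embedding_mult: "x \<in> E \<Longrightarrow> y \<in> E \<Longrightarrow> \<tau> (x * y) = \<tau> x * \<tau> y"
  using \<tau> by (simp add: embedding_def)
lemma embedding_zero: "\<tau> 0 = 0" using embedding_add[OF subfld_zero subfld_zero] by simp
lemma embedding_uminus: "x \<in> E \<Longrightarrow> \<tau> (- x) = - \<tau> x"
  using embedding_add[of x "-x"] subfld_uminus embedding_zero by (simp add: eq_neg_iff_add_eq_0 add.commute)
lemma embedding_diff: "x \<in> E \<Longrightarrow> y \<in> E \<Longrightarrow> \<tau> (x - y) = \<tau> x - \<tau> y"
  using embedding_add[of x "-y"] embedding_uminus subfld_uminus by simp
lemma embedding_sum: "(\<And>i. i \<in> I \<Longrightarrow> f i \<in> E) \<Longrightarrow> \<tau> (\<Sum>i\<in>I. f i) = (\<Sum>i\<in>I. \<tau> (f i))"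
  by (induction I rule: infinite_finite_induct) (auto simp: embedding_zero embedding_add subfld_sum)
lemma embedding_power: "x \<in> E \<Longrightarrow> \<tau> (x ^ k) = \<tau> x ^ k"
  by (induction k) (auto simp: embedding_one embedding_mult subfld_power)
lemma embedding_inverse: "x \<in> E \<Longrightarrow> \<tau> (inverse x) = inverse (\<tau> x)"
proof (cases "x = 0")
  case False
  assume "x \<in> E"
  then have "\<tau> x * \<tau> (inverse x) = 1"
    using embedding_mult[of x "inverse x"] subfld_inverse False embedding_one by simp
  then show ?thesis by (metis inverse_unique)
qed (simp add: embedding_zero)
lemma embedding_divide: "x \<in> E \<Longrightarrow> y \<in> E \<Longrightarrow> \<tau> (x / y) = \<tau> x / \<tau> y"
  by (simp add: divide_inverse embedding_mult embedding_inverse subfld_inverse)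
lemma embedding_nonzero: "x \<in> E \<Longrightarrow> x \<noteq> 0 \<Longrightarrow> \<tau> x \<noteq> 0"
  using embedding_mult[of x "inverse x"] subfld_inverse embedding_one by fastforce
lemma embedding_of_nat: "\<tau> (of_nat k) = of_nat k"
  by (induction k) (auto simp: embedding_zero embedding_one embedding_add subfld_one subfld_of_nat)
lemma embedding_of_int: "\<tau> (of_int k) = of_int k"
  by (cases k rule: int_cases2) (auto simp: embedding_of_nat embedding_uminus subfld_of_nat)
lemma embedding_Rats: "x \<in> \<rat> \<Longrightarrow> \<tau> x = x"
  by (elim Rats_cases') (auto simp: embedding_divide embedding_of_int subfld_of_int)

lemma map_poly_embedding_mult:
  assumes "\<forall>i. coeff f i \<in> E" "\<forall>i. coeff g i \<in> E"
  shows "map_poly \<tau> (f * g) = map_poly \<tau> f * map_poly \<tau> g"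
  using assms by (intro poly_eqI)
    (auto simp: coeff_map_poly embedding_zero coeff_mult embedding_sum embedding_mult subfld_mult)

lemma map_poly_embedding_add:
  assumes "\<forall>i. coeff f i \<in> E" "\<forall>i. coeff g i \<in> E"
  shows "map_poly \<tau> (f + g) = map_poly \<tau> f + map_poly \<tau> g"
  using assms by (intro poly_eqI) (auto simp: coeff_map_poly embedding_zero embedding_add)

text \<open>The map sends \<open>f(z)\<close> to the value at \<open>w\<close> of the transported
  polynomial. Two polynomials with the same value at \<open>z\<close> differ by a multiple of
  \<open>m\<close>, whose image vanishes at \<open>w\<close>, so the choice made by
  \<open>SOME\<close> is immaterial.\<close>

lemma embedding_adjoin:
  assumes m: "\<And>f. \<forall>i. coeff f i \<in> E \<Longrightarrow> poly f z = 0 \<Longrightarrow> \<exists>q. (\<forall>i. coeff q i \<in> E) \<and> f = q * m"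
    and mE: "\<forall>i. coeff m i \<in> E" and w: "poly (map_poly \<tau> m) w = 0"
  obtains \<tau>' where "embedding (adjoin E z) \<tau>'" "\<And>x. x \<in> E \<Longrightarrow> \<tau>' x = \<tau> x" "\<tau>' z = w"
proof -
  define \<tau>' where "\<tau>' x = poly (map_poly \<tau> (SOME f. (\<forall>i. coeff f i \<in> E) \<and> poly f z = x)) w" for x
  have eq: "\<tau>' (poly f z) = poly (map_poly \<tau> f) w" if f: "\<forall>i. coeff f i \<in> E" for f
  proof -
    define g where "g = (SOME g. (\<forall>i. coeff g i \<in> E) \<and> poly g z = poly f z)"
    have g: "(\<forall>i. coeff g i \<in> E) \<and> poly g z = poly f z"
      unfolding g_def by (rule someI[of _ f]) (use f in auto)
    have "\<forall>i. coeff (g - f) i \<in> E" using f g by (auto intro: subfld_diff)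
    then obtain q where q: "\<forall>i. coeff q i \<in> E" "g - f = q * m" using m[of "g - f"] g by auto
    then have "g = f + q * m" by (simp add: algebra_simps)
    then have "map_poly \<tau> g = map_poly \<tau> f + map_poly \<tau> q * map_poly \<tau> m"
      using f q mE by (simp add: map_poly_embedding_add map_poly_embedding_mult subfld_coeff_mult)
    then show ?thesis using w by (simp add: \<tau>'_def g_def)
  qed
  have E1: "\<forall>i. coeff [:x:] i \<in> E" if "x \<in> E" for x
    using that by (auto simp: coeff_pCons subfld_zero split: nat.splits)
  have base: "\<tau>' x = \<tau> x" if "x \<in> E" for x
    using eq[OF E1[OF that]] by (simp add: Polynomial.map_poly_pCons embedding_zero)
  have "\<forall>i. coeff [:0, 1:] i \<in> E"
    by (auto simp: coeff_pCons subfld_zero subfld_one split: nat.splits)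
  from eq[OF this] have z: "\<tau>' z = w"
    by (simp add: Polynomial.map_poly_pCons embedding_zero embedding_one)
  have "embedding (adjoin E z) \<tau>'"
    unfolding embedding_def
  proof (intro conjI ballI)
    show "\<tau>' 1 = 1" using base subfld_one embedding_one by simp
    fix x y assume "x \<in> adjoin E z" "y \<in> adjoin E z"
    then obtain f g where fg: "x = poly f z" "y = poly g z" "\<forall>i. coeff f i \<in> E" "\<forall>i. coeff g i \<in> E"
      unfolding adjoin_def by blast
    then show "\<tau>' (x + y) = \<tau>' x + \<tau>' y" "\<tau>' (x * y) = \<tau>' x * \<tau>' y"
      using eq[of "f + g"] eq[of "f * g"] eq[of f] eq[of g]
      by (auto simp: subfld_add subfld_coeff_mult map_poly_embedding_add map_poly_embedding_mult)
  qed
  with base z show ?thesis using that by blast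
qed

end
end

section \<open>Extending embeddings through algebraic elements\<close>

lemma alg_over_mono: "E \<subseteq> F \<Longrightarrow> alg_over E z \<Longrightarrow> alg_over F z"
  unfolding alg_over_def by blast

lemma alg_over_radical:
  assumes "subfld E" "N \<ge> 1" "z ^ N \<in> E" shows "alg_over E z"
proof -
  have "monom 1 N - [:z ^ N:] \<noteq> 0"
    using assms(2) by (metis coeff_0 coeff_diff coeff_monom coeff_pCons_Suc Suc_diff_1 coeff_0 diff_0_right diff_zero less_eq_Suc_le One_nat_def zero_neq_one)
  moreover have "\<forall>i. coeff (monom 1 N - [:z ^ N:]) i \<in> E"
    using assms subfld_diff[OF assms(1)] subfld_zero[OF assms(1)] subfld_one[OF assms(1)]
    by (simp add: coeff_pCons split: nat.split)
  ultimately show ?thesis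
    unfolding alg_over_def by (intro exI[of _ "monom 1 N - [:z ^ N:]"]) (auto simp: poly_monom)
qed

text \<open>Each transported minimal polynomial has a root because \<complex> is algebraically
  closed. A linear relation involves finitely many radicals, so a finite \<open>F\<close> is enough
  and no Zorn argument enters here.\<close>

lemma embedding_extend:
  assumes "finite F" "subfld E" "embedding E \<tau>" "\<And>z. z \<in> F \<Longrightarrow> alg_over E z"
  shows "\<exists>E' \<tau>'. subfld E' \<and> E \<subseteq> E' \<and> F \<subseteq> E' \<and> embedding E' \<tau>' \<and> (\<forall>x\<in>E. \<tau>' x = \<tau> x)"
  using assms(1,4)
proof (induction F)
  case empty
  then show ?case using assms by blast
next
  case (insert z F)
  then obtain E' \<tau>' where E': "subfld E'" "E \<subseteq> E'" "F \<subseteq> E'" "embedding E' \<tau>'" "\<forall>x\<in>E. \<tau>' x = \<tau> x"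
    by blast
  have alg: "alg_over E' z" using insert.prems E'(2) alg_over_mono by blast
  then obtain m where m: "\<forall>i. coeff m i \<in> E'" "lead_coeff m = 1" "poly m z = 0"
    "\<And>f. \<forall>i. coeff f i \<in> E' \<Longrightarrow> poly f z = 0 \<Longrightarrow> \<exists>q. (\<forall>i. coeff q i \<in> E') \<and> f = q * m"
    using minimal_poly_exists[OF E'(1)] by blast
  have dm: "degree m \<noteq> 0"
  proof
    assume "degree m = 0"
    then obtain c where "m = [:c:]" by (rule degree_eq_zeroE)
    with m(2,3) show False by simp
  qed
  have "degree (map_poly \<tau>' m) = degree m"
    using m(2) embedding_one[OF E'(1,4)] by (intro map_poly_degree_eq) auto
  then have "\<not> constant (poly (map_poly \<tau>' m))" using dm by (simp add: constant_degree)
  then obtain w where "poly (map_poly \<tau>' m) w = 0"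
    using fundamental_theorem_of_algebra by blast
  then obtain \<tau>'' where "embedding (adjoin E' z) \<tau>''" "\<And>x. x \<in> E' \<Longrightarrow> \<tau>'' x = \<tau>' x"
    using embedding_adjoin[OF E'(1,4) m(4) m(1)] by metis
  then show ?case
    using E' subfld_adjoin[OF E'(1) alg] adjoin_superset[OF E'(1), of z] adjoin_mem[OF E'(1), of z]
    by (intro exI[of _ "adjoin E' z"] exI[of _ \<tau>'']) auto
qed

text \<open>The substitute for the Galois correspondence: whatever every embedding over
  \<open>E\<close> fixes lies in \<open>E\<close>. The embedding sends \<open>y\<close> to a second
  root of its minimal polynomial; the finite set \<open>F\<close> is carried along so that it can be
  applied to all terms of a given relation.\<close>

lemma embedding_moving:
  assumes "subfld E" "alg_over E y" "y \<notin> E" "finite F" "\<And>z. z \<in> F \<Longrightarrow> alg_over E z"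
  obtains E' \<tau> where "subfld E'" "E \<subseteq> E'" "F \<subseteq> E'" "y \<in> E'" "embedding E' \<tau>"
    "\<And>x. x \<in> E \<Longrightarrow> \<tau> x = x" "\<tau> y \<noteq> y"
proof -
  obtain m where m: "\<forall>i. coeff m i \<in> E" "lead_coeff m = 1" "poly m y = 0"
    "\<And>f. \<forall>i. coeff f i \<in> E \<Longrightarrow> poly f y = 0 \<Longrightarrow> \<exists>q. (\<forall>i. coeff q i \<in> E) \<and> f = q * m"
    using minimal_poly_exists[OF assms(1,2)] by blast
  obtain w where w: "w \<noteq> y" "poly m w = 0"
    using minimal_poly_other_root[OF assms(1,3) m] by blast
  have id: "embedding E (\<lambda>x. x)" by (simp add: embedding_def)
  have w': "poly (map_poly (\<lambda>x. x) m) w = 0" using w by (simp add: map_poly_id')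
  obtain \<tau>0 where \<tau>0: "embedding (adjoin E y) \<tau>0" "\<And>x. x \<in> E \<Longrightarrow> \<tau>0 x = x" "\<tau>0 y = w"
    by (rule embedding_adjoin[OF assms(1) id m(4) m(1) w']) auto
  have sub: "E \<subseteq> adjoin E y" using adjoin_superset[OF assms(1)] .
  obtain E' \<tau> where E': "subfld E'" "adjoin E y \<subseteq> E'" "F \<subseteq> E'" "embedding E' \<tau>"
      "\<forall>x\<in>adjoin E y. \<tau> x = \<tau>0 x"
    using embedding_extend[OF assms(4) subfld_adjoin[OF assms(1,2)] \<tau>0(1)]
      assms(5) alg_over_mono[OF sub] by metis
  have y: "y \<in> adjoin E y" by (rule adjoin_mem[OF assms(1)])
  show ?thesis
  proof (rule that[OF E'(1) _ E'(3) _ E'(4)])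
    show "E \<subseteq> E'" "y \<in> E'" using E'(2) sub y by auto
    show "\<tau> x = x" if "x \<in> E" for x using that bspec[OF E'(5), of x] \<tau>0(2)[of x] subsetD[OF sub, of x] by simp
    show "\<tau> y \<noteq> y" using bspec[OF E'(5) y] \<tau>0(3) w(1) by simp
  qed
qed

text \<open>Kummer theory without degrees: an embedding that moves the quotient of two radicals turns a
  shortest linear relation into a shorter one.\<close>

lemma radicals_independent:
  assumes K: "subfld K" "\<And>z m. m \<ge> 1 \<Longrightarrow> z ^ m = 1 \<Longrightarrow> z \<in> K"
    and A: "finite A" "\<And>x. x \<in> A \<Longrightarrow> x \<noteq> 0 \<and> (\<exists>N\<ge>1. x ^ N \<in> K)"
      "\<And>x y. x \<in> A \<Longrightarrow> y \<in> A \<Longrightarrow> x \<noteq> y \<Longrightarrow> x / y \<notin> K"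
  shows "(\<And>x. x \<in> A \<Longrightarrow> c x \<in> K) \<Longrightarrow> (\<Sum>x\<in>A. c x * x) = 0 \<Longrightarrow> x \<in> A \<Longrightarrow> c x = 0"
proof (induction "card {x\<in>A. c x \<noteq> 0}" arbitrary: c x rule: less_induct)
  case less
  show ?case
  proof (rule ccontr)
    assume cx: "c x \<noteq> 0"
    have "\<exists>y\<in>A. y \<noteq> x \<and> c y \<noteq> 0"
    proof (rule ccontr)
      assume "\<not> ?thesis"
      then have "(\<Sum>y\<in>A. c y * y) = (\<Sum>y\<in>{x}. c y * y)"
        using A(1) less.prems(3) by (intro sum.mono_neutral_right) auto
      then show False using less.prems(2,3) cx A(2) by auto
    qed
    then obtain y where y: "y \<in> A" "y \<noteq> x" "c y \<noteq> 0" by blast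
    obtain N1 N2 where "N1 \<ge> 1" "N2 \<ge> 1" "x ^ N1 \<in> K" "y ^ N2 \<in> K"
      using A(2) less.prems(3) y(1) by meson
    then have "(x / y) ^ (N1 * N2) \<in> K" "N1 * N2 \<ge> 1"
      using subfld_power[OF K(1), of "x ^ N1" N2] subfld_power[OF K(1), of "y ^ N2" N1]
      by (auto simp: power_divide power_mult[symmetric] mult.commute intro!: subfld_divide K(1))
    then have alg: "alg_over K (x / y)" using alg_over_radical K(1) by blast
    have "x / y \<notin> K" using A(3) less.prems(3) y by blast
    moreover have "alg_over K z" if "z \<in> A" for z using alg_over_radical[OF K(1)] A(2) that by blast
    ultimately obtain E \<tau> where E: "subfld E" "K \<subseteq> E" "A \<subseteq> E" "embedding E \<tau>"
        "\<And>z. z \<in> K \<Longrightarrow> \<tau> z = z" "\<tau> (x / y) \<noteq> x / y"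
      using embedding_moving[OF K(1) alg _ A(1)] by metis
    note emb = embedding_mult[OF E(1,4)] embedding_sum[OF E(1,4)] embedding_power[OF E(1,4)]
    \<comment> \<open>Some \<open>N\<close>-th power of each radical lies in \<open>K\<close> and is
      fixed by \<open>\<tau>\<close>, so these quotients are roots of unity and lie in
      \<open>K\<close> by hypothesis.\<close>
    define \<zeta> where "\<zeta> z = \<tau> z / z" for z
    have \<zeta>: "\<tau> z = \<zeta> z * z" "\<zeta> z \<in> K" if z: "z \<in> A" for z
    proof -
      obtain N where N: "N \<ge> 1" "z ^ N \<in> K" "z \<noteq> 0" using A(2) z by blast
      then have "\<tau> z ^ N = z ^ N" using emb(3)[of z N] E(3,5) z by auto
      then have "\<zeta> z ^ N = 1" using N by (simp add: \<zeta>_def power_divide)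
      then show "\<zeta> z \<in> K" using K(2) N by blast
      show "\<tau> z = \<zeta> z * z" using N by (simp add: \<zeta>_def)
    qed
    have "(\<Sum>z\<in>A. c z * \<zeta> z * z) = \<tau> (\<Sum>z\<in>A. c z * z)"
      using E(2,3,5) less.prems(1) \<zeta>
      by (subst emb(2)) (auto intro!: sum.cong subfld_mult[OF E(1)] simp: emb(1) subset_iff mult_ac)
    also have "\<dots> = 0" using less.prems(2) embedding_zero[OF E(1,4)] by simp
    \<comment> \<open>Subtracting \<open>\<zeta> x\<close> times the relation removes the term at
      \<open>x\<close> and creates no new one. The induction hypothesis then kills the term at
      \<open>y\<close> too, so \<open>\<zeta> y = \<zeta> x\<close>, although \<open>\<tau>\<close>
      was chosen to move \<open>x / y\<close>.\<close>
    finally have "(\<Sum>z\<in>A. c z * \<zeta> z * z) - \<zeta> x * (\<Sum>z\<in>A. c z * z) = 0"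
      using less.prems(2) by simp
    then have rel: "(\<Sum>z\<in>A. c z * (\<zeta> z - \<zeta> x) * z) = 0"
      by (simp add: sum_distrib_left sum_subtractf[symmetric] right_diff_distrib left_diff_distrib mult_ac)
    have "{z\<in>A. c z * (\<zeta> z - \<zeta> x) \<noteq> 0} \<subset> {z\<in>A. c z \<noteq> 0}"
      using less.prems(3) cx by auto
    then have "card {z\<in>A. c z * (\<zeta> z - \<zeta> x) \<noteq> 0} < card {z\<in>A. c z \<noteq> 0}"
      using A(1) by (intro psubset_card_mono) auto
    from less.hyps[OF this _ rel y(1)] have "c y * (\<zeta> y - \<zeta> x) = 0"
      using less.prems(1,3) \<zeta> by (auto intro!: subfld_mult[OF K(1)] subfld_diff[OF K(1)])
    then have "\<zeta> y = \<zeta> x" using y by simp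
    then have "\<tau> x / \<tau> y = x / y"
      using \<zeta>(1)[OF less.prems(3)] \<zeta>(1)[OF y(1)] embedding_nonzero[OF E(1,4), of y] E(3) A(2) y(1)
      by auto
    then show False using E(6) embedding_divide[OF E(1,4), of x y] E(3) less.prems(3) y(1) by auto
  qed
qed

section \<open>Cyclotomic fields\<close>

text \<open>The ring \<int>[z], built one monomial at a time, so that closure under sums and
  products follows by rule induction.\<close>

inductive_set cyclo_int :: "complex \<Rightarrow> complex set" for z where
  zero: "0 \<in> cyclo_int z"
| add: "y \<in> cyclo_int z \<Longrightarrow> of_int k * z ^ j + y \<in> cyclo_int z"

lemma cyclo_int_add: "x \<in> cyclo_int z \<Longrightarrow> y \<in> cyclo_int z \<Longrightarrow> x + y \<in> cyclo_int z"
  by (induction rule: cyclo_int.induct) (auto simp: add.assoc intro: cyclo_int.intros)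

lemma cyclo_int_monom: "of_int k * z ^ j \<in> cyclo_int z"
  using cyclo_int.add[OF cyclo_int.zero, of k z j] by simp

lemma cyclo_int_of_int: "of_int k \<in> cyclo_int z"
  using cyclo_int_monom[of k z 0] by simp

lemma cyclo_int_monom_mult: "x \<in> cyclo_int z \<Longrightarrow> of_int k * z ^ j * x \<in> cyclo_int z"
proof (induction rule: cyclo_int.induct)
  case zero
  then show ?case by (simp add: cyclo_int.zero)
next
  case (add y l i)
  have "of_int k * z ^ j * (of_int l * z ^ i + y) = of_int (k * l) * z ^ (j + i) + of_int k * z ^ j * y"
    by (simp add: algebra_simps power_add)
  then show ?case using add.IH cyclo_int.add by metis
qed

lemma cyclo_int_mult: "x \<in> cyclo_int z \<Longrightarrow> y \<in> cyclo_int z \<Longrightarrow> x * y \<in> cyclo_int z"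
proof (induction rule: cyclo_int.induct)
  case (add x k j)
  then show ?case
    using cyclo_int_add[OF cyclo_int_monom_mult[OF add.prems]] by (simp add: distrib_right)
qed (simp add: cyclo_int.zero)

lemma cyclo_int_power: "x \<in> cyclo_int z \<Longrightarrow> x ^ k \<in> cyclo_int z"
  by (induction k) (use cyclo_int_of_int[of 1] in \<open>auto intro: cyclo_int_mult\<close>)

lemma cyclo_int_sum: "(\<And>i. i \<in> I \<Longrightarrow> f i \<in> cyclo_int z) \<Longrightarrow> (\<Sum>i\<in>I. f i) \<in> cyclo_int z"
  by (induction I rule: infinite_finite_induct) (auto intro: cyclo_int.zero cyclo_int_add)

lemma cyclo_int_uminus: "x \<in> cyclo_int z \<Longrightarrow> - x \<in> cyclo_int z"
  using cyclo_int_monom_mult[of x z "-1" 0] by simp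

text \<open>Exponents are reduced modulo \<open>m\<close>: as a \<int>-module the ring is spanned by
  \<open>m\<close> powers of \<open>z\<close>, and this finite generation is what makes its elements
  integral.\<close>

lemma cyclo_int_repr:
  assumes "z ^ m = 1" "m \<ge> 1" "x \<in> cyclo_int z"
  shows "\<exists>c. x = (\<Sum>k<m. of_int (c k) * z ^ k)"
  using assms(3)
proof (induction rule: cyclo_int.induct)
  case zero
  then show ?case by (intro exI[of _ "\<lambda>_. 0"]) auto
next
  case (add y l j)
  then obtain c where c: "y = (\<Sum>k<m. of_int (c k) * z ^ k)" by blast
  define c' where "c' k = (if k = j mod m then c k + l else c k)" for k
  have "z ^ j = z ^ (j mod m)"
    using assms(1) by (metis mult_div_mod_eq power_add power_mult power_one mult_1)
  then have "of_int l * z ^ j + y = (\<Sum>k<m. (if k = j mod m then of_int l * z ^ k else 0) + of_int (c k) * z ^ k)"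
  proof -
    have "(\<Sum>k<m. if k = j mod m then of_int l * z ^ k else 0) = of_int l * z ^ (j mod m)"
      using assms(2) by (subst sum.delta) auto
    then show ?thesis unfolding sum.distrib c \<open>z ^ j = z ^ (j mod m)\<close> by (simp only:)
  qed
  also have "\<dots> = (\<Sum>k<m. of_int (c' k) * z ^ k)"
    by (intro sum.cong) (auto simp: c'_def algebra_simps)
  finally show ?case by blast
qed

text \<open>Multiplication by \<open>x\<close> acts on the powers of \<open>z\<close> through an
  integer matrix. The vector of these powers is an eigenvector with eigenvalue \<open>x\<close>,
  nonzero because its first entry is 1; so \<open>x\<close> is a root of a monic integer
  characteristic polynomial.\<close>

lemma cyclo_int_algebraic_int:
  assumes z: "z ^ m = 1" "m \<ge> 1" and x: "x \<in> cyclo_int z"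
  shows "algebraic_int x"
proof -
  have "\<exists>c. x * z ^ i = (\<Sum>k<m. of_int (c k) * z ^ k)" for i
    using cyclo_int_repr[OF z cyclo_int_mult[OF x cyclo_int_monom[of 1 z i]]] by simp
  then obtain C where C: "\<And>i. x * z ^ i = (\<Sum>k<m. of_int (C i k) * z ^ k)" by metis
  define A where "A = mat m m (\<lambda>(i, k). C i k)"
  define v where "v = vec m (\<lambda>k. z ^ k)"
  have A: "A \<in> carrier_mat m m" by (simp add: A_def)
  let ?A = "map_mat complex_of_int A"
  have Ac: "?A \<in> carrier_mat m m" using A by simp
  have "?A *\<^sub>v v = x \<cdot>\<^sub>v v"
    by (rule eq_vecI) (auto simp: A_def v_def C scalar_prod_def lessThan_atLeast0)
  moreover have "v \<noteq> 0\<^sub>v m"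
  proof
    assume "v = 0\<^sub>v m"
    then have "v $ 0 = 0" using z(2) by simp
    then show False using z(2) by (simp add: v_def)
  qed
  ultimately have "eigenvalue ?A x"
    unfolding eigenvalue_def eigenvector_def using Ac by (intro exI[of _ v]) (auto simp: v_def A_def)
  then have "poly (char_poly ?A) x = 0" using eigenvalue_root_char_poly[OF Ac] by simp
  then have "poly (map_poly of_int (char_poly A)) x = 0"
    using of_int_hom.char_poly_hom[OF A, where 'a = complex] by simp
  moreover have "lead_coeff (char_poly A) = 1" using degree_monic_char_poly[OF A] by simp
  ultimately show ?thesis unfolding algebraic_int_altdef_ipoly by blast
qed

text \<open>For nonzero \<open>p\<close> the element \<open>x\<close> equals \<open>N / p\<close>:
  rational and an algebraic integer, hence an integer. This carries divisibility from \<int>[z] back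
  to \<int>.\<close>

lemma cyclo_int_dvd_int:
  assumes z: "z ^ m = 1" "m \<ge> 1" and x: "x \<in> cyclo_int z" and "of_int p * x = of_int N"
  shows "p dvd N"
proof (cases "p = 0")
  case False
  then have "x = of_int N / of_int p" using assms(4) by (simp add: field_simps)
  then have "x \<in> \<rat>" by simp
  then have "x \<in> \<int>"
    using rational_algebraic_int_is_int[OF cyclo_int_algebraic_int[OF z x]] by simp
  then obtain k where "x = of_int k" by (elim Ints_cases)
  then have "of_int (p * k) = (of_int N :: complex)" using assms(4) by simp
  then have "p * k = N" by (simp only: of_int_eq_iff)
  then show ?thesis by auto
qed (use assms in auto)

text \<open>A substitute for the norm. An integer polynomial of least degree vanishing at
  \<open>x\<close> has nonzero constant term, as otherwise \<open>x\<close> could be cancelled;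
  moving that term to the other side exhibits it as a multiple of \<open>x\<close>.\<close>

lemma cyclo_int_norm:
  assumes z: "z ^ m = 1" "m \<ge> 1" and x: "x \<in> cyclo_int z" "x \<noteq> 0"
  shows "\<exists>N \<delta>. N \<noteq> 0 \<and> \<delta> \<in> cyclo_int z \<and> x * \<delta> = of_int N"
proof -
  define P where "P q \<longleftrightarrow> q \<noteq> 0 \<and> poly (map_poly of_int q) x = 0" for q :: "int poly"
  obtain q0 where q0: "poly (map_poly of_int q0) x = 0" "lead_coeff q0 = 1"
    using cyclo_int_algebraic_int[OF z x(1)] unfolding algebraic_int_altdef_ipoly by blast
  have "q0 \<noteq> 0"
  proof
    assume "q0 = 0"
    with q0(2) show False by simp
  qed
  with q0 have "\<exists>q. P q" unfolding P_def by blast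
  then obtain q where q: "P q" "\<And>r. P r \<Longrightarrow> degree q \<le> degree r"
    using ex_has_least_nat[of P _ degree] by blast
  obtain a r where ar: "q = pCons a r" by (rule pCons_cases)
  have rq: "of_int a + x * poly (map_poly of_int r) x = 0"
    using q(1) unfolding P_def ar of_int_hom.map_poly_pCons_hom poly_pCons by blast
  have "a \<noteq> 0"
  proof
    assume "a = 0"
    then have "r \<noteq> 0" using q(1) unfolding P_def ar by (metis pCons_0_0)
    moreover have "poly (map_poly of_int r) x = 0" using rq x(2) unfolding \<open>a = 0\<close> of_int_0 add_0_left mult_eq_0_iff by blast
    ultimately have "P r" by (simp add: P_def)
    from q(2)[OF this] show False using \<open>r \<noteq> 0\<close> unfolding ar degree_pCons_eq_if by simp
  qed
  moreover have "- poly (map_poly of_int r) x \<in> cyclo_int z"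
    unfolding poly_altdef
    by (intro cyclo_int_uminus cyclo_int_sum cyclo_int_mult cyclo_int_power x)
       (simp add: coeff_map_poly cyclo_int_of_int)
  moreover have "x * (- poly (map_poly of_int r) x) = of_int a"
    using rq by (metis add.commute add_eq_0_iff minus_mult_right minus_minus)
  ultimately show ?thesis by blast
qed

lemma cyclo_int_freshman:
  assumes "prime (p :: nat)" "x \<in> cyclo_int z" "y \<in> cyclo_int z"
  shows "\<exists>d\<in>cyclo_int z. (x + y) ^ p = x ^ p + y ^ p + of_nat p * d"
proof -
  have p: "p \<ge> 2" using assms(1) prime_ge_2_nat by blast
  define d where "d = (\<Sum>k\<in>{1..<p}. of_nat ((p choose k) div p) * x ^ k * y ^ (p - k))"
  have "of_nat (p choose k) = (of_nat p :: complex) * of_nat ((p choose k) div p)" if "k \<in> {1..<p}" for k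
  proof -
    have "p dvd (p choose k)" using that assms(1) by (intro dvd_choose_prime) auto
    then show ?thesis by (metis dvd_mult_div_cancel of_nat_mult)
  qed
  then have "of_nat p * d = (\<Sum>k\<in>{1..<p}. of_nat (p choose k) * x ^ k * y ^ (p - k))"
    unfolding d_def sum_distrib_left by (intro sum.cong) (simp_all add: mult.assoc)
  moreover have "{..p} = insert 0 (insert p {1..<p})" using p by auto
  ultimately have "(x + y) ^ p = x ^ p + y ^ p + of_nat p * d"
    using p by (simp add: binomial_ring)
  moreover have "d \<in> cyclo_int z"
    unfolding d_def using cyclo_int_of_int[of "int _" z]
    by (auto intro!: cyclo_int_sum cyclo_int_mult cyclo_int_power assms)
  ultimately show ?thesis by blast
qed

text \<open>Frobenius modulo \<open>p\<close>: the inner binomial coefficients are multiples of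
  \<open>p\<close>, and Fermat's theorem replaces \<open>c ^ p\<close> by \<open>c\<close> in each
  coefficient. The error is kept as \<open>p\<close> times a ring element.\<close>

lemma cyclo_int_frobenius:
  assumes p: "prime (p :: nat)" and "finite I"
  shows "\<exists>d\<in>cyclo_int z. (\<Sum>i\<in>I. of_int (c i) * z ^ (k i)) ^ p
           = (\<Sum>i\<in>I. of_int (c i) * z ^ (k i * p)) + of_nat p * d"
  using assms(2)
proof (induction I rule: finite_induct)
  case empty
  then show ?case using p by (intro bexI[of _ 0]) (simp_all add: cyclo_int.zero prime_gt_0_nat)
next
  case (insert i I)
  then obtain d where d: "d \<in> cyclo_int z" "(\<Sum>i\<in>I. of_int (c i) * z ^ (k i)) ^ p
           = (\<Sum>i\<in>I. of_int (c i) * z ^ (k i * p)) + of_nat p * d" by blast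
  obtain e where e: "e \<in> cyclo_int z"
    "(of_int (c i) * z ^ (k i) + (\<Sum>i\<in>I. of_int (c i) * z ^ (k i))) ^ p
     = (of_int (c i) * z ^ (k i)) ^ p + (\<Sum>i\<in>I. of_int (c i) * z ^ (k i)) ^ p + of_nat p * e"
    using cyclo_int_freshman[OF p cyclo_int_monom[of "c i" z "k i"]
        cyclo_int_sum[of I "\<lambda>i. of_int (c i) * z ^ k i" z, OF cyclo_int_monom]] by (elim bexE)
  have "[c i ^ p = c i] (mod int p)"
  proof (cases "int p dvd c i")
    case True
    then have "int p dvd c i ^ p" using dvd_trans[OF True dvd_power[of p "c i"]] p
      by (simp add: prime_gt_0_nat)
    then show ?thesis using True unfolding cong_iff_dvd_diff by (rule dvd_diff)
  next
    case False
    define r where "r = nat (c i mod int p)"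
    have "0 < int p" using prime_gt_0_nat[OF p] by linarith
    then have "int r = c i mod int p" unfolding r_def by (intro nat_0_le pos_mod_sign)
    then have r: "[int r = c i] (mod int p)" unfolding cong_def by (metis mod_mod_trivial)
    then have "\<not> int p dvd int r" using False cong_dvd_iff by blast
    then have "[r ^ (p - 1) = 1] (mod p)" using fermat_theorem[OF p] by (simp only: int_dvd_int_iff)
    then have "[int (r ^ (p - 1)) = int 1] (mod int p)" by (simp only: cong_int_iff)
    then have "[int r ^ (p - 1) = 1] (mod int p)" by simp
    then have "[c i ^ (p - 1) = 1] (mod int p)"
      by (rule cong_trans[OF cong_sym[OF cong_pow[OF r]]])
    then have "[c i ^ (p - 1) * c i = 1 * c i] (mod int p)" by (intro cong_mult) auto
    then show ?thesis using power_minus_mult[of p "c i"] p by (metis cong_sym cong_trans mult_1 cong_refl prime_gt_0_nat)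
  qed
  then obtain l where l: "c i ^ p = c i + int p * l"
    using cong_sym cong_iff_lin[of "c i" "c i ^ p"] by blast
  have "(of_int (c i) * z ^ (k i)) ^ p = of_int (c i ^ p) * z ^ (k i * p)"
    by (simp add: power_mult_distrib power_mult)
  also have "\<dots> = of_int (c i) * z ^ (k i * p) + of_nat p * (of_int l * z ^ (k i * p))"
    unfolding l by (simp add: algebra_simps)
  finally have "(\<Sum>i\<in>insert i I. of_int (c i) * z ^ (k i)) ^ p
      = (\<Sum>i\<in>insert i I. of_int (c i) * z ^ (k i * p)) + of_nat p * (of_int l * z ^ (k i * p) + d + e)"
    using insert.hyps d(2) e(2) by (simp add: algebra_simps)
  moreover have "of_int l * z ^ (k i * p) + d + e \<in> cyclo_int z"
    using d(1) e(1) cyclo_int_monom by (auto intro!: cyclo_int_add)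
  ultimately show ?case by blast
qed

text \<open>Irreducibility of the cyclotomic polynomials. Any exponent coprime to \<open>m\<close> may be replaced by
  one whose prime factors are all large, and a large prime cannot divide a nonzero value
  \<open>f(\<zeta>\<^sup>p) \<equiv> f(\<zeta>)\<^sup>p = 0\<close>, because that value divides a fixed nonzero integer.\<close>

lemma cyclotomic_conjugate:
  fixes z :: complex and c :: "'i \<Rightarrow> int"
  assumes z: "z ^ m = 1" "m \<ge> 1" and I: "finite I" and u: "coprime u m"
    and rel: "(\<Sum>i\<in>I. of_int (c i) * z ^ (k i)) = 0"
  shows "(\<Sum>i\<in>I. of_int (c i) * z ^ (k i * u)) = 0"
proof -
  define f where "f j = (\<Sum>i\<in>I. of_int (c i) * z ^ (k i * j))" for j
  have zmod: "z ^ i = z ^ j" if "[i = j] (mod m)" for i j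
  proof -
    have "z ^ i = z ^ (i mod m)" for i
      using z(1) by (metis mult_div_mod_eq power_add power_mult power_one mult_1)
    then show ?thesis using that unfolding cong_def by metis
  qed
  have fmod: "f i = f j" if "[i = j] (mod m)" for i j
    unfolding f_def using zmod[OF cong_scalar_left[OF that]] by (intro sum.cong refl arg_cong2[of _ _ _ _ "(*)"])
  have fR: "f j \<in> cyclo_int z" for j
    unfolding f_def by (intro cyclo_int_sum cyclo_int_monom)
  have "\<forall>j. \<exists>N. f j \<noteq> 0 \<longrightarrow> N \<noteq> 0 \<and> (\<exists>\<delta>\<in>cyclo_int z. f j * \<delta> = of_int N)"
    using cyclo_int_norm[OF z fR] by metis
  then obtain N where N: "\<And>j. f j \<noteq> 0 \<Longrightarrow> N j \<noteq> 0 \<and> (\<exists>\<delta>\<in>cyclo_int z. f j * \<delta> = of_int (N j))"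
    by metis
  \<comment> \<open>\<open>f\<close> depends only on its argument modulo \<open>m\<close>, so
    finitely many integers \<open>N j\<close> decide which primes could divide a nonzero
    value.\<close>
  define B where "B = Max ((\<lambda>j. nat \<bar>N j\<bar>) ` {..<m})"
  have B: "nat \<bar>N j\<bar> \<le> B" if "j < m" for j
    unfolding B_def using that by (intro Max_ge) auto
  have step: "f (j * p) = 0" if p: "prime p" "p > B" and fj: "f j = 0" for p j
  proof (rule ccontr)
    assume "f (j * p) \<noteq> 0"
    define i where "i = (j * p) mod m"
    have fi: "f (j * p) = f i" by (rule fmod) (simp add: i_def cong_def)
    have im: "i < m" using z(2) by (simp add: i_def)
    obtain d where d: "d \<in> cyclo_int z" "f j ^ p = f (j * p) + of_nat p * d"
      using cyclo_int_frobenius[OF p(1) I, of z c "\<lambda>i. k i * j"] by (auto simp: f_def mult.assoc)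
    then have "f i + of_nat p * d = 0" using fj p(1) fi
      by (simp add: power_0_left split: if_splits)
    then have e1: "f i = of_nat p * (- d)" by (simp add: eq_neg_iff_add_eq_0)
    obtain \<delta> where \<delta>: "\<delta> \<in> cyclo_int z" "f i * \<delta> = of_int (N i)" "N i \<noteq> 0"
      using N[of i] \<open>f (j * p) \<noteq> 0\<close> fi by auto
    have "of_int (int p) * (- d * \<delta>) = of_int (N i)" using \<delta>(2) e1 by (simp add: mult.assoc)
    then have "int p dvd N i"
      using cyclo_int_dvd_int[OF z] cyclo_int_mult[OF cyclo_int_uminus[OF d(1)] \<delta>(1)] by blast
    then have "p \<le> nat \<bar>N i\<bar>" using \<delta>(3) using zdvd_imp_le[of "int p" "\<bar>N i\<bar>"] by simp
    then show False using B[OF im] p(2) by simp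
  qed
  have steps: "(\<And>q. prime q \<Longrightarrow> q dvd v \<Longrightarrow> q > B) \<Longrightarrow> v \<noteq> 0 \<Longrightarrow> f v = 0" for v
  proof (induction v rule: prime_divisors_induct)
    case (unit v)
    then show ?case using rel by (simp add: f_def)
  next
    case (factor p v)
    then have "f v = 0" by auto
    then show ?case using step[of p v] factor by (auto simp: mult.commute)
  qed auto
  \<comment> \<open>The small primes not dividing \<open>m\<close>. An exponent congruent to
    \<open>u\<close> modulo \<open>m\<close> and to 1 modulo \<open>P\<close> has no prime factor up
    to \<open>B\<close>: those dividing \<open>m\<close> are excluded because \<open>u\<close> is
    coprime to \<open>m\<close>, the others by the second congruence.\<close>
  define P where "P = \<Prod>{q. prime q \<and> q \<le> B \<and> \<not> q dvd m}"
  have finP: "finite {q. prime q \<and> q \<le> B \<and> \<not> q dvd m}" by simp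
  have "coprime m P"
    unfolding P_def
    by (rule prod_coprime_right) (use prime_imp_coprime coprime_commute in blast)
  then obtain v where v: "[v = u] (mod m)" "[v = 1] (mod P)"
    using binary_chinese_remainder_nat by blast
  \<comment> \<open>Adding \<open>m * P\<close> keeps both congruences and makes the exponent
    nonzero, as the induction over its prime factors requires.\<close>
  define v' where "v' = v + m * P"
  have v': "[v' = u] (mod m)" "[v' = 1] (mod P)"
    using v unfolding v'_def by (metis cong_add_rcancel_0_nat cong_mult_self_left cong_mult_self_right cong_trans cong_add add.right_neutral cong_0_iff dvd_triv_left dvd_triv_right)+
  have P0: "P \<noteq> 0" unfolding P_def using finP by (auto simp: prime_gt_0_nat)
  have "v' \<noteq> 0" using z(2) P0 by (simp add: v'_def)
  moreover have "q > B" if q: "prime q" "q dvd v'" for q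
  proof (rule ccontr)
    assume "\<not> q > B"
    show False
    proof (cases "q dvd m")
      case True
      then have "q dvd u" using v'(1) q(2) by (meson cong_dvd_iff cong_dvd_modulus_nat)
      then show False using True u q(1) by (meson coprime_common_divisor not_prime_unit)
    next
      case False
      then have "q dvd P" unfolding P_def using finP q(1) \<open>\<not> q > B\<close> by (intro dvd_prodI) auto
      then have "[v' = 1] (mod q)" using v'(2) cong_dvd_modulus_nat by blast
      then have "q dvd 1" using q(2) cong_dvd_iff by blast
      then show False using q(1) by simp
    qed
  qed
  ultimately have "f v' = 0" using steps by blast
  then show ?thesis using fmod[OF v'(1)] by (simp add: f_def)
qed

section \<open>Linear relations between radicals\<close>

text \<open>Subgroups of the nonzero complex numbers as bare sets with explicit laws; the structures
  of HOL-Algebra appear only where the notions of the theorem are unfolded.\<close>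

definition mgroup :: "complex set \<Rightarrow> bool" where
  "mgroup M \<longleftrightarrow> 1 \<in> M \<and> 0 \<notin> M \<and> (\<forall>x\<in>M. \<forall>y\<in>M. x * y \<in> M) \<and> (\<forall>x\<in>M. inverse x \<in> M)"

definition mhom :: "complex set \<Rightarrow> (complex \<Rightarrow> complex) \<Rightarrow> bool" where
  "mhom M \<sigma> \<longleftrightarrow> (\<forall>x\<in>M. \<sigma> x \<noteq> 0) \<and> (\<forall>x\<in>M. \<forall>y\<in>M. \<sigma> (x * y) = \<sigma> x * \<sigma> y)"

context fixes M assumes M: "mgroup M"
begin

lemma mgroup_one: "1 \<in> M" using M by (simp add: mgroup_def)
lemma mgroup_nonzero: "x \<in> M \<Longrightarrow> x \<noteq> 0" using M by (auto simp: mgroup_def)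
lemma mgroup_mult: "x \<in> M \<Longrightarrow> y \<in> M \<Longrightarrow> x * y \<in> M" using M by (simp add: mgroup_def)
lemma mgroup_inverse: "x \<in> M \<Longrightarrow> inverse x \<in> M" using M by (simp add: mgroup_def)
lemma mgroup_divide: "x \<in> M \<Longrightarrow> y \<in> M \<Longrightarrow> x / y \<in> M"
  using mgroup_mult[OF _ mgroup_inverse] by (simp add: divide_inverse)
lemma mgroup_power: "x \<in> M \<Longrightarrow> x ^ k \<in> M"
  by (induction k) (auto intro: mgroup_one mgroup_mult)
lemma mgroup_power_int: "x \<in> M \<Longrightarrow> x powi k \<in> M"
  by (auto simp: power_int_def intro: mgroup_power mgroup_inverse)
lemma mgroup_prod: "(\<And>i. i \<in> I \<Longrightarrow> f i \<in> M) \<Longrightarrow> (\<Prod>i\<in>I. f i) \<in> M"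
  by (induction I rule: infinite_finite_induct) (auto intro: mgroup_one mgroup_mult)

context fixes \<sigma> assumes \<sigma>: "mhom M \<sigma>"
begin

lemma mhom_nonzero: "x \<in> M \<Longrightarrow> \<sigma> x \<noteq> 0" using \<sigma> by (simp add: mhom_def)
lemma mhom_mult: "x \<in> M \<Longrightarrow> y \<in> M \<Longrightarrow> \<sigma> (x * y) = \<sigma> x * \<sigma> y" using \<sigma> by (simp add: mhom_def)
lemma mhom_one: "\<sigma> 1 = 1" using mhom_mult[OF mgroup_one mgroup_one] mhom_nonzero[OF mgroup_one] by simp
lemma mhom_inverse: "x \<in> M \<Longrightarrow> \<sigma> (inverse x) = inverse (\<sigma> x)"
  using mhom_mult[of x "inverse x"] mgroup_inverse mgroup_nonzero mhom_one
  by (metis inverse_unique right_inverse)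
lemma mhom_divide: "x \<in> M \<Longrightarrow> y \<in> M \<Longrightarrow> \<sigma> (x / y) = \<sigma> x / \<sigma> y"
  by (simp add: divide_inverse mhom_mult mhom_inverse mgroup_inverse)
lemma mhom_power: "x \<in> M \<Longrightarrow> \<sigma> (x ^ k) = \<sigma> x ^ k"
  by (induction k) (auto simp: mhom_one mhom_mult mgroup_power)
lemma mhom_power_int: "x \<in> M \<Longrightarrow> \<sigma> (x powi k) = \<sigma> x powi k"
  by (auto simp: power_int_def mhom_power mhom_inverse mgroup_inverse)
end
end

lemma mhom_mono: "mhom M f \<Longrightarrow> H \<subseteq> M \<Longrightarrow> mhom H f"
  unfolding mhom_def by blast

text \<open>Formal \<rat>-linear combinations are lists with repetitions allowed, so applying
  \<open>\<sigma>\<close> to every radical needs no well-definedness. With the identity in place of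
  \<open>\<sigma>\<close> the result is the actual value.\<close>

definition lcomb :: "(complex \<Rightarrow> complex) \<Rightarrow> (rat \<times> complex) list \<Rightarrow> complex" where
  "lcomb \<sigma> l = (\<Sum>p\<leftarrow>l. of_rat (fst p) * \<sigma> (snd p))"

definition qspan :: "complex set \<Rightarrow> complex set" where
  "qspan M = lcomb (\<lambda>x. x) ` lists (UNIV \<times> M)"

text \<open>Exactly what makes the \<rat>-linear extension of \<open>\<sigma>\<close> to the span
  well defined; it takes the place of membership in the Galois group.\<close>

definition preserves_relations :: "complex set \<Rightarrow> (complex \<Rightarrow> complex) \<Rightarrow> bool" where
  "preserves_relations M \<sigma> \<longleftrightarrow> (\<forall>l\<in>lists (UNIV \<times> M). lcomb (\<lambda>x. x) l = 0 \<longrightarrow> lcomb \<sigma> l = 0)"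

definition lcomb_times :: "(rat \<times> complex) list \<Rightarrow> (rat \<times> complex) list \<Rightarrow> (rat \<times> complex) list" where
  "lcomb_times l l' = concat (map (\<lambda>p. map (\<lambda>p'. (fst p * fst p', snd p * snd p')) l') l)"

lemma lcomb_Nil [simp]: "lcomb \<sigma> [] = 0" by (simp add: lcomb_def)
lemma lcomb_Cons [simp]: "lcomb \<sigma> (p # l) = of_rat (fst p) * \<sigma> (snd p) + lcomb \<sigma> l" by (simp add: lcomb_def)
lemma lcomb_append [simp]: "lcomb \<sigma> (l @ l') = lcomb \<sigma> l + lcomb \<sigma> l'" by (simp add: lcomb_def)

lemma lcomb_lcomb_times:
  assumes "\<And>x y. x \<in> M \<Longrightarrow> y \<in> M \<Longrightarrow> \<sigma> (x * y) = \<sigma> x * \<sigma> y"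
  shows "l \<in> lists (UNIV \<times> M) \<Longrightarrow> l' \<in> lists (UNIV \<times> M) \<Longrightarrow> lcomb \<sigma> (lcomb_times l l') = lcomb \<sigma> l * lcomb \<sigma> l'"
proof (induction l)
  case (Cons p l)
  have "snd p \<in> M" using Cons.prems(1) by auto
  then have "lcomb \<sigma> (map (\<lambda>p'. (fst p * fst p', snd p * snd p')) l') = of_rat (fst p) * \<sigma> (snd p) * lcomb \<sigma> l'"
    if "l' \<in> lists (UNIV \<times> M)" for l'
    using that by (induction l') (auto simp: algebra_simps of_rat_mult assms)
  then show ?case using Cons by (simp add: lcomb_times_def algebra_simps)
qed (simp add: lcomb_times_def)

lemma lcomb_times_lists:
  assumes "mgroup M" "l \<in> lists (UNIV \<times> M)" "l' \<in> lists (UNIV \<times> M)"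
  shows "lcomb_times l l' \<in> lists (UNIV \<times> M)"
  using assms by (auto simp: lcomb_times_def in_lists_conv_set mem_Times_iff intro!: mgroup_mult)

lemma lcomb_uminus: "lcomb \<sigma> (map (\<lambda>p. (- fst p, snd p)) l) = - lcomb \<sigma> l"
  by (induction l) (auto simp: of_rat_minus)

lemma lcomb_sum: "lcomb \<sigma> l = (\<Sum>i<length l. of_rat (fst (l ! i)) * \<sigma> (snd (l ! i)))"
  by (simp add: lcomb_def sum_list_sum_nth lessThan_atLeast0)

lemma qspan_superset: "M \<subseteq> qspan M"
proof
  fix x assume "x \<in> M"
  then show "x \<in> qspan M" unfolding qspan_def by (intro image_eqI[of _ _ "[(1, x)]"]) auto
qed

lemma qspan_add: assumes "x \<in> qspan M" "y \<in> qspan M" shows "x + y \<in> qspan M"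
proof -
  obtain l l' where "l \<in> lists (UNIV \<times> M)" "l' \<in> lists (UNIV \<times> M)" "x = lcomb (\<lambda>x. x) l" "y = lcomb (\<lambda>x. x) l'"
    using assms unfolding qspan_def by blast
  then show ?thesis unfolding qspan_def by (intro image_eqI[of _ _ "l @ l'"]) auto
qed

lemma qspan_uminus: assumes "x \<in> qspan M" shows "- x \<in> qspan M"
proof -
  obtain l where "l \<in> lists (UNIV \<times> M)" "x = lcomb (\<lambda>x. x) l"
    using assms unfolding qspan_def by blast
  then show ?thesis unfolding qspan_def
    by (intro image_eqI[of _ _ "map (\<lambda>p. (- fst p, snd p)) l"]) (auto simp: lcomb_uminus in_lists_conv_set)
qed

lemma qspan_mult: assumes "mgroup M" "x \<in> qspan M" "y \<in> qspan M" shows "x * y \<in> qspan M"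
proof -
  obtain l l' where l: "l \<in> lists (UNIV \<times> M)" "l' \<in> lists (UNIV \<times> M)" "x = lcomb (\<lambda>x. x) l" "y = lcomb (\<lambda>x. x) l'"
    using assms unfolding qspan_def by blast
  then have "x * y = lcomb (\<lambda>x. x) (lcomb_times l l')" by (subst lcomb_lcomb_times[of M]) auto
  then show ?thesis unfolding qspan_def using lcomb_times_lists[OF assms(1) l(1,2)] by blast
qed

lemma qspan_Rats: assumes "mgroup M" "q \<in> \<rat>" shows "q \<in> qspan M"
proof -
  obtain r where "q = of_rat r" using assms(2) by (elim Rats_cases)
  then show ?thesis unfolding qspan_def using mgroup_one[OF assms(1)]
    by (intro image_eqI[of _ _ "[(r, 1)]"]) auto
qed

lemma subfld_Rats': "subfld \<rat>"
  by (auto simp: subfld_def)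

text \<open>Adjoining an algebraic element of \<open>M\<close> only forms polynomial expressions,
  and the span is already a ring, so a field containing finitely many given elements can be built
  inside it. This provides the inverses in \<open>subfld_qspan\<close>.\<close>

lemma qspan_finite_subfld:
  assumes M: "mgroup M" "\<And>x. x \<in> M \<Longrightarrow> alg_over \<rat> x" and "finite F" "F \<subseteq> M"
  shows "\<exists>E. subfld E \<and> F \<subseteq> E \<and> E \<subseteq> qspan M"
  using assms(3,4)
proof (induction F)
  case empty
  then show ?case using subfld_Rats' qspan_Rats[OF M(1)] by blast
next
  case (insert z F)
  then obtain E where E: "subfld E" "F \<subseteq> E" "E \<subseteq> qspan M" by auto
  have "alg_over E z" using insert.prems M(2) alg_over_mono[of \<rat> E] subfld_Rats[OF E(1)] by blast
  then have "subfld (adjoin E z)" by (rule subfld_adjoin[OF E(1)])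
  moreover have "insert z F \<subseteq> adjoin E z"
    using adjoin_mem[OF E(1)] adjoin_superset[OF E(1)] E(2) by blast
  moreover have "adjoin E z \<subseteq> qspan M"
  proof
    fix y assume "y \<in> adjoin E z"
    then obtain f where f: "y = poly f z" "\<forall>i. coeff f i \<in> E" by (auto simp: adjoin_def)
    have "poly f z \<in> qspan M"
      using f(2)
    proof (induction f)
      case 0
      then show ?case using qspan_Rats[OF M(1), of 0] by simp
    next
      case (pCons c f)
      have "\<forall>i. coeff f i \<in> E" using pCons.prems by (metis coeff_pCons_Suc)
      moreover have "c \<in> E" using pCons.prems by (metis coeff_pCons_0)
      moreover have "z \<in> qspan M" using insert.prems qspan_superset by blast
      ultimately show ?case using pCons.IH E(3) by (auto intro!: qspan_add qspan_mult M(1))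
    qed
    then show "y \<in> qspan M" using f by simp
  qed
  ultimately show ?case by blast
qed

lemma subfld_qspan:
  assumes M: "mgroup M" "\<And>x. x \<in> M \<Longrightarrow> alg_over \<rat> x"
  shows "subfld (qspan M)"
proof -
  have "inverse x \<in> qspan M" if x: "x \<in> qspan M" for x
  proof -
    obtain l where l: "l \<in> lists (UNIV \<times> M)" "x = lcomb (\<lambda>x. x) l"
      using x unfolding qspan_def by blast
    have "finite (snd ` set l)" "snd ` set l \<subseteq> M" using l(1) by (auto simp: in_lists_conv_set mem_Times_iff)
    then obtain E where E: "subfld E" "snd ` set l \<subseteq> E" "E \<subseteq> qspan M"
      using qspan_finite_subfld[OF M] by blast
    have "x \<in> E" unfolding l(2) lcomb_sum
    proof (intro subfld_sum[OF E(1)] subfld_mult[OF E(1)])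
      fix i assume "i \<in> {..<length l}"
      then show "snd (l ! i) \<in> E" "of_rat (fst (l ! i)) \<in> E"
        using E(2) subfld_Rats[OF E(1)] by auto
    qed
    then show ?thesis using subfld_inverse[OF E(1)] E(3) by blast
  qed
  moreover have "x - y \<in> qspan M" if "x \<in> qspan M" "y \<in> qspan M" for x y
    using qspan_add[OF that(1) qspan_uminus[OF that(2)]] by simp
  ultimately show ?thesis
    unfolding subfld_def using qspan_superset[of M] mgroup_one[OF M(1)] qspan_mult[OF M(1)] by blast
qed

text \<open>The value at an element is computed from an arbitrary list representing it. Two such
  lists differ by a relation, which \<open>\<sigma>\<close> preserves; products are handled by
  \<open>lcomb_times\<close>.\<close>

lemma preserves_relations_embedding:
  assumes M: "mgroup M" "mhom M \<sigma>" "preserves_relations M \<sigma>"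
  obtains \<theta> where "embedding (qspan M) \<theta>" "\<And>x. x \<in> M \<Longrightarrow> \<theta> x = \<sigma> x"
    "\<And>l. l \<in> lists (UNIV \<times> M) \<Longrightarrow> \<theta> (lcomb (\<lambda>x. x) l) = lcomb \<sigma> l"
proof -
  define \<theta> where "\<theta> y = lcomb \<sigma> (SOME l. l \<in> lists (UNIV \<times> M) \<and> lcomb (\<lambda>x. x) l = y)" for y
  have eq: "\<theta> (lcomb (\<lambda>x. x) l) = lcomb \<sigma> l" if l: "l \<in> lists (UNIV \<times> M)" for l
  proof -
    define l' where "l' = (SOME l'. l' \<in> lists (UNIV \<times> M) \<and> lcomb (\<lambda>x. x) l' = lcomb (\<lambda>x. x) l)"
    have l': "l' \<in> lists (UNIV \<times> M) \<and> lcomb (\<lambda>x. x) l' = lcomb (\<lambda>x. x) l"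
      unfolding l'_def by (rule someI[of _ l]) (use l in auto)
    define d where "d = l' @ map (\<lambda>p. (- fst p, snd p)) l"
    have "d \<in> lists (UNIV \<times> M)" using l l' by (auto simp: d_def in_lists_conv_set)
    moreover have "lcomb (\<lambda>x. x) d = 0" using l' by (simp add: d_def lcomb_uminus)
    ultimately have "lcomb \<sigma> d = 0" using M(3) unfolding preserves_relations_def by blast
    then show ?thesis by (simp add: d_def lcomb_uminus \<theta>_def l'_def)
  qed
  have base: "\<theta> x = \<sigma> x" if "x \<in> M" for x
    using eq[of "[(1, x)]"] that by simp
  have "embedding (qspan M) \<theta>"
    unfolding embedding_def
  proof (intro conjI ballI)
    show "\<theta> 1 = 1" using base[OF mgroup_one[OF M(1)]] mhom_one[OF M(1,2)] by simp
    fix x y assume "x \<in> qspan M" "y \<in> qspan M"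
    then obtain l l' where l: "l \<in> lists (UNIV \<times> M)" "l' \<in> lists (UNIV \<times> M)"
      "x = lcomb (\<lambda>x. x) l" "y = lcomb (\<lambda>x. x) l'"
      unfolding qspan_def by blast
    show "\<theta> (x + y) = \<theta> x + \<theta> y"
      using eq[of "l @ l'"] eq[OF l(1)] eq[OF l(2)] l by simp
    have "x * y = lcomb (\<lambda>x. x) (lcomb_times l l')"
      using l by (subst lcomb_lcomb_times[of M]) auto
    then show "\<theta> (x * y) = \<theta> x * \<theta> y"
      using eq[OF lcomb_times_lists[OF M(1) l(1,2)]] eq[OF l(1)] eq[OF l(2)] l
        lcomb_lcomb_times[of M \<sigma>, OF mhom_mult[OF M(1,2)] l(1,2)] by simp
  qed
  with base eq show ?thesis using that by blast
qed

section \<open>Roots of unity and radicals in the maximal cyclotomic field\<close>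

definition runity :: "complex set" where "runity = {z. \<exists>m\<ge>1. z ^ m = 1}"

lemma runity_mem: "m \<ge> 1 \<Longrightarrow> z ^ m = 1 \<Longrightarrow> z \<in> runity"
  unfolding runity_def by blast

lemma runity_common_exponent:
  assumes "finite F" "F \<subseteq> runity"
  shows "\<exists>m\<ge>1. \<forall>z\<in>F. z ^ m = 1"
  using assms
proof (induction F)
  case (insert z F)
  then obtain m k where "m \<ge> 1" "k \<ge> 1" "\<forall>z\<in>F. z ^ m = 1" "z ^ k = 1" unfolding runity_def by blast
  moreover have "x ^ (m * k) = 1" if "x ^ m = 1 \<or> x ^ k = 1" for x :: complex
    using that by (metis mult.commute power_mult power_one)
  ultimately show ?case by (intro exI[of _ "m * k"]) auto
qed auto

lemma mgroup_runity: "mgroup runity"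
proof -
  have "x * y \<in> runity" if "x \<in> runity" "y \<in> runity" for x y
    using runity_common_exponent[of "{x, y}"] that by (auto simp: runity_def power_mult_distrib)
  moreover have "inverse x \<in> runity" if "x \<in> runity" for x
    using that by (auto simp: runity_def power_inverse)
  ultimately show ?thesis unfolding mgroup_def by (auto simp: runity_def power_0_left intro: exI[of _ 1])
qed

lemma alg_over_runity: "z \<in> runity \<Longrightarrow> alg_over \<rat> z"
  unfolding runity_def using alg_over_radical[OF subfld_Rats'] by auto

lemma subfld_qspan_runity: "subfld (qspan runity)"
  by (rule subfld_qspan[OF mgroup_runity alg_over_runity])

lemma primitive_root_of_unity:
  assumes "m \<ge> 1"
  shows "\<exists>z::complex. z ^ m = 1 \<and> (\<forall>x. x ^ m = 1 \<longrightarrow> (\<exists>k<m. x = z ^ k)) \<and> (\<forall>k. 0 < k \<and> k < m \<longrightarrow> z ^ k \<noteq> 1)"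
proof -
  define z where "z = cis (2 * pi / real m)"
  have zk: "z ^ k = cis (2 * pi * real k / real m)" for k
    unfolding z_def Complex.DeMoivre by (simp add: field_simps)
  have bij: "bij_betw (\<lambda>k. z ^ k) {..<m} {z. z ^ m = 1}"
    using Complex.bij_betw_roots_unity[of m] assms unfolding zk by simp
  have "z ^ m = 1" using assms by (simp add: zk)
  moreover have "\<exists>k<m. x = z ^ k" if "x ^ m = 1" for x
    using bij that unfolding bij_betw_def by blast
  moreover have "z ^ k \<noteq> 1" if "0 < k" "k < m" for k
    using inj_onD[OF bij_betw_imp_inj_on[OF bij], of k 0] that by auto
  ultimately show ?thesis by blast
qed

lemma rat_common_denominator:
  "finite F \<Longrightarrow> \<exists>D::int. D > 0 \<and> (\<forall>q\<in>F. \<exists>c. of_int D * q = (of_int c :: rat))"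
proof (induction F rule: finite_induct)
  case (insert q F)
  from insert.IH obtain D where D: "D > 0" "\<forall>q\<in>F. \<exists>c. of_int D * q = (of_int c :: rat)"
    by (elim exE conjE)
  obtain a b where qq: "quotient_of q = (a, b)" by (rule prod.exhaust)
  have ab: "b > 0" "q = of_int a / of_int b"
    by (rule quotient_of_denom_pos[OF qq], rule quotient_of_div[OF qq])
  have "\<exists>c. of_int (D * b) * r = (of_int c :: rat)" if r: "r \<in> F" for r
  proof -
    obtain c where "of_int D * r = (of_int c :: rat)" using D(2) r by blast
    then have "of_int (D * b) * r = of_int (c * b)"
      unfolding of_int_mult by (metis mult.assoc mult.commute)
    then show ?thesis by (rule exI)
  qed
  moreover have "of_int (D * b) * q = of_int (D * a)" using ab by simp
  ultimately have "\<forall>r\<in>insert q F. \<exists>c. of_int (D * b) * r = (of_int c :: rat)" by blast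
  moreover have "D * b > 0" using D(1) ab(1) by simp
  ultimately show ?case by blast
qed (auto intro: exI[of _ 1])

text \<open>On the \<open>m\<close>-th roots of unity that occur, \<open>\<sigma>\<close> is raising
  to a power \<open>u\<close>; injectivity makes \<open>u\<close> coprime to \<open>m\<close>, and
  after clearing denominators \<open>cyclotomic_conjugate\<close> applies.\<close>

lemma runity_preserves_relations:
  assumes \<sigma>: "mhom runity \<sigma>" and inj: "\<And>z. z \<in> runity \<Longrightarrow> \<sigma> z = 1 \<Longrightarrow> z = 1"
  shows "preserves_relations runity \<sigma>"
  unfolding preserves_relations_def
proof (intro ballI impI)
  fix l assume l: "l \<in> lists (UNIV \<times> runity)" and rel: "lcomb (\<lambda>x. x) l = 0"
  note U = mgroup_runity
  have "finite (snd ` set l)" "snd ` set l \<subseteq> runity" using l by (auto simp: in_lists_conv_set mem_Times_iff)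
  then obtain m where m: "m \<ge> 1" "\<forall>x\<in>snd ` set l. x ^ m = 1" using runity_common_exponent by blast
  obtain z :: complex where z: "z ^ m = 1" "\<forall>x. x ^ m = 1 \<longrightarrow> (\<exists>k<m. x = z ^ k)"
    "\<forall>k. 0 < k \<and> k < m \<longrightarrow> z ^ k \<noteq> 1"
    using primitive_root_of_unity[OF m(1)] by (elim exE conjE)
  have zU: "z \<in> runity" using z(1) m(1) by (rule runity_mem[rotated])
  have "\<sigma> z ^ m = 1" using mhom_power[OF U \<sigma> zU, of m] z(1) mhom_one[OF U \<sigma>] by simp
  then obtain u where u: "\<sigma> z = z ^ u" using z(2) by blast
  \<comment> \<open>A common divisor \<open>d > 1\<close> would make \<open>\<sigma>\<close> send
    \<open>z ^ (m div d)\<close>, which is different from 1, to 1.\<close>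
  have "coprime u m"
  proof (rule ccontr)
    assume "\<not> coprime u m"
    define d where "d = gcd u m"
    have "d \<noteq> 0" using m(1) by (simp add: d_def)
    moreover have "d \<noteq> 1" using \<open>\<not> coprime u m\<close> unfolding d_def coprime_iff_gcd_eq_1 .
    ultimately have d: "d > 1" "d dvd u" "d dvd m" by (linarith, simp_all add: d_def)
    obtain u' where "u = d * u'" using d(2) by (rule dvdE)
    moreover obtain m' where "m = d * m'" using d(3) by (rule dvdE)
    ultimately have um: "u = d * u'" "m = d * m'" by auto
    have "z ^ (u * m') = (z ^ m) ^ u'" by (simp add: um power_mult[symmetric] mult_ac)
    then have "z ^ (u * m') = 1" using z(1) by simp
    then have "\<sigma> (z ^ m') = 1" using mhom_power[OF U \<sigma> zU, of m'] u by (simp add: power_mult)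
    then have "z ^ m' = 1" using inj[OF mgroup_power[OF U zU]] by blast
    moreover have m': "0 < m'" using um(2) m(1) by (metis mult_0_right not_one_le_zero gr0I)
    moreover have "1 * m' < d * m'" using d(1) m' by (rule mult_strict_right_mono)
    then have "m' < m" unfolding um(2) by (simp only: mult_1)
    ultimately show False using z(3) by blast
  qed
  have "finite (fst ` set l)" by simp
  from rat_common_denominator[OF this]
  obtain D where D: "D > 0" "\<forall>q\<in>fst ` set l. \<exists>c. of_int D * q = (of_int c :: rat)"
    by (elim exE conjE)
  have "\<exists>c. i < length l \<longrightarrow> of_int D * fst (l ! i) = of_int c" for i
    using D(2) nth_mem[of i l] by blast
  then obtain c where "\<And>i. i < length l \<Longrightarrow> of_int D * fst (l ! i) = of_int (c i)" by metis
  then have c: "of_int D * of_rat (fst (l ! i)) = (of_int (c i) :: complex)" if "i < length l" for i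
    using that by (metis of_rat_mult of_rat_of_int_eq)
  have "\<exists>k. i < length l \<longrightarrow> snd (l ! i) = z ^ k" for i
    using m(2) z(2) nth_mem[of i l] by blast
  then obtain k where k: "\<And>i. i < length l \<Longrightarrow> snd (l ! i) = z ^ k i" by metis
  have "(\<Sum>i<length l. of_int (c i) * z ^ k i) = of_int D * lcomb (\<lambda>x. x) l"
    unfolding lcomb_sum sum_distrib_left by (intro sum.cong) (auto simp: c[symmetric] k)
  then have "(\<Sum>i<length l. of_int (c i) * z ^ k i) = 0" using rel by simp
  then have "(\<Sum>i<length l. of_int (c i) * z ^ (k i * u)) = 0"
    by (intro cyclotomic_conjugate[OF z(1) m(1) _ \<open>coprime u m\<close>]) auto
  moreover have "(\<Sum>i<length l. of_int (c i) * z ^ (k i * u)) = of_int D * lcomb \<sigma> l"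
    unfolding lcomb_sum sum_distrib_left
  proof (intro sum.cong refl)
    fix i assume "i \<in> {..<length l}"
    then have i: "i < length l" by simp
    have "\<sigma> (snd (l ! i)) = z ^ (k i * u)"
      using k[OF i] mhom_power[OF U \<sigma> zU] u by (simp add: power_mult[symmetric] mult.commute)
    then show "of_int (c i) * z ^ (k i * u) = of_int D * (of_rat (fst (l ! i)) * \<sigma> (snd (l ! i)))"
      by (simp add: c[OF i, symmetric])
  qed
  ultimately show "lcomb \<sigma> l = 0" using D(1) by simp
qed

lemma cnj_Rats: "q \<in> \<rat> \<Longrightarrow> cnj q = q"
  by (elim Rats_cases') simp

text \<open>Complex conjugation commutes with every embedding of a cyclotomic field, so an embedding
  cannot change \<open>\<bar>x\<bar>\<^sup>2\<close>.\<close>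

lemma cyclotomic_radical_norm:
  assumes x: "x \<in> qspan runity" and N: "N \<ge> 1" "x ^ N \<in> \<rat>"
  shows "x * cnj x \<in> \<rat>"
proof (rule ccontr)
  assume nr: "x * cnj x \<notin> \<rat>"
  obtain l where l: "l \<in> lists (UNIV \<times> runity)" "x = lcomb (\<lambda>x. x) l"
    using x unfolding qspan_def by blast
  have lU: "snd (l ! i) \<in> runity" if "i < length l" for i
    using l(1) that by (auto simp: in_lists_conv_set mem_Times_iff)
  have cnjN: "cnj x ^ N \<in> \<rat>"
    using N(2) by (metis complex_cnj_power cnj_Rats)
  have "(x * cnj x) ^ N \<in> \<rat>" using N(2) cnjN by (simp add: power_mult_distrib)
  then have alg: "alg_over \<rat> (x * cnj x)" using alg_over_radical[OF subfld_Rats'] N by blast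
  define F where "F = insert x (insert (cnj x) (snd ` set l))"
  have "finite F" by (simp add: F_def)
  moreover have "alg_over \<rat> z" if "z \<in> F" for z
    using that l(1) alg_over_runity alg_over_radical[OF subfld_Rats' N] alg_over_radical[OF subfld_Rats' N(1) cnjN]
    by (auto simp: F_def in_lists_conv_set mem_Times_iff)
  ultimately obtain E \<tau> where E: "subfld E" "\<rat> \<subseteq> E" "F \<subseteq> E" "embedding E \<tau>" "\<tau> (x * cnj x) \<noteq> x * cnj x"
    using embedding_moving[OF subfld_Rats' alg nr] by metis
  note hom = embedding_mult[OF E(1,4)] embedding_sum[OF E(1,4)] embedding_power[OF E(1,4)]
    embedding_inverse[OF E(1,4)] embedding_Rats[OF E(1,4)]
  have lE: "snd (l ! i) \<in> E" if "i < length l" for i using E(3) that by (auto simp: F_def)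
  have unit: "cnj z = inverse z" if z: "z \<in> runity" for z
  proof -
    obtain m where m: "m \<ge> 1" "z ^ m = 1" using z unfolding runity_def by blast
    then have "norm z ^ m = 1" by (simp add: norm_power[symmetric])
    then have "norm z = 1" using m(1) by (intro power_eq_imp_eq_base[of "norm z" m 1]) auto
    then have "z * cnj z = 1" unfolding complex_norm_square[symmetric] by simp
    then show ?thesis by (rule inverse_unique[symmetric])
  qed
  have \<tau>U: "\<tau> z \<in> runity" if z: "z \<in> runity" "z \<in> E" for z
  proof -
    obtain m where m: "m \<ge> 1" "z ^ m = 1" using z(1) unfolding runity_def by blast
    have "\<tau> z ^ m = 1" using hom(3)[OF z(2), of m] embedding_one[OF E(1,4)] m(2) by simp
    then show ?thesis by (rule runity_mem[OF m(1)])
  qed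
  \<comment> \<open>Conjugation inverts roots of unity, so \<open>cnj x\<close> is the same
    combination of inverses. As \<open>\<tau>\<close> maps roots of unity to roots of unity, it
    commutes with conjugation on \<open>x\<close>.\<close>
  have cx: "cnj x = (\<Sum>i<length l. of_rat (fst (l ! i)) * inverse (snd (l ! i)))"
    unfolding l(2) lcomb_sum using unit[OF lU] by (simp add: cnj_Rats)
  have "\<tau> (cnj x) = (\<Sum>i<length l. of_rat (fst (l ! i)) * inverse (\<tau> (snd (l ! i))))"
    unfolding cx
  proof (subst hom(2))
    show "of_rat (fst (l ! i)) * inverse (snd (l ! i)) \<in> E" if "i \<in> {..<length l}" for i
      using lE[of i] that subfld_Rats[OF E(1) Rats_of_rat] by (intro subfld_mult[OF E(1)] subfld_inverse[OF E(1)]) simp_all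
    show "(\<Sum>i<length l. \<tau> (of_rat (fst (l ! i)) * inverse (snd (l ! i)))) =
        (\<Sum>i<length l. of_rat (fst (l ! i)) * inverse (\<tau> (snd (l ! i))))"
      using lE by (intro sum.cong refl)
        (simp add: hom(1,4,5) subfld_inverse[OF E(1)] subfld_Rats[OF E(1)])
  qed
  also have "\<dots> = cnj (\<Sum>i<length l. of_rat (fst (l ! i)) * \<tau> (snd (l ! i)))"
    using unit[OF \<tau>U[OF lU lE]] by (simp add: cnj_Rats)
  also have "(\<Sum>i<length l. of_rat (fst (l ! i)) * \<tau> (snd (l ! i))) = \<tau> x"
    unfolding l(2) lcomb_sum
  proof (subst hom(2))
    show "of_rat (fst (l ! i)) * snd (l ! i) \<in> E" if "i \<in> {..<length l}" for i
      using lE[of i] that subfld_Rats[OF E(1) Rats_of_rat] by (intro subfld_mult[OF E(1)]) simp_all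
    show "(\<Sum>i<length l. of_rat (fst (l ! i)) * \<tau> (snd (l ! i))) =
        (\<Sum>i<length l. \<tau> (of_rat (fst (l ! i)) * snd (l ! i)))"
      using lE by (intro sum.cong refl) (simp add: hom(1,5) subfld_Rats[OF E(1)])
  qed
  finally have c: "\<tau> (cnj x) = cnj (\<tau> x)" .
  \<comment> \<open>The rational number \<open>x ^ N\<close> is fixed, so \<open>\<tau> x\<close>
    has the absolute value of \<open>x\<close>; with the commutation this fixes
    \<open>x * cnj x\<close>, which \<open>\<tau>\<close> was chosen to move.\<close>
  have "\<tau> x ^ N = x ^ N" using hom(3)[of x N] hom(5)[OF N(2)] E(3) by (simp add: F_def)
  then have "norm (\<tau> x) ^ N = norm x ^ N" by (metis norm_power)
  then have "norm (\<tau> x) = norm x" using N(1) by (intro power_eq_imp_eq_base[of "norm (\<tau> x)" N "norm x"]) auto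
  then have "\<tau> x * cnj (\<tau> x) = x * cnj x" by (metis complex_norm_square)
  moreover have "\<tau> (x * cnj x) = \<tau> x * \<tau> (cnj x)" using E(3) by (intro hom(1)) (auto simp: F_def)
  ultimately show False using E(5) c by simp
qed

text \<open>As \<open>x ^ N\<close> is rational, hence real, the numbers \<open>x ^ (2 * N)\<close>
  and \<open>norm x ^ (2 * N)\<close> agree, and the phase of \<open>x\<close> is a root of unity.
  So the only radicals tying \<open>\<sigma>\<close> to the cyclotomic field are square roots of
  rational numbers.\<close>

lemma cyclotomic_radical:
  assumes x: "x \<in> qspan runity" "x \<noteq> 0" and N: "N \<ge> 1" "x ^ N \<in> \<rat>"
  shows "complex_of_real (norm x) ^ 2 \<in> \<rat>" "x / complex_of_real (norm x) \<in> runity"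
proof -
  show "complex_of_real (norm x) ^ 2 \<in> \<rat>"
    using cyclotomic_radical_norm[OF x(1) N] by (simp add: complex_norm_square[symmetric])
  have q: "cnj (x ^ N) = x ^ N" using N(2) by (rule cnj_Rats)
  have "complex_of_real (norm x) ^ (2 * N) = complex_of_real (norm (x ^ N) ^ 2)"
    by (simp add: norm_power power_mult[symmetric] mult.commute)
  also have "\<dots> = x ^ N * cnj (x ^ N)" by (rule complex_norm_square)
  also have "\<dots> = x ^ (2 * N)" unfolding q by (simp add: power2_eq_square[symmetric] power_mult[symmetric] mult.commute)
  finally have "(x / complex_of_real (norm x)) ^ (2 * N) = 1" using x(2) by (simp add: power_divide)
  then show "x / complex_of_real (norm x) \<in> runity" using N(1) by (intro runity_mem[of "2 * N"]) auto
qed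

text \<open>Kummer independence reduces a relation among radicals to relations inside the cyclotomic
  field, where \<open>\<sigma>\<close> acts as the field embedding \<open>\<theta>\<close>.\<close>

lemma radical_preserves_relations:
  assumes M: "mgroup M" "\<And>x. x \<in> M \<Longrightarrow> \<exists>N\<ge>1. x ^ N \<in> \<rat>" and \<sigma>: "mhom M \<sigma>"
    and \<theta>: "embedding (qspan runity) \<theta>" "\<And>x. x \<in> M \<Longrightarrow> x \<in> qspan runity \<Longrightarrow> \<theta> x = \<sigma> x"
  shows "preserves_relations M \<sigma>"
  unfolding preserves_relations_def
proof (intro ballI impI)
  fix l assume l: "l \<in> lists (UNIV \<times> M)" and rel: "lcomb (\<lambda>x. x) l = 0"
  define K where "K = qspan runity"
  have K: "subfld K" using subfld_qspan_runity by (simp add: K_def)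
  define S where "S = snd ` set l"
  define I where "I = {..<length l}"
  define q where "q i = (of_rat (fst (l ! i)) :: complex)" for i
  define x where "x i = snd (l ! i)" for i
  have S: "finite S" "S \<subseteq> M" using l by (auto simp: S_def in_lists_conv_set mem_Times_iff)
  have x: "x i \<in> S" if "i \<in> I" for i using that by (auto simp: x_def I_def S_def)
  have qK: "q i \<in> K" for i using subfld_Rats[OF K] by (simp add: q_def)
  \<comment> \<open>One representative in \<open>S\<close> for each class modulo the nonzero
    elements of \<open>K\<close>; the predicate under \<open>SOME\<close> depends only on the class,
    so equivalent elements get the same one.\<close>
  define r where "r y = (SOME s. s \<in> S \<and> y / s \<in> K)" for y
  have nz: "s \<noteq> 0" if "s \<in> S" for s using that S(2) mgroup_nonzero[OF M(1)] by blast
  have r: "r y \<in> S" "y / r y \<in> K" if "y \<in> S" for y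
  proof -
    have "y \<in> S \<and> y / y \<in> K" using that nz subfld_one[OF K] by auto
    then have "r y \<in> S \<and> y / r y \<in> K" unfolding r_def by (rule someI)
    then show "r y \<in> S" "y / r y \<in> K" by auto
  qed
  have req: "r y = r y'" if "y \<in> S" "y' \<in> S" "y / y' \<in> K" for y y'
  proof -
    have "(s \<in> S \<and> y / s \<in> K) \<longleftrightarrow> (s \<in> S \<and> y' / s \<in> K)" for s
    proof -
      have "y' / s = (y / s) / (y / y')" "y / s = (y' / s) * (y / y')" using that nz by auto
      then show ?thesis using that subfld_divide[OF K] subfld_mult[OF K] by metis
    qed
    then show ?thesis by (simp add: r_def)
  qed
  define R where "R = r ` S"
  have R: "finite R" "R \<subseteq> S" using S r by (auto simp: R_def)
  have sep: "y / y' \<notin> K" if yy: "y \<in> R" "y' \<in> R" "y \<noteq> y'" for y y'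
  proof
    assume a: "y / y' \<in> K"
    obtain s s' where s: "s \<in> S" "s' \<in> S" "y = r s" "y' = r s'" using yy by (auto simp: R_def)
    have "s / s' = (s / r s) * (y / y') / (s' / r s')"
      using s nz r by (simp add: field_simps)
    then have "s / s' \<in> K" using a r[OF s(1)] r[OF s(2)] subfld_divide[OF K] subfld_mult[OF K] by metis
    then show False using req[OF s(1,2)] s yy(3) by simp
  qed
  \<comment> \<open>The terms of the class of \<open>y\<close>, divided by \<open>y\<close>: a
    coefficient in \<open>K\<close>.\<close>
  define c where "c y = (\<Sum>i\<in>{i\<in>I. r (x i) = y}. q i * (x i / y))" for y
  have tm: "q i * (x i / y) \<in> K" if "i \<in> I" "r (x i) = y" for i y
    using r(2)[OF x[OF that(1)]] that(2) by (auto intro!: subfld_mult[OF K] qK simp del: times_divide_eq_right)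
  have cK: "c y \<in> K" for y
    unfolding c_def by (intro subfld_sum[OF K]) (use tm in auto)
  have split: "(\<Sum>i\<in>I. h i) = (\<Sum>y\<in>R. \<Sum>i\<in>{i\<in>I. r (x i) = y}. h i)" for h :: "nat \<Rightarrow> complex"
    using sum.group[of I R "\<lambda>i. r (x i)" h] R(1) x by (simp add: I_def R_def image_subset_iff)
  have "(\<Sum>y\<in>R. c y * y) = (\<Sum>y\<in>R. \<Sum>i\<in>{i\<in>I. r (x i) = y}. q i * x i)"
    unfolding c_def sum_distrib_right using R(2) nz by (intro sum.cong) auto
  also have "\<dots> = 0" using rel split[of "\<lambda>i. q i * x i"] by (simp add: lcomb_sum I_def q_def x_def)
  finally have rel': "(\<Sum>y\<in>R. c y * y) = 0" .
  have UK: "z \<in> K" if "m \<ge> 1" "z ^ m = 1" for z m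
    unfolding K_def using runity_mem[OF that] qspan_superset by blast
  have rad: "y \<noteq> 0 \<and> (\<exists>N\<ge>1. y ^ N \<in> K)" if "y \<in> R" for y
  proof -
    have "y \<in> M" "y \<noteq> 0" using that R(2) S(2) nz by auto
    then show ?thesis using M(2)[of y] subfld_Rats[OF K] by blast
  qed
  have "c y = 0" if "y \<in> R" for y
    by (rule radicals_independent[OF K UK R(1) rad sep cK rel' that])
  \<comment> \<open>By Kummer independence each class cancels separately, inside \<open>K\<close>,
    where \<open>\<theta>\<close> can be applied; multiplying by \<open>\<sigma> y\<close> then
    gives the image relation class by class.\<close>
  then have \<theta>c: "\<theta> (c y) = 0" if "y \<in> R" for y
    using that embedding_zero[OF subfld_qspan_runity \<theta>(1)] by simp
  have "lcomb \<sigma> l = (\<Sum>y\<in>R. \<Sum>i\<in>{i\<in>I. r (x i) = y}. q i * \<sigma> (x i))"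
    using split[of "\<lambda>i. q i * \<sigma> (x i)"] by (simp add: lcomb_sum I_def q_def x_def)
  also have "\<dots> = (\<Sum>y\<in>R. \<sigma> y * \<theta> (c y))"
  proof (intro sum.cong refl)
    fix y assume y: "y \<in> R"
    have "\<theta> (c y) = (\<Sum>i\<in>{i\<in>I. r (x i) = y}. \<theta> (q i * (x i / y)))"
      unfolding c_def using tm
      by (intro embedding_sum[OF subfld_qspan_runity \<theta>(1)]) (auto simp: K_def)
    also have "\<dots> = (\<Sum>i\<in>{i\<in>I. r (x i) = y}. q i * (\<sigma> (x i) / \<sigma> y))"
    proof (intro sum.cong refl)
      fix i assume "i \<in> {i\<in>I. r (x i) = y}"
      then have i: "i \<in> I" "r (x i) = y" by auto
      have xM: "x i \<in> M" "y \<in> M" using x[OF i(1)] S R y by auto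
      have k: "x i / y \<in> K" using r[OF x[OF i(1)]] i(2) by simp
      have "\<theta> (q i * (x i / y)) = \<theta> (q i) * \<theta> (x i / y)"
        using qK k by (intro embedding_mult[OF subfld_qspan_runity \<theta>(1)]) (auto simp: K_def)
      also have "\<theta> (q i) = q i"
        by (intro embedding_Rats[OF subfld_qspan_runity \<theta>(1)]) (simp add: q_def)
      also have "\<theta> (x i / y) = \<sigma> (x i) / \<sigma> y"
        using \<theta>(2)[of "x i / y"] k mgroup_divide[OF M(1) xM] mhom_divide[OF M(1) \<sigma> xM] by (simp add: K_def)
      finally show "\<theta> (q i * (x i / y)) = q i * (\<sigma> (x i) / \<sigma> y)" .
    qed
    finally show "(\<Sum>i\<in>{i\<in>I. r (x i) = y}. q i * \<sigma> (x i)) = \<sigma> y * \<theta> (c y)"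
      using mhom_nonzero[OF M(1) \<sigma>, of y] R S y by (auto simp: sum_distrib_left intro!: sum.cong)
  qed
  also have "\<dots> = 0" using \<theta>c by simp
  finally show "lcomb \<sigma> l = 0" .
qed

section \<open>Automorphisms of groups of radicals\<close>

lemma CC_simps [simp]: "carrier CC = UNIV" "monoid.mult CC = (*)" "one CC = 1" "ring.zero CC = 0" "add CC = (+)"
  by (simp_all add: ring_of_type_algebra_def fun_eq_iff)

lemma a_inv_CC: "a_inv CC x = - x"
  unfolding a_inv_def m_inv_def
  by (rule the_equality) (simp_all add: eq_neg_iff_add_eq_0 add.commute)

lemma m_inv_CC: "x \<noteq> 0 \<Longrightarrow> m_inv CC x = inverse x"
  unfolding m_inv_def
  by (rule the_equality) (use inverse_unique in \<open>fastforce+\<close>)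

lemma inv_Cstar: "x \<noteq> 0 \<Longrightarrow> m_inv Cstar x = inverse x"
  unfolding m_inv_def
  by (rule the_equality) (use inverse_unique in \<open>fastforce+\<close>)

lemma group_Cstar: "Group.group Cstar"
proof (rule groupI)
  show "\<exists>y\<in>carrier Cstar. y \<otimes>\<^bsub>Cstar\<^esub> x = \<one>\<^bsub>Cstar\<^esub>" if "x \<in> carrier Cstar" for x
    using that by (intro bexI[of _ "inverse x"]) simp_all
qed (simp_all add: mult.assoc)

lemma mgroup_generate:
  assumes "A \<subseteq> carrier Cstar" shows "mgroup (generate Cstar A)"
proof -
  have nz: "x \<noteq> 0" if "x \<in> generate Cstar A" for x
    using group.generate_incl[OF group_Cstar assms] that by auto
  moreover have "inverse x \<in> generate Cstar A" if x: "x \<in> generate Cstar A" for x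
    using group.generate_m_inv_closed[OF group_Cstar assms x] unfolding inv_Cstar[OF nz[OF x]] .
  moreover have "x * y \<in> generate Cstar A" if xy: "x \<in> generate Cstar A" "y \<in> generate Cstar A" for x y
    using generate.eng[OF xy] by simp
  moreover have "1 \<in> generate Cstar A" using generate.one[of Cstar A] by simp
  ultimately show ?thesis unfolding mgroup_def by blast
qed

lemma generate_minimal:
  assumes "mgroup H" "A \<subseteq> H" shows "generate Cstar A \<subseteq> H"
proof
  fix x assume "x \<in> generate Cstar A"
  then show "x \<in> H"
  proof induction
    case (inv h)
    then have h: "h \<in> H" using assms(2) by blast
    then show ?case
      unfolding inv_Cstar[OF mgroup_nonzero[OF assms(1) h]] by (rule mgroup_inverse[OF assms(1)])
  qed (use assms mgroup_one mgroup_mult in auto)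
qed

lemma mgroup_Qstar: "mgroup Qstar"
  by (auto simp: mgroup_def Qstar_def)

lemma alg_over_Qstar_root: "N \<ge> 1 \<Longrightarrow> x ^ N \<in> Qstar \<Longrightarrow> alg_over \<rat> x"
  by (rule alg_over_radical[OF subfld_Rats']) (auto simp: Qstar_def)

text \<open>The groups \<open>\<Gamma>\<^sub>\<infinity>\<close> and \<open>\<Gamma>\<^bsub>p\<^sup>\<infinity>\<^esub>\<close> share this property; it makes an injective endomorphism that
  fixes the rational elements an automorphism, as it permutes the finitely many roots of \<open>z\<^sup>m = y\<^sup>m\<close>.\<close>

definition radical_group :: "complex set \<Rightarrow> bool" where
  "radical_group M \<longleftrightarrow> mgroup M \<and> (\<forall>y\<in>M. \<exists>m\<ge>1. y ^ m \<in> Qstar \<and> (\<forall>z. z ^ m = y ^ m \<longrightarrow> z \<in> M))"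

lemma radical_group_mgroup: "radical_group M \<Longrightarrow> mgroup M"
  by (simp add: radical_group_def)

lemma rad_inf_iff: "x \<in> rad_inf \<Gamma> \<longleftrightarrow> x \<noteq> 0 \<and> (\<exists>m\<ge>1. x ^ m \<in> \<Gamma>)"
  by (auto simp: rad_inf_def)
lemma rad_infI: "x \<noteq> 0 \<Longrightarrow> m \<ge> 1 \<Longrightarrow> x ^ m \<in> \<Gamma> \<Longrightarrow> x \<in> rad_inf \<Gamma>"
  unfolding rad_inf_iff by blast
lemma rad_pinf_iff: "x \<in> rad_pinf p \<Gamma> \<longleftrightarrow> x \<noteq> 0 \<and> (\<exists>m\<ge>1. x ^ (p ^ m) \<in> \<Gamma>)"
  by (auto simp: rad_pinf_def)
lemma rad_pinfI: "x \<noteq> 0 \<Longrightarrow> m \<ge> 1 \<Longrightarrow> x ^ (p ^ m) \<in> \<Gamma> \<Longrightarrow> x \<in> rad_pinf p \<Gamma>"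
  unfolding rad_pinf_iff by blast
lemma rad_iff: "x \<in> rad p \<Gamma> \<longleftrightarrow> x \<noteq> 0 \<and> x ^ p \<in> \<Gamma>"
  by (auto simp: rad_def)

context fixes \<Gamma> assumes \<Gamma>: "mgroup \<Gamma>"
begin

lemma rad_inf_mono_exp: "x ^ m \<in> \<Gamma> \<Longrightarrow> x ^ (m * k) \<in> \<Gamma>"
  by (simp add: power_mult mgroup_power[OF \<Gamma>])

lemma mgroup_rad_inf: "mgroup (rad_inf \<Gamma>)"
proof -
  have "x * y \<in> rad_inf \<Gamma>" if xy: "x \<in> rad_inf \<Gamma>" "y \<in> rad_inf \<Gamma>" for x y
  proof -
    obtain m k where mk: "m \<ge> 1" "k \<ge> 1" "x ^ m \<in> \<Gamma>" "y ^ k \<in> \<Gamma>" using xy unfolding rad_inf_iff by blast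
    have "x * y \<noteq> 0" using xy unfolding rad_inf_iff by simp
    moreover have "(x * y) ^ (m * k) \<in> \<Gamma>"
      using rad_inf_mono_exp[OF mk(3), of k] rad_inf_mono_exp[OF mk(4), of m]
      by (simp add: power_mult_distrib mgroup_mult[OF \<Gamma>] mult.commute)
    moreover have "m * k \<ge> 1" using mk by simp
    ultimately show ?thesis by (intro rad_infI)
  qed
  moreover have "inverse x \<in> rad_inf \<Gamma>" if x: "x \<in> rad_inf \<Gamma>" for x
  proof -
    obtain m where m: "x \<noteq> 0" "m \<ge> 1" "x ^ m \<in> \<Gamma>" using x unfolding rad_inf_iff by blast
    have "inverse x ^ m \<in> \<Gamma>" using mgroup_inverse[OF \<Gamma> m(3)] by (simp only: power_inverse)
    then show ?thesis using m(1,2) by (intro rad_infI[of "inverse x" m]) simp_all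
  qed
  moreover have "1 \<in> rad_inf \<Gamma>" by (rule rad_infI[of 1 1]) (simp_all add: mgroup_one[OF \<Gamma>])
  moreover have "0 \<notin> rad_inf \<Gamma>" unfolding rad_inf_iff by blast
  ultimately show ?thesis unfolding mgroup_def by blast
qed

lemma mgroup_rad_pinf: "mgroup (rad_pinf p \<Gamma>)"
proof -
  have "x * y \<in> rad_pinf p \<Gamma>" if xy: "x \<in> rad_pinf p \<Gamma>" "y \<in> rad_pinf p \<Gamma>" for x y
  proof -
    obtain m k where mk: "m \<ge> 1" "k \<ge> 1" "x ^ (p ^ m) \<in> \<Gamma>" "y ^ (p ^ k) \<in> \<Gamma>" using xy unfolding rad_pinf_iff by blast
    have "x * y \<noteq> 0" using xy unfolding rad_pinf_iff by simp
    moreover have "(x * y) ^ (p ^ (m + k)) \<in> \<Gamma>"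
      using rad_inf_mono_exp[OF mk(3), of "p ^ k"] rad_inf_mono_exp[OF mk(4), of "p ^ m"]
      by (simp add: power_mult_distrib mgroup_mult[OF \<Gamma>] mult.commute power_add)
    moreover have "m + k \<ge> 1" using mk by simp
    ultimately show ?thesis by (intro rad_pinfI)
  qed
  moreover have "inverse x \<in> rad_pinf p \<Gamma>" if x: "x \<in> rad_pinf p \<Gamma>" for x
  proof -
    obtain m where m: "x \<noteq> 0" "m \<ge> 1" "x ^ (p ^ m) \<in> \<Gamma>" using x unfolding rad_pinf_iff by blast
    have "inverse x ^ (p ^ m) \<in> \<Gamma>" using mgroup_inverse[OF \<Gamma> m(3)] by (simp only: power_inverse)
    then show ?thesis using m(1,2) by (intro rad_pinfI[of "inverse x" m]) simp_all
  qed
  moreover have "1 \<in> rad_pinf p \<Gamma>" by (rule rad_pinfI[of 1 1]) (simp_all add: mgroup_one[OF \<Gamma>])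
  moreover have "0 \<notin> rad_pinf p \<Gamma>" unfolding rad_pinf_iff by blast
  ultimately show ?thesis unfolding mgroup_def by blast
qed

lemma rad_pinf_subset: "p \<ge> 1 \<Longrightarrow> rad_pinf p \<Gamma> \<subseteq> rad_inf \<Gamma>"
proof
  fix x assume p: "p \<ge> 1" and "x \<in> rad_pinf p \<Gamma>"
  then obtain m where m: "x \<noteq> 0" "x ^ (p ^ m) \<in> \<Gamma>" unfolding rad_pinf_iff by blast
  have "p ^ m \<ge> 1" using p by simp
  then show "x \<in> rad_inf \<Gamma>" by (rule rad_infI[OF m(1) _ m(2)])
qed

lemma rad_inf_superset: "\<Gamma> \<subseteq> rad_inf \<Gamma>"
  using mgroup_nonzero[OF \<Gamma>] rad_infI[of _ 1 \<Gamma>] by auto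

lemma rad_pinf_superset: "\<Gamma> \<subseteq> rad_pinf p \<Gamma>"
  using mgroup_nonzero[OF \<Gamma>] mgroup_power[OF \<Gamma>] rad_pinfI[of _ 1 p \<Gamma>] by auto

lemma rad_subset: "\<Delta> \<subseteq> \<Gamma> \<Longrightarrow> rad p \<Delta> \<subseteq> rad_pinf p \<Gamma>"
  using rad_pinfI[of _ 1 p \<Gamma>] by (auto simp: rad_iff)

lemma runity_subset: "runity \<subseteq> rad_inf \<Gamma>"
proof
  fix x assume "x \<in> runity"
  then obtain m where m: "m \<ge> 1" "x ^ m = 1" unfolding runity_def by blast
  have "x \<noteq> 0" using m by (auto simp: power_0_left)
  then show "x \<in> rad_inf \<Gamma>" using m mgroup_one[OF \<Gamma>] by (intro rad_infI[of x m]) simp_all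
qed

context assumes sub: "\<Gamma> \<subseteq> Qstar"
begin

lemma radical_group_rad_inf: "radical_group (rad_inf \<Gamma>)"
proof -
  have "\<exists>m\<ge>1. y ^ m \<in> Qstar \<and> (\<forall>z. z ^ m = y ^ m \<longrightarrow> z \<in> rad_inf \<Gamma>)" if y: "y \<in> rad_inf \<Gamma>" for y
  proof -
    obtain m where m: "m \<ge> 1" "y ^ m \<in> \<Gamma>" "y \<noteq> 0" using y unfolding rad_inf_iff by blast
    have "z \<in> rad_inf \<Gamma>" if z: "z ^ m = y ^ m" for z
    proof (rule rad_infI[OF _ m(1)])
      show "z ^ m \<in> \<Gamma>" using z m(2) by simp
      show "z \<noteq> 0" using z m by (auto simp: power_0_left)
    qed
    then show ?thesis using m sub by blast
  qed
  then show ?thesis using mgroup_rad_inf by (simp add: radical_group_def)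
qed

lemma radical_group_rad_pinf: "p \<ge> 1 \<Longrightarrow> radical_group (rad_pinf p \<Gamma>)"
proof -
  assume p: "p \<ge> 1"
  have "\<exists>m\<ge>1. y ^ m \<in> Qstar \<and> (\<forall>z. z ^ m = y ^ m \<longrightarrow> z \<in> rad_pinf p \<Gamma>)" if y: "y \<in> rad_pinf p \<Gamma>" for y
  proof -
    obtain m where m: "m \<ge> 1" "y ^ (p ^ m) \<in> \<Gamma>" "y \<noteq> 0" using y unfolding rad_pinf_iff by blast
    have pm: "p ^ m \<ge> 1" using p by simp
    have "z \<in> rad_pinf p \<Gamma>" if z: "z ^ (p ^ m) = y ^ (p ^ m)" for z
    proof (rule rad_pinfI[OF _ m(1)])
      show "z ^ (p ^ m) \<in> \<Gamma>" using z m(2) by simp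
      show "z \<noteq> 0" using z m(3) p by (cases "z = 0") (auto simp: power_0_left)
    qed
    then show ?thesis using m sub pm by blast
  qed
  then show ?thesis using mgroup_rad_pinf by (simp add: radical_group_def)
qed

end
end

lemma AutQ_iff:
  "\<sigma> \<in> carrier (AutQ H) \<longleftrightarrow> \<sigma> \<in> extensional H \<and> bij_betw \<sigma> H H \<and>
     (\<forall>x\<in>H. \<forall>y\<in>H. \<sigma> (x * y) = \<sigma> x * \<sigma> y) \<and> (\<forall>x\<in>H \<inter> Qstar. \<sigma> x = x)"
  by (auto simp: AutQ_def auto_def Bij_def hom_def bij_betw_def)

lemma one_AutQ: "one (AutQ H) = (\<lambda>x\<in>H. x)"
  by (simp add: AutQ_def AutoGroup_def BijGroup_def)

lemma mult_AutQ:
  assumes "\<sigma> \<in> carrier (AutQ H)" "\<tau> \<in> carrier (AutQ H)"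
  shows "\<sigma> \<otimes>\<^bsub>AutQ H\<^esub> \<tau> = (\<lambda>x\<in>H. \<sigma> (\<tau> x))"
proof -
  have "\<sigma> \<in> Bij H" "\<tau> \<in> Bij H" using assms unfolding AutQ_iff Bij_def by blast+
  then show ?thesis by (simp add: AutQ_def AutoGroup_def BijGroup_def compose_def)
qed

context fixes M \<sigma> assumes \<sigma>: "\<sigma> \<in> carrier (AutQ M)"
begin

lemma AutQ_ext: "\<sigma> \<in> extensional M" using \<sigma> by (simp add: AutQ_iff)
lemma AutQ_bij: "bij_betw \<sigma> M M" using \<sigma> by (simp add: AutQ_iff)
lemma AutQ_mem: "x \<in> M \<Longrightarrow> \<sigma> x \<in> M" using AutQ_bij bij_betwE by blast
lemma AutQ_fix: "x \<in> M \<Longrightarrow> x \<in> Qstar \<Longrightarrow> \<sigma> x = x" using \<sigma> by (simp add: AutQ_iff)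
lemma AutQ_mhom: "mgroup M \<Longrightarrow> mhom M \<sigma>"
  using \<sigma> AutQ_mem mgroup_nonzero unfolding mhom_def AutQ_iff by blast
lemma AutQ_inj: "mgroup M \<Longrightarrow> x \<in> M \<Longrightarrow> \<sigma> x = 1 \<Longrightarrow> x = 1"
  using mhom_one[OF _ AutQ_mhom] AutQ_bij mgroup_one by (metis bij_betw_inv_into_left)

end

lemma AutQ_I:
  assumes M: "radical_group M" and \<sigma>: "mhom M \<sigma>" "\<sigma> \<in> extensional M"
    and fixQ: "\<And>x. x \<in> M \<Longrightarrow> x \<in> Qstar \<Longrightarrow> \<sigma> x = x"
    and inj: "\<And>x. x \<in> M \<Longrightarrow> \<sigma> x = 1 \<Longrightarrow> x = 1"
  shows "\<sigma> \<in> carrier (AutQ M)"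
proof -
  have m: "mgroup M" using M by (rule radical_group_mgroup)
  have io: "inj_on \<sigma> M"
  proof (rule inj_onI)
    fix x y assume xy: "x \<in> M" "y \<in> M" "\<sigma> x = \<sigma> y"
    then have "\<sigma> (x / y) = 1"
      using mhom_divide[OF m \<sigma>(1) xy(1,2)] mhom_nonzero[OF m \<sigma>(1) xy(2)] by simp
    then have "x / y = 1" using inj mgroup_divide[OF m xy(1,2)] by blast
    then show "x = y" using mgroup_nonzero[OF m xy(2)] by simp
  qed
  have key: "\<sigma> y \<in> M \<and> y \<in> \<sigma> ` M" if y: "y \<in> M" for y
  proof -
    obtain k where k: "k \<ge> 1" "y ^ k \<in> Qstar" "\<forall>z. z ^ k = y ^ k \<longrightarrow> z \<in> M"
      using M y unfolding radical_group_def by blast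
    define Z where "Z = {z. z ^ k = y ^ k}"
    have Z: "finite Z" "Z \<subseteq> M" "y \<in> Z"
      using k finite_nth_roots[of k "y ^ k"] by (auto simp: Z_def)
    have "\<sigma> z ^ k = y ^ k" if "z \<in> Z" for z
    proof -
      have "\<sigma> z ^ k = \<sigma> (y ^ k)" using mhom_power[OF m \<sigma>(1), of z k] that Z by (auto simp: Z_def)
      then show ?thesis using fixQ[of "y ^ k"] k(2) mgroup_power[OF m y] by simp
    qed
    then have "\<sigma> ` Z \<subseteq> Z" by (auto simp: Z_def)
    then have "\<sigma> ` Z = Z" using Z io by (intro endo_inj_surj) (auto intro: inj_on_subset)
    then show ?thesis using Z by blast
  qed
  have "\<sigma> ` M = M" using key by blast
  then show ?thesis
    using io \<sigma> fixQ mhom_mult[OF m \<sigma>(1)] unfolding AutQ_iff bij_betw_def by blast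
qed

lemma restrict_AutQ:
  assumes M: "radical_group M" and N: "radical_group N" "N \<subseteq> M" and \<sigma>: "\<sigma> \<in> carrier (AutQ M)"
  shows "restrict \<sigma> N \<in> carrier (AutQ N)"
proof (rule AutQ_I[OF N(1)])
  note m = radical_group_mgroup[OF M] and nm = radical_group_mgroup[OF N(1)]
  show "mhom N (restrict \<sigma> N)"
    using mhom_mono[OF AutQ_mhom[OF \<sigma> m] N(2)] mgroup_mult[OF nm] by (auto simp: mhom_def)
  show "restrict \<sigma> N x = x" if "x \<in> N" "x \<in> Qstar" for x
    using that AutQ_fix[OF \<sigma>] N(2) by auto
  show "x = 1" if "x \<in> N" "restrict \<sigma> N x = 1" for x
    using that AutQ_inj[OF \<sigma> m] N(2) by auto
qed simp

lemma radical_group_root: "radical_group M \<Longrightarrow> x \<in> M \<Longrightarrow> \<exists>N\<ge>1. x ^ N \<in> Qstar"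
  unfolding radical_group_def by blast

text \<open>Quotients are not lost by passing to linear combinations: radicals are algebraic, so
  their \<rat>-span is closed under inverses.\<close>

lemma generate_field_eq_qspan:
  assumes M: "radical_group M"
  shows "generate_field CC (\<rat> \<union> M) = qspan M"
proof
  note m = radical_group_mgroup[OF M]
  have S: "subfld (qspan M)"
    using subfld_qspan[OF m] radical_group_root[OF M] alg_over_Qstar_root by blast
  show "generate_field CC (\<rat> \<union> M) \<subseteq> qspan M"
  proof
    fix x assume "x \<in> generate_field CC (\<rat> \<union> M)"
    then show "x \<in> qspan M"
      by induction (use S qspan_superset[of M] subfld_Rats[OF S] subfld_one[OF S] in
        \<open>auto simp: a_inv_CC m_inv_CC intro: subfld_uminus[OF S] subfld_inverse[OF S] subfld_add[OF S] subfld_mult[OF S]\<close>)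
  qed
  show "qspan M \<subseteq> generate_field CC (\<rat> \<union> M)"
  proof
    fix x assume "x \<in> qspan M"
    then obtain l where l: "x = lcomb (\<lambda>x. x) l" "l \<in> lists (UNIV \<times> M)" by (auto simp: qspan_def)
    have "lcomb (\<lambda>x. x) l \<in> generate_field CC (\<rat> \<union> M)"
      using l(2)
    proof (induction l)
      case Nil
      have "1 \<in> generate_field CC (\<rat> \<union> M)" using generate_field.one[of CC] by simp
      then have "- 1 + 1 \<in> generate_field CC (\<rat> \<union> M)"
        using generate_field.eng_add[of "-1" CC _ 1] generate_field.a_inv[of 1 CC] by (simp add: a_inv_CC)
      then show ?case by simp
    next
      case (Cons p l)
      then have "snd p \<in> M" by auto
      then have "of_rat (fst p) * snd p \<in> generate_field CC (\<rat> \<union> M)"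
        using generate_field.eng_mult[of "of_rat (fst p)" CC _ "snd p"] generate_field.incl[of _ "\<rat> \<union> M" CC] by simp
      then show ?case using generate_field.eng_add[of "of_rat (fst p) * snd p" CC _ "lcomb (\<lambda>x. x) l"] Cons by simp
    qed
    then show "x \<in> generate_field CC (\<rat> \<union> M)" using l(1) by simp
  qed
qed

text \<open>Restrictions of field automorphisms respect relations. Conversely a relation-preserving
  \<open>\<sigma>\<close> extends to an embedding of the span, and this is onto because
  \<open>\<sigma>\<close> permutes the radicals: a preimage is obtained term by term.\<close>

lemma Gal_group_eq:
  assumes \<Gamma>: "mgroup \<Gamma>" "\<Gamma> \<subseteq> Qstar"
  shows "Gal_group \<Gamma> = {\<sigma> \<in> carrier (A_group \<Gamma>). preserves_relations (rad_inf \<Gamma>) \<sigma>}"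
proof -
  define M where "M = rad_inf \<Gamma>"
  have M: "radical_group M" unfolding M_def by (rule radical_group_rad_inf[OF \<Gamma>])
  note m = radical_group_mgroup[OF M]
  have S: "subfld (qspan M)"
    using subfld_qspan[OF m] radical_group_root[OF M] alg_over_Qstar_root by blast
  define L where "L = (CC\<lparr>carrier := qspan M\<rparr>)"
  have L [simp]: "carrier L = qspan M" "monoid.mult L = (*)" "one L = 1" "add L = (+)" by (simp_all add: L_def)
  have Gal: "Gal_group \<Gamma> = (\<lambda>\<tau>. restrict \<tau> M) ` {\<tau> \<in> ring_iso L L. \<forall>x \<in> \<rat>. \<tau> x = x}"
    unfolding Gal_group_def Let_def M_def[symmetric] generate_field_eq_qspan[OF M] L_def ..
  have h1: "restrict \<tau> M \<in> carrier (AutQ M) \<and> preserves_relations M (restrict \<tau> M)"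
    if \<tau>: "\<tau> \<in> ring_iso L L" "\<forall>x\<in>\<rat>. \<tau> x = x" for \<tau>
  proof
    have emb: "embedding (qspan M) \<tau>" and inj: "inj_on \<tau> (qspan M)"
      using \<tau>(1) by (auto simp: ring_iso_def Ring.ring_hom_def embedding_def bij_betw_def)
    have MS: "x \<in> qspan M" if "x \<in> M" for x using that qspan_superset by blast
    show "restrict \<tau> M \<in> carrier (AutQ M)"
    proof (rule AutQ_I[OF M])
      show "mhom M (restrict \<tau> M)"
        using embedding_mult[OF S emb] embedding_nonzero[OF S emb] MS mgroup_mult[OF m] mgroup_nonzero[OF m]
        by (auto simp: mhom_def)
      show "restrict \<tau> M x = x" if "x \<in> M" "x \<in> Qstar" for x
        using that \<tau>(2) by (auto simp: Qstar_def)
      show "x = 1" if "x \<in> M" "restrict \<tau> M x = 1" for x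
        using that inj_onD[OF inj, of x 1] embedding_one[OF S emb] MS mgroup_one[OF m] by auto
    qed simp
    have "lcomb (restrict \<tau> M) l = \<tau> (lcomb (\<lambda>x. x) l)" if "l \<in> lists (UNIV \<times> M)" for l
      using that
    proof (induction l)
      case Nil
      then show ?case using embedding_zero[OF S emb] by simp
    next
      case (Cons p l)
      then have p: "snd p \<in> M" "l \<in> lists (UNIV \<times> M)" by auto
      then have "lcomb (\<lambda>x. x) l \<in> qspan M" by (auto simp: qspan_def)
      moreover have "of_rat (fst p) * snd p \<in> qspan M"
        using p MS subfld_Rats[OF S Rats_of_rat] by (intro subfld_mult[OF S]) auto
      ultimately have "\<tau> (lcomb (\<lambda>x. x) (p # l)) = \<tau> (of_rat (fst p) * snd p) + \<tau> (lcomb (\<lambda>x. x) l)"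
        using embedding_add[OF S emb] by simp
      also have "\<tau> (of_rat (fst p) * snd p) = of_rat (fst p) * \<tau> (snd p)"
        using embedding_mult[OF S emb subfld_Rats[OF S Rats_of_rat] MS[OF p(1)]] \<tau>(2) by simp
      finally show ?case using Cons.IH p by simp
    qed
    then show "preserves_relations M (restrict \<tau> M)"
      unfolding preserves_relations_def using embedding_zero[OF S emb] by simp
  qed
  have h2: "\<sigma> \<in> Gal_group \<Gamma>" if \<sigma>: "\<sigma> \<in> carrier (AutQ M)" "preserves_relations M \<sigma>" for \<sigma>
  proof -
    obtain \<theta> where \<theta>: "embedding (qspan M) \<theta>" "\<And>x. x \<in> M \<Longrightarrow> \<theta> x = \<sigma> x"
      "\<And>l. l \<in> lists (UNIV \<times> M) \<Longrightarrow> \<theta> (lcomb (\<lambda>x. x) l) = lcomb \<sigma> l"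
      using preserves_relations_embedding[OF m AutQ_mhom[OF \<sigma>(1) m] \<sigma>(2)] by blast
    have map: "lcomb (\<lambda>x. x) (map (\<lambda>p. (fst p, g (snd p))) l) = lcomb g l" for g l
      by (induction l) auto
    have "\<theta> x \<in> qspan M" if x: "x \<in> qspan M" for x
    proof -
      obtain l where l: "l \<in> lists (UNIV \<times> M)" "x = lcomb (\<lambda>x. x) l" using x by (auto simp: qspan_def)
      then have "\<theta> x = lcomb (\<lambda>x. x) (map (\<lambda>p. (fst p, \<sigma> (snd p))) l)" using \<theta>(3) map by simp
      moreover have "map (\<lambda>p. (fst p, \<sigma> (snd p))) l \<in> lists (UNIV \<times> M)"
        using l(1) AutQ_mem[OF \<sigma>(1)] by (auto simp: in_lists_conv_set)
      ultimately show ?thesis unfolding qspan_def by blast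
    qed
    moreover have "x \<in> \<theta> ` qspan M" if x: "x \<in> qspan M" for x
    proof -
      obtain l where l: "l \<in> lists (UNIV \<times> M)" "x = lcomb (\<lambda>x. x) l" using x by (auto simp: qspan_def)
      define g where "g = inv_into M \<sigma>"
      have g: "g y \<in> M" "\<sigma> (g y) = y" if "y \<in> M" for y
        using that AutQ_bij[OF \<sigma>(1)] by (auto simp: g_def bij_betw_def inv_into_into f_inv_into_f)
      define l' where "l' = map (\<lambda>p. (fst p, g (snd p))) l"
      have l': "l' \<in> lists (UNIV \<times> M)" using l(1) g(1) by (auto simp: l'_def in_lists_conv_set)
      have "lcomb \<sigma> l' = lcomb (\<lambda>x. x) l" using l(1) unfolding l'_def by (induction l) (auto simp: g)
      then have "\<theta> (lcomb (\<lambda>x. x) l') = x" using \<theta>(3)[OF l'] l(2) by simp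
      then show ?thesis using l' unfolding qspan_def by blast
    qed
    moreover have "inj_on \<theta> (qspan M)"
    proof (rule inj_onI)
      fix x y assume xy: "x \<in> qspan M" "y \<in> qspan M" "\<theta> x = \<theta> y"
      then have "\<theta> (x - y) = 0" using embedding_diff[OF S \<theta>(1)] by simp
      then show "x = y" using embedding_nonzero[OF S \<theta>(1) subfld_diff[OF S xy(1,2)]] by auto
    qed
    ultimately have "\<theta> \<in> ring_iso L L"
      using embedding_one[OF S \<theta>(1)] embedding_add[OF S \<theta>(1)] embedding_mult[OF S \<theta>(1)]
      by (auto simp: ring_iso_def Ring.ring_hom_def bij_betw_def)
    moreover have "\<forall>x\<in>\<rat>. \<theta> x = x" using embedding_Rats[OF S \<theta>(1)] by blast
    moreover have "restrict \<theta> M = \<sigma>"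
      using \<theta>(2) AutQ_ext[OF \<sigma>(1)] by (auto simp: extensional_def fun_eq_iff)
    ultimately show ?thesis unfolding Gal by blast
  qed
  show ?thesis
    unfolding A_group_def M_def[symmetric]
  proof (intro equalityI subsetI)
    fix \<sigma> assume "\<sigma> \<in> Gal_group \<Gamma>"
    then obtain \<tau> where "\<tau> \<in> ring_iso L L" "\<forall>x\<in>\<rat>. \<tau> x = x" "\<sigma> = restrict \<tau> M" unfolding Gal by blast
    then show "\<sigma> \<in> {\<sigma> \<in> carrier (AutQ M). preserves_relations M \<sigma>}" using h1 by simp
  next
    fix \<sigma> assume "\<sigma> \<in> {\<sigma> \<in> carrier (AutQ M). preserves_relations M \<sigma>}"
    then show "\<sigma> \<in> Gal_group \<Gamma>" using h2 by simp
  qed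
qed

section \<open>Extension of homomorphisms\<close>

text \<open>Partial homomorphisms from \<open>M\<close> to \<open>\<complex>\<^sup>*\<close> are handled through their graphs, so that the union of a
  chain is literally a union.\<close>

definition hom_graph :: "complex set \<Rightarrow> (complex \<times> complex) set \<Rightarrow> bool" where
  "hom_graph M G \<longleftrightarrow> G \<subseteq> M \<times> (- {0}) \<and> (1, 1) \<in> G \<and>
     (\<forall>p\<in>G. \<forall>q\<in>G. (fst p * fst q, snd p * snd q) \<in> G) \<and>
     (\<forall>p\<in>G. (inverse (fst p), inverse (snd p)) \<in> G) \<and> (\<forall>y. (1, y) \<in> G \<longrightarrow> y = 1)"

context fixes M G assumes M: "mgroup M" and G: "hom_graph M G"
begin

lemma hom_graph_mult: "(x, y) \<in> G \<Longrightarrow> (x', y') \<in> G \<Longrightarrow> (x * x', y * y') \<in> G"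
  using G unfolding hom_graph_def by fastforce
lemma hom_graph_inverse: "(x, y) \<in> G \<Longrightarrow> (inverse x, inverse y) \<in> G"
  using G unfolding hom_graph_def by fastforce
lemma hom_graph_one: "(1, 1) \<in> G" using G unfolding hom_graph_def by blast
lemma hom_graph_range: "(x, y) \<in> G \<Longrightarrow> x \<in> M \<and> y \<noteq> 0" using G unfolding hom_graph_def by blast
lemma hom_graph_kernel: "(1, y) \<in> G \<Longrightarrow> y = 1" using G unfolding hom_graph_def by blast
lemma hom_graph_power: "(x, y) \<in> G \<Longrightarrow> (x ^ k, y ^ k) \<in> G"
  by (induction k) (auto intro: hom_graph_one hom_graph_mult)
lemma hom_graph_power_int: "(x, y) \<in> G \<Longrightarrow> (x powi k, y powi k) \<in> G"
  by (auto simp: power_int_def intro: hom_graph_power hom_graph_inverse)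
lemma hom_graph_unique: 
  assumes "(x, y) \<in> G" "(x, y') \<in> G" shows "y = y'"
proof -
  have "(x * inverse x, y * inverse y') \<in> G" using assms hom_graph_mult hom_graph_inverse by blast
  moreover have "x \<noteq> 0" using assms(1) hom_graph_range mgroup_nonzero[OF M] by blast
  ultimately have "y * inverse y' = 1" using hom_graph_kernel by simp
  then show ?thesis using hom_graph_range[OF assms(2)] by (simp add: field_simps)
qed
lemma mgroup_Domain: "mgroup (Domain G)"
proof -
  have "0 \<notin> Domain G" using hom_graph_range mgroup_nonzero[OF M] by blast
  then show ?thesis
    unfolding mgroup_def using hom_graph_one hom_graph_mult hom_graph_inverse by (meson Domain.simps)
qed

text \<open>The exponents \<open>k\<close> with \<open>x powi k\<close> in the domain are multiples
  of \<open>d\<close>, so consistency has to be checked only at \<open>x ^ d\<close>. The value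
  \<open>d = 0\<close> covers an \<open>x\<close> none of whose powers with nonzero exponent lies in
  the domain.\<close>

lemma hom_graph_step:
  assumes x: "x \<in> M" and y: "y \<noteq> 0" and d: "\<And>k::int. x powi k \<in> Domain G \<Longrightarrow> int d dvd k"
    and xy: "(x ^ d, y ^ d) \<in> G"
  shows "\<exists>G'. hom_graph M G' \<and> G \<subseteq> G' \<and> (x, y) \<in> G'"
proof -
  have x0: "x \<noteq> 0" using x mgroup_nonzero[OF M] by blast
  define G' where "G' = {(h * x powi k, g * y powi k) |h g k. (h, g) \<in> G}"
  have G'I: "(h * x powi k, g * y powi k) \<in> G'" if "(h, g) \<in> G" for h g k
    using that by (auto simp: G'_def)
  have sub: "G \<subseteq> G'" using G'I[where k = 0] by auto
  have mem: "(x, y) \<in> G'" using G'I[OF hom_graph_one, of 1] by simp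
  have "hom_graph M G'"
    unfolding hom_graph_def
  proof (intro conjI ballI allI impI)
    show "G' \<subseteq> M \<times> (- {0})"
      using hom_graph_range y x by (auto simp: G'_def intro!: mgroup_mult[OF M] mgroup_power_int[OF M])
    show "(1, 1) \<in> G'" using hom_graph_one sub by blast
    show "(fst p * fst q, snd p * snd q) \<in> G'" if pq: "p \<in> G'" "q \<in> G'" for p q
    proof -
      obtain h g k where e1: "(h, g) \<in> G" "p = (h * x powi k, g * y powi k)"
        using pq(1) unfolding G'_def by blast
      obtain h' g' k' where e2: "(h', g') \<in> G" "q = (h' * x powi k', g' * y powi k')"
        using pq(2) unfolding G'_def by blast
      have "fst p * fst q = (h * h') * x powi (k + k')" "snd p * snd q = (g * g') * y powi (k + k')"
        using e1 e2 x0 y by (simp_all add: power_int_add mult_ac)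
      then show ?thesis using G'I[OF hom_graph_mult[OF e1(1) e2(1)]] by simp
    qed
    show "(inverse (fst p), inverse (snd p)) \<in> G'" if p: "p \<in> G'" for p
    proof -
      obtain h g k where e: "(h, g) \<in> G" "p = (h * x powi k, g * y powi k)"
        using p unfolding G'_def by blast
      have "inverse (fst p) = inverse h * x powi (- k)" "inverse (snd p) = inverse g * y powi (- k)"
        using e by (simp_all add: power_int_minus)
      then show ?thesis using G'I[OF hom_graph_inverse[OF e(1)]] by simp
    qed
    show "z = 1" if z: "(1, z) \<in> G'" for z
    proof -
      obtain h g k where e: "(h, g) \<in> G" "h * x powi k = 1" "z = g * y powi k" using z unfolding G'_def by fastforce
      have h: "x powi k = inverse h" by (rule inverse_unique[OF e(2), symmetric])
      then have "x powi k \<in> Domain G" using hom_graph_inverse[OF e(1)] by (metis DomainI)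
      then have "int d dvd k" by (rule d)
      then obtain j where j: "k = int d * j" by (rule dvdE)
      have "((x ^ d) powi j, (y ^ d) powi j) \<in> G" by (rule hom_graph_power_int[OF xy])
      moreover have "(x ^ d) powi j = x powi k" "(y ^ d) powi j = y powi k"
        by (simp_all add: j power_int_mult)
      ultimately have "(inverse h, y powi k) \<in> G" using h by simp
      then have "y powi k = inverse g" using hom_graph_unique hom_graph_inverse[OF e(1)] by blast
      then show "z = 1" using e hom_graph_range[OF e(1)] by simp
    qed
  qed
  then show ?thesis using sub mem by blast
qed

end

text \<open>The order of \<open>x\<close> modulo \<open>H\<close>, with 0 standing for infinite
  order.\<close>

lemma order_modulo_subgroup:
  assumes H: "mgroup H" and x: "x \<noteq> (0::complex)"
  shows "\<exists>d::nat. x ^ d \<in> H \<and> (\<forall>k::int. x powi k \<in> H \<longrightarrow> int d dvd k)"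
proof (cases "\<exists>k>0. x ^ k \<in> H")
  case True
  define d where "d = (LEAST k. k > 0 \<and> x ^ k \<in> H)"
  have d: "d > 0" "x ^ d \<in> H" using LeastI_ex[OF True] by (auto simp: d_def)
  have "int d dvd k" if k: "x powi k \<in> H" for k
  proof -
    define r where "r = nat (k mod int d)"
    have r: "int r = k mod int d" using d(1) by (simp add: r_def)
    have "k = int d * (k div int d) + int r" using r by simp
    then have "x powi k = (x ^ d) powi (k div int d) * x powi (int r)"
      using x by (metis power_int_add power_int_mult power_int_of_nat)
    then have "x ^ r = x powi k / (x ^ d) powi (k div int d)" using x by simp
    then have "x ^ r \<in> H" using mgroup_divide[OF H k mgroup_power_int[OF H d(2)]] by simp
    moreover have "r < d" using d(1) r by (metis of_nat_less_iff pos_mod_bound of_nat_0_less_iff)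
    ultimately have "r = 0" using not_less_Least[of r "\<lambda>k. k > 0 \<and> x ^ k \<in> H"] by (auto simp: d_def)
    then show ?thesis using r by (simp add: dvd_eq_mod_eq_0)
  qed
  then show ?thesis using d by blast
next
  case False
  have "k = 0" if k: "x powi k \<in> H" for k
  proof (rule ccontr)
    assume "k \<noteq> 0"
    have "x ^ nat \<bar>k\<bar> \<in> H"
      using k mgroup_inverse[OF H k] by (cases "k \<ge> 0") (auto simp: power_int_def power_inverse split: if_splits)
    moreover have "nat \<bar>k\<bar> > 0" using \<open>k \<noteq> 0\<close> by simp
    ultimately show False using False by blast
  qed
  then show ?thesis using mgroup_one[OF H] by (intro exI[of _ 0]) auto
qed

lemma complex_root_exists: "d > 0 \<Longrightarrow> w \<noteq> 0 \<Longrightarrow> \<exists>y::complex. y \<noteq> 0 \<and> y ^ d = w"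
proof -
  assume d: "d > 0" "w \<noteq> 0"
  have "(exp (Ln w / of_nat d)) ^ d = w" using d by (simp add: exp_of_nat_mult[symmetric])
  then show ?thesis by (intro exI[of _ "exp (Ln w / of_nat d)"]) simp
qed

text \<open>The nonzero complex numbers form a divisible, hence injective, group. Zorn's lemma
  yields a maximal graph, and an element outside its domain could be added after extracting a
  \<open>d\<close>-th root.\<close>

lemma hom_graph_extend:
  assumes M: "mgroup M" and G: "hom_graph M G"
  shows "\<exists>G'. hom_graph M G' \<and> G \<subseteq> G' \<and> Domain G' = M"
proof -
  define A where "A = {G'. hom_graph M G' \<and> G \<subseteq> G'}"
  have mx: "\<exists>N\<in>A. \<forall>Y\<in>A. N \<subseteq> Y \<longrightarrow> Y = N"
  proof (rule subset_Zorn_nonempty)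
    show "A \<noteq> {}" using G by (auto simp: A_def)
    fix C assume C: "C \<noteq> {}" "subset.chain A C"
    then have CA: "hom_graph M c" "G \<subseteq> c" if "c \<in> C" for c using that by (auto simp: subset_chain_def A_def)
    have two: "\<exists>c\<in>C. p \<in> c \<and> q \<in> c" if pq: "p \<in> \<Union>C" "q \<in> \<Union>C" for p q
    proof -
      obtain c c' where c: "c \<in> C" "c' \<in> C" "p \<in> c" "q \<in> c'" using pq by blast
      then have "c \<subseteq> c' \<or> c' \<subseteq> c" using C(2) unfolding subset_chain_def by blast
      then show ?thesis using c by blast
    qed
    have "hom_graph M (\<Union>C)"
      unfolding hom_graph_def
    proof (intro conjI ballI allI impI)
      show "\<Union>C \<subseteq> M \<times> - {0}" using CA(1) unfolding hom_graph_def by blast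
      show "(1, 1) \<in> \<Union>C" using C(1) CA(1) unfolding hom_graph_def by blast
      show "(fst p * fst q, snd p * snd q) \<in> \<Union>C" if pq: "p \<in> \<Union>C" "q \<in> \<Union>C" for p q
        using two[OF pq] CA(1) unfolding hom_graph_def by blast
      show "(inverse (fst p), inverse (snd p)) \<in> \<Union>C" if "p \<in> \<Union>C" for p
        using that CA(1) unfolding hom_graph_def by blast
      show "y = 1" if "(1, y) \<in> \<Union>C" for y
        using that CA(1) unfolding hom_graph_def by blast
    qed
    then show "\<Union>C \<in> A" using C(1) CA(2) by (auto simp: A_def)
  qed
  obtain N where NA: "N \<in> A" "\<forall>Y\<in>A. N \<subseteq> Y \<longrightarrow> Y = N" using mx by (elim bexE)
  have N: "hom_graph M N" "G \<subseteq> N" using NA(1) by (simp_all add: A_def)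
  have max: "Y = N" if "hom_graph M Y" "N \<subseteq> Y" for Y
    using NA(2) N(2) that by (simp add: A_def)
  have "x \<in> Domain N" if x: "x \<in> M" for x
  proof -
    have x0: "x \<noteq> 0" using x mgroup_nonzero[OF M] by blast
    obtain d where d: "x ^ d \<in> Domain N" "\<forall>k::int. x powi k \<in> Domain N \<longrightarrow> int d dvd k"
      using order_modulo_subgroup[OF mgroup_Domain[OF M N(1)] x0] by blast
    obtain w where w: "(x ^ d, w) \<in> N" using d(1) by blast
    have "\<exists>y. y \<noteq> 0 \<and> (x ^ d, y ^ d) \<in> N"
    proof (cases "d = 0")
      case True
      then show ?thesis using hom_graph_one[OF M N(1)] by (intro exI[of _ 1]) simp
    next
      case False
      then show ?thesis using complex_root_exists[of d w] w hom_graph_range[OF M N(1) w] by auto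
    qed
    then obtain y where y: "y \<noteq> 0" "(x ^ d, y ^ d) \<in> N" by blast
    obtain G' where "hom_graph M G'" "N \<subseteq> G'" "(x, y) \<in> G'"
      using hom_graph_step[OF M N(1) x y(1) _ y(2)] d(2) by blast
    then show ?thesis using max by blast
  qed
  then have "Domain N = M" using hom_graph_range[OF M N(1)] by blast
  then show ?thesis using N by blast
qed

lemma hom_graph_of_mhom:
  assumes "mgroup H" "H \<subseteq> M" "mhom H f" shows "hom_graph M ((\<lambda>h. (h, f h)) ` H)"
  unfolding hom_graph_def
proof (intro conjI ballI allI impI)
  note h = mhom_mult[OF assms(1,3)] mhom_one[OF assms(1,3)] mhom_inverse[OF assms(1,3)] mhom_nonzero[OF assms(1,3)]
  show "(\<lambda>h. (h, f h)) ` H \<subseteq> M \<times> - {0}" using assms(2) h(4) by auto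
  show "(1, 1) \<in> (\<lambda>h. (h, f h)) ` H" using mgroup_one[OF assms(1)] h(2) by (intro image_eqI[of _ _ 1]) auto
  show "(fst p * fst q, snd p * snd q) \<in> (\<lambda>h. (h, f h)) ` H" if "p \<in> (\<lambda>h. (h, f h)) ` H" "q \<in> (\<lambda>h. (h, f h)) ` H" for p q
    using that mgroup_mult[OF assms(1)] h(1) by (intro image_eqI[of _ _ "fst p * fst q"]) auto
  show "(inverse (fst p), inverse (snd p)) \<in> (\<lambda>h. (h, f h)) ` H" if "p \<in> (\<lambda>h. (h, f h)) ` H" for p
    using that mgroup_inverse[OF assms(1)] h(3) by (intro image_eqI[of _ _ "inverse (fst p)"]) auto
  show "y = 1" if "(1, y) \<in> (\<lambda>h. (h, f h)) ` H" for y using that h(2) by auto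
qed

lemma mhom_of_hom_graph:
  assumes M: "mgroup M" and G: "hom_graph M G" "Domain G = M"
  shows "\<exists>F. mhom M F \<and> (\<forall>p\<in>G. F (fst p) = snd p)"
proof -
  have "\<exists>y. (x, y) \<in> G" if "x \<in> M" for x using that G(2) by blast
  then obtain F where F: "\<And>x. x \<in> M \<Longrightarrow> (x, F x) \<in> G" by metis
  have u: "F x = y" if "(x, y) \<in> G" for x y
    using hom_graph_unique[OF M G(1) F that] hom_graph_range[OF M G(1) that] by blast
  have "F x \<noteq> 0" if "x \<in> M" for x using hom_graph_range[OF M G(1) F[OF that]] by simp
  moreover have "F (x * y) = F x * F y" if "x \<in> M" "y \<in> M" for x y
    by (rule u[OF hom_graph_mult[OF M G(1) F[OF that(1)] F[OF that(2)]]])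
  ultimately have "mhom M F" unfolding mhom_def by blast
  moreover have "\<forall>p\<in>G. F (fst p) = snd p" using u by (metis prod.collapse)
  ultimately show ?thesis by blast
qed

text \<open>Primality makes the order of \<open>x\<close> modulo \<open>H\<close> exactly
  \<open>p\<close>, so every \<open>p\<close>-th root of \<open>f (x ^ p)\<close> is a legitimate
  value at \<open>x\<close>. Most of the local automorphisms and the cubic characters are built from
  this freedom.\<close>

theorem mhom_extend_prime:
  assumes H: "mgroup H" and M: "mgroup M" "H \<subseteq> M" and f: "mhom H f"
    and p: "Factorial_Ring.prime (p::nat)" and x: "x \<in> M" "x \<notin> H" "x ^ p \<in> H" and y: "y ^ p = f (x ^ p)"
  shows "\<exists>F. mhom M F \<and> (\<forall>h\<in>H. F h = f h) \<and> F x = y"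
proof -
  define G where "G = (\<lambda>h. (h, f h)) ` H"
  have G: "hom_graph M G" unfolding G_def by (rule hom_graph_of_mhom[OF H M(2) f])
  have DG: "Domain G = H" by (auto simp: G_def)
  have x0: "x \<noteq> 0" using x(1) mgroup_nonzero[OF M(1)] by blast
  have y0: "y \<noteq> 0" using y mhom_nonzero[OF H f x(3)] prime_gt_0_nat[OF p] by (auto simp: power_0_left)
  obtain d where d: "x ^ d \<in> H" "\<forall>k::int. x powi k \<in> H \<longrightarrow> int d dvd k"
    using order_modulo_subgroup[OF H x0] by blast
  have "x powi (int p) \<in> H" using x(3) by simp
  then have "d dvd p" using d(2) by (metis int_dvd_int_iff)
  moreover have "d \<noteq> 1" using d(1) x(2) by auto
  ultimately have dp: "d = p" using p by (auto simp: prime_nat_iff)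
  have "(x ^ p, y ^ p) \<in> G" using x(3) y by (simp add: G_def)
  then obtain G1 where G1: "hom_graph M G1" "G \<subseteq> G1" "(x, y) \<in> G1"
    using hom_graph_step[OF M(1) G x(1) y0, of p] d(2) dp DG by blast
  obtain G' where G': "hom_graph M G'" "G1 \<subseteq> G'" "Domain G' = M"
    using hom_graph_extend[OF M(1) G1(1)] by blast
  obtain F where F: "mhom M F" "\<forall>p\<in>G'. F (fst p) = snd p"
    using mhom_of_hom_graph[OF M(1) G'(1,3)] by blast
  have "F x = y" using F(2) G1(3) G'(2) by fastforce
  moreover have "F h = f h" if "h \<in> H" for h
  proof -
    have "(h, f h) \<in> G'" using G1(2) G'(2) that unfolding G_def by blast
    then show ?thesis using F(2) by fastforce
  qed
  ultimately show ?thesis using F(1) by blast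
qed

definition mjoin :: "complex set \<Rightarrow> complex \<Rightarrow> complex set" where
  "mjoin H x = {h * x powi k |h k. h \<in> H}"

lemma mgroup_mjoin:
  assumes H: "mgroup H" and x: "x \<noteq> 0" shows "mgroup (mjoin H x)"
proof -
  have I: "h * x powi k \<in> mjoin H x" if "h \<in> H" for h k using that by (auto simp: mjoin_def)
  have "u * v \<in> mjoin H x" if uv: "u \<in> mjoin H x" "v \<in> mjoin H x" for u v
  proof -
    obtain h k h' k' where e: "h \<in> H" "h' \<in> H" "u = h * x powi k" "v = h' * x powi k'"
      using uv by (auto simp: mjoin_def)
    have "u * v = (h * h') * x powi (k + k')" using e x by (simp add: power_int_add)
    then show ?thesis using I[OF mgroup_mult[OF H e(1,2)]] by simp
  qed
  moreover have "inverse u \<in> mjoin H x" if u: "u \<in> mjoin H x" for u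
  proof -
    obtain h k where e: "h \<in> H" "u = h * x powi k" using u by (auto simp: mjoin_def)
    have "inverse u = inverse h * x powi (- k)" using e by (simp add: power_int_minus)
    then show ?thesis using I[OF mgroup_inverse[OF H e(1)]] by simp
  qed
  moreover have "1 \<in> mjoin H x" using I[OF mgroup_one[OF H], of 0] by simp
  moreover have "0 \<notin> mjoin H x" using x mgroup_nonzero[OF H] by (auto simp: mjoin_def)
  ultimately show ?thesis unfolding mgroup_def by blast
qed

lemma mjoin_superset: "H \<subseteq> mjoin H x"
proof
  fix h assume "h \<in> H"
  then show "h \<in> mjoin H x" unfolding mjoin_def by (intro CollectI exI[of _ h] exI[of _ 0]) auto
qed

lemma mjoin_mem: "mgroup H \<Longrightarrow> x \<in> mjoin H x"
  unfolding mjoin_def using mgroup_one by (intro CollectI exI[of _ 1] exI[of _ 1]) auto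

lemma mjoin_subset: "mgroup M \<Longrightarrow> H \<subseteq> M \<Longrightarrow> x \<in> M \<Longrightarrow> mjoin H x \<subseteq> M"
  unfolding mjoin_def using mgroup_mult mgroup_power_int by blast

section \<open>Square roots of rational numbers\<close>

lemma root_of_unity_power_sum:
  assumes "(r::complex) ^ p = 1" "r \<noteq> 1" shows "(\<Sum>u<p. r ^ u) = 0"
  using geometric_sum[OF assms(2), of p] assms(1) by simp

lemma power_mod_root:
  assumes "(z::complex) ^ p = 1" "[i = j] (mod p)" shows "z ^ i = z ^ j"
proof -
  have red: "z ^ i = z ^ (i mod p)" for i
  proof -
    have "z ^ i = z ^ (p * (i div p) + i mod p)" by simp
    also have "\<dots> = z ^ (i mod p)" unfolding power_add power_mult assms(1) by simp
    finally show ?thesis .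
  qed
  show ?thesis using red[of i] red[of j] assms(2) by (simp add: cong_def)
qed

lemma prime_root_eq_one_iff:
  assumes p: "Factorial_Ring.prime (p::nat)" and z: "(z::complex) ^ p = 1" "z \<noteq> 1"
  shows "z ^ k = 1 \<longleftrightarrow> p dvd k"
proof
  assume k: "z ^ k = 1"
  show "p dvd k"
  proof (rule ccontr)
    assume "\<not> p dvd k"
    then have "coprime k p" using prime_imp_coprime[OF p] by (simp add: coprime_commute)
    then obtain v where v: "[k * v = Suc 0] (mod p)" using cong_solve_coprime_nat by blast
    have "z = z ^ (k * v)" using power_mod_root[OF z(1) v] by simp
    also have "\<dots> = 1" unfolding power_mult k by simp
    finally show False using z(2) by simp
  qed
next
  assume "p dvd k"
  then obtain j where "k = p * j" by (rule dvdE)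
  then show "z ^ k = 1" by (simp add: power_mult z(1))
qed

text \<open>The quadratic Gauss sum, with the quadratic character written as \<open>g\<^sup>i \<mapsto> (-1)\<^sup>i\<close> for a primitive root \<open>g\<close>.\<close>

lemma quadratic_gauss_sum:
  assumes p: "Factorial_Ring.prime (p::nat)" "p \<ge> 3" and z: "z ^ p = 1" "z \<noteq> 1"
  shows "\<exists>g k G. coprime p g \<and> ord p g = p - 1 \<and> [g ^ k = p - 1] (mod p) \<and> G \<in> qspan runity \<and>
     G * cnj G = of_nat p \<and> cnj G = (- 1) ^ k * G \<and>
     (\<forall>\<theta> j. embedding (qspan runity) \<theta> \<longrightarrow> \<theta> z = z ^ (g ^ j) \<longrightarrow> \<theta> G = (- 1) ^ j * G)"
proof -
  have U: "subfld (qspan runity)" by (rule subfld_qspan_runity)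
  have zU: "z \<in> runity" using z(1) p(2) by (intro runity_mem[of p]) auto
  obtain g where g: "residue_primroot p g" using prime_primitive_root_exists[OF _ p(1)] p(2) by auto
  have cop: "coprime p g" and og: "ord p g = p - 1"
    using g totient_prime[OF p(1)] by (auto simp: residue_primroot_def)
  define n where "n = p - 1"
  have evn: "even n" using p prime_odd_nat[of p] by (simp add: n_def)
  have gcong: "[g ^ i = g ^ j] (mod p) \<longleftrightarrow> [i = j] (mod n)" for i j
    using order_divides_expdiff[OF cop] og by (simp add: n_def)
  define S where "S u = (\<Sum>i<n. (- 1) ^ i * z ^ (u * g ^ i))" for u
  \<comment> \<open>Replacing \<open>u\<close> by \<open>u * g\<close> shifts the summation index by
    one and flips each sign; the two ends match because \<open>n = p - 1\<close> is even.\<close>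
  have shift: "S (u * g) = - S u" for u
  proof -
    have "S (u * g) = (\<Sum>i<n. (- 1) ^ i * z ^ (u * g ^ Suc i))" unfolding S_def by (simp add: mult.assoc)
    also have "\<dots> = - (\<Sum>i<n. (- 1) ^ Suc i * z ^ (u * g ^ Suc i))" by (simp add: sum_negf)
    also have "(\<Sum>i<n. (- 1) ^ Suc i * z ^ (u * g ^ Suc i)) = S u"
    proof -
      define h where "h i = (- 1) ^ i * z ^ (u * g ^ i)" for i
      have "[g ^ n = g ^ 0] (mod p)" unfolding gcong by (simp add: cong_0_iff)
      then have "[u * g ^ n = u * g ^ 0] (mod p)" by (rule cong_scalar_left)
      then have "h n = h 0" using evn power_mod_root[OF z(1)] by (simp add: h_def)
      moreover have "h 0 + (\<Sum>i<n. h (Suc i)) = (\<Sum>i<n. h i) + h n"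
        unfolding sum.lessThan_Suc_shift[symmetric] by (rule sum.lessThan_Suc)
      ultimately have "(\<Sum>i<n. h (Suc i)) = (\<Sum>i<n. h i)" by simp
      then show ?thesis unfolding h_def S_def .
    qed
    finally show ?thesis .
  qed
  have shiftj: "S (u * g ^ j) = (- 1) ^ j * S u" for u j
  proof (induction j)
    case (Suc j)
    have "S (u * g ^ Suc j) = S ((u * g ^ j) * g)" by (simp add: mult_ac)
    then show ?case using shift Suc by simp
  qed simp
  define G where "G = S 1"
  have Scong: "S u = S v" if "[u = v] (mod p)" for u v
    unfolding S_def using power_mod_root[OF z(1) cong_scalar_right[OF that]] by simp
  have gen: "\<exists>j. [g ^ j = u] (mod p)" if u: "0 < u" "u < p" for u
  proof -
    have "bij_betw (\<lambda>i. g ^ i mod p) {..<totient p} (totatives p)"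
      using residue_primroot_is_generator[OF _ g] p(2) by simp
    moreover have "u \<in> totatives p"
      using u p(1) by (auto simp: totatives_def intro!: prime_imp_coprime[THEN coprime_commute[THEN iffD1]] dest: dvd_imp_le)
    ultimately have "u \<in> (\<lambda>i. g ^ i mod p) ` {..<totient p}" by (simp add: bij_betw_def)
    then obtain j where "u = g ^ j mod p" by blast
    then show ?thesis by (intro exI[of _ j]) (simp add: cong_def)
  qed
  obtain k where k: "[g ^ k = p - 1] (mod p)" using gen[of "p - 1"] p(2) by auto
  have zn: "norm z = 1"
    using z(1) p(2) by (intro power_eq_imp_eq_base[of "norm z" p 1]) (auto simp: norm_power[symmetric])
  have cz: "cnj z = inverse z"
  proof -
    have "z * cnj z = 1" unfolding complex_norm_square[symmetric] using zn by simp
    then show ?thesis by (rule inverse_unique[symmetric])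
  qed
  have z0: "z \<noteq> 0" using zn by auto
  have inv: "inverse z = z ^ (p - 1)"
  proof (rule inverse_unique)
    show "z * z ^ (p - 1) = 1" using z(1) p(2) by (simp add: power_Suc[symmetric] del: power_Suc)
  qed
  have cS: "cnj (S u) = S (u * (p - 1))" for u
    unfolding S_def by (simp add: cz inv power_mult[symmetric] mult_ac)
  have cG: "cnj G = (- 1) ^ k * G"
  proof -
    have "cnj G = S (p - 1)" unfolding G_def cS by simp
    also have "\<dots> = S (1 * g ^ k)" using Scong[OF cong_sym[OF k]] by simp
    finally show ?thesis unfolding shiftj G_def .
  qed
  have S0: "S 0 = 0"
    using shift[of 0] by simp
  have nSu: "S u * cnj (S u) = G * cnj G" if u: "0 < u" "u < p" for u
  proof -
    obtain j where j: "[g ^ j = u] (mod p)" using gen[OF u] by blast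
    have "S u = (- 1) ^ j * G" using Scong[OF j] shiftj[of 1 j] by (simp add: G_def)
    then show ?thesis by (simp add: power_mult_distrib[symmetric] mult_ac)
  qed
  \<comment> \<open>The sum of the squared absolute values is evaluated twice: as \<open>n\<close>
    times that of \<open>G\<close>, since \<open>S 0 = 0\<close> and the other terms agree, and by
    orthogonality of the powers of \<open>z\<close> as \<open>n * p\<close>.\<close>
  have "(\<Sum>u<p. S u * cnj (S u)) = S 0 * cnj (S 0) + (\<Sum>u\<in>{1..<p}. S u * cnj (S u))"
  proof -
    have "{..<p} = insert 0 {1..<p}" using p(2) by auto
    then show ?thesis by simp
  qed
  also have "\<dots> = of_nat n * (G * cnj G)"
    using nSu S0 by (simp add: n_def)
  finally have e1: "(\<Sum>u<p. S u * cnj (S u)) = of_nat n * (G * cnj G)" .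
  have "S u * cnj (S u) = (\<Sum>i<n. \<Sum>j<n. (- 1) ^ i * (- 1) ^ j * (z ^ g ^ i * inverse (z ^ g ^ j)) ^ u)" for u
  proof -
    have e: "z ^ (u * l) = (z ^ l) ^ u" for l by (simp add: power_mult[symmetric] mult.commute)
    have "S u = (\<Sum>i<n. (- 1) ^ i * (z ^ g ^ i) ^ u)" unfolding S_def e ..
    moreover from this have "cnj (S u) = (\<Sum>j<n. (- 1) ^ j * inverse (z ^ g ^ j) ^ u)"
      by (simp add: cz power_inverse)
    ultimately have "S u * cnj (S u) = (\<Sum>i<n. \<Sum>j<n. ((- 1) ^ i * (z ^ g ^ i) ^ u) * ((- 1) ^ j * inverse (z ^ g ^ j) ^ u))"
      by (simp only: sum_product)
    then show ?thesis by (simp add: power_mult_distrib mult_ac)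
  qed
  then have "(\<Sum>u<p. S u * cnj (S u)) =
      (\<Sum>u<p. \<Sum>i<n. \<Sum>j<n. (- 1) ^ i * (- 1) ^ j * (z ^ g ^ i * inverse (z ^ g ^ j)) ^ u)" by simp
  also have "\<dots> = (\<Sum>i<n. \<Sum>j<n. (- 1) ^ i * (- 1) ^ j * (\<Sum>u<p. (z ^ g ^ i * inverse (z ^ g ^ j)) ^ u))"
    unfolding sum_distrib_left by (rule trans[OF sum.swap]) (intro sum.cong refl sum.swap)
  also have "\<dots> = (\<Sum>i<n. \<Sum>j<n. if i = j then of_nat p else 0)"
  proof (intro sum.cong refl)
    fix i j assume ij: "i \<in> {..<n}" "j \<in> {..<n}"
    define r where "r = z ^ g ^ i * inverse (z ^ g ^ j)"
    have rp: "r ^ p = 1"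
    proof -
      have "(z ^ l) ^ p = 1" for l 
      proof -
        have "(z ^ l) ^ p = (z ^ p) ^ l" by (simp add: power_mult[symmetric] mult.commute)
        then show ?thesis using z(1) by simp
      qed
      then show ?thesis by (simp add: r_def power_mult_distrib power_inverse)
    qed
    show "(- 1) ^ i * (- 1) ^ j * (\<Sum>u<p. r ^ u) = (if i = j then of_nat p else 0)"
    proof (cases "i = j")
      case True
      then have "r = 1" using z0 by (simp add: r_def)
      then show ?thesis using True by (simp add: power_add[symmetric] mult_2[symmetric])
    next
      case False
      have "r \<noteq> 1"
      proof
        assume "r = 1"
        have "[g ^ i = g ^ j] (mod p)"
        proof (rule ccontr)
          assume nc: "\<not> [g ^ i = g ^ j] (mod p)"
          have "z ^ (g ^ i) * inverse z ^ (g ^ j) = 1" using \<open>r = 1\<close> unfolding r_def power_inverse .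
          then have "z ^ (g ^ i + (p - 1) * g ^ j) = 1" unfolding power_add power_mult inv[symmetric] .
          then have "p dvd g ^ i + (p - 1) * g ^ j" using prime_root_eq_one_iff[OF p(1) z] by blast
          then have "int p dvd int (g ^ i + (p - 1) * g ^ j)" by (simp only: int_dvd_int_iff)
          moreover have "int (g ^ i + (p - 1) * g ^ j) = int (g ^ i) + (int p - 1) * int (g ^ j)"
            using p(2) by (simp add: of_nat_diff)
          ultimately have d: "int p dvd int (g ^ i) + (int p - 1) * int (g ^ j)" by (simp only:)
          have "int (g ^ i) + (int p - 1) * int (g ^ j) = (int (g ^ i) - int (g ^ j)) + int p * int (g ^ j)"
            by (simp add: algebra_simps)
          then have "int p dvd (int (g ^ i) - int (g ^ j)) + int p * int (g ^ j)" using d by (simp only:)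
          then have "int p dvd int (g ^ i) - int (g ^ j)" by (simp add: dvd_add_left_iff)
          then have "[int (g ^ i) = int (g ^ j)] (mod int p)" by (simp add: cong_iff_dvd_diff)
          then show False using nc by (simp only: cong_int_iff)
        qed
        then have "[i = j] (mod n)" by (simp only: gcong)
        then show False using ij False by (simp add: cong_def)
      qed
      then show ?thesis using root_of_unity_power_sum[OF rp] False by simp
    qed
  qed
  also have "\<dots> = of_nat n * of_nat p" by simp
  finally have "of_nat n * (G * cnj G) = of_nat n * of_nat p" using e1 by simp
  then have GG: "G * cnj G = of_nat p" using p(2) by (simp add: n_def)
  have zq: "z ^ j \<in> qspan runity" for j
    using mgroup_power[OF mgroup_runity zU] qspan_superset by blast
  have m1: "(- 1) ^ j \<in> \<rat>" for j :: nat
    by simp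
  have GU: "G \<in> qspan runity"
    unfolding G_def S_def by (intro subfld_sum[OF U] subfld_mult[OF U] zq subfld_Rats[OF U] m1)
  have "\<theta> G = (- 1) ^ j * G" if \<theta>: "embedding (qspan runity) \<theta>" "\<theta> z = z ^ (g ^ j)" for \<theta> j
  proof -
    have "\<theta> G = (\<Sum>i<n. \<theta> ((- 1) ^ i * z ^ (1 * g ^ i)))"
      unfolding G_def S_def by (intro embedding_sum[OF U \<theta>(1)] subfld_mult[OF U] zq subfld_Rats[OF U] m1)
    also have "\<dots> = (\<Sum>i<n. (- 1) ^ i * z ^ (g ^ j * g ^ i))"
    proof (intro sum.cong refl)
      fix i
      have "\<theta> ((- 1) ^ i * z ^ (1 * g ^ i)) = \<theta> ((- 1) ^ i) * \<theta> (z ^ (1 * g ^ i))"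
        by (intro embedding_mult[OF U \<theta>(1)] zq subfld_Rats[OF U] m1)
      also have "\<theta> ((- 1) ^ i) = (- 1) ^ i" by (rule embedding_Rats[OF U \<theta>(1) m1])
      also have "\<theta> (z ^ (1 * g ^ i)) = z ^ (g ^ j * g ^ i)"
        using embedding_power[OF U \<theta>(1), of z "g ^ i"] zq[of 1] \<theta>(2) by (simp add: power_mult[symmetric])
      finally show "\<theta> ((- 1) ^ i * z ^ (1 * g ^ i)) = (- 1) ^ i * z ^ (g ^ j * g ^ i)" .
    qed
    also have "\<dots> = S (1 * g ^ j)" by (simp add: S_def)
    finally show ?thesis unfolding shiftj G_def .
  qed
  then show ?thesis using cop og k GU GG cG by blast
qed

lemma imaginary_unit_runity: "\<i> \<in> runity"
  by (rule runity_mem[of 4]) simp_all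

text \<open>The Gauss sum is \<open>sqrt p\<close> up to sign and a factor 1 or \<open>\<i>\<close>,
  so an embedding acts on \<open>sqrt p\<close> through its exponent on \<open>z\<close>, corrected
  by its sign on \<open>\<i>\<close>. Both signs come from an exponent that moves \<open>z\<close>,
  except for \<open>p = 3\<close>, where the product of the two signs, the action on a square root
  of -3, decides.\<close>

lemma sqrt_prime_sign_odd:
  assumes p: "Factorial_Ring.prime (p::nat)" "p \<ge> 3" and z: "z ^ p = 1" "z \<noteq> 1"
    and s: "\<epsilon> \<in> {1, -1}" "\<delta> \<in> {1, -1 :: complex}"
  shows "complex_of_real (sqrt p) \<in> qspan runity \<and> (\<exists>u. \<not> p dvd u \<and> (p \<noteq> 3 \<or> \<epsilon> * \<delta> \<noteq> 1 \<longrightarrow> z ^ u \<noteq> z) \<and>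
     (p = 3 \<and> \<epsilon> * \<delta> = 1 \<longrightarrow> z ^ u = z) \<and>
     (\<forall>\<theta>. embedding (qspan runity) \<theta> \<longrightarrow> \<theta> z = z ^ u \<longrightarrow> \<theta> \<i> = \<delta> * \<i> \<longrightarrow>
          \<theta> (complex_of_real (sqrt p)) = \<epsilon> * complex_of_real (sqrt p)))"
proof -
  have U: "subfld (qspan runity)" by (rule subfld_qspan_runity)
  have iU: "\<i> \<in> qspan runity" using imaginary_unit_runity qspan_superset by blast
  obtain g k G where g: "coprime p g" "ord p g = p - 1" "[g ^ k = p - 1] (mod p)" and G: "G \<in> qspan runity"
     "G * cnj G = of_nat p" "cnj G = (- 1) ^ k * G"
     "\<And>\<theta> j. embedding (qspan runity) \<theta> \<Longrightarrow> \<theta> z = z ^ (g ^ j) \<Longrightarrow> \<theta> G = (- 1) ^ j * G"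
    using quadratic_gauss_sum[OF p z] by blast
  have gone: "z ^ (g ^ j) = z \<longleftrightarrow> (p - 1) dvd j" for j
  proof -
    have "z ^ (g ^ j) = z \<longleftrightarrow> [g ^ j = 1] (mod p)"
    proof
      assume e: "z ^ (g ^ j) = z"
      have z0: "z \<noteq> 0" using z(1) p(2) by (auto simp: power_0_left)
      have gj: "g ^ j \<noteq> 0"
      proof
        assume "g ^ j = 0"
        with e have "z = 1" by simp
        then show False using z(2) by simp
      qed
      then have "z * z ^ (g ^ j - 1) = z * 1" using e by (metis Suc_pred' gr0I mult.right_neutral power_Suc)
      then have "z ^ (g ^ j - 1) = 1" using z0 by simp
      then have "p dvd g ^ j - 1" using prime_root_eq_one_iff[OF p(1) z] by blast
      then show "[g ^ j = 1] (mod p)" using gj by (subst cong_altdef_nat) (simp_all add: Suc_le_eq)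
    next
      assume "[g ^ j = 1] (mod p)"
      then show "z ^ (g ^ j) = z" using power_mod_root[OF z(1)] by fastforce
    qed
    then show ?thesis using ord_divides[of g j p] g(2) by simp
  qed
  define r where "r = complex_of_real (sqrt p)"
  have r2: "r * r = of_nat p" by (simp add: r_def flip: of_real_mult)
  have r0: "r \<noteq> 0" using p(2) by (simp add: r_def)
  have m1: "(- 1 :: complex) ^ k = 1 \<or> (- 1 :: complex) ^ k = - 1" by (cases "even k") auto
  \<comment> \<open>\<open>k\<close> is the exponent of -1 to the base \<open>g\<close>, so
    \<open>\<kappa>\<close> is 1 or \<open>\<i>\<close> according as -1 is a square modulo
    \<open>p\<close> or not.\<close>
  define \<kappa> where "\<kappa> = (if even k then 1 else \<i>)"
  have \<kappa>: "\<kappa> \<in> qspan runity" "\<kappa> \<noteq> 0" using iU subfld_one[OF U] by (auto simp: \<kappa>_def)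
  have "(G - \<kappa> * r) * (G + \<kappa> * r) = 0"
  proof (cases "even k")
    case True
    then have "G * G = of_nat p" using G(2,3) by simp
    then show ?thesis using True r2 by (simp add: \<kappa>_def algebra_simps)
  next
    case False
    then have "- (G * G) = of_nat p" using G(2,3) by simp
    then have "G * G = - (r * r)" using r2 by (simp add: equation_minus_iff)
    then show ?thesis using False by (simp add: \<kappa>_def algebra_simps)
  qed
  then obtain c where c: "c \<in> {1, - 1}" "G = c * (\<kappa> * r)"
    by (metis (no_types, lifting) eq_iff_diff_eq_0 eq_neg_iff_add_eq_0 insertCI mult_1 mult_minus1 mult_eq_0_iff)
  then have rG: "r = c * (G / \<kappa>)" using \<kappa> by auto
  have cR: "c \<in> \<rat>" using c(1) by auto
  have rU: "r \<in> qspan runity"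
    unfolding rG by (intro subfld_mult[OF U] subfld_divide[OF U] G(1) \<kappa> subfld_Rats[OF U] cR)
  define t where "t = (if even k then \<epsilon> else \<epsilon> * \<delta>)"
  have t: "t = 1 \<or> t = - 1" using s by (auto simp: t_def)
  \<comment> \<open>For the trivial sign the exponent is \<open>g ^ 2\<close> and not 1, so that
    \<open>z\<close> moves whenever \<open>p > 3\<close>.\<close>
  define j where "j = (if t = 1 then 2 else 1::nat)"
  have jt: "(- 1) ^ j = t" using t by (auto simp: j_def)
  have "\<not> p dvd g ^ j"
    using g(1) p(1) by (metis coprime_common_divisor coprime_power_right_iff dvd_refl not_prime_unit)
  moreover have "\<theta> r = \<epsilon> * r"
    if \<theta>: "embedding (qspan runity) \<theta>" "\<theta> z = z ^ (g ^ j)" "\<theta> \<i> = \<delta> * \<i>" for \<theta>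
  proof -
    have tG: "\<theta> G = t * G" using G(4)[OF \<theta>(1,2)] jt by simp
    have \<theta>\<kappa>: "\<theta> \<kappa> = (if even k then 1 else \<delta>) * \<kappa>"
      using \<theta>(3) embedding_one[OF U \<theta>(1)] by (simp add: \<kappa>_def)
    have "\<theta> r = \<theta> c * (\<theta> G / \<theta> \<kappa>)"
      unfolding rG using embedding_mult[OF U \<theta>(1) subfld_Rats[OF U cR] subfld_divide[OF U G(1) \<kappa>(1)]]
        embedding_divide[OF U \<theta>(1) G(1) \<kappa>(1)] by simp
    also have "\<dots> = \<epsilon> * (c * (G / \<kappa>))"
      unfolding tG \<theta>\<kappa> embedding_Rats[OF U \<theta>(1) cR] t_def using s by auto
    finally show ?thesis using rG by simp
  qed
  moreover have "z ^ (g ^ j) = z \<longleftrightarrow> p = 3 \<and> \<epsilon> * \<delta> = 1"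
  proof (cases "p = 3")
    case True
    \<comment> \<open>Since -1 is not a square modulo 3, the relevant sign is
      \<open>\<epsilon> * \<delta>\<close>.\<close>
    have "odd k"
    proof
      assume "even k"
      then have "(p - 1) dvd k" using True by simp
      then have "[g ^ k = 1] (mod p)" using ord_divides[of g k p] g(2) by simp
      then have "[p - 1 = 1] (mod p)" using g(3) cong_sym cong_trans by blast
      then show False using True by (simp add: cong_def)
    qed
    then have "t = \<epsilon> * \<delta>" by (simp add: t_def)
    then show ?thesis unfolding gone using True by (simp add: j_def)
  next
    case False
    then have "p - 1 > 2" using p(2) by simp
    then have "\<not> (p - 1) dvd j" using nat_dvd_not_less[of j "p - 1"] by (simp add: j_def split: if_splits)
    then show ?thesis unfolding gone using False by simp
  qed
  ultimately show ?thesis using rU unfolding r_def by blast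
qed

text \<open>Some \<open>B\<close> captures all \<open>a i\<close>, hence all of Gamma and, by
  \<open>smooth_root\<close>, the rational radicals over it; so the finitely many primes up to
  \<open>B\<close> control all square roots.\<close>

definition smooth :: "nat \<Rightarrow> complex set" where
  "smooth B = {of_int r / of_nat k |r k. r \<noteq> 0 \<and> k > 0 \<and>
     (\<forall>q. Factorial_Ring.prime q \<longrightarrow> q dvd nat \<bar>r\<bar> * k \<longrightarrow> q \<le> B)}"

lemma smoothI:
  assumes "r \<noteq> 0" "k > 0" "\<And>q. Factorial_Ring.prime q \<Longrightarrow> q dvd nat \<bar>r\<bar> * k \<Longrightarrow> q \<le> B"
  shows "of_int r / of_nat k \<in> smooth B"
  using assms unfolding smooth_def by blast

lemma smoothE:
  assumes "x \<in> smooth B"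
  shows "\<exists>r k. x = of_int r / of_nat k \<and> r \<noteq> 0 \<and> k > 0 \<and>
    (\<forall>q. Factorial_Ring.prime q \<longrightarrow> q dvd nat \<bar>r\<bar> \<longrightarrow> q \<le> B) \<and>
    (\<forall>q. Factorial_Ring.prime q \<longrightarrow> q dvd k \<longrightarrow> q \<le> B)"
proof -
  obtain r k where "x = of_int r / of_nat k" "r \<noteq> 0" "k > 0"
    "\<forall>q. Factorial_Ring.prime q \<longrightarrow> q dvd nat \<bar>r\<bar> * k \<longrightarrow> q \<le> B"
    using assms unfolding smooth_def by blast
  then show ?thesis by (intro exI[of _ r] exI[of _ k]) (auto intro: dvd_mult dvd_mult2)
qed

lemma smooth_subset_Qstar: "smooth B \<subseteq> Qstar"
proof
  fix x assume x: "x \<in> smooth B"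
  obtain r k where "x = of_int r / of_nat k" "r \<noteq> 0" "k > 0" using smoothE[OF x] by blast
  then show "x \<in> Qstar" by (simp add: Qstar_def)
qed

lemma mgroup_smooth: "mgroup (smooth B)"
proof -
  have "x * y \<in> smooth B" if xy: "x \<in> smooth B" "y \<in> smooth B" for x y
  proof -
    obtain r k where 1: "x = of_int r / of_nat k" "r \<noteq> 0" "k > 0"
      "\<forall>q. Factorial_Ring.prime q \<longrightarrow> q dvd nat \<bar>r\<bar> \<longrightarrow> q \<le> B"
      "\<forall>q. Factorial_Ring.prime q \<longrightarrow> q dvd k \<longrightarrow> q \<le> B"
      using smoothE[OF xy(1)] by blast
    obtain r' k' where 2: "y = of_int r' / of_nat k'" "r' \<noteq> 0" "k' > 0"
      "\<forall>q. Factorial_Ring.prime q \<longrightarrow> q dvd nat \<bar>r'\<bar> \<longrightarrow> q \<le> B"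
      "\<forall>q. Factorial_Ring.prime q \<longrightarrow> q dvd k' \<longrightarrow> q \<le> B"
      using smoothE[OF xy(2)] by blast
    have "of_int (r * r') / of_nat (k * k') \<in> smooth B"
    proof (rule smoothI)
      fix q assume q: "Factorial_Ring.prime q" "q dvd nat \<bar>r * r'\<bar> * (k * k')"
      have "nat \<bar>r * r'\<bar> = nat \<bar>r\<bar> * nat \<bar>r'\<bar>" by (simp add: abs_mult nat_mult_distrib)
      then show "q \<le> B" using q 1(4,5) 2(4,5) by (auto simp: prime_dvd_mult_iff)
    qed (use 1 2 in auto)
    then show ?thesis using 1(1) 2(1) by (simp add: times_divide_times_eq)
  qed
  moreover have "inverse x \<in> smooth B" if x: "x \<in> smooth B" for x
  proof -
    obtain r k where 1: "x = of_int r / of_nat k" "r \<noteq> 0" "k > 0"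
      "\<forall>q. Factorial_Ring.prime q \<longrightarrow> q dvd nat \<bar>r\<bar> \<longrightarrow> q \<le> B"
      "\<forall>q. Factorial_Ring.prime q \<longrightarrow> q dvd k \<longrightarrow> q \<le> B"
      using smoothE[OF x] by blast
    have "of_int (sgn r * int k) / of_nat (nat \<bar>r\<bar>) \<in> smooth B"
    proof (rule smoothI)
      fix q assume q: "Factorial_Ring.prime q" "q dvd nat \<bar>sgn r * int k\<bar> * nat \<bar>r\<bar>"
      have "nat \<bar>sgn r * int k\<bar> = k" using 1(2) by (simp add: abs_mult)
      then show "q \<le> B" using q 1(4,5) by (auto simp: prime_dvd_mult_iff)
    qed (use 1 in \<open>auto simp: sgn_if\<close>)
    moreover have "of_int (sgn r * int k) / of_nat (nat \<bar>r\<bar>) = inverse x"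
      unfolding 1(1) using 1(2) by (cases "r > 0") (simp_all add: sgn_if)
    ultimately show ?thesis by simp
  qed
  moreover have "1 \<in> smooth B" using smoothI[of 1 1 B] by simp
  moreover have "0 \<notin> smooth B" using smooth_subset_Qstar by (auto simp: Qstar_def)
  ultimately show ?thesis unfolding mgroup_def by blast
qed

text \<open>In lowest terms a prime of the numerator cannot cancel against the denominator, so it is
  still present in the \<open>n\<close>-th power; likewise for the denominator.\<close>

lemma smooth_root:
  assumes x: "x \<in> Qstar" and n: "n \<ge> 1" "x ^ n \<in> smooth B"
  shows "x \<in> smooth B"
proof -
  have "x \<in> \<rat>" "x \<noteq> 0" using x by (simp_all add: Qstar_def)
  obtain r k where 1: "x ^ n = of_int r / of_nat k" "r \<noteq> 0" "k > 0"
      "\<forall>q. Factorial_Ring.prime q \<longrightarrow> q dvd nat \<bar>r\<bar> \<longrightarrow> q \<le> B"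
      "\<forall>q. Factorial_Ring.prime q \<longrightarrow> q dvd k \<longrightarrow> q \<le> B"
    using smoothE[OF n(2)] by blast
  obtain s d where 2: "d > 0" "coprime s d" "x = of_int s / of_int d"
    using \<open>x \<in> \<rat>\<close> by (rule Rats_cases')
  have s0: "s \<noteq> 0" using 2(3) \<open>x \<noteq> 0\<close> by auto
  have "of_int (s ^ n * int k) = (of_int (r * d ^ n) :: complex)"
    using 1(1,3) 2(1,3) by (simp add: power_divide field_simps)
  then have eq: "s ^ n * int k = r * d ^ n" by (simp only: of_int_eq_iff)
  have "of_int s / of_nat (nat d) \<in> smooth B"
  proof (rule smoothI)
    fix q assume q: "Factorial_Ring.prime q" "q dvd nat \<bar>s\<bar> * nat d"
    then have pq: "Factorial_Ring.prime (int q)" by simp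
    have "q dvd nat \<bar>s\<bar> \<or> q dvd nat d" using q by (simp add: prime_dvd_mult_iff)
    then show "q \<le> B"
    proof
      assume "q dvd nat \<bar>s\<bar>"
      then have qs: "int q dvd s" by (simp add: int_dvd_int_iff[symmetric])
      then have nd: "\<not> int q dvd d" using 2(2) pq coprime_common_divisor not_prime_unit by blast
      have "int q dvd s ^ n" using dvd_trans[OF qs dvd_power[of n s]] n(1) by simp
      then have "int q dvd r * d ^ n" using eq[symmetric] by simp
      then have "int q dvd r"
        using prime_dvd_mult_iff[OF pq, of r "d ^ n"] prime_dvd_power[OF pq, of d n] nd by blast
      then have "q dvd nat \<bar>r\<bar>" by (simp add: int_dvd_int_iff[symmetric])
      then show ?thesis using 1(4) q(1) by blast
    next
      assume "q dvd nat d"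
      then have qd: "int q dvd d" using 2(1) by (simp add: int_dvd_int_iff[symmetric])
      then have ns: "\<not> int q dvd s" using 2(2) pq coprime_common_divisor not_prime_unit by blast
      have "int q dvd d ^ n" using dvd_trans[OF qd dvd_power[of n d]] n(1) by simp
      then have "int q dvd s ^ n * int k" using eq by simp
      then have "int q dvd int k"
        using prime_dvd_mult_iff[OF pq, of "s ^ n" "int k"] prime_dvd_power[OF pq, of s n] ns by blast
      then show ?thesis using 1(5) q(1) by simp
    qed
  qed (use s0 2(1) in auto)
  then show ?thesis using 2(1,3) by simp
qed

lemma smooth_exists:
  assumes "finite F" "F \<subseteq> Qstar" shows "\<exists>B. F \<subseteq> smooth B"
  using assms
proof (induction F)
  case (insert x F)
  then obtain B where B: "F \<subseteq> smooth B" by auto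
  have "x \<in> \<rat>" "x \<noteq> 0" using insert.prems by (simp_all add: Qstar_def)
  obtain s d where 2: "d > 0" "coprime s d" "x = of_int s / of_int d"
    using \<open>x \<in> \<rat>\<close> by (rule Rats_cases')
  define C where "C = max B (nat \<bar>s\<bar> * nat d)"
  have s0: "s \<noteq> 0" using 2(3) \<open>x \<noteq> 0\<close> by auto
  have "of_int s / of_nat (nat d) \<in> smooth C"
  proof (rule smoothI)
    fix q assume "Factorial_Ring.prime q" "q dvd nat \<bar>s\<bar> * nat d"
    then have "q \<le> nat \<bar>s\<bar> * nat d" using s0 2(1) by (intro dvd_imp_le) auto
    then show "q \<le> C" by (simp add: C_def)
  qed (use s0 2(1) in auto)
  then have "x \<in> smooth C" using 2(1,3) by simp
  moreover have "smooth B \<subseteq> smooth C"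
    unfolding smooth_def C_def by (blast intro: max.coboundedI1)
  ultimately show ?case using B by blast
qed auto

lemma smooth_mono: "B \<le> C \<Longrightarrow> smooth B \<subseteq> smooth C"
  unfolding smooth_def by (blast intro: le_trans)

text \<open>Up to squares only the signed divisors of the product of the primes up to
  \<open>B\<close> occur. This finiteness turns a condition on all square roots into a finite
  one.\<close>

lemma smooth_squarefree:
  "\<exists>D. finite D \<and> D \<subseteq> Qstar \<and> (\<forall>x\<in>smooth B. \<exists>s\<in>D. \<exists>c\<in>Qstar. x = s * c ^ 2)"
proof -
  define P where "P = \<Prod>{q. Factorial_Ring.prime q \<and> q \<le> B}"
  have P0: "P > 0" unfolding P_def by (rule prod_pos) (auto dest: prime_gt_0_nat)
  define D where "D = (\<lambda>m. of_nat m) ` {1..P} \<union> (\<lambda>m. - of_nat m) ` {1..P} - {0::complex}"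
  have "\<exists>s\<in>D. \<exists>c\<in>Qstar. x = s * c ^ 2" if x: "x \<in> smooth B" for x
  proof -
    obtain r k where 1: "x = of_int r / of_nat k" "r \<noteq> 0" "k > 0"
      "\<forall>q. Factorial_Ring.prime q \<longrightarrow> q dvd nat \<bar>r\<bar> \<longrightarrow> q \<le> B"
      "\<forall>q. Factorial_Ring.prime q \<longrightarrow> q dvd k \<longrightarrow> q \<le> B"
      using smoothE[OF x] by blast
    \<comment> \<open>\<open>r / k\<close> and \<open>r * k\<close> differ by the square of
      \<open>k\<close>, so it suffices to split an integer.\<close>
    define N where "N = nat \<bar>r\<bar> * k"
    have N: "q \<le> B" if "Factorial_Ring.prime q" "q dvd N" for q
      using that 1(4,5) by (auto simp: N_def prime_dvd_mult_iff)
    have N0: "N > 0" using 1 by (simp add: N_def)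
    obtain s c where sc: "N = s * c ^ 2" "squarefree s"
      using squarefree_decompose[of N] squarefree_squarefree_part[of N] by (rule that)
    have s0: "s > 0" "c > 0" using sc(1) N0 by (auto intro: gr0I)
    have "s dvd P"
    proof (rule multiplicity_le_imp_dvd)
      fix q :: nat assume q: "Factorial_Ring.prime q"
      show "multiplicity q s \<le> multiplicity q P"
      proof (cases "q dvd s")
        case True
        then have "q \<in> prime_factors s" using s0 q by (simp add: in_prime_factors_iff)
        then have le1: "multiplicity q s = 1" using sc(2) s0 squarefree_factorial_semiring'[of s] by simp
        have "q dvd P" unfolding P_def using N[OF q] sc(1) q True by (intro dvd_prodI) auto
        then have "multiplicity q P \<ge> 1" using q P0 by (intro multiplicity_geI) auto
        then show ?thesis using le1 by simp
      qed (simp add: not_dvd_imp_multiplicity_0)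
    qed (use s0 in auto)
    then have sP: "s \<in> {1..P}" using P0 s0 by (auto dest: dvd_imp_le)
    define t where "t = (if r > 0 then of_nat s else - of_nat s :: complex)"
    have "t \<in> D" using sP s0 by (auto simp: t_def D_def)
    moreover have "of_nat c / of_nat k \<in> Qstar" using s0 1(3) by (simp add: Qstar_def)
    moreover have "x = t * (of_nat c / of_nat k) ^ 2"
    proof -
      have "of_int \<bar>r\<bar> * of_nat k = (of_nat s * of_nat c ^ 2 :: complex)"
      proof -
        have "of_nat N = (of_nat (s * c ^ 2) :: complex)" using sc(1) by simp
        then show ?thesis by (simp add: N_def)
      qed
      then have "of_int r * of_nat k = t * of_nat c ^ 2"
      proof (cases "r > 0")
        case False
        with \<open>of_int \<bar>r\<bar> * of_nat k = of_nat s * of_nat c ^ 2\<close>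
        have "- (of_int r * of_nat k) = (of_nat s * of_nat c ^ 2 :: complex)" by simp
        then have "- (of_nat s * of_nat c ^ 2) = (of_int r * of_nat k :: complex)"
          by (rule minus_equation_iff[THEN iffD1])
        then show ?thesis using False by (simp add: t_def)
      qed (simp add: t_def)
      then have "of_int r * of_nat k / of_nat k ^ 2 = t * (of_nat c / of_nat k) ^ 2"
        by (simp add: power_divide)
      then show ?thesis using 1(1,3) by (simp add: power2_eq_square)
    qed
    ultimately show ?thesis by blast
  qed
  moreover have "finite D" "D \<subseteq> Qstar" by (auto simp: D_def Qstar_def)
  ultimately show ?thesis by blast
qed

text \<open>Both the square root and its sign are multiplicative in \<open>t\<close>, so the primes
  up to \<open>B\<close> decide.\<close>

lemma sqrt_smooth_action:
  assumes \<theta>: "embedding (qspan runity) \<theta>" and w: "mhom Qstar w"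
    and q: "\<And>q. Factorial_Ring.prime q \<Longrightarrow> q \<le> B \<Longrightarrow> complex_of_real (sqrt q) \<in> qspan runity \<and>
       \<theta> (complex_of_real (sqrt q)) = w (of_nat q) * complex_of_real (sqrt q)"
    and b: "complex_of_real t \<in> smooth B" "t > 0"
  shows "complex_of_real (sqrt t) \<in> qspan runity \<and>
       \<theta> (complex_of_real (sqrt t)) = w (complex_of_real t) * complex_of_real (sqrt t)"
proof -
  have U: "subfld (qspan runity)" by (rule subfld_qspan_runity)
  have Qn: "of_nat m \<in> Qstar" if "m > 0" for m using that by (simp add: Qstar_def)
  have nat: "m \<noteq> 0 \<Longrightarrow> (\<And>q. Factorial_Ring.prime q \<Longrightarrow> q dvd m \<Longrightarrow> q \<le> B) \<Longrightarrow>
     complex_of_real (sqrt m) \<in> qspan runity \<and>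
       \<theta> (complex_of_real (sqrt m)) = w (of_nat m) * complex_of_real (sqrt m)" for m :: nat
  proof (induction m rule: prime_divisors_induct)
    case (unit m)
    then show ?case using subfld_one[OF U] embedding_one[OF U \<theta>] mhom_one[OF mgroup_Qstar w] by simp
  next
    case (factor p m)
    have m: "complex_of_real (sqrt m) \<in> qspan runity" "\<theta> (complex_of_real (sqrt m)) = w (of_nat m) * complex_of_real (sqrt m)"
      using factor by auto
    have p: "complex_of_real (sqrt p) \<in> qspan runity" "\<theta> (complex_of_real (sqrt p)) = w (of_nat p) * complex_of_real (sqrt p)"
      using q[of p] factor by auto
    have e: "complex_of_real (sqrt (real (p * m))) = complex_of_real (sqrt p) * complex_of_real (sqrt m)"
      by (simp add: real_sqrt_mult)
    have "w (of_nat (p * m)) = w (of_nat p) * w (of_nat m)"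
      using mhom_mult[OF mgroup_Qstar w Qn[of p] Qn[of m]] factor prime_gt_0_nat[of p] by simp
    then show ?case
      unfolding e using subfld_mult[OF U p(1) m(1)] embedding_mult[OF U \<theta> p(1) m(1)] m(2) p(2) by simp
  qed simp
  obtain r k where 1: "complex_of_real t = of_int r / of_nat k" "r \<noteq> 0" "k > 0"
      "\<forall>q. Factorial_Ring.prime q \<longrightarrow> q dvd nat \<bar>r\<bar> \<longrightarrow> q \<le> B"
      "\<forall>q. Factorial_Ring.prime q \<longrightarrow> q dvd k \<longrightarrow> q \<le> B"
    using smoothE[OF b(1)] by blast
  have "complex_of_real t = complex_of_real (of_int r / of_nat k)" using 1(1) by simp
  then have t: "t = of_int r / of_nat k" by (simp only: of_real_eq_iff)
  then have "r > 0" using b(2) 1(3) by (simp add: zero_less_divide_iff)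
  define m where "m = nat r"
  have m: "m > 0" "nat \<bar>r\<bar> = m" using \<open>r > 0\<close> by (auto simp: m_def)
  have t': "t = real m / real k" using t \<open>r > 0\<close> by (simp add: m_def)
  have M: "complex_of_real (sqrt m) \<in> qspan runity" "\<theta> (complex_of_real (sqrt m)) = w (of_nat m) * complex_of_real (sqrt m)"
    using nat[of m] m 1(4) by auto
  have K: "complex_of_real (sqrt k) \<in> qspan runity" "\<theta> (complex_of_real (sqrt k)) = w (of_nat k) * complex_of_real (sqrt k)"
    using nat[of k] 1(3,5) by auto
  have e: "complex_of_real (sqrt t) = complex_of_real (sqrt m) / complex_of_real (sqrt k)"
    by (simp add: t' real_sqrt_divide)
  have "complex_of_real t = of_nat m / of_nat k" by (simp add: t')
  then have "w (complex_of_real t) = w (of_nat m) / w (of_nat k)"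
    using mhom_divide[OF mgroup_Qstar w Qn[OF m(1)] Qn[OF 1(3)]] by simp
  then show ?thesis
    unfolding e using subfld_divide[OF U M(1) K(1)] embedding_divide[OF U \<theta> M(1) K(1)] M(2) K(2) by simp
qed

text \<open>Plays at 2 the part of the Gauss sum: its square is \<open>\<i>\<close> and
  \<open>zeta8 + inverse zeta8\<close> is the square root of 2, so one exponent controls
  both.\<close>

definition zeta8 :: complex where "zeta8 = cis (pi / 4)"

lemma zeta8: "zeta8 ^ 2 = \<i>" "zeta8 ^ 8 = 1" "zeta8 + inverse zeta8 = complex_of_real (sqrt 2)"
proof -
  show a: "zeta8 ^ 2 = \<i>" unfolding zeta8_def Complex.DeMoivre by simp
  have "zeta8 ^ 8 = (zeta8 ^ 2) ^ 4" unfolding power_mult[symmetric] by simp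
  then show "zeta8 ^ 8 = 1" unfolding a by simp
  show "zeta8 + inverse zeta8 = complex_of_real (sqrt 2)"
    by (simp add: zeta8_def complex_eq_iff cos_45 sin_45)
qed

text \<open>The four units 1, 3, 5, 7 modulo 8 realise the four pairs of signs on
  \<open>\<i>\<close> and the square root of 2.\<close>

lemma sqrt_two_sign:
  assumes s: "\<epsilon> \<in> {1, -1}" "\<delta> \<in> {1, -1 :: complex}"
  shows "\<exists>u. \<i> ^ u = \<delta> * \<i> \<and> zeta8 ^ u + inverse (zeta8 ^ u) = \<epsilon> * complex_of_real (sqrt 2)"
proof -
  have z0: "zeta8 \<noteq> 0" by (simp add: zeta8_def)
  have z4: "zeta8 ^ 4 = - 1"
  proof -
    have "zeta8 ^ 4 = (zeta8 ^ 2) ^ 2" unfolding power_mult[symmetric] by simp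
    then show ?thesis unfolding zeta8(1) by simp
  qed
  have z3: "zeta8 ^ 3 = - inverse zeta8"
  proof -
    have "zeta8 * zeta8 ^ 3 = - 1" using z4 by (simp add: power_Suc[symmetric] del: power_Suc)
    then show ?thesis using z0 by (simp add: field_simps)
  qed
  have z5: "zeta8 ^ 5 = - zeta8"
  proof -
    have "zeta8 ^ 5 = zeta8 * zeta8 ^ 4" by (simp add: power_Suc[symmetric] del: power_Suc)
    then show ?thesis using z4 by simp
  qed
  have z7: "zeta8 ^ 7 = inverse zeta8"
  proof -
    have "zeta8 ^ 7 = zeta8 ^ 3 * zeta8 ^ 4" unfolding power_add[symmetric] by simp
    then show ?thesis using z4 z3 by simp
  qed
  have i: "\<i> ^ 3 = - \<i>" "\<i> ^ 5 = \<i>" "\<i> ^ 7 = - \<i>" by (simp_all add: eval_nat_numeral)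
  consider "\<epsilon> = 1" "\<delta> = 1" | "\<epsilon> = 1" "\<delta> = - 1" | "\<epsilon> = - 1" "\<delta> = 1" | "\<epsilon> = - 1" "\<delta> = - 1"
    using s by blast
  then show ?thesis
  proof cases
    case 1
    then show ?thesis using zeta8(3) by (intro exI[of _ 1]) simp
  next
    case 2
    then show ?thesis using zeta8(3) i z7 by (intro exI[of _ 7]) (simp add: add.commute)
  next
    case 3
    then show ?thesis using i z5 zeta8(3)[symmetric] by (intro exI[of _ 5]) simp
  next
    case 4
    then show ?thesis using i z3 zeta8(3)[symmetric] by (intro exI[of _ 3]) simp
  qed
qed

section \<open>Characters of \<open>\<Gamma>\<close> modulo powers\<close>

lemma one_powers: "1 \<in> powers p"
  unfolding powers_def by (intro image_eqI[of _ _ 1]) (simp_all add: Qstar_def)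

lemma powers_mult: "x \<in> powers p \<Longrightarrow> y \<in> powers p \<Longrightarrow> x * y \<in> powers p"
proof -
  assume "x \<in> powers p" "y \<in> powers p"
  then obtain c d where "c \<in> Qstar" "d \<in> Qstar" "x = c ^ p" "y = d ^ p" unfolding powers_def by blast
  then show ?thesis unfolding powers_def
    using mgroup_mult[OF mgroup_Qstar] by (intro image_eqI[of _ _ "c * d"]) (auto simp: power_mult_distrib)
qed

lemma powers_inverse: "x \<in> powers p \<Longrightarrow> inverse x \<in> powers p"
proof -
  assume "x \<in> powers p"
  then obtain c where "c \<in> Qstar" "x = c ^ p" unfolding powers_def by blast
  then show ?thesis unfolding powers_def
    using mgroup_inverse[OF mgroup_Qstar] by (intro image_eqI[of _ _ "inverse c"]) (auto simp: power_inverse)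
qed

lemma powers_subset: "powers p \<subseteq> Qstar"
  unfolding powers_def using mgroup_power[OF mgroup_Qstar] by blast

lemma cls_eq: "cls p x = {h * x |h. h \<in> powers p}"
  by (auto simp: cls_def r_coset_def)

lemma cls_mem: "x \<in> cls p x"
  unfolding cls_eq using one_powers by force

lemma cls_eq_iff: "x \<noteq> 0 \<Longrightarrow> cls p x = cls p y \<longleftrightarrow> x / y \<in> powers p \<and> y \<noteq> 0"
proof (intro iffI)
  assume x: "x \<noteq> 0" and e: "cls p x = cls p y"
  then have "x \<in> cls p y" using cls_mem by blast
  then obtain h where "h \<in> powers p" "x = h * y" unfolding cls_eq by blast
  with x show "x / y \<in> powers p \<and> y \<noteq> 0" by auto
next
  assume x: "x \<noteq> 0" and "x / y \<in> powers p \<and> y \<noteq> 0"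
  then have h: "x / y \<in> powers p" "y \<noteq> 0" by auto
  have "\<exists>h'. h * x = h' * y \<and> h' \<in> powers p" if "h \<in> powers p" for h
    using powers_mult[OF that h(1)] h(2) by (intro exI[of _ "h * (x / y)"]) auto
  moreover have "\<exists>h'. h * y = h' * x \<and> h' \<in> powers p" if "h \<in> powers p" for h
    using powers_mult[OF that powers_inverse[OF h(1)]] h(2) x by (intro exI[of _ "h * inverse (x / y)"]) auto
  ultimately show "cls p x = cls p y" unfolding cls_eq by blast
qed

lemma carrier_Gbar: "carrier (Gbar \<Gamma> p) = cls p ` \<Gamma>" by (simp add: Gbar_def)

lemma mult_Gbar: "cls p x \<otimes>\<^bsub>Gbar \<Gamma> p\<^esub> cls p y = cls p (x * y)"
proof -
  have "cls p x \<otimes>\<^bsub>Gbar \<Gamma> p\<^esub> cls p y = {h * k |h k. h \<in> cls p x \<and> k \<in> cls p y}"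
    by (auto simp: Gbar_def FactGroup_def set_mult_def)
  also have "\<dots> = cls p (x * y)"
  proof (intro equalityI subsetI)
    fix u assume "u \<in> {h * k |h k. h \<in> cls p x \<and> k \<in> cls p y}"
    then obtain h k where "u = (h * x) * (k * y)" "h \<in> powers p" "k \<in> powers p" unfolding cls_eq by blast
    then show "u \<in> cls p (x * y)" unfolding cls_eq using powers_mult
      by (intro CollectI exI[of _ "h * k"]) (auto simp: mult_ac)
  next
    fix u assume "u \<in> cls p (x * y)"
    then obtain h where "u = h * x * y" "h \<in> powers p" unfolding cls_eq by (auto simp: mult_ac)
    then show "u \<in> {h * k |h k. h \<in> cls p x \<and> k \<in> cls p y}"
      using cls_mem[of y p] unfolding cls_eq[of p x] by blast
  qed
  finally show ?thesis .
qed

lemma carrier_mu: "carrier (mu k) = {z. z ^ k = 1}" by (simp add: mu_def)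
lemma mult_mu: "x \<otimes>\<^bsub>mu k\<^esub> y = x * y" by (simp add: mu_def)
lemma one_mu: "one (mu k) = 1" by (simp add: mu_def)

lemma hom_Gbar_mhom:
  assumes \<Gamma>: "mgroup \<Gamma>" "\<Gamma> \<subseteq> Qstar" and p: "p \<ge> 1" and \<psi>: "\<psi> \<in> hom (Gbar \<Gamma> p) (mu p)"
  shows "mhom \<Gamma> (\<lambda>x. \<psi> (cls p x))" "\<And>x. x \<in> \<Gamma> \<Longrightarrow> \<psi> (cls p x) ^ p = 1"
    "\<And>x. x \<in> \<Gamma> \<Longrightarrow> x \<in> powers p \<Longrightarrow> \<psi> (cls p x) = 1"
proof -
  show p1: "\<psi> (cls p x) ^ p = 1" if "x \<in> \<Gamma>" for x
    using \<psi> that by (auto simp: hom_def carrier_mu carrier_Gbar)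
  have m: "\<psi> (cls p (x * y)) = \<psi> (cls p x) * \<psi> (cls p y)" if "x \<in> \<Gamma>" "y \<in> \<Gamma>" for x y
  proof -
    have "\<psi> (cls p x \<otimes>\<^bsub>Gbar \<Gamma> p\<^esub> cls p y) = \<psi> (cls p x) * \<psi> (cls p y)"
      using \<psi> that by (simp add: hom_def mult_mu carrier_Gbar)
    then show ?thesis unfolding mult_Gbar .
  qed
  have nz: "\<psi> (cls p x) \<noteq> 0" if "x \<in> \<Gamma>" for x
    using p1[OF that] p by (auto simp: power_0_left)
  then show h: "mhom \<Gamma> (\<lambda>x. \<psi> (cls p x))" unfolding mhom_def using m by blast
  show "\<psi> (cls p x) = 1" if "x \<in> \<Gamma>" "x \<in> powers p" for x
  proof -
    have "cls p x = cls p 1" using that mgroup_nonzero[OF \<Gamma>(1) that(1)] by (subst cls_eq_iff) auto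
    then show ?thesis using mhom_one[OF \<Gamma>(1) h] by simp
  qed
qed

text \<open>The kernel of Gamma onto its image consists of its elements that are \<open>p\<close>-th
  powers in \<open>Qstar\<close>, possibly with a root outside Gamma. As \<open>f\<close> kills
  these, the choice of a representative is immaterial.\<close>

lemma mhom_hom_Gbar:
  assumes \<Gamma>: "mgroup \<Gamma>" "\<Gamma> \<subseteq> Qstar" and f: "mhom \<Gamma> f" "\<And>x. x \<in> \<Gamma> \<Longrightarrow> f x ^ p = 1"
    "\<And>x. x \<in> \<Gamma> \<Longrightarrow> x \<in> powers p \<Longrightarrow> f x = 1"
  shows "\<exists>\<psi>\<in>hom (Gbar \<Gamma> p) (mu p) \<inter> extensional (carrier (Gbar \<Gamma> p)). \<forall>x\<in>\<Gamma>. \<psi> (cls p x) = f x"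
proof -
  define \<psi> where "\<psi> = (\<lambda>C\<in>cls p ` \<Gamma>. f (SOME x. x \<in> \<Gamma> \<and> cls p x = C))"
  have eq: "\<psi> (cls p x) = f x" if x: "x \<in> \<Gamma>" for x
  proof -
    define y where "y = (SOME y. y \<in> \<Gamma> \<and> cls p y = cls p x)"
    have y: "y \<in> \<Gamma> \<and> cls p y = cls p x" unfolding y_def by (rule someI[of _ x]) (simp add: x)
    then have "y / x \<in> powers p" using cls_eq_iff[of y p x] mgroup_nonzero[OF \<Gamma>(1)] by blast
    then have "f (y / x) = 1" using f(3) mgroup_divide[OF \<Gamma>(1)] x y by blast
    then have "f y = f x" using mhom_divide[OF \<Gamma>(1) f(1), of y x] x y mhom_nonzero[OF \<Gamma>(1) f(1) x] by simp
    then show ?thesis using x by (simp add: \<psi>_def y_def)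
  qed
  have "\<psi> \<in> hom (Gbar \<Gamma> p) (mu p)"
  proof (rule homI)
    show "\<psi> C \<in> carrier (mu p)" if "C \<in> carrier (Gbar \<Gamma> p)" for C
      using that eq f(2) by (auto simp: carrier_Gbar carrier_mu)
    fix C D assume "C \<in> carrier (Gbar \<Gamma> p)" "D \<in> carrier (Gbar \<Gamma> p)"
    then obtain x y where xy: "x \<in> \<Gamma>" "y \<in> \<Gamma>" "C = cls p x" "D = cls p y" by (auto simp: carrier_Gbar)
    show "\<psi> (C \<otimes>\<^bsub>Gbar \<Gamma> p\<^esub> D) = \<psi> C \<otimes>\<^bsub>mu p\<^esub> \<psi> D"
      unfolding xy(3,4) mult_Gbar mult_mu eq[OF xy(1)] eq[OF xy(2)] eq[OF mgroup_mult[OF \<Gamma>(1) xy(1,2)]]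
      by (rule mhom_mult[OF \<Gamma>(1) f(1) xy(1,2)])
  qed
  moreover have "\<psi> \<in> extensional (carrier (Gbar \<Gamma> p))" by (simp add: \<psi>_def carrier_Gbar)
  ultimately show ?thesis using eq by blast
qed

context
  fixes n :: nat and a :: "nat \<Rightarrow> complex"
  assumes a: "\<And>i. i \<in> {1..n} \<Longrightarrow> a i \<in> Qstar"
begin

lemma mgroup_Gam: "mgroup (Gam n a)"
  unfolding Gam_def using a by (intro mgroup_generate) (auto simp: Qstar_def)

lemma Gam_subset: "Gam n a \<subseteq> Qstar"
  unfolding Gam_def using a by (intro generate_minimal[OF mgroup_Qstar]) auto

lemma Gam_mem: "i \<in> {1..n} \<Longrightarrow> a i \<in> Gam n a"
  unfolding Gam_def by (rule generate.incl) auto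

lemma mhom_Gam_eq:
  assumes f: "mhom (Gam n a) f" "mhom (Gam n a) g" "\<And>i. i \<in> {1..n} \<Longrightarrow> f (a i) = g (a i)" and x: "x \<in> Gam n a"
  shows "f x = g x"
proof -
  define H where "H = {x \<in> Gam n a. f x = g x}"
  have "mgroup H"
    unfolding mgroup_def H_def
    using mgroup_Gam mhom_mult[OF mgroup_Gam f(1)] mhom_mult[OF mgroup_Gam f(2)]
      mhom_one[OF mgroup_Gam f(1)] mhom_one[OF mgroup_Gam f(2)]
      mhom_inverse[OF mgroup_Gam f(1)] mhom_inverse[OF mgroup_Gam f(2)]
    by (auto simp: mgroup_def)
  moreover have "a ` {1..n} \<subseteq> H" using Gam_mem f(3) by (auto simp: H_def)
  ultimately have "Gam n a \<subseteq> H" unfolding Gam_def by (rule generate_minimal)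
  then show ?thesis using x by (auto simp: H_def)
qed

text \<open>Resolves the definite description in \<open>w2\<close>: the descended \<open>w\<close>
  satisfies it, and the values at the generators leave no other candidate.\<close>

lemma w2_props:
  assumes w: "mhom (Gam n a) w" "\<And>x. x \<in> Gam n a \<Longrightarrow> w x ^ 2 = 1"
    "\<And>x. x \<in> Gam n a \<Longrightarrow> x \<in> powers 2 \<Longrightarrow> w x = 1" "\<And>i. i \<in> {1..n} \<Longrightarrow> w (a i) = - 1" and x: "x \<in> Gam n a"
  shows "w2 n a (cls 2 x) = w x"
proof -
  obtain v where v: "v \<in> hom (Gbar (Gam n a) 2) (mu 2) \<inter> extensional (carrier (Gbar (Gam n a) 2))"
    "\<forall>x\<in>Gam n a. v (cls 2 x) = w x"
    using mhom_hom_Gbar[OF mgroup_Gam Gam_subset w(1-3)] by blast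
  have "w2 n a = v"
    unfolding w2_def
  proof (rule the_equality)
    show "v \<in> hom (Gbar (Gam n a) 2) (mu 2) \<inter> extensional (carrier (Gbar (Gam n a) 2)) \<and>
       (\<forall>i\<in>{1..n}. v (cls 2 (a i)) = - 1)"
      using v(1) by (intro conjI ballI) (simp_all add: v(2) w(4) Gam_mem)
  next
    fix u assume u: "u \<in> hom (Gbar (Gam n a) 2) (mu 2) \<inter> extensional (carrier (Gbar (Gam n a) 2)) \<and>
       (\<forall>i\<in>{1..n}. u (cls 2 (a i)) = - 1)"
    have "u C = v C" if C: "C \<in> carrier (Gbar (Gam n a) 2)" for C
    proof -
      obtain y where y: "y \<in> Gam n a" "C = cls 2 y" using C by (auto simp: carrier_Gbar)
      have "mhom (Gam n a) (\<lambda>x. u (cls 2 x))"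
        using hom_Gbar_mhom(1)[OF mgroup_Gam Gam_subset, of 2 u] u by simp
      then have "u (cls 2 y) = w y"
        using mhom_Gam_eq[OF _ w(1) _ y(1), of "\<lambda>x. u (cls 2 x)"] u w(4) by simp
      then show ?thesis using v(2) y by simp
    qed
    then show "u = v" using u v(1) by (intro extensionalityI[of u "carrier (Gbar (Gam n a) 2)" v]) blast+
  qed
  then show ?thesis using v(2) x by simp
qed

text \<open>The graph of \<open>\<Prod>a\<^sub>i\<^bsup>e(i)\<^esup> c\<^sup>2 \<mapsto> (-1)\<^bsup>\<Sum>e(i)\<^esup>\<close>.\<close>

lemma sign_graph:
  assumes odd: "\<not> (\<exists>I \<subseteq> {1..n}. odd (card I) \<and> (\<exists>y \<in> Qstar. (\<Prod>i\<in>I. a i) = y ^ 2))"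
  shows "\<exists>G. hom_graph Qstar G \<and> (\<forall>i\<in>{1..n}. (a i, - 1) \<in> G) \<and> (\<forall>c\<in>Qstar. (c ^ 2, 1) \<in> G) \<and>
    Domain G = {x * c ^ 2 |x c. x \<in> Gam n a \<and> c \<in> Qstar} \<and> Range G \<subseteq> {1, - 1}"
proof -
  define A where "A e = (\<Prod>i\<in>{1..n}. a i powi e i)" for e :: "nat \<Rightarrow> int"
  define s where "s e = (\<Prod>i\<in>{1..n}. (- 1 :: complex) powi e i)" for e :: "nat \<Rightarrow> int"
  have a0: "a i \<noteq> 0" if "i \<in> {1..n}" for i using a[OF that] by (simp add: Qstar_def)
  have AQ: "A e \<in> Gam n a" for e
    unfolding A_def using Gam_mem by (intro mgroup_prod[OF mgroup_Gam] mgroup_power_int[OF mgroup_Gam])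
  have AQ': "A e \<in> Qstar" for e using AQ Gam_subset by blast
  have Aadd: "A e * A e' = A (\<lambda>i. e i + e' i)" for e e'
    unfolding A_def prod.distrib[symmetric] using a0 by (intro prod.cong) (auto simp: power_int_add)
  have sadd: "s e * s e' = s (\<lambda>i. e i + e' i)" for e e'
    unfolding s_def prod.distrib[symmetric] by (intro prod.cong) (auto simp: power_int_add)
  have Aminus: "inverse (A e) = A (\<lambda>i. - e i)" for e
    unfolding A_def by (simp add: power_int_minus prod_inversef[symmetric])
  have sminus: "inverse (s e) = s (\<lambda>i. - e i)" for e
    unfolding s_def by (simp add: power_int_minus prod_inversef[symmetric])
  have spm: "s e \<in> {1, - 1}" for e
  proof -
    have "s e * s e = s (\<lambda>i. 2 * e i)" unfolding sadd mult_2 ..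
    also have "\<dots> = 1" unfolding s_def power_int_mult by simp
    finally show ?thesis by (simp add: square_eq_1_iff)
  qed
  \<comment> \<open>Here the hypothesis on odd subsets enters. Modulo squares only the
    \<open>a i\<close> with odd exponent survive, so their product is a square, their number is
    even, and the sign is 1.\<close>
  have kernel: "s e = 1" if e: "A e * c ^ 2 = 1" and c: "c \<in> Qstar" for e c
  proof -
    define I where "I = {i \<in> {1..n}. odd (e i)}"
    have I: "I \<subseteq> {1..n}" "finite I" by (auto simp: I_def)
    have split: "a i powi e i = (if odd (e i) then a i else 1) * (a i powi (e i div 2)) ^ 2" if "i \<in> {1..n}" for i
    proof -
      have "e i = e i mod 2 + (e i div 2) * 2" by simp
      then have "a i powi e i = a i powi (e i mod 2) * (a i powi (e i div 2)) powi 2"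
        using a0[OF that] power_int_add[of "a i" "e i mod 2" "(e i div 2) * 2"]
        power_int_mult[of "a i" "e i div 2" 2] by simp
      moreover have "e i mod 2 = (if odd (e i) then 1 else 0)" by presburger
      ultimately show ?thesis by simp
    qed
    have "A e = (\<Prod>i\<in>{1..n}. (if odd (e i) then a i else 1) * (a i powi (e i div 2)) ^ 2)"
      unfolding A_def using split by (intro prod.cong) auto
    also have "\<dots> = (\<Prod>i\<in>{1..n}. if odd (e i) then a i else 1) * A (\<lambda>i. e i div 2) ^ 2"
      by (simp add: prod.distrib A_def prod_power_distrib)
    also have "(\<Prod>i\<in>{1..n}. if odd (e i) then a i else 1) = (\<Prod>i\<in>I. a i)"
      unfolding I_def by (rule prod.inter_filter[symmetric]) simp
    finally have eq: "A e = (\<Prod>i\<in>I. a i) * A (\<lambda>i. e i div 2) ^ 2" .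
    define d where "d = inverse (A (\<lambda>i. e i div 2) * c)"
    have d: "d \<in> Qstar" unfolding d_def using AQ' c mgroup_mult[OF mgroup_Qstar] mgroup_inverse[OF mgroup_Qstar] by blast
    have "(\<Prod>i\<in>I. a i) * (A (\<lambda>i. e i div 2) * c) ^ 2 = 1" using e eq by (simp add: power_mult_distrib mult_ac)
    then have "(\<Prod>i\<in>I. a i) = inverse ((A (\<lambda>i. e i div 2) * c) ^ 2)" using inverse_unique[of "(A (\<lambda>i. e i div 2) * c) ^ 2"] by (simp add: mult.commute)
    then have "(\<Prod>i\<in>I. a i) = d ^ 2" by (simp only: d_def power_inverse)
    then have ev: "even (card I)" using odd I(1) d by blast
    have "s e = (\<Prod>i\<in>{1..n}. if odd (e i) then - 1 else 1)"
      unfolding s_def by (intro prod.cong) (auto simp: power_int_minus_left)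
    also have "\<dots> = (\<Prod>i\<in>I. - 1)" unfolding I_def by (rule prod.inter_filter[symmetric]) simp
    also have "\<dots> = 1" using ev by simp
    finally show ?thesis .
  qed
  define G where "G = {(A e * c ^ 2, s e) |e c. c \<in> Qstar}"
  have GI: "(A e * c ^ 2, s e) \<in> G" if "c \<in> Qstar" for e c using that by (auto simp: G_def)
  have one: "1 \<in> Qstar" by (simp add: Qstar_def)
  have A0: "A (\<lambda>_. 0) = 1" "s (\<lambda>_. 0) = 1" by (simp_all add: A_def s_def)
  have "hom_graph Qstar G"
    unfolding hom_graph_def
  proof (intro conjI ballI allI impI)
    show "G \<subseteq> Qstar \<times> - {0}"
    proof
      fix q assume "q \<in> G"
      then obtain e c where q: "q = (A e * c ^ 2, s e)" "c \<in> Qstar" unfolding G_def by blast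
      have "A e * c ^ 2 \<in> Qstar" using AQ' q(2) by (intro mgroup_mult[OF mgroup_Qstar] mgroup_power[OF mgroup_Qstar])
      then show "q \<in> Qstar \<times> - {0}" using q(1) spm[of e] by auto
    qed
    show "(1, 1) \<in> G" using GI[OF one, of "\<lambda>_. 0"] A0 by simp
    show "(fst x * fst y, snd x * snd y) \<in> G" if xy: "x \<in> G" "y \<in> G" for x y
    proof -
      obtain e c where x: "x = (A e * c ^ 2, s e)" "c \<in> Qstar" using xy(1) unfolding G_def by blast
      obtain e' c' where y: "y = (A e' * c' ^ 2, s e')" "c' \<in> Qstar" using xy(2) unfolding G_def by blast
      have "fst x * fst y = A (\<lambda>i. e i + e' i) * (c * c') ^ 2" "snd x * snd y = s (\<lambda>i. e i + e' i)"
        unfolding x y Aadd[symmetric] sadd[symmetric] by (simp_all add: power_mult_distrib mult_ac)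
      then show ?thesis using GI[OF mgroup_mult[OF mgroup_Qstar x(2) y(2)]] by simp
    qed
    show "(inverse (fst x), inverse (snd x)) \<in> G" if x: "x \<in> G" for x
    proof -
      obtain e c where x: "x = (A e * c ^ 2, s e)" "c \<in> Qstar" using x unfolding G_def by blast
      have "inverse (fst x) = A (\<lambda>i. - e i) * inverse c ^ 2" "inverse (snd x) = s (\<lambda>i. - e i)"
        unfolding x Aminus[symmetric] sminus[symmetric] by (simp_all add: power_inverse)
      then show ?thesis using GI[OF mgroup_inverse[OF mgroup_Qstar x(2)]] by simp
    qed
    show "y = 1" if y: "(1, y) \<in> G" for y
    proof -
      obtain e c where "1 = A e * c ^ 2" "y = s e" "c \<in> Qstar" using y unfolding G_def by blast
      then show ?thesis using kernel[of e c] by simp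
    qed
  qed
  moreover have "(a i, - 1) \<in> G" if i: "i \<in> {1..n}" for i
  proof -
    define e where "e j = (if j = i then 1 else 0 :: int)" for j
    have "A e = (\<Prod>j\<in>{1..n}. if j = i then a i else 1)" unfolding A_def e_def by (intro prod.cong) auto
    then have "A e = a i" using i by (simp add: prod.delta)
    moreover have "s e = (\<Prod>j\<in>{1..n}. if j = i then - 1 else 1)" unfolding s_def e_def by (intro prod.cong) auto
    then have "s e = - 1" using i by (simp add: prod.delta)
    ultimately show ?thesis using GI[OF one, of e] by simp
  qed
  moreover have "(c ^ 2, 1) \<in> G" if "c \<in> Qstar" for c using GI[OF that, of "\<lambda>_. 0"] A0 by simp
  moreover have "Domain G = {x * c ^ 2 |x c. x \<in> Gam n a \<and> c \<in> Qstar}"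
  proof (intro equalityI subsetI)
    fix x assume "x \<in> Domain G"
    then obtain y where "(x, y) \<in> G" by blast
    then obtain e c where "x = A e * c ^ 2" "c \<in> Qstar" unfolding G_def by blast
    then show "x \<in> {x * c ^ 2 |x c. x \<in> Gam n a \<and> c \<in> Qstar}" using AQ by blast
  next
    fix x assume "x \<in> {x * c ^ 2 |x c. x \<in> Gam n a \<and> c \<in> Qstar}"
    then obtain g c where x: "x = g * c ^ 2" "g \<in> Gam n a" "c \<in> Qstar" by blast
    have m: "mgroup (Domain G)" by (rule mgroup_Domain[OF mgroup_Qstar calculation(1)])
    have "a ` {1..n} \<subseteq> Domain G" using calculation(2) by blast
    then have "Gam n a \<subseteq> Domain G" unfolding Gam_def by (rule generate_minimal[OF m])
    moreover have "c ^ 2 \<in> Domain G" using \<open>\<And>c. c \<in> Qstar \<Longrightarrow> (c ^ 2, 1) \<in> G\<close> x(3) by blast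
    ultimately show "x \<in> Domain G" unfolding x(1) using x(2) mgroup_mult[OF m] by blast
  qed
  moreover have "Range G \<subseteq> {1, - 1}" using spm unfolding G_def by auto
  ultimately show ?thesis by blast
qed

end

section \<open>Local automorphisms\<close>

lemma power_int_two_mult_add_one:
  assumes "(t::complex) \<noteq> 0" shows "t powi (2 * j + 1) = (t powi j) ^ 2 * t"
proof -
  have "t powi (2 * j) = (t powi j) powi 2" using power_int_mult[of t j 2] by (simp add: mult.commute)
  then show ?thesis using assms by (simp add: power_int_add)
qed

context
  fixes n :: nat and a :: "nat \<Rightarrow> complex"
  assumes a: "\<And>i. i \<in> {1..n} \<Longrightarrow> a i \<in> Qstar"
begin

text \<open>The signs at the \<open>a i\<close> determine \<open>w\<close> on Gamma times squares.
  Either -3 lies there, and failure of (a) says that its sign is -1, or it is independent, and the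
  value -1 is prescribed before extending to all of \<open>Qstar\<close>.\<close>

lemma sign_character_exists:
  assumes odd: "\<not> (\<exists>I \<subseteq> {1..n}. odd (card I) \<and> (\<exists>y \<in> Qstar. (\<Prod>i\<in>I. a i) = y ^ 2))"
  shows "\<exists>w. mhom Qstar w \<and> (\<forall>x\<in>Qstar. w x = 1 \<or> w x = - 1) \<and> (\<forall>i\<in>{1..n}. w (a i) = - 1) \<and>
    (cls 2 (-3) \<notin> kernel (Gbar (Gam n a) 2) (mu 2) (w2 n a) \<longrightarrow> w (-3) = - 1)"
proof -
  obtain G where G: "hom_graph Qstar G" "\<forall>i\<in>{1..n}. (a i, - 1) \<in> G" "\<forall>c\<in>Qstar. (c ^ 2, 1) \<in> G"
    "Domain G = {x * c ^ 2 |x c. x \<in> Gam n a \<and> c \<in> Qstar}"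
    using sign_graph[OF a odd] by blast
  have m3: "-3 \<in> Qstar" by (simp add: Qstar_def)
  have "\<exists>G'. hom_graph Qstar G' \<and> G \<subseteq> G' \<and> (-3 \<notin> Domain G \<longrightarrow> (-3, - 1) \<in> G')"
  proof (cases "-3 \<in> Domain G")
    case False
    have m: "mgroup (Domain G)" by (rule mgroup_Domain[OF mgroup_Qstar G(1)])
    have sq: "c ^ 2 \<in> Domain G" if "c \<in> Qstar" for c using G(3) that by blast
    have dvd2: "int 2 dvd k" if k: "(-3 :: complex) powi k \<in> Domain G" for k :: int
    proof (rule ccontr)
      assume "\<not> int 2 dvd k"
      then obtain j where j: "k = 2 * j + 1" by (auto elim: oddE)
      have "(-3 :: complex) powi k = ((-3) powi j) ^ 2 * (-3)"
        unfolding j by (rule power_int_two_mult_add_one) simp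
      moreover have "((-3 :: complex) powi j) ^ 2 \<noteq> 0"
        using mgroup_nonzero[OF mgroup_Qstar mgroup_power_int[OF mgroup_Qstar m3]] by (intro power_not_zero)
      ultimately have "-3 = (-3 :: complex) powi k / ((-3) powi j) ^ 2" by (metis nonzero_mult_div_cancel_left)
      also have "\<dots> \<in> Domain G"
        using k sq[OF mgroup_power_int[OF mgroup_Qstar m3]] by (rule mgroup_divide[OF m])
      finally show False using False by simp
    qed
    have "((-3 :: complex) ^ 2, 1) \<in> G" using G(3) m3 by blast
    then have mem2: "((-3 :: complex) ^ 2, (- 1) ^ 2) \<in> G" by simp
    have "\<exists>G'. hom_graph Qstar G' \<and> G \<subseteq> G' \<and> (-3, - 1) \<in> G'"
      by (rule hom_graph_step[OF mgroup_Qstar G(1) m3 _ dvd2 mem2]) simp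
    then show ?thesis by blast
  qed (use G(1) in blast)
  then obtain G1 where G1: "hom_graph Qstar G1" "G \<subseteq> G1" "-3 \<notin> Domain G \<longrightarrow> (-3, - 1) \<in> G1" by blast
  obtain G2 where G2: "hom_graph Qstar G2" "G1 \<subseteq> G2" "Domain G2 = Qstar"
    using hom_graph_extend[OF mgroup_Qstar G1(1)] by blast
  obtain w where w: "mhom Qstar w" "\<forall>p\<in>G2. w (fst p) = snd p"
    using mhom_of_hom_graph[OF mgroup_Qstar G2(1,3)] by blast
  have wG: "w x = y" if "(x, y) \<in> G1" for x y using w(2) G2(2) that by fastforce
  have wa: "w (a i) = - 1" if "i \<in> {1..n}" for i using wG G1(2) G(2) that by blast
  have wsq: "w (c ^ 2) = 1" if "c \<in> Qstar" for c using wG G1(2) G(3) that by blast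
  have w2: "w x ^ 2 = 1" if "x \<in> Qstar" for x using wsq[OF that] mhom_power[OF mgroup_Qstar w(1) that, of 2] by simp
  then have pm: "w x = 1 \<or> w x = - 1" if "x \<in> Qstar" for x using that by (simp add: power2_eq_1_iff)
  have "w (-3) = - 1" if nk: "cls 2 (-3) \<notin> kernel (Gbar (Gam n a) 2) (mu 2) (w2 n a)"
  proof (cases "-3 \<in> Domain G")
    case False
    then show ?thesis using G1(3) wG by blast
  next
    case True
    then obtain x c where x: "-3 = x * c ^ 2" "x \<in> Gam n a" "c \<in> Qstar" using G(4) by blast
    have sub: "Gam n a \<subseteq> Qstar" by (rule Gam_subset[OF a])
    have xQ: "x \<in> Qstar" using x(2) sub by blast
    have wx: "w (-3) = w x"
      using mhom_mult[OF mgroup_Qstar w(1) xQ mgroup_power[OF mgroup_Qstar x(3)], of 2] wsq[OF x(3)] x(1) by simp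
    have "-3 / x = c ^ 2" unfolding x(1) using mgroup_nonzero[OF mgroup_Qstar xQ] by simp
    then have "-3 / x \<in> powers 2" using x(3) by (auto simp: powers_def)
    then have cls: "cls 2 (-3) = cls 2 x"
      using cls_eq_iff[of "-3" 2 x] mgroup_nonzero[OF mgroup_Qstar xQ] by simp
    have wp: "w y = 1" if "y \<in> powers 2" for y using that wsq by (auto simp: powers_def)
    have "w2 n a (cls 2 x) = w x"
      by (rule w2_props[OF a mhom_mono[OF w(1) sub] _ _ wa x(2)]) (use w2 sub wp in auto)
    then have "w x \<noteq> 1" using nk x(2) unfolding cls by (auto simp: kernel_def carrier_Gbar one_mu)
    then show ?thesis using pm[OF xQ] wx by simp
  qed
  then show ?thesis using w(1) pm wa by blast
qed

end

lemma rational_odd_root_of_unity: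
  assumes "z \<in> Qstar" "z ^ p = 1" "odd p" shows "z = 1"
proof -
  have "z \<in> \<real>" using assms(1) cnj_Rats[of z] by (simp add: Qstar_def Reals_cnj_iff)
  then obtain r where r: "z = complex_of_real r" by (elim Reals_cases)
  have "r ^ p = 1" using assms(2) unfolding r by (metis of_real_eq_1_iff of_real_power)
  then have "r = root p 1" using assms(3) odd_real_root_unique by metis
  then show ?thesis using r assms(3) by (simp add: odd_pos)
qed

context
  fixes \<Gamma> :: "complex set" and p :: nat
  assumes \<Gamma>: "mgroup \<Gamma>" "\<Gamma> \<subseteq> Qstar" and p: "Factorial_Ring.prime p"
begin

lemma prime_root_mem: "z ^ p = 1 \<Longrightarrow> z \<in> rad_pinf p \<Gamma>"
  using mgroup_one[OF \<Gamma>(1)] prime_gt_0_nat[OF p] by (intro rad_pinfI[of z 1]) (auto simp: power_0_left)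

text \<open>Automorphisms in \<open>A\<^sub>p\<close> correspond to the characters \<open>\<eta>(x) = \<sigma>(x)/x\<close> that are trivial on the
  rational elements and do not send any \<open>\<zeta>\<close> of order \<open>p\<close> to its inverse.\<close>

lemma AutQ_of_character:
  assumes \<eta>: "mhom (rad_pinf p \<Gamma>) \<eta>" "\<And>x. x \<in> rad_pinf p \<Gamma> \<Longrightarrow> x \<in> Qstar \<Longrightarrow> \<eta> x = 1"
    and inj: "\<And>z. z ^ p = 1 \<Longrightarrow> z \<noteq> 1 \<Longrightarrow> z * \<eta> z \<noteq> 1"
  shows "(\<lambda>x\<in>rad_pinf p \<Gamma>. x * \<eta> x) \<in> carrier (AutQ (rad_pinf p \<Gamma>))"
proof (rule AutQ_I)
  define M where "M = rad_pinf p \<Gamma>"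
  have p1: "p \<ge> 1" using prime_gt_0_nat[OF p] by simp
  show M: "radical_group (rad_pinf p \<Gamma>)" by (rule radical_group_rad_pinf[OF \<Gamma> p1])
  note m = radical_group_mgroup[OF M, folded M_def]
  define \<sigma> where "\<sigma> = (\<lambda>x\<in>M. x * \<eta> x)"
  have \<sigma>: "mhom M \<sigma>"
    unfolding mhom_def \<sigma>_def using mgroup_mult[OF m] mgroup_nonzero[OF m]
      mhom_nonzero[OF m \<eta>(1)[folded M_def]] mhom_mult[OF m \<eta>(1)[folded M_def]] by auto
  then show "mhom (rad_pinf p \<Gamma>) (\<lambda>x\<in>rad_pinf p \<Gamma>. x * \<eta> x)" by (simp add: \<sigma>_def M_def)
  show "(\<lambda>x\<in>rad_pinf p \<Gamma>. x * \<eta> x) x = x" if "x \<in> rad_pinf p \<Gamma>" "x \<in> Qstar" for x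
    using that \<eta>(2) by simp
  show "x = 1" if xM: "x \<in> rad_pinf p \<Gamma>" and x1: "(\<lambda>x\<in>rad_pinf p \<Gamma>. x * \<eta> x) x = 1" for x
  proof (rule ccontr)
    assume "x \<noteq> 1"
    have xM': "x \<in> M" and \<sigma>x: "\<sigma> x = 1" using xM x1 by (simp_all add: M_def \<sigma>_def)
    obtain k where k: "x ^ (p ^ k) \<in> \<Gamma>" using xM unfolding rad_pinf_iff by blast
    have "\<sigma> (x ^ (p ^ k)) = x ^ (p ^ k)"
      using \<eta>(2) k \<Gamma>(2) mgroup_power[OF m xM'] by (auto simp: \<sigma>_def M_def)
    then have ex: "x ^ (p ^ k) = 1" using mhom_power[OF m \<sigma> xM', of "p ^ k"] \<sigma>x by simp
    \<comment> \<open>An element sent to 1 is torsion of \<open>p\<close>-power order, because its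
      power in Gamma is fixed; its last nontrivial \<open>p\<close>-power is a root of unity
      \<open>z\<close> of order \<open>p\<close>.\<close>
    define l where "l = (LEAST k. x ^ (p ^ k) = 1)"
    have l: "x ^ (p ^ l) = 1" unfolding l_def by (rule LeastI[of _ k]) (rule ex)
    have "l \<noteq> 0" using l \<open>x \<noteq> 1\<close> by (cases l) auto
    then obtain j where j: "l = Suc j" by (cases l) auto
    define z where "z = x ^ (p ^ j)"
    have "z \<noteq> 1"
    proof
      assume "z = 1"
      then have "l \<le> j" unfolding l_def z_def by (rule Least_le)
      then show False using j by simp
    qed
    moreover have "z ^ p = 1" using l by (simp add: z_def j power_mult[symmetric] mult.commute)
    moreover have "\<sigma> z = 1" using mhom_power[OF m \<sigma> xM', of "p ^ j"] \<sigma>x by (simp add: z_def)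
    then have "z * \<eta> z = 1" using mgroup_power[OF m xM', of "p ^ j"] by (simp add: \<sigma>_def z_def)
    ultimately show False using inj by blast
  qed
qed simp

lemma prime_root_generates:
  assumes "z ^ p = 1" "z \<noteq> 1" "y ^ p = 1" shows "\<exists>j. y = (z::complex) ^ j"
proof -
  have p1: "p \<ge> 1" using prime_gt_0_nat[OF p] by simp
  obtain g :: complex where g: "g ^ p = 1" "\<forall>x. x ^ p = 1 \<longrightarrow> (\<exists>k<p. x = g ^ k)"
    using primitive_root_of_unity[OF p1] by blast
  obtain k l where kl: "z = g ^ k" "y = g ^ l" using g(2) assms by blast
  have "\<not> p dvd k"
  proof
    assume "p dvd k"
    then obtain j where "k = p * j" by (rule dvdE)
    then show False using kl(1) g(1) assms(2) by (simp add: power_mult)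
  qed
  then have "coprime k p" using prime_imp_coprime[OF p] by (simp add: coprime_commute)
  then obtain v where v: "[k * v = Suc 0] (mod p)" using cong_solve_coprime_nat by blast
  have "[k * v * l = Suc 0 * l] (mod p)" by (rule cong_scalar_right[OF v])
  then have "g ^ (k * v * l) = g ^ (Suc 0 * l)" by (rule power_mod_root[OF g(1)])
  then have "z ^ (v * l) = y" unfolding kl by (simp add: power_mult[symmetric] mult.assoc)
  then show ?thesis by metis
qed

context
  fixes z u
  assumes z: "(z::complex) ^ p = 1" "z \<noteq> 1" and u: "\<not> p dvd u"
begin

lemma inj_of_prime_root:
  assumes \<eta>: "mhom (rad_pinf p \<Gamma>) \<eta>" "\<eta> z = z ^ u / z" and y: "y ^ p = 1" "y \<noteq> 1"
  shows "y * \<eta> y \<noteq> 1"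
proof -
  have m: "mgroup (rad_pinf p \<Gamma>)" by (rule mgroup_rad_pinf[OF \<Gamma>(1)])
  have z0: "z \<noteq> 0" using z prime_gt_0_nat[OF p] by (auto simp: power_0_left)
  obtain j where j: "y = z ^ j" using prime_root_generates[OF z y(1)] by blast
  have "\<eta> y = (z ^ u / z) ^ j" using mhom_power[OF m \<eta>(1) prime_root_mem[OF z(1)], of j] \<eta>(2) j by simp
  then have e: "y * \<eta> y = z ^ (u * j)" using z0 j by (simp add: power_divide power_mult)
  have "\<not> p dvd j" using y(2) j prime_root_eq_one_iff[OF p z] by blast
  then have "\<not> p dvd u * j" using u p by (simp add: prime_dvd_mult_iff)
  then show ?thesis unfolding e using prime_root_eq_one_iff[OF p z] by blast
qed

text \<open>For odd \<open>p\<close> no nontrivial \<open>p\<close>-th root of unity is rational, so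
  triviality on rational elements leaves \<open>\<eta> z\<close> free among them. At 2 this fails
  for -1, whence the separate construction in \<open>local_two\<close>.\<close>

lemma local_cyclotomic_character:
  assumes "odd p"
  shows "\<exists>\<eta>. mhom (rad_pinf p \<Gamma>) \<eta> \<and> (\<forall>x \<in> rad_pinf p \<Gamma> \<inter> Qstar. \<eta> x = 1) \<and> \<eta> z = z ^ u / z"
proof -
  define M where "M = rad_pinf p \<Gamma>"
  have m: "mgroup M" unfolding M_def by (rule mgroup_rad_pinf[OF \<Gamma>(1)])
  have H: "mgroup (M \<inter> Qstar)" using m mgroup_Qstar by (auto simp: mgroup_def)
  have "mhom (M \<inter> Qstar) (\<lambda>_. 1)" by (simp add: mhom_def)
  moreover have "z \<in> M" unfolding M_def by (rule prime_root_mem[OF z(1)])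
  moreover have "z \<notin> M \<inter> Qstar" using rational_odd_root_of_unity z assms by blast
  moreover have "z ^ p \<in> M \<inter> Qstar" using z(1) mgroup_one[OF H] by simp
  moreover have "(z ^ u / z) ^ p = 1"
  proof -
    have "(z ^ u) ^ p = (z ^ p) ^ u" by (simp add: power_mult[symmetric] mult.commute)
    then show ?thesis using z(1) by (simp add: power_divide)
  qed
  ultimately show ?thesis
    unfolding M_def[symmetric] using mhom_extend_prime[OF H m _ _ p, of "\<lambda>_. 1" z "z ^ u / z"] by blast
qed

lemma local_cyclotomic:
  assumes "odd p"
  shows "\<exists>\<sigma>\<in>carrier (AutQ (rad_pinf p \<Gamma>)). \<sigma> z = z ^ u"
proof -
  obtain \<eta> where \<eta>: "mhom (rad_pinf p \<Gamma>) \<eta>" "\<forall>x \<in> rad_pinf p \<Gamma> \<inter> Qstar. \<eta> x = 1" "\<eta> z = z ^ u / z"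
    using local_cyclotomic_character[OF assms] by blast
  have "(\<lambda>x\<in>rad_pinf p \<Gamma>. x * \<eta> x) \<in> carrier (AutQ (rad_pinf p \<Gamma>))"
    by (rule AutQ_of_character[OF \<eta>(1)]) (use \<eta>(2) inj_of_prime_root[OF \<eta>(1,3)] in auto)
  moreover have "z * \<eta> z = z ^ u"
    using \<eta>(3) z prime_gt_0_nat[OF p] by (cases "z = 0") (auto simp: power_0_left)
  ultimately show ?thesis using prime_root_mem[OF z(1)] by (intro bexI) auto
qed

text \<open>If \<open>x\<close> were a rational number times a power of \<open>z\<close>, its
  \<open>p\<close>-th power would be a rational \<open>p\<close>-th power. So
  \<open>\<eta> x\<close> can be chosen independently of \<open>\<eta> z\<close>; the resulting
  \<open>p * (p - 1)\<close> choices give the measure bound in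
  \<open>haar_Kummer_stabilizer\<close>.\<close>

lemma local_kummer:
  assumes "odd p" and x: "x ^ p \<in> \<Gamma>" "x ^ p \<notin> powers p"
  shows "\<exists>\<sigma>\<in>carrier (AutQ (rad_pinf p \<Gamma>)). \<sigma> z = z ^ u \<and> \<sigma> x = z ^ k * x"
proof -
  define M where "M = rad_pinf p \<Gamma>"
  have m: "mgroup M" unfolding M_def by (rule mgroup_rad_pinf[OF \<Gamma>(1)])
  have z0: "z \<noteq> 0" using z prime_gt_0_nat[OF p] by (auto simp: power_0_left)
  have zM: "z \<in> M" unfolding M_def by (rule prime_root_mem[OF z(1)])
  have x0: "x \<noteq> 0" using mgroup_nonzero[OF \<Gamma>(1) x(1)] prime_gt_0_nat[OF p] by (auto simp: power_0_left)
  have xM: "x \<in> M" unfolding M_def using x(1) x0 by (intro rad_pinfI[of x 1]) auto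
  have H: "mgroup (M \<inter> Qstar)" using m mgroup_Qstar by (auto simp: mgroup_def)
  obtain \<eta> where \<eta>: "mhom M \<eta>" "\<forall>x \<in> M \<inter> Qstar. \<eta> x = 1" "\<eta> z = z ^ u / z"
    using local_cyclotomic_character[OF assms(1)] unfolding M_def by blast
  define J where "J = mjoin (M \<inter> Qstar) z"
  have J: "mgroup J" unfolding J_def by (rule mgroup_mjoin[OF H z0])
  have JM: "J \<subseteq> M" unfolding J_def by (rule mjoin_subset[OF m _ zM]) blast
  have zkp: "(z powi j) ^ p = 1" for j
  proof -
    have "(z powi j) ^ p = (z ^ p) powi j" by (simp add: power_int_mult[symmetric] mult.commute flip: power_int_of_nat)
    then show ?thesis using z(1) by simp
  qed
  have xJ: "x \<notin> J"
  proof
    assume "x \<in> J"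
    then obtain h j where "x = h * z powi j" "h \<in> Qstar" unfolding J_def mjoin_def by blast
    then have "x ^ p = h ^ p" using zkp by (simp add: power_mult_distrib)
    then show False using x(2) \<open>h \<in> Qstar\<close> by (auto simp: powers_def)
  qed
  have xp: "x ^ p \<in> M \<inter> Qstar" using x(1) \<Gamma>(2) rad_pinf_superset[OF \<Gamma>(1)] unfolding M_def by blast
  then have xpJ: "x ^ p \<in> J" using mjoin_superset unfolding J_def by blast
  have "(z ^ k) ^ p = \<eta> (x ^ p)"
    using \<eta>(2) xp zkp[of "int k"] by simp
  then obtain F where F: "mhom M F" "\<forall>h\<in>J. F h = \<eta> h" "F x = z ^ k"
    using mhom_extend_prime[OF J m JM mhom_mono[OF \<eta>(1) JM] p xM xJ xpJ] by blast
  have Fz: "F z = z ^ u / z" using F(2) mjoin_mem[OF H, of z] \<eta>(3) by (simp add: J_def)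
  have FQ: "F y = 1" if "y \<in> M" "y \<in> Qstar" for y
    using F(2) mjoin_superset[of "M \<inter> Qstar" z] \<eta>(2) that by (auto simp: J_def)
  have "(\<lambda>x\<in>M. x * F x) \<in> carrier (AutQ M)"
    using AutQ_of_character[OF F(1)[unfolded M_def]] FQ inj_of_prime_root[OF F(1)[unfolded M_def] Fz]
    unfolding M_def by blast
  moreover have "z * F z = z ^ u" using Fz z0 by simp
  ultimately show ?thesis unfolding M_def[symmetric] using zM xM F(3) by (intro bexI) (auto simp: mult.commute)
qed

end
end

text \<open>The values are forced on the subgroup \<open>H\<close> of elements with rational square,
  which contains \<open>\<i>\<close> but not \<open>zeta8\<close>. The value of
  \<open>\<eta>\<close> at \<open>zeta8\<close> must then square to \<open>w (- 1)\<close>, and this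
  is the condition on \<open>u\<close>. Rational \<open>x\<close> stay fixed because
  \<open>w (x ^ 2) = 1\<close>.\<close>

lemma local_two:
  assumes \<Gamma>: "mgroup \<Gamma>" "\<Gamma> \<subseteq> Qstar" and w: "mhom Qstar w" "\<And>x. x \<in> Qstar \<Longrightarrow> w x = 1 \<or> w x = - 1"
    and u: "\<i> ^ u = w (- 1) * \<i>"
  shows "\<exists>\<sigma>\<in>carrier (AutQ (rad_pinf 2 \<Gamma>)). \<sigma> zeta8 = zeta8 ^ u \<and> (\<forall>x\<in>rad_pinf 2 \<Gamma>. x ^ 2 \<in> Qstar \<longrightarrow> \<sigma> x = w (x ^ 2) * x)"
proof -
  define M where "M = rad_pinf 2 \<Gamma>"
  have m: "mgroup M" unfolding M_def by (rule mgroup_rad_pinf[OF \<Gamma>(1)])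
  have z0: "zeta8 \<noteq> 0" by (simp add: zeta8_def)
  have zM: "zeta8 \<in> M" unfolding M_def using z0 mgroup_one[OF \<Gamma>(1)] zeta8(2)
    by (intro rad_pinfI[of zeta8 3]) auto
  define H where "H = {x \<in> M. x ^ 2 \<in> Qstar}"
  have H: "mgroup H"
    unfolding H_def using m mgroup_Qstar by (auto simp: mgroup_def power_mult_distrib power_inverse)
  have HM: "H \<subseteq> M" by (auto simp: H_def)
  have f: "mhom H (\<lambda>x. w (x ^ 2))"
    unfolding mhom_def H_def using mhom_nonzero[OF mgroup_Qstar w(1)] mhom_mult[OF mgroup_Qstar w(1)]
    by (auto simp: power_mult_distrib)
  have zsq: "zeta8 ^ 2 = \<i>" by (rule zeta8(1))
  have iH: "\<i> \<in> H"
    unfolding H_def using mgroup_power[OF m zM, of 2] zsq by (auto simp: Qstar_def)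
  have "\<i> \<notin> Qstar"
  proof
    assume "\<i> \<in> Qstar"
    then have "cnj \<i> = \<i>" by (intro cnj_Rats) (simp add: Qstar_def)
    then show False by simp
  qed
  then have zH: "zeta8 \<notin> H" using zsq by (simp add: H_def)
  have "(zeta8 ^ u / zeta8) ^ 2 = w ((zeta8 ^ 2) ^ 2)"
  proof -
    have "(zeta8 ^ u) ^ 2 = (zeta8 ^ 2) ^ u" by (simp add: power_mult[symmetric] mult.commute)
    then have "(zeta8 ^ u / zeta8) ^ 2 = w (- 1) * \<i> / \<i>" using u zsq by (simp only: power_divide)
    also have "\<dots> = w (- 1)" by (rule nonzero_mult_div_cancel_right) simp
    finally have "(zeta8 ^ u / zeta8) ^ 2 = w (- 1)" .
    moreover have "(zeta8 ^ 2) ^ 2 = - 1" unfolding zsq by simp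
    ultimately show ?thesis by simp
  qed
  have "zeta8 ^ 2 \<in> H" unfolding zsq by (rule iH)
  from mhom_extend_prime[OF H m HM f two_is_prime_nat zM zH this \<open>(zeta8 ^ u / zeta8) ^ 2 = w ((zeta8 ^ 2) ^ 2)\<close>]
  obtain \<eta> where \<eta>: "mhom M \<eta>" "\<forall>x\<in>H. \<eta> x = w (x ^ 2)" "\<eta> zeta8 = zeta8 ^ u / zeta8"
    by blast
  have "(\<lambda>x\<in>M. x * \<eta> x) \<in> carrier (AutQ M)"
    unfolding M_def
  proof (rule AutQ_of_character[OF \<Gamma> two_is_prime_nat \<eta>(1)[unfolded M_def]])
    show "\<eta> x = 1" if "x \<in> rad_pinf 2 \<Gamma>" "x \<in> Qstar" for x
    proof -
      have "x \<in> H" using that mgroup_power[OF mgroup_Qstar] by (simp add: H_def M_def)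
      then have "\<eta> x = w x ^ 2" using \<eta>(2) mhom_power[OF mgroup_Qstar w(1) that(2)] by simp
      then show ?thesis using w(2)[OF that(2)] by auto
    qed
    show "z * \<eta> z \<noteq> 1" if "z ^ 2 = 1" "z \<noteq> 1" for z
    proof -
      have "z = - 1" using that by (simp add: power2_eq_1_iff)
      moreover have "-1 \<in> H" using prime_root_mem[OF \<Gamma>(1) _ _, of 2 "-1"] \<Gamma> by (simp add: H_def M_def Qstar_def)
      ultimately have "\<eta> z = w 1" using \<eta>(2) by simp
      then show ?thesis using \<open>z = - 1\<close> mhom_one[OF mgroup_Qstar w(1)] by simp
    qed
  qed
  moreover have "zeta8 * \<eta> zeta8 = zeta8 ^ u" using \<eta>(3) z0 by simp
  moreover have "x * \<eta> x = w (x ^ 2) * x" if "x \<in> M" "x ^ 2 \<in> Qstar" for x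
    using \<eta>(2) that by (simp add: H_def)
  ultimately show ?thesis
    unfolding M_def[symmetric] using zM by (intro bexI) auto
qed

text \<open>\<open>\<eta>\<close> is \<open>f (x ^ 3)\<close> on cube roots \<open>x\<close> of
  elements of Gamma and 1 on rational elements. The two prescriptions agree: if
  \<open>x * c = 1\<close> with \<open>c\<close> rational, then \<open>x ^ 3\<close> is a rational
  cube. Cube roots of unity are fixed, as \<open>f 1 = 1\<close>.\<close>

lemma local_three:
  assumes \<Gamma>: "mgroup \<Gamma>" "\<Gamma> \<subseteq> Qstar" and f: "mhom \<Gamma> f" "\<And>x. x \<in> \<Gamma> \<Longrightarrow> x \<in> powers 3 \<Longrightarrow> f x = 1"
  shows "\<exists>\<sigma>\<in>carrier (AutQ (rad_pinf 3 \<Gamma>)). \<forall>x\<in>rad_pinf 3 \<Gamma>. x ^ 3 \<in> \<Gamma> \<longrightarrow> \<sigma> x = f (x ^ 3) * x"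
proof -
  have p3: "Factorial_Ring.prime (3::nat)" by simp
  define M where "M = rad_pinf 3 \<Gamma>"
  have m: "mgroup M" unfolding M_def by (rule mgroup_rad_pinf[OF \<Gamma>(1)])
  define G where "G = {(x * c, f (x ^ 3)) |x c. x \<in> M \<and> x ^ 3 \<in> \<Gamma> \<and> c \<in> M \<and> c \<in> Qstar}"
  have GI: "(x * c, f (x ^ 3)) \<in> G" if "x \<in> M" "x ^ 3 \<in> \<Gamma>" "c \<in> M" "c \<in> Qstar" for x c
    using that by (auto simp: G_def)
  have oneQ: "1 \<in> Qstar" by (rule mgroup_one[OF mgroup_Qstar])
  have "hom_graph M G"
    unfolding hom_graph_def
  proof (intro conjI ballI allI impI)
    show "G \<subseteq> M \<times> - {0}"
      using mgroup_mult[OF m] mhom_nonzero[OF \<Gamma>(1) f(1)] by (auto simp: G_def)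
    show "(1, 1) \<in> G"
      using GI[of 1 1] mgroup_one[OF m] mgroup_one[OF \<Gamma>(1)] oneQ mhom_one[OF \<Gamma>(1) f(1)] by simp
    show "(fst q * fst r, snd q * snd r) \<in> G" if qr: "q \<in> G" "r \<in> G" for q r
    proof -
      obtain x c where q: "q = (x * c, f (x ^ 3))" "x \<in> M" "x ^ 3 \<in> \<Gamma>" "c \<in> M" "c \<in> Qstar"
        using qr(1) unfolding G_def by blast
      obtain y d where r: "r = (y * d, f (y ^ 3))" "y \<in> M" "y ^ 3 \<in> \<Gamma>" "d \<in> M" "d \<in> Qstar"
        using qr(2) unfolding G_def by blast
      have "fst q * fst r = (x * y) * (c * d)" "snd q * snd r = f ((x * y) ^ 3)"
        using q r mhom_mult[OF \<Gamma>(1) f(1) q(3) r(3)] by (simp_all add: power_mult_distrib mult_ac)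
      moreover have "(x * y) ^ 3 \<in> \<Gamma>" using mgroup_mult[OF \<Gamma>(1) q(3) r(3)] by (simp add: power_mult_distrib)
      ultimately show ?thesis
        using GI[OF mgroup_mult[OF m q(2) r(2)] _ mgroup_mult[OF m q(4) r(4)] mgroup_mult[OF mgroup_Qstar q(5) r(5)]] by simp
    qed
    show "(inverse (fst q), inverse (snd q)) \<in> G" if q: "q \<in> G" for q
    proof -
      obtain x c where q: "q = (x * c, f (x ^ 3))" "x \<in> M" "x ^ 3 \<in> \<Gamma>" "c \<in> M" "c \<in> Qstar"
        using q unfolding G_def by blast
      have "inverse (fst q) = inverse x * inverse c" "inverse (snd q) = f (inverse x ^ 3)"
        using q mhom_inverse[OF \<Gamma>(1) f(1) q(3)] by (simp_all add: power_inverse)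
      moreover have "inverse x ^ 3 \<in> \<Gamma>" using mgroup_inverse[OF \<Gamma>(1) q(3)] by (simp add: power_inverse)
      ultimately show ?thesis
        using GI[OF mgroup_inverse[OF m q(2)] _ mgroup_inverse[OF m q(4)] mgroup_inverse[OF mgroup_Qstar q(5)]] by simp
    qed
    show "y = 1" if y: "(1, y) \<in> G" for y
    proof -
      obtain x c where q: "1 = x * c" "y = f (x ^ 3)" "x \<in> M" "x ^ 3 \<in> \<Gamma>" "c \<in> Qstar"
        using y unfolding G_def by blast
      have "inverse c = x" using q(1) by (metis inverse_unique mult.commute)
      then have "x \<in> Qstar" using mgroup_inverse[OF mgroup_Qstar q(5)] by simp
      then have "x ^ 3 \<in> powers 3" by (auto simp: powers_def)
      then show ?thesis using f(2) q by simp
    qed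
  qed
  then obtain G' where G': "hom_graph M G'" "G \<subseteq> G'" "Domain G' = M"
    using hom_graph_extend[OF m] by blast
  obtain \<eta> where \<eta>: "mhom M \<eta>" "\<forall>q\<in>G'. \<eta> (fst q) = snd q"
    using mhom_of_hom_graph[OF m G'(1,3)] by blast
  have \<eta>G: "\<eta> (x * c) = f (x ^ 3)" if "x \<in> M" "x ^ 3 \<in> \<Gamma>" "c \<in> M" "c \<in> Qstar" for x c
    using \<eta>(2) G'(2) GI[OF that] by fastforce
  have \<eta>x: "\<eta> x = f (x ^ 3)" if "x \<in> M" "x ^ 3 \<in> \<Gamma>" for x
    using \<eta>G[OF that mgroup_one[OF m] oneQ] by simp
  have f1: "f 1 = 1" by (rule mhom_one[OF \<Gamma>(1) f(1)])
  have \<eta>c: "\<eta> c = 1" if "c \<in> M" "c \<in> Qstar" for c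
    using \<eta>G[OF mgroup_one[OF m] _ that] mgroup_one[OF \<Gamma>(1)] f1 by simp
  have "(\<lambda>x\<in>M. x * \<eta> x) \<in> carrier (AutQ M)"
    unfolding M_def
  proof (rule AutQ_of_character[OF \<Gamma> p3 \<eta>(1)[unfolded M_def]])
    show "\<eta> x = 1" if "x \<in> rad_pinf 3 \<Gamma>" "x \<in> Qstar" for x
      using \<eta>c that by (simp add: M_def)
    show "z * \<eta> z \<noteq> 1" if z: "z ^ 3 = 1" "z \<noteq> 1" for z
    proof -
      have "z \<in> M" unfolding M_def by (rule prime_root_mem[OF \<Gamma> p3 z(1)])
      then have "\<eta> z = 1" using \<eta>x z(1) mgroup_one[OF \<Gamma>(1)] f1 by simp
      then show ?thesis using z(2) by simp
    qed
  qed
  then show ?thesis unfolding M_def[symmetric] using \<eta>x by (intro bexI) (auto simp: mult.commute)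
qed

section \<open>Finite local conditions at single primes\<close>

lemma kernel_phi:
  "\<sigma> \<in> kernel (Ap_group \<Gamma> p) (AutQ (rad p (generate Cstar {a i}))) (phi a p i) \<longleftrightarrow>
     \<sigma> \<in> carrier (Ap_group \<Gamma> p) \<and> (\<forall>x\<in>rad p (generate Cstar {a i}). \<sigma> x = x)"
  unfolding kernel_def one_AutQ phi_def by (auto simp: restrict_def fun_eq_iff)

lemma Sp_set_iff:
  "\<sigma> \<in> Sp_set n a p \<longleftrightarrow> \<sigma> \<in> carrier (AutQ (rad_pinf p (Gam n a))) \<and>
     (\<forall>i\<in>{1..n}. \<exists>x\<in>rad p (generate Cstar {a i}). \<sigma> x \<noteq> x)"
  unfolding Sp_set_def using kernel_phi[of \<sigma> "Gam n a" p a] by (auto simp: Ap_group_def)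

text \<open>Openness of \<open>S_p\<close>: one moved radical for each generator already witnesses
  membership.\<close>

lemma Sp_set_witnesses:
  assumes "\<sigma> \<in> Sp_set n a p"
  shows "\<exists>F. finite F \<and> F \<subseteq> (\<Union>i\<in>{1..n}. rad p (generate Cstar {a i})) \<and>
    (\<forall>\<tau>\<in>carrier (AutQ (rad_pinf p (Gam n a))). (\<forall>x\<in>F. \<tau> x = \<sigma> x) \<longrightarrow> \<tau> \<in> Sp_set n a p)"
proof -
  have "\<exists>x. i \<in> {1..n} \<longrightarrow> x \<in> rad p (generate Cstar {a i}) \<and> \<sigma> x \<noteq> x" for i
    using assms unfolding Sp_set_iff by blast
  then obtain f where f: "\<And>i. i \<in> {1..n} \<longrightarrow> f i \<in> rad p (generate Cstar {a i}) \<and> \<sigma> (f i) \<noteq> f i" by metis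
  have "\<tau> \<in> Sp_set n a p" if "\<tau> \<in> carrier (AutQ (rad_pinf p (Gam n a)))" "\<forall>x\<in>f ` {1..n}. \<tau> x = \<sigma> x" for \<tau>
    unfolding Sp_set_iff
  proof (intro conjI ballI that(1))
    fix i assume i: "i \<in> {1..n}"
    then have "\<tau> (f i) = \<sigma> (f i)" using that(2) by blast
    then show "\<exists>x\<in>rad p (generate Cstar {a i}). \<tau> x \<noteq> x" using f i by (intro bexI[of _ "f i"]) auto
  qed
  moreover have "f ` {1..n} \<subseteq> (\<Union>i\<in>{1..n}. rad p (generate Cstar {a i}))" using f by blast
  ultimately show ?thesis by (intro exI[of _ "f ` {1..n}"]) blast
qed

lemma odd_part_exists: "m > 0 \<Longrightarrow> \<exists>k l. (m::nat) = 2 ^ k * l \<and> odd l"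
proof (induction m rule: less_induct)
  case (less m)
  show ?case
  proof (cases "odd m")
    case True
    then show ?thesis by (intro exI[of _ 0] exI[of _ m]) simp
  next
    case False
    then obtain h where h: "m = 2 * h" by (auto elim: evenE)
    then obtain k l where "h = 2 ^ k * l" "odd l" using less.IH[of h] less.prems by auto
    then show ?thesis using h by (intro exI[of _ "Suc k"] exI[of _ l]) simp
  qed
qed

context
  fixes n :: nat and a :: "nat \<Rightarrow> complex"
  assumes a: "\<And>i. i \<in> {1..n} \<Longrightarrow> a i \<in> Qstar"
begin

lemma Gam_group: "mgroup (Gam n a)" "Gam n a \<subseteq> Qstar"
  by (rule mgroup_Gam, rule a, assumption) (rule Gam_subset, rule a, assumption)

lemma Gam_generator: "i \<in> {1..n} \<Longrightarrow> a i \<in> Gam n a"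
  unfolding Gam_def by (rule generate.incl) auto

lemma Gam_single: "i \<in> {1..n} \<Longrightarrow> generate Cstar {a i} \<subseteq> Gam n a"
  by (rule generate_minimal[OF Gam_group(1)]) (simp add: Gam_generator)

lemma rad_single_subset: "i \<in> {1..n} \<Longrightarrow> rad p (generate Cstar {a i}) \<subseteq> rad_pinf p (Gam n a)"
  by (rule rad_subset[OF Gam_group(1) Gam_single])

lemma rad_single_root_of_unity:
  assumes "i \<in> {1..n}" "z ^ p = 1" "p \<ge> 1" shows "z \<in> rad p (generate Cstar {a i})"
  using assms generate.one[of Cstar "{a i}"] by (auto simp: rad_iff power_0_left)

lemma rad_single_root:
  assumes "i \<in> {1..n}" "x ^ p = a i" "p \<ge> 1" shows "x \<in> rad p (generate Cstar {a i})"
  using assms generate.incl[of "a i" "{a i}" Cstar] mgroup_nonzero[OF mgroup_Qstar a[OF assms(1)]]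
  by (auto simp: rad_iff power_0_left)

lemma rad_inf_smooth:
  assumes "a ` {1..n} \<subseteq> smooth B" "x \<in> rad_inf (Gam n a)" "x \<in> Qstar" shows "x \<in> smooth B"
proof -
  have "Gam n a \<subseteq> smooth B" unfolding Gam_def by (rule generate_minimal[OF mgroup_smooth assms(1)])
  then show ?thesis using smooth_root[OF assms(3)] assms(2) unfolding rad_inf_iff by blast
qed

text \<open>All square roots \<open>x\<close> are controlled by finitely many. Their squares are
  \<open>B\<close>-smooth, so they fall into finitely many square classes, and two square roots for
  the same class differ by a rational factor, which every \<open>\<tau>\<close> fixes. The set
  \<open>R\<close> contains one element for each class that occurs.\<close>

lemma local_two_data:
  assumes w: "mhom Qstar w" "\<And>x. x \<in> Qstar \<Longrightarrow> w x = 1 \<or> w x = - 1" "\<And>i. i \<in> {1..n} \<Longrightarrow> w (a i) = - 1"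
    and B: "a ` {1..n} \<subseteq> smooth B" and u: "\<i> ^ u = w (- 1) * \<i>"
  shows "\<exists>\<sigma> F. \<sigma> \<in> Sp_set n a 2 \<and> finite F \<and> F \<subseteq> rad_pinf 2 (Gam n a) \<and>
    (\<forall>\<tau>\<in>carrier (AutQ (rad_pinf 2 (Gam n a))). (\<forall>x\<in>F. \<tau> x = \<sigma> x) \<longrightarrow>
        \<tau> \<in> Sp_set n a 2 \<and> \<tau> zeta8 = zeta8 ^ u \<and>
        (\<forall>x\<in>rad_pinf 2 (Gam n a). x ^ 2 \<in> Qstar \<longrightarrow> \<tau> x = w (x ^ 2) * x))"
proof -
  define \<Gamma> where "\<Gamma> = Gam n a"
  have \<Gamma>: "mgroup \<Gamma>" "\<Gamma> \<subseteq> Qstar" unfolding \<Gamma>_def by (fact Gam_group)+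
  define M where "M = rad_pinf 2 \<Gamma>"
  have m: "mgroup M" unfolding M_def by (rule mgroup_rad_pinf[OF \<Gamma>(1)])
  obtain \<sigma> where \<sigma>: "\<sigma> \<in> carrier (AutQ M)" "\<sigma> zeta8 = zeta8 ^ u"
    "\<And>x. x \<in> M \<Longrightarrow> x ^ 2 \<in> Qstar \<Longrightarrow> \<sigma> x = w (x ^ 2) * x"
    using local_two[OF \<Gamma> w(1,2) u] unfolding M_def by blast
  have S: "\<sigma> \<in> Sp_set n a 2"
    unfolding Sp_set_iff
  proof (intro conjI ballI)
    show "\<sigma> \<in> carrier (AutQ (rad_pinf 2 (Gam n a)))" using \<sigma>(1) by (simp add: M_def \<Gamma>_def)
    fix i assume i: "i \<in> {1..n}"
    have ai: "a i \<noteq> 0" by (rule mgroup_nonzero[OF mgroup_Qstar a[OF i]])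
    obtain x where x: "x \<noteq> 0" "x ^ 2 = a i" using complex_root_exists[of 2 "a i"] ai by auto
    have xr: "x \<in> rad 2 (generate Cstar {a i})" by (rule rad_single_root[OF i x(2)]) simp
    then have "x \<in> M" using rad_single_subset[OF i] by (auto simp: M_def \<Gamma>_def)
    then have "\<sigma> x = - x" using \<sigma>(3)[of x] x(2) w(3)[OF i] a[OF i] by simp
    then show "\<exists>x\<in>rad 2 (generate Cstar {a i}). \<sigma> x \<noteq> x" using xr x(1) by (intro bexI[of _ x]) auto
  qed
  obtain F where F: "finite F" "F \<subseteq> (\<Union>i\<in>{1..n}. rad 2 (generate Cstar {a i}))"
    "\<forall>\<tau>\<in>carrier (AutQ (rad_pinf 2 (Gam n a))). (\<forall>x\<in>F. \<tau> x = \<sigma> x) \<longrightarrow> \<tau> \<in> Sp_set n a 2"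
    using Sp_set_witnesses[OF S] by blast
  obtain D where D: "finite D" "D \<subseteq> Qstar" "\<forall>x\<in>smooth B. \<exists>s\<in>D. \<exists>c\<in>Qstar. x = s * c ^ 2"
    using smooth_squarefree[of B] by (elim exE conjE)
  define P where "P s x \<longleftrightarrow> x \<in> M \<and> (\<exists>c\<in>Qstar. x ^ 2 = s * c ^ 2)" for s x
  define R where "R = (\<lambda>s. SOME x. P s x) ` {s \<in> D. \<exists>x. P s x}"
  have R: "finite R" using D(1) by (simp add: R_def)
  have PR: "P s (SOME x. P s x)" if "\<exists>x. P s x" for s using someI_ex[OF that] .
  have RM: "R \<subseteq> M" using PR by (auto simp: R_def P_def)
  have zM: "zeta8 \<in> M"
    unfolding M_def using zeta8(2) mgroup_one[OF \<Gamma>(1)] by (intro rad_pinfI[of zeta8 3]) (auto simp: zeta8_def)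
  have FM: "F \<subseteq> M" using F(2) rad_single_subset unfolding M_def \<Gamma>_def by blast
  have key: "\<tau> x = w (x ^ 2) * x"
    if \<tau>: "\<tau> \<in> carrier (AutQ M)" "\<forall>x\<in>R. \<tau> x = \<sigma> x" and x: "x \<in> M" "x ^ 2 \<in> Qstar" for \<tau> x
  proof -
    have "x \<in> rad_inf \<Gamma>" using rad_pinf_subset[OF \<Gamma>(1), of 2] x(1) unfolding M_def by auto
    then have "x ^ 2 \<in> rad_inf \<Gamma>" by (rule mgroup_power[OF mgroup_rad_inf[OF \<Gamma>(1)]])
    then have "x ^ 2 \<in> smooth B" using rad_inf_smooth[OF B _ x(2)] by (simp add: \<Gamma>_def)
    then obtain s c where s: "s \<in> D" "c \<in> Qstar" "x ^ 2 = s * c ^ 2" using D(3) by blast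
    then have ex: "\<exists>x. P s x" using x(1) unfolding P_def by blast
    define y where "y = (SOME x. P s x)"
    have y: "y \<in> R" "y \<in> M" using s(1) ex RM by (auto simp: R_def y_def)
    obtain d where d: "d \<in> Qstar" "y ^ 2 = s * d ^ 2" using PR[OF ex] unfolding P_def y_def by blast
    have nz: "y \<noteq> 0" "d \<noteq> 0" "s \<noteq> 0"
      using mgroup_nonzero[OF m y(2)] mgroup_nonzero[OF mgroup_Qstar d(1)] D(2) s(1) mgroup_nonzero[OF mgroup_Qstar] by auto
    have "(x / y) ^ 2 = (c / d) ^ 2" using s(3) d(2) nz by (simp add: power_divide)
    then have "x / y = c / d \<or> x / y = - (c / d)" by (simp add: power2_eq_iff)
    moreover have "c / d \<in> Qstar" by (rule mgroup_divide[OF mgroup_Qstar s(2) d(1)])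
    ultimately have r: "x / y \<in> Qstar" by (auto simp: Qstar_def)
    have rM: "x / y \<in> M" by (rule mgroup_divide[OF m x(1) y(2)])
    have y2: "y ^ 2 \<in> Qstar"
      using d D(2) s(1) mgroup_mult[OF mgroup_Qstar] mgroup_power[OF mgroup_Qstar] by (metis subsetD)
    have fixr: "\<tau> x = w (x ^ 2) * x" if \<rho>: "\<rho> y = w (y ^ 2) * y" "\<rho> = \<tau>" for \<rho>
    proof -
      have "\<tau> x = \<tau> (x / y * y)" using nz by simp
      also have "\<dots> = \<tau> (x / y) * \<tau> y" by (rule mhom_mult[OF m AutQ_mhom[OF \<tau>(1) m] rM y(2)])
      also have "\<tau> (x / y) = x / y" by (rule AutQ_fix[OF \<tau>(1) rM r])
      finally have e: "\<tau> x = w (y ^ 2) * x" using \<rho> nz by simp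
      have "x ^ 2 = (x / y) ^ 2 * y ^ 2" using nz by (simp add: power_divide)
      then have "w (x ^ 2) = w (x / y) ^ 2 * w (y ^ 2)"
        using mhom_mult[OF mgroup_Qstar w(1) mgroup_power[OF mgroup_Qstar r, of 2] y2]
          mhom_power[OF mgroup_Qstar w(1) r, of 2] by simp
      moreover have "w (x / y) ^ 2 = 1" using w(2)[OF r] by auto
      ultimately show ?thesis using e by simp
    qed
    have "\<tau> y = w (y ^ 2) * y" using \<tau>(2) y(1) \<sigma>(3)[OF y(2) y2] by simp
    then show ?thesis using fixr by blast
  qed
  define F' where "F' = insert zeta8 (F \<union> R)"
  have "finite F'" "F' \<subseteq> rad_pinf 2 (Gam n a)"
    using F(1) R zM FM RM by (auto simp: F'_def M_def \<Gamma>_def)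
  moreover have "\<tau> \<in> Sp_set n a 2 \<and> \<tau> zeta8 = zeta8 ^ u \<and>
        (\<forall>x\<in>rad_pinf 2 (Gam n a). x ^ 2 \<in> Qstar \<longrightarrow> \<tau> x = w (x ^ 2) * x)"
    if "\<tau> \<in> carrier (AutQ (rad_pinf 2 (Gam n a)))" "\<forall>x\<in>F'. \<tau> x = \<sigma> x" for \<tau>
    using that F(3) \<sigma>(2) key[of \<tau>] by (auto simp: F'_def M_def \<Gamma>_def)
  ultimately show ?thesis using S by blast
qed

text \<open>If \<open>z\<close> is moved, it alone witnesses \<open>S_p\<close>, as it belongs to
  every group of \<open>p\<close>-th roots involved. It must stay fixed only when
  \<open>p = 3\<close> and \<open>w (-3) = 1\<close>; there the cubic character \<open>f\<close>
  does the work, and this is why \<open>f\<close> is assumed conditionally.\<close>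

lemma local_odd_data:
  assumes w: "mhom Qstar w" "\<And>x. x \<in> Qstar \<Longrightarrow> w x = 1 \<or> w x = - 1"
    and f: "w (-3) = 1 \<Longrightarrow> mhom (Gam n a) f \<and> (\<forall>x\<in>Gam n a. x \<in> powers 3 \<longrightarrow> f x = 1) \<and> (\<forall>i\<in>{1..n}. f (a i) \<noteq> 1)"
    and p: "Factorial_Ring.prime (p::nat)" "p \<ge> 3"
  shows "\<exists>\<sigma> F. \<sigma> \<in> Sp_set n a p \<and> finite F \<and> F \<subseteq> rad_pinf p (Gam n a) \<and>
    (\<forall>\<tau>\<in>carrier (AutQ (rad_pinf p (Gam n a))). (\<forall>x\<in>F. \<tau> x = \<sigma> x) \<longrightarrow> \<tau> \<in> Sp_set n a p) \<and>
    (\<forall>\<tau> \<theta>. (\<forall>x\<in>F. \<tau> x = \<sigma> x) \<longrightarrow> embedding (qspan runity) \<theta> \<longrightarrow> (\<forall>x\<in>runity. \<theta> x = \<tau> x) \<longrightarrow> \<theta> \<i> = w (- 1) * \<i> \<longrightarrow>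
       complex_of_real (sqrt p) \<in> qspan runity \<and> \<theta> (complex_of_real (sqrt p)) = w (of_nat p) * complex_of_real (sqrt p))"
proof -
  define \<Gamma> where "\<Gamma> = Gam n a"
  have \<Gamma>: "mgroup \<Gamma>" "\<Gamma> \<subseteq> Qstar" unfolding \<Gamma>_def by (fact Gam_group)+
  have oddp: "odd p" using p prime_odd_nat[of p] by simp
  obtain z :: complex where z: "z ^ p = 1" "\<forall>k. 0 < k \<and> k < p \<longrightarrow> z ^ k \<noteq> 1"
    using primitive_root_of_unity[of p] p(2) by auto
  have z1: "z \<noteq> 1" using z(2)[rule_format, of 1] p(2) by auto
  have pQ: "of_nat p \<in> Qstar" "- 1 \<in> Qstar" using p(2) by (auto simp: Qstar_def)
  have s: "w (of_nat p) \<in> {1, - 1}" "w (- 1) \<in> {1, - 1}" using w(2)[OF pQ(1)] w(2)[OF pQ(2)] by auto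
  have wneg: "w (of_nat p) * w (- 1) = w (- of_nat p)"
    using mhom_mult[OF mgroup_Qstar w(1) pQ] by simp
  obtain u where u: "complex_of_real (sqrt p) \<in> qspan runity" "\<not> p dvd u"
     "p \<noteq> 3 \<or> w (of_nat p) * w (- 1) \<noteq> 1 \<longrightarrow> z ^ u \<noteq> z" "p = 3 \<and> w (of_nat p) * w (- 1) = 1 \<longrightarrow> z ^ u = z"
     "\<forall>\<theta>. embedding (qspan runity) \<theta> \<longrightarrow> \<theta> z = z ^ u \<longrightarrow> \<theta> \<i> = w (- 1) * \<i> \<longrightarrow>
          \<theta> (complex_of_real (sqrt p)) = w (of_nat p) * complex_of_real (sqrt p)"
    using sqrt_prime_sign_odd[OF p z(1) z1 s] by blast
  have zr: "z \<in> rad p (generate Cstar {a i})" if "i \<in> {1..n}" for i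
    using rad_single_root_of_unity[OF that z(1)] p(2) by simp
  have zM: "z \<in> rad_pinf p \<Gamma>" by (rule prime_root_mem[OF \<Gamma> p(1) z(1)])
  have zU: "z \<in> runity" using z(1) p(2) by (intro runity_mem[of p]) auto
  have "\<exists>\<sigma>\<in>Sp_set n a p. \<sigma> z = z ^ u"
  proof (cases "z ^ u = z")
    case False
    obtain \<sigma> where "\<sigma> \<in> carrier (AutQ (rad_pinf p \<Gamma>))" "\<sigma> z = z ^ u"
      using local_cyclotomic[OF \<Gamma> p(1) z(1) z1 u(2) oddp] by blast
    moreover from this have "\<sigma> \<in> Sp_set n a p"
      unfolding Sp_set_iff using False zr unfolding \<Gamma>_def by metis
    ultimately show ?thesis by blast
  next
    case True
    then have p3: "p = 3" and "w (of_nat p) * w (- 1) = 1" using u(3) by auto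
    then have "w (-3) = 1" using wneg by simp
    note f' = f[OF this]
    have f1: "mhom \<Gamma> f" "\<And>x. x \<in> \<Gamma> \<Longrightarrow> x \<in> powers 3 \<Longrightarrow> f x = 1" using f' by (auto simp: \<Gamma>_def)
    obtain \<sigma> where \<sigma>: "\<sigma> \<in> carrier (AutQ (rad_pinf 3 \<Gamma>))" "\<forall>x\<in>rad_pinf 3 \<Gamma>. x ^ 3 \<in> \<Gamma> \<longrightarrow> \<sigma> x = f (x ^ 3) * x"
      using local_three[OF \<Gamma> f1] by blast
    have "\<sigma> z = z"
      using \<sigma>(2) zM z(1) p3 mgroup_one[OF \<Gamma>(1)] mhom_one[OF \<Gamma>(1) f1(1)] by simp
    moreover have "\<sigma> \<in> Sp_set n a 3"
      unfolding Sp_set_iff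
    proof (intro conjI ballI)
      show "\<sigma> \<in> carrier (AutQ (rad_pinf 3 (Gam n a)))" using \<sigma>(1) by (simp add: \<Gamma>_def)
      fix i assume i: "i \<in> {1..n}"
      have ai: "a i \<noteq> 0" by (rule mgroup_nonzero[OF mgroup_Qstar a[OF i]])
      obtain x where x: "x \<noteq> 0" "x ^ 3 = a i" using complex_root_exists[of 3 "a i"] ai by auto
      have xr: "x \<in> rad 3 (generate Cstar {a i})" by (rule rad_single_root[OF i x(2)]) simp
      then have "x \<in> rad_pinf 3 \<Gamma>" using rad_single_subset[OF i] by (auto simp: \<Gamma>_def)
      then have "\<sigma> x = f (a i) * x" using \<sigma>(2) x(2) Gam_generator[OF i] by (simp add: \<Gamma>_def)
      moreover have "f (a i) \<noteq> 1" using f' i by blast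
      ultimately show "\<exists>x\<in>rad 3 (generate Cstar {a i}). \<sigma> x \<noteq> x" using xr x(1) by (intro bexI[of _ x]) auto
    qed
    ultimately show ?thesis using True p3 by (intro bexI[of _ \<sigma>]) auto
  qed
  then obtain \<sigma> where \<sigma>: "\<sigma> \<in> Sp_set n a p" "\<sigma> z = z ^ u" by blast
  obtain F where F: "finite F" "F \<subseteq> (\<Union>i\<in>{1..n}. rad p (generate Cstar {a i}))"
    "\<forall>\<tau>\<in>carrier (AutQ (rad_pinf p (Gam n a))). (\<forall>x\<in>F. \<tau> x = \<sigma> x) \<longrightarrow> \<tau> \<in> Sp_set n a p"
    using Sp_set_witnesses[OF \<sigma>(1)] by blast
  have "F \<subseteq> rad_pinf p (Gam n a)" using F(2) rad_single_subset by blast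
  then have FM: "finite (insert z F)" "insert z F \<subseteq> rad_pinf p (Gam n a)" using F(1) zM by (auto simp: \<Gamma>_def)
  have act: "complex_of_real (sqrt p) \<in> qspan runity \<and> \<theta> (complex_of_real (sqrt p)) = w (of_nat p) * complex_of_real (sqrt p)"
    if "\<forall>x\<in>insert z F. \<tau> x = \<sigma> x" "embedding (qspan runity) \<theta>" "\<forall>x\<in>runity. \<theta> x = \<tau> x" "\<theta> \<i> = w (- 1) * \<i>" for \<tau> \<theta>
  proof -
    have "\<theta> z = z ^ u" using that(1,3) zU \<sigma>(2) by simp
    then show ?thesis using u(1,5) that(2,4) by blast
  qed
  show ?thesis
    by (intro exI[of _ \<sigma>] exI[of _ "insert z F"] conjI ballI allI impI)
      (use \<sigma>(1) FM F(3) act in \<open>blast+\<close>)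
qed

text \<open>A radical contained in the maximal cyclotomic field is a root of unity times a square root of
  a positive rational number, so only these square roots have to be checked.\<close>

lemma Gal_criterion:
  assumes w: "mhom Qstar w" "\<And>x. x \<in> Qstar \<Longrightarrow> w x = 1 \<or> w x = - 1"
    and B: "a ` {1..n} \<subseteq> smooth B"
    and \<sigma>: "\<sigma> \<in> carrier (A_group (Gam n a))"
    and two: "\<sigma> zeta8 = zeta8 ^ u" "\<i> ^ u = w (- 1) * \<i>"
      "zeta8 ^ u + inverse (zeta8 ^ u) = w 2 * complex_of_real (sqrt 2)"
      "\<And>x. x \<in> rad_pinf 2 (Gam n a) \<Longrightarrow> x ^ 2 \<in> Qstar \<Longrightarrow> \<sigma> x = w (x ^ 2) * x"
    and odd: "\<And>p \<theta>. Factorial_Ring.prime (p::nat) \<Longrightarrow> p \<ge> 3 \<Longrightarrow> p \<le> B \<Longrightarrow> embedding (qspan runity) \<theta> \<Longrightarrow>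
       \<forall>x\<in>runity. \<theta> x = \<sigma> x \<Longrightarrow> \<theta> \<i> = w (- 1) * \<i> \<Longrightarrow>
       complex_of_real (sqrt p) \<in> qspan runity \<and> \<theta> (complex_of_real (sqrt p)) = w (of_nat p) * complex_of_real (sqrt p)"
  shows "\<sigma> \<in> Gal_group (Gam n a)"
proof -
  define \<Gamma> where "\<Gamma> = Gam n a"
  have \<Gamma>: "mgroup \<Gamma>" "\<Gamma> \<subseteq> Qstar" unfolding \<Gamma>_def by (fact Gam_group)+
  define M where "M = rad_inf \<Gamma>"
  have M: "radical_group M" unfolding M_def by (rule radical_group_rad_inf[OF \<Gamma>])
  note m = radical_group_mgroup[OF M]
  have \<sigma>A: "\<sigma> \<in> carrier (AutQ M)" using \<sigma> by (simp add: A_group_def M_def \<Gamma>_def)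
  have hom: "mhom M \<sigma>" by (rule AutQ_mhom[OF \<sigma>A m])
  have UM: "runity \<subseteq> M" unfolding M_def by (rule runity_subset[OF \<Gamma>(1)])
  have homU: "mhom runity \<sigma>" by (rule mhom_mono[OF hom UM])
  have U: "subfld (qspan runity)" by (rule subfld_qspan_runity)
  \<comment> \<open>On roots of unity every injective homomorphism comes from a field embedding, so
    \<open>\<theta>\<close> exists before \<open>\<sigma>\<close> is known to lie in
    \<open>G\<close>; what remains is agreement on square roots.\<close>
  have "preserves_relations runity \<sigma>"
    by (rule runity_preserves_relations[OF homU]) (use AutQ_inj[OF \<sigma>A m] UM in blast)
  then obtain \<theta> where \<theta>: "embedding (qspan runity) \<theta>" "\<And>x. x \<in> runity \<Longrightarrow> \<theta> x = \<sigma> x"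
    using preserves_relations_embedding[OF mgroup_runity homU] by blast
  have zU: "zeta8 \<in> runity" using zeta8(2) by (intro runity_mem[of 8]) auto
  have zK: "zeta8 \<in> qspan runity" using zU qspan_superset by blast
  have \<theta>z: "\<theta> zeta8 = zeta8 ^ u" using \<theta>(2)[OF zU] two(1) by simp
  have \<theta>i: "\<theta> \<i> = w (- 1) * \<i>"
  proof -
    have "\<theta> (zeta8 ^ 2) = (zeta8 ^ u) ^ 2" using embedding_power[OF U \<theta>(1) zK, of 2] \<theta>z by simp
    also have "\<dots> = (zeta8 ^ 2) ^ u" by (simp add: power_mult[symmetric] mult.commute)
    finally show ?thesis unfolding zeta8(1) two(2) .
  qed
  have \<theta>2: "complex_of_real (sqrt 2) \<in> qspan runity \<and> \<theta> (complex_of_real (sqrt 2)) = w 2 * complex_of_real (sqrt 2)"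
    unfolding zeta8(3)[symmetric]
    using two(3)[folded zeta8(3)] subfld_add[OF U zK subfld_inverse[OF U zK]] embedding_add[OF U \<theta>(1) zK subfld_inverse[OF U zK]]
      embedding_inverse[OF U \<theta>(1) zK] \<theta>z by simp
  have primes: "complex_of_real (sqrt q) \<in> qspan runity \<and>
       \<theta> (complex_of_real (sqrt q)) = w (of_nat q) * complex_of_real (sqrt q)"
    if q: "Factorial_Ring.prime q" "q \<le> B" for q
  proof (cases "q = 2")
    case True
    then show ?thesis using \<theta>2 by simp
  next
    case False
    then have "q \<ge> 3" using prime_ge_2_nat[OF q(1)] by simp
    then show ?thesis using odd[OF q(1) _ q(2) \<theta>(1) _ \<theta>i] \<theta>(2) by blast
  qed
  \<comment> \<open>Condition \<open>two\<close> reaches only radicals of 2-power order. Some odd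
    power of \<open>r\<close> is one of these, and an odd power determines the sign.\<close>
  have sq: "\<sigma> r = w (r ^ 2) * r" if r: "r \<in> M" "r ^ 2 \<in> Qstar" for r
  proof -
    obtain k where k: "k \<ge> 1" "r ^ k \<in> \<Gamma>" "r \<noteq> 0" using r(1) unfolding M_def rad_inf_iff by blast
    then obtain j l where jl: "k = 2 ^ j * l" "odd l" using odd_part_exists[of k] by auto
    have rl2: "(r ^ l) ^ 2 \<in> Qstar"
      using mgroup_power[OF mgroup_Qstar r(2), of l] by (simp add: power_mult[symmetric] mult.commute)
    have "(r ^ l) ^ (2 ^ Suc j) = (r ^ k) ^ 2" by (simp add: jl(1) power_mult[symmetric] mult_ac)
    then have "(r ^ l) ^ (2 ^ Suc j) \<in> \<Gamma>" using mgroup_power[OF \<Gamma>(1) k(2), of 2] by simp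
    then have "r ^ l \<in> rad_pinf 2 \<Gamma>" using k(3) by (intro rad_pinfI[of _ "Suc j"]) auto
    then have "\<sigma> (r ^ l) = w ((r ^ l) ^ 2) * r ^ l" using two(4)[of "r ^ l"] rl2 by (simp add: \<Gamma>_def)
    moreover have "w ((r ^ l) ^ 2) = w (r ^ 2) ^ l"
      using mhom_power[OF mgroup_Qstar w(1) r(2), of l] by (simp add: power_mult[symmetric] mult.commute)
    ultimately have e: "\<sigma> r ^ l = (w (r ^ 2) * r) ^ l" using mhom_power[OF m hom r(1), of l] by (simp add: power_mult_distrib)
    have "\<sigma> r ^ 2 = r ^ 2"
      using mhom_power[OF m hom r(1), of 2] AutQ_fix[OF \<sigma>A mgroup_power[OF m r(1)] r(2)] by simp
    then have "\<sigma> r = r \<or> \<sigma> r = - r" by (simp add: power2_eq_iff)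
    then have "\<sigma> r = w (r ^ 2) * r \<or> \<sigma> r = - (w (r ^ 2) * r)" using w(2)[OF r(2)] by auto
    moreover have "\<sigma> r \<noteq> - (w (r ^ 2) * r)"
    proof
      assume "\<sigma> r = - (w (r ^ 2) * r)"
      then have "- ((w (r ^ 2) * r) ^ l) = (w (r ^ 2) * r) ^ l" using e jl(2) by (simp add: power_minus_odd)
      then have "(w (r ^ 2) * r) ^ l = 0" by (simp add: neg_eq_iff_add_eq_0)
      then show False using k(3) w(2)[OF r(2)] by auto
    qed
    ultimately show ?thesis by blast
  qed
  have "preserves_relations M \<sigma>"
  proof (rule radical_preserves_relations[OF m _ hom \<theta>(1)])
    show "\<exists>N\<ge>1. x ^ N \<in> \<rat>" if "x \<in> M" for x
      using radical_group_root[OF M that] by (auto simp: Qstar_def)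
    fix x assume x: "x \<in> M" "x \<in> qspan runity"
    have x0: "x \<noteq> 0" by (rule mgroup_nonzero[OF m x(1)])
    obtain N where N: "N \<ge> 1" "x ^ N \<in> \<rat>" using radical_group_root[OF M x(1)] by (auto simp: Qstar_def)
    define r where "r = complex_of_real (norm x)"
    have r: "r ^ 2 \<in> \<rat>" "x / r \<in> runity" using cyclotomic_radical[OF x(2) x0 N] by (simp_all add: r_def)
    have r0: "r \<noteq> 0" using x0 by (simp add: r_def)
    have r2: "r ^ 2 \<in> Qstar" using r(1) r0 by (simp add: Qstar_def)
    have "r = x / (x / r)" using x0 by simp
    then have rM: "r \<in> M" using mgroup_divide[OF m x(1)] r(2) UM by (metis subsetD)
    have "r ^ 2 \<in> smooth B" using rad_inf_smooth[OF B _ r2] mgroup_power[OF m rM, of 2] by (simp add: M_def \<Gamma>_def)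
    moreover have "r ^ 2 = complex_of_real ((norm x) ^ 2)" by (simp add: r_def)
    ultimately have act: "complex_of_real (sqrt ((norm x) ^ 2)) \<in> qspan runity \<and>
       \<theta> (complex_of_real (sqrt ((norm x) ^ 2))) = w (complex_of_real ((norm x) ^ 2)) * complex_of_real (sqrt ((norm x) ^ 2))"
      using x0 by (intro sqrt_smooth_action[OF \<theta>(1) w(1) primes]) auto
    have act': "r \<in> qspan runity" "\<theta> r = w (r ^ 2) * r" using act by (simp_all add: r_def)
    have xr: "x = (x / r) * r" using r0 by simp
    have "\<theta> x = \<theta> (x / r) * \<theta> r"
      using embedding_mult[OF U \<theta>(1), of "x / r" r] r(2) qspan_superset act'(1) xr by (metis subsetD)
    also have "\<dots> = \<sigma> (x / r) * \<sigma> r" using \<theta>(2)[OF r(2)] act'(2) sq[OF rM r2] by simp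
    also have "\<dots> = \<sigma> x" using mhom_mult[OF m hom, of "x / r" r] r(2) UM rM xr by (metis subsetD)
    finally show "\<theta> x = \<sigma> x" .
  qed
  then show ?thesis using \<sigma> unfolding Gal_group_eq[OF \<Gamma>, unfolded \<Gamma>_def] by (simp add: M_def \<Gamma>_def)
qed

end

section \<open>Measurability\<close>

lemma topspace_AutQ: "topspace (AutQ_topology H) = carrier (AutQ H)"
proof -
  have "carrier (AutQ H) \<subseteq> (\<Pi>\<^sub>E x\<in>H. H)"
  proof
    fix \<sigma> assume s: "\<sigma> \<in> carrier (AutQ H)"
    show "\<sigma> \<in> (\<Pi>\<^sub>E x\<in>H. H)"
    proof (rule PiE_I)
      show "\<sigma> x \<in> H" if "x \<in> H" for x by (rule AutQ_mem[OF s that])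
      show "\<sigma> x = undefined" if "x \<notin> H" for x using AutQ_ext[OF s] that by (simp add: extensional_def)
    qed
  qed
  then show ?thesis unfolding AutQ_topology_def by (auto simp: topspace_subtopology)
qed

lemma open_AutQ_subset: "{U. openin (AutQ_topology H) U} \<subseteq> Pow (carrier (AutQ H))"
  using openin_subset topspace_AutQ by blast

lemma space_borel_AutQ: "space (borel_of (AutQ_topology H)) = carrier (AutQ H)"
  unfolding borel_of_def topspace_AutQ by (rule space_measure_of[OF open_AutQ_subset])

lemma sets_borel_AutQ_open: "openin (AutQ_topology H) U \<Longrightarrow> U \<in> sets (borel_of (AutQ_topology H))"
  unfolding borel_of_def topspace_AutQ using open_AutQ_subset[of H] by (simp add: sets_measure_of)

lemma openin_AutQ_evaluation:
  assumes "x \<in> H" shows "openin (AutQ_topology H) {\<sigma> \<in> carrier (AutQ H). \<sigma> x \<in> Y}"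
proof -
  have c: "continuous_map (product_topology (\<lambda>_. discrete_topology H) H) (discrete_topology H) (\<lambda>\<sigma>. \<sigma> x)"
    by (rule continuous_map_product_projection) (rule assms)
  have "openin (product_topology (\<lambda>_. discrete_topology H) H)
      {\<sigma> \<in> topspace (product_topology (\<lambda>_. discrete_topology H) H). \<sigma> x \<in> Y \<inter> H}"
    by (rule openin_continuous_map_preimage[OF c]) simp
  then have "openin (AutQ_topology H)
      (carrier (AutQ H) \<inter> {\<sigma> \<in> topspace (product_topology (\<lambda>_. discrete_topology H) H). \<sigma> x \<in> Y \<inter> H})"
    unfolding AutQ_topology_def by (subst Int_commute) (rule openin_subtopology_Int)
  moreover have "carrier (AutQ H) \<inter> {\<sigma> \<in> topspace (product_topology (\<lambda>_. discrete_topology H) H). \<sigma> x \<in> Y \<inter> H}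
      = {\<sigma> \<in> carrier (AutQ H). \<sigma> x \<in> Y}"
  proof -
    have "carrier (AutQ H) \<subseteq> topspace (product_topology (\<lambda>_. discrete_topology H) H)"
      using topspace_AutQ[of H] unfolding AutQ_topology_def topspace_subtopology by blast
    moreover have "\<sigma> x \<in> H" if "\<sigma> \<in> carrier (AutQ H)" for \<sigma> by (rule AutQ_mem[OF that assms])
    ultimately show ?thesis by blast
  qed
  ultimately show ?thesis by simp
qed

lemma evaluation_measurable:
  assumes "x \<in> H" shows "(\<lambda>\<sigma>. \<sigma> x) \<in> borel_measurable (borel_of (AutQ_topology H))"
proof (rule measurableI)
  fix Y :: "complex set" assume "Y \<in> sets borel"
  have "(\<lambda>\<sigma>. \<sigma> x) -` Y \<inter> space (borel_of (AutQ_topology H)) = {\<sigma> \<in> carrier (AutQ H). \<sigma> x \<in> Y}"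
    unfolding space_borel_AutQ by blast
  then show "(\<lambda>\<sigma>. \<sigma> x) -` Y \<inter> space (borel_of (AutQ_topology H)) \<in> sets (borel_of (AutQ_topology H))"
    using sets_borel_AutQ_open[OF openin_AutQ_evaluation[OF assms, of Y]] by simp
qed simp

text \<open>A basic neighbourhood is recorded as a list of argument-value pairs, which makes the
  neighbourhoods countably many when \<open>H\<close> is countable.\<close>

lemma openin_AutQ_cylinder:
  assumes "openin (AutQ_topology H) U" "\<sigma> \<in> U"
  shows "\<exists>l. l \<in> lists (H \<times> H) \<and> (\<forall>p\<in>set l. \<sigma> (fst p) = snd p) \<and>
    (\<forall>\<tau>\<in>carrier (AutQ H). (\<forall>p\<in>set l. \<tau> (fst p) = snd p) \<longrightarrow> \<tau> \<in> U)"
proof -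
  obtain V where V: "openin (product_topology (\<lambda>_. discrete_topology H) H) V" "U = V \<inter> carrier (AutQ H)"
    using assms(1) unfolding AutQ_topology_def openin_subtopology by blast
  have "\<sigma> \<in> V" using assms(2) V(2) by blast
  then obtain W where W: "finite {i \<in> H. W i \<noteq> topspace (discrete_topology H)}" "\<sigma> \<in> Pi\<^sub>E H W" "Pi\<^sub>E H W \<subseteq> V"
    using V(1) unfolding openin_product_topology_alt by blast
  obtain F where F: "set F = {i \<in> H. W i \<noteq> H}" using finite_list[OF W(1)] by auto
  let ?l = "map (\<lambda>x. (x, \<sigma> x)) F"
  have \<sigma>: "\<sigma> \<in> carrier (AutQ H)" using assms(2) V(2) by blast
  have "?l \<in> lists (H \<times> H)" using F AutQ_mem[OF \<sigma>] by auto
  moreover have "\<tau> \<in> U" if t: "\<tau> \<in> carrier (AutQ H)" "\<forall>p\<in>set ?l. \<tau> (fst p) = snd p" for \<tau>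
  proof -
    have "\<tau> \<in> Pi\<^sub>E H W"
    proof (rule PiE_I)
      fix x assume x: "x \<in> H"
      show "\<tau> x \<in> W x"
      proof (cases "W x = H")
        case True then show ?thesis using AutQ_mem[OF t(1) x] by simp
      next
        case False
        then have "x \<in> set F" using F x by blast
        then have "\<tau> x = \<sigma> x" using t(2) by simp
        then show ?thesis using W(2) x by (auto simp: PiE_def Pi_def)
      qed
    next
      fix x assume "x \<notin> H" then show "\<tau> x = undefined" using AutQ_ext[OF t(1)] by (simp add: extensional_def)
    qed
    then show ?thesis using W(3) V(2) t(1) by blast
  qed
  ultimately show ?thesis by (intro exI[of _ ?l]) auto
qed

text \<open>For countable \<open>H\<close> an open set is a countable union of cylinders, and a
  cylinder is a finite intersection of evaluation conditions.\<close>

lemma measurable_into_AutQ: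
  assumes H: "countable H" and f: "\<And>\<omega>. \<omega> \<in> space N \<Longrightarrow> f \<omega> \<in> carrier (AutQ H)"
    and ev: "\<And>x. x \<in> H \<Longrightarrow> (\<lambda>\<omega>. f \<omega> x) \<in> borel_measurable N"
  shows "f \<in> measurable N (borel_of (AutQ_topology H))"
  unfolding borel_of_def topspace_AutQ
proof (rule measurable_measure_of[OF open_AutQ_subset])
  show "f \<in> space N \<rightarrow> carrier (AutQ H)" using f by blast
  fix U assume "U \<in> {U. openin (AutQ_topology H) U}"
  then have U: "openin (AutQ_topology H) U" by simp
  define L where "L = {l \<in> lists (H \<times> H). \<forall>\<tau>\<in>carrier (AutQ H). (\<forall>p\<in>set l. \<tau> (fst p) = snd p) \<longrightarrow> \<tau> \<in> U}"
  have L: "countable L"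
    by (rule countable_subset[of _ "lists (H \<times> H)"]) (auto simp: L_def intro!: countable_lists H)
  have "f -` U \<inter> space N = (\<Union>l\<in>L. {\<omega> \<in> space N. \<forall>p\<in>set l. f \<omega> (fst p) = snd p})"
  proof (intro equalityI subsetI)
    fix \<omega> assume w: "\<omega> \<in> f -` U \<inter> space N"
    then have "f \<omega> \<in> U" by blast
    from openin_AutQ_cylinder[OF U this] obtain l where "l \<in> lists (H \<times> H)" "\<forall>p\<in>set l. f \<omega> (fst p) = snd p"
      "\<forall>\<tau>\<in>carrier (AutQ H). (\<forall>p\<in>set l. \<tau> (fst p) = snd p) \<longrightarrow> \<tau> \<in> U" by (elim exE conjE)
    then show "\<omega> \<in> (\<Union>l\<in>L. {\<omega> \<in> space N. \<forall>p\<in>set l. f \<omega> (fst p) = snd p})"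
      using w unfolding L_def by blast
  next
    fix \<omega> assume "\<omega> \<in> (\<Union>l\<in>L. {\<omega> \<in> space N. \<forall>p\<in>set l. f \<omega> (fst p) = snd p})"
    then show "\<omega> \<in> f -` U \<inter> space N" using f unfolding L_def by blast
  qed
  moreover have "{\<omega> \<in> space N. \<forall>p\<in>set l. f \<omega> (fst p) = snd p} \<in> sets N" if "l \<in> L" for l
  proof -
    have m: "{\<omega> \<in> space N. f \<omega> (fst p) = snd p} \<in> sets N" if "p \<in> set l" for p
    proof -
      have "fst p \<in> H" using \<open>l \<in> L\<close> \<open>p \<in> set l\<close> unfolding L_def by auto
      from measurable_sets[OF ev[OF this], of "{snd p}"]
      have "(\<lambda>\<omega>. f \<omega> (fst p)) -` {snd p} \<inter> space N \<in> sets N" by simp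
      also have "(\<lambda>\<omega>. f \<omega> (fst p)) -` {snd p} \<inter> space N = {\<omega> \<in> space N. f \<omega> (fst p) = snd p}" by blast
      finally show ?thesis .
    qed
    show ?thesis by (rule sets.sets_Collect_finite_All[OF m]) auto
  qed
  ultimately show "f -` U \<inter> space N \<in> sets N"
    using sets.countable_UN''[OF L, of "\<lambda>l. {\<omega> \<in> space N. \<forall>p\<in>set l. f \<omega> (fst p) = snd p}" N] by simp
qed

lemma countable_Qstar: "countable Qstar"
proof -
  have "countable (range (of_rat :: rat \<Rightarrow> complex))" by (rule countable_image) simp
  then have "countable (\<rat> :: complex set)" unfolding Rats_def .
  then show ?thesis unfolding Qstar_def by (rule countable_Diff)
qed

lemma countable_rad_inf: assumes "\<Gamma> \<subseteq> Qstar" shows "countable (rad_inf \<Gamma>)"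
proof -
  have "rad_inf \<Gamma> \<subseteq> (\<Union>m\<in>{1..}. \<Union>q\<in>Qstar. {z. z ^ m = q})"
  proof
    fix x assume "x \<in> rad_inf \<Gamma>"
    then obtain m where m: "m \<ge> 1" "x ^ m \<in> \<Gamma>" unfolding rad_inf_iff by blast
    then have "m \<in> {1..}" "x ^ m \<in> Qstar" using assms by auto
    then show "x \<in> (\<Union>m\<in>{1..}. \<Union>q\<in>Qstar. {z. z ^ m = q})" by blast
  qed
  moreover have "countable (\<Union>m\<in>{1::nat..}. \<Union>q\<in>Qstar. {z::complex. z ^ m = q})"
  proof (rule countable_UN, simp, rule countable_UN, rule countable_Qstar)
    fix m :: nat and q :: complex assume "m \<in> {1..}"
    then show "countable {z. z ^ m = q}" by (intro countable_finite finite_nth_roots) simp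
  qed
  ultimately show ?thesis by (rule countable_subset)
qed

section \<open>The restriction isomorphism\<close>

text \<open>Bezout: with \<open>s * c + t * d = 1\<close> the factors are the powers of
  \<open>x\<close> with exponents \<open>s * c\<close> and \<open>t * d\<close>, so they are
  rational if \<open>x\<close> is.\<close>

lemma coprime_split:
  assumes \<Gamma>: "mgroup \<Gamma>" and x: "x \<noteq> 0" "x ^ (c * d) \<in> \<Gamma>" and "coprime c (d::nat)"
  shows "\<exists>y z. y \<noteq> 0 \<and> z \<noteq> 0 \<and> x = y * z \<and> y ^ d \<in> \<Gamma> \<and> z ^ c \<in> \<Gamma> \<and> (x \<in> Qstar \<longrightarrow> z \<in> Qstar)"
proof -
  have "coprime (int c) (int d)" using assms(4) by (simp only: coprime_int_iff)
  then obtain s t where st: "s * int c + t * int d = 1"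
    using bezout_int[of "int c" "int d"] by auto
  define y z where "y = x powi (s * int c)" and "z = x powi (t * int d)"
  have nz: "y \<noteq> 0" "z \<noteq> 0" unfolding y_def z_def using x(1) by auto
  have yz: "x = y * z" unfolding y_def z_def using x(1) st by (simp flip: power_int_add)
  have "y ^ d = x powi (s * int c * int d)"
    unfolding y_def by (simp only: power_int_mult power_int_of_nat)
  also have "\<dots> = x powi (int (c * d) * s)" by (simp add: mult_ac)
  also have "\<dots> = (x ^ (c * d)) powi s" by (simp only: power_int_mult power_int_of_nat)
  finally have yk: "y ^ d \<in> \<Gamma>" using mgroup_power_int[OF \<Gamma> x(2)] by simp
  have "z ^ c = x powi (t * int d * int c)"
    unfolding z_def by (simp only: power_int_mult power_int_of_nat)
  also have "\<dots> = x powi (int (c * d) * t)" by (simp add: mult_ac)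
  also have "\<dots> = (x ^ (c * d)) powi t" by (simp only: power_int_mult power_int_of_nat)
  finally have zc: "z ^ c \<in> \<Gamma>" using mgroup_power_int[OF \<Gamma> x(2)] by simp
  have "x \<in> Qstar \<longrightarrow> z \<in> Qstar" unfolding z_def using mgroup_power_int[OF mgroup_Qstar] by blast
  then show ?thesis using nz yz yk zc by blast
qed

lemma coprime_powers_mem:
  assumes \<Gamma>: "mgroup \<Gamma>" and x: "x \<noteq> 0" "x ^ c \<in> \<Gamma>" "x ^ d \<in> \<Gamma>" and "coprime c (d::nat)"
  shows "x \<in> \<Gamma>"
proof -
  have "coprime (int c) (int d)" using assms(5) by (simp only: coprime_int_iff)
  then obtain s t where st: "int c * s + int d * t = 1"
    using bezout_int[of "int c" "int d"] by (auto simp: mult.commute)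
  have "x = x powi (int c * s + int d * t)" unfolding st by simp
  also have "\<dots> = (x ^ c) powi s * (x ^ d) powi t" using x(1)
    by (simp only: power_int_add power_int_mult power_int_of_nat simp_thms)
  finally have "x = (x ^ c) powi s * (x ^ d) powi t" .
  then show ?thesis
    by (rule ssubst) (rule mgroup_mult[OF \<Gamma> mgroup_power_int[OF \<Gamma> x(2)] mgroup_power_int[OF \<Gamma> x(3)]])
qed

lemma prime_part:
  assumes "m \<ge> (1::nat)" "Factorial_Ring.prime (p::nat)"
  shows "\<exists>e k. m = p ^ e * k \<and> k \<ge> 1 \<and> coprime k p \<and> (p dvd m \<longrightarrow> k < m)"
proof -
  have m0: "m \<noteq> 0" "\<not> is_unit p" using assms by auto
  obtain k where k: "m = p ^ multiplicity p m * k" "\<not> p dvd k"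
    using multiplicity_decompose'[OF m0] by metis
  have c: "coprime k p" using prime_imp_coprime[OF assms(2) k(2)] by (rule coprime_commute[THEN iffD1])
  have k1: "k \<ge> 1" using k(1) m0(1) by (cases k) auto
  have "k < m" if "p dvd m"
  proof -
    have "k dvd m" using k(1) by (metis dvd_triv_right)
    then have "k \<le> m" using m0(1) by (simp add: dvd_imp_le)
    moreover have "k \<noteq> m" using that k(2) by blast
    ultimately show ?thesis by simp
  qed
  then show ?thesis using k(1) k1 c by blast
qed

text \<open>The prime-power parts generate: splitting the exponent into a power of \<open>p\<close>
  and a cofactor prime to \<open>p\<close> writes \<open>x\<close> as a product with one factor in
  the \<open>p\<close>-part and one of smaller exponent.\<close>

lemma rad_inf_induct:
  assumes \<Gamma>: "mgroup \<Gamma>" and "x \<in> rad_inf \<Gamma>"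
    and prime: "\<And>p x. Factorial_Ring.prime p \<Longrightarrow> x \<in> rad_pinf p \<Gamma> \<Longrightarrow> Q x"
    and mult: "\<And>x y. x \<in> rad_inf \<Gamma> \<Longrightarrow> y \<in> rad_inf \<Gamma> \<Longrightarrow> Q x \<Longrightarrow> Q y \<Longrightarrow> Q (x * y)"
  shows "Q x"
proof -
  have "\<forall>x. x \<noteq> 0 \<longrightarrow> x ^ m \<in> \<Gamma> \<longrightarrow> m \<ge> 1 \<longrightarrow> Q x" for m
  proof (induction m rule: less_induct)
    case (less m)
    show ?case
    proof (intro allI impI)
      fix x assume x: "x \<noteq> 0" "x ^ m \<in> \<Gamma>" "m \<ge> 1"
      show "Q x"
      proof (cases "m = 1")
        case True
        then have "x \<in> rad_pinf 2 \<Gamma>" using x rad_pinf_superset[OF \<Gamma>, of 2] by auto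
        then show ?thesis by (rule prime[OF two_is_prime_nat])
      next
        case False
        then obtain p where p: "Factorial_Ring.prime p" "p dvd m" using prime_factor_nat by blast
        obtain e k where k: "m = p ^ e * k" "k \<ge> 1" "coprime k p" "p dvd m \<longrightarrow> k < m"
          using prime_part[OF x(3) p(1)] by blast
        have cop: "coprime (p ^ e) k" using k(3) by (simp add: coprime_commute)
        obtain y z where yz: "y \<noteq> 0" "z \<noteq> 0" "x = y * z" "y ^ k \<in> \<Gamma>" "z ^ (p ^ e) \<in> \<Gamma>"
          using coprime_split[OF \<Gamma> x(1) x(2)[unfolded k(1)] cop] by blast
        have "k < m" using k(4) p(2) by blast
        then have "e \<noteq> 0" using k(1) by (cases e) auto
        then have zp: "z \<in> rad_pinf p \<Gamma>" using yz(2,5) by (intro rad_pinfI) auto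
        have "Q y" using less.IH[OF \<open>k < m\<close>] yz(1,4) k(2) by blast
        moreover have "Q z" by (rule prime[OF p(1) zp])
        moreover have "y \<in> rad_inf \<Gamma>" by (rule rad_infI[OF yz(1) k(2) yz(4)])
        moreover have "z \<in> rad_inf \<Gamma>"
          using rad_pinf_subset[OF \<Gamma>, of p] zp prime_ge_1_nat[OF p(1)] by blast
        ultimately show ?thesis unfolding yz(3) using mult by blast
      qed
    qed
  qed
  then show ?thesis using assms(2) unfolding rad_inf_iff by blast
qed

context
  fixes \<Gamma> assumes \<Gamma>: "mgroup \<Gamma>" "\<Gamma> \<subseteq> Qstar"
begin

lemma rad_pinf_prime_subset: "Factorial_Ring.prime p \<Longrightarrow> rad_pinf p \<Gamma> \<subseteq> rad_inf \<Gamma>"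
  by (rule rad_pinf_subset[OF \<Gamma>(1) prime_ge_1_nat])

lemma A_to_prod_mem:
  assumes "\<sigma> \<in> carrier (A_group \<Gamma>)"
  shows "A_to_prod \<Gamma> \<sigma> \<in> (\<Pi>\<^sub>E p\<in>{p. Factorial_Ring.prime p}. carrier (Ap_group \<Gamma> p))"
  unfolding A_to_prod_def Ap_group_def
proof (rule restrict_PiE_iff[THEN iffD2], rule ballI)
  fix p :: nat assume "p \<in> {p. Factorial_Ring.prime p}"
  then have p: "Factorial_Ring.prime p" by simp
  show "restrict \<sigma> (rad_pinf p \<Gamma>) \<in> carrier (AutQ (rad_pinf p \<Gamma>))"
    by (rule restrict_AutQ[OF radical_group_rad_inf[OF \<Gamma>] radical_group_rad_pinf[OF \<Gamma> prime_ge_1_nat[OF p]]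
          rad_pinf_prime_subset[OF p] assms[unfolded A_group_def]])
qed

lemma A_to_prod_inj: "inj_on (A_to_prod \<Gamma>) (carrier (A_group \<Gamma>))"
proof (rule inj_onI)
  fix \<sigma> \<tau> assume s: "\<sigma> \<in> carrier (A_group \<Gamma>)" and t: "\<tau> \<in> carrier (A_group \<Gamma>)"
    and eq: "A_to_prod \<Gamma> \<sigma> = A_to_prod \<Gamma> \<tau>"
  note s = s[unfolded A_group_def] and t = t[unfolded A_group_def]
  note M = mgroup_rad_inf[OF \<Gamma>(1)]
  note hs = AutQ_mhom[OF s M] and ht = AutQ_mhom[OF t M]
  show "\<sigma> = \<tau>"
  proof (rule extensionalityI[OF AutQ_ext[OF s] AutQ_ext[OF t]])
    fix x assume "x \<in> rad_inf \<Gamma>"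
    then show "\<sigma> x = \<tau> x"
    proof (rule rad_inf_induct[OF \<Gamma>(1)])
      fix p :: nat and y assume p: "Factorial_Ring.prime p" and y: "y \<in> rad_pinf p \<Gamma>"
      have "A_to_prod \<Gamma> \<sigma> p y = A_to_prod \<Gamma> \<tau> p y" using eq by simp
      then show "\<sigma> y = \<tau> y" using p y by (simp add: A_to_prod_def)
    next
      fix y z assume "y \<in> rad_inf \<Gamma>" "z \<in> rad_inf \<Gamma>" "\<sigma> y = \<tau> y" "\<sigma> z = \<tau> z"
      then show "\<sigma> (y * z) = \<tau> (y * z)" using mhom_mult[OF M hs] mhom_mult[OF M ht] by simp
    qed
  qed
qed

text \<open>Gluing: \<open>\<sigma> x\<close> is \<open>x\<close> times the product over all
  \<open>p\<close> of \<open>\<omega> p y / y\<close>, where \<open>y\<close> is a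
  \<open>p\<close>-part of \<open>x\<close>, i.e. \<open>x / y\<close> has a power prime to
  \<open>p\<close> in Gamma. Two \<open>p\<close>-parts differ by an element of Gamma, which is
  rational and fixed, so the factor is well defined; it is 1 unless \<open>p\<close> divides every
  exponent taking \<open>x\<close> into Gamma, so the product is finite.\<close>

lemma A_to_prod_surj:
  assumes \<omega>: "\<omega> \<in> (\<Pi>\<^sub>E p\<in>{p. Factorial_Ring.prime p}. carrier (Ap_group \<Gamma> p))"
  shows "\<exists>\<sigma>\<in>carrier (A_group \<Gamma>). A_to_prod \<Gamma> \<sigma> = \<omega>"
proof -
  define valid where "valid p x y \<longleftrightarrow> y \<in> rad_pinf p \<Gamma> \<and> (\<exists>k. coprime k p \<and> (x / y) ^ k \<in> \<Gamma>)" for p :: nat and x y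
  define E where "E p x = (let y = SOME y. valid p x y in \<omega> p y / y)" for p x
  note M = mgroup_rad_inf[OF \<Gamma>(1)]
  note Mp = mgroup_rad_pinf[OF \<Gamma>(1)]
  have wp: "\<omega> p \<in> carrier (AutQ (rad_pinf p \<Gamma>))" if "Factorial_Ring.prime p" for p
    using \<omega> that unfolding Ap_group_def by (auto simp: PiE_def Pi_def)
  note wh = AutQ_mhom[OF wp Mp]
  have wfix: "\<omega> p y = y" if "Factorial_Ring.prime p" "y \<in> rad_pinf p \<Gamma>" "y \<in> Qstar" for p y
    by (rule AutQ_fix[OF wp[OF that(1)] that(2,3)])
  have validE: "E p x = \<omega> p y / y" if p: "Factorial_Ring.prime p" and v: "valid p x y" and x: "x \<noteq> 0" for p x y
  proof -
    define z where "z = (SOME y. valid p x y)"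
    have z: "valid p x z" unfolding z_def using v by (rule someI)
    obtain k where k: "coprime k p" "(x / y) ^ k \<in> \<Gamma>" using v unfolding valid_def by blast
    obtain l where l: "coprime l p" "(x / z) ^ l \<in> \<Gamma>" using z unfolding valid_def by blast
    have ym: "y \<in> rad_pinf p \<Gamma>" and zm: "z \<in> rad_pinf p \<Gamma>" using v z unfolding valid_def by blast+
    have nz: "y \<noteq> 0" "z \<noteq> 0" using mgroup_nonzero[OF Mp] ym zm by blast+
    have yz: "y / z \<in> rad_pinf p \<Gamma>" by (rule mgroup_divide[OF Mp ym zm])
    then obtain j where j: "(y / z) ^ (p ^ j) \<in> \<Gamma>" unfolding rad_pinf_iff by blast
    have "(y / z) ^ (k * l) = ((x / z) ^ l) ^ k / ((x / y) ^ k) ^ l"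
      using nz x by (simp add: power_divide power_mult field_simps) (metis mult.commute power_mult)
    then have "(y / z) ^ (k * l) \<in> \<Gamma>"
      using mgroup_divide[OF \<Gamma>(1) mgroup_power[OF \<Gamma>(1) l(2)] mgroup_power[OF \<Gamma>(1) k(2)]] by simp
    moreover have "coprime (k * l) (p ^ j)" using k(1) l(1) by simp
    ultimately have g: "y / z \<in> \<Gamma>" using coprime_powers_mem[OF \<Gamma>(1) _ _ j] nz by simp
    have "\<omega> p (y / z) = y / z" by (rule wfix[OF p yz]) (use g \<Gamma>(2) in blast)
    then have "\<omega> p y / \<omega> p z = y / z" using mhom_divide[OF Mp wh[OF p] ym zm] by simp
    then have "\<omega> p z / z = \<omega> p y / y"
      using nz mhom_nonzero[OF Mp wh[OF p] zm] mhom_nonzero[OF Mp wh[OF p] ym] by (simp add: field_simps)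
    then show ?thesis unfolding E_def z_def[symmetric] Let_def .
  qed
  have valid_ex: "\<exists>y. valid p x y \<and> (x \<in> Qstar \<longrightarrow> y \<in> Qstar)" if p: "Factorial_Ring.prime p" and x: "x \<in> rad_inf \<Gamma>" for p x
  proof -
    obtain m where m: "m \<ge> 1" "x ^ m \<in> \<Gamma>" and x0: "x \<noteq> 0" using x unfolding rad_inf_iff by blast
    obtain e k where k: "m = p ^ e * k" "coprime k p" using prime_part[OF m(1) p] by blast
    have cop: "coprime (p ^ e) k" using k(2) by (simp add: coprime_commute)
    obtain y z where yz: "y \<noteq> 0" "z \<noteq> 0" "x = y * z" "y ^ k \<in> \<Gamma>" "z ^ (p ^ e) \<in> \<Gamma>" "x \<in> Qstar \<longrightarrow> z \<in> Qstar"
      using coprime_split[OF \<Gamma>(1) x0 m(2)[unfolded k(1)] cop] by blast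
    have "(z ^ (p ^ e)) ^ p \<in> \<Gamma>" by (rule mgroup_power[OF \<Gamma>(1) yz(5)])
    then have "z ^ (p ^ Suc e) \<in> \<Gamma>" by (simp add: power_mult[symmetric] mult.commute)
    then have "z \<in> rad_pinf p \<Gamma>" using yz(2) by (intro rad_pinfI[of z "Suc e"]) auto
    moreover have "(x / z) ^ k \<in> \<Gamma>" using yz by simp
    ultimately show ?thesis using k(2) yz(6) unfolding valid_def by blast
  qed
  have E_mult: "E p (x * y) = E p x * E p y" if p: "Factorial_Ring.prime p" and x: "x \<in> rad_inf \<Gamma>" and y: "y \<in> rad_inf \<Gamma>" for p x y
  proof -
    obtain u where u: "valid p x u" using valid_ex[OF p x] by blast
    obtain v where v: "valid p y v" using valid_ex[OF p y] by blast
    obtain k where k: "coprime k p" "(x / u) ^ k \<in> \<Gamma>" using u unfolding valid_def by blast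
    obtain l where l: "coprime l p" "(y / v) ^ l \<in> \<Gamma>" using v unfolding valid_def by blast
    have um: "u \<in> rad_pinf p \<Gamma>" and vm: "v \<in> rad_pinf p \<Gamma>" using u v unfolding valid_def by blast+
    have "((x * y) / (u * v)) ^ (k * l) = ((x / u) ^ k) ^ l * ((y / v) ^ l) ^ k"
      by (simp add: power_mult[symmetric] power_mult_distrib power_divide mult.commute)
    then have "((x * y) / (u * v)) ^ (k * l) \<in> \<Gamma>"
      using mgroup_mult[OF \<Gamma>(1) mgroup_power[OF \<Gamma>(1) k(2)] mgroup_power[OF \<Gamma>(1) l(2)]] by simp
    moreover have "coprime (k * l) p" using k(1) l(1) by simp
    ultimately have uv: "valid p (x * y) (u * v)" using mgroup_mult[OF Mp um vm] unfolding valid_def by blast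
    have nz: "x \<noteq> 0" "y \<noteq> 0" "x * y \<noteq> 0" using mgroup_nonzero[OF M] x y by auto
    show ?thesis unfolding validE[OF p uv nz(3)] validE[OF p u nz(1)] validE[OF p v nz(2)]
        mhom_mult[OF Mp wh[OF p] um vm] by simp
  qed
  have E_nonzero: "E p x \<noteq> 0" if p: "Factorial_Ring.prime p" and x: "x \<in> rad_inf \<Gamma>" for p x
  proof -
    obtain u where u: "valid p x u" using valid_ex[OF p x] by blast
    have um: "u \<in> rad_pinf p \<Gamma>" using u unfolding valid_def by blast
    have nz: "x \<noteq> 0" using mgroup_nonzero[OF M] x by auto
    show ?thesis unfolding validE[OF p u nz]
      using mgroup_nonzero[OF Mp um] mhom_nonzero[OF Mp wh[OF p] um] by simp
  qed
  have E_trivial: "E p x = 1" if p: "Factorial_Ring.prime p" and x: "x \<noteq> 0" "x ^ m \<in> \<Gamma>" "\<not> p dvd m" for p x m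
  proof -
    have "coprime m p" using prime_imp_coprime[OF p x(3)] by (rule coprime_commute[THEN iffD1])
    then have "valid p x 1" unfolding valid_def using x(2) mgroup_one[OF Mp] by auto
    from validE[OF p this x(1)] show ?thesis using mhom_one[OF Mp wh[OF p]] by simp
  qed
  have E_fix: "E p x = 1" if p: "Factorial_Ring.prime p" and x: "x \<in> rad_inf \<Gamma>" "x \<in> Qstar" for p x
  proof -
    obtain u where u: "valid p x u" "u \<in> Qstar" using valid_ex[OF p x(1)] x(2) by blast
    have um: "u \<in> rad_pinf p \<Gamma>" using u unfolding valid_def by blast
    have nz: "x \<noteq> 0" using mgroup_nonzero[OF M] x(1) by auto
    show ?thesis unfolding validE[OF p u(1) nz] wfix[OF p um u(2)] using mgroup_nonzero[OF Mp um] by simp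
  qed
  have E_local: "x * E p x = \<omega> p x" if p: "Factorial_Ring.prime p" and x: "x \<in> rad_pinf p \<Gamma>" for p x
  proof -
    have nz: "x \<noteq> 0" using mgroup_nonzero[OF Mp] x by auto
    have "coprime 1 p" by simp
    moreover have "(x / x) ^ 1 \<in> \<Gamma>" using nz mgroup_one[OF \<Gamma>(1)] by simp
    ultimately have "valid p x x" unfolding valid_def using x by blast
    then show ?thesis using validE[OF p _ nz] nz by simp
  qed
  define D where "D m = {p. Factorial_Ring.prime p \<and> p dvd m}" for m :: nat
  have finD: "finite (D m)" if "m \<ge> 1" for m unfolding D_def using that by (intro finite_subset[OF _ finite_divisors_nat[of m]]) auto
  define \<sigma> where "\<sigma> = (\<lambda>x\<in>rad_inf \<Gamma>. x * (\<Prod>p\<in>{p. Factorial_Ring.prime p \<and> E p x \<noteq> 1}. E p x))"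
  \<comment> \<open>The factor \<open>l\<close> only enlarges the set of primes, so that
    \<open>x\<close>, \<open>y\<close> and \<open>x * y\<close> can be evaluated over a common
    one.\<close>
  have \<sigma>: "\<sigma> x = x * (\<Prod>p\<in>D (m * l). E p x)" if x: "x \<noteq> 0" "x ^ m \<in> \<Gamma>" "m \<ge> 1" "l \<ge> 1" for x m l
  proof -
    have "(\<Prod>p\<in>{p. Factorial_Ring.prime p \<and> E p x \<noteq> 1}. E p x) = (\<Prod>p\<in>D (m * l). E p x)"
    proof (rule prod.mono_neutral_left)
      show "finite (D (m * l))" by (rule finD) (use x(3,4) in simp)
      show "{p. Factorial_Ring.prime p \<and> E p x \<noteq> 1} \<subseteq> D (m * l)"
        using E_trivial[OF _ x(1,2)] unfolding D_def by (blast intro: dvd_mult2)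
      show "\<forall>p\<in>D (m * l) - {p. Factorial_Ring.prime p \<and> E p x \<noteq> 1}. E p x = 1" unfolding D_def by blast
    qed
    moreover have "x \<in> rad_inf \<Gamma>" by (rule rad_infI[OF x(1,3,2)])
    ultimately show ?thesis unfolding \<sigma>_def by simp
  qed
  have prD: "Factorial_Ring.prime p" if "p \<in> D m" for p m using that unfolding D_def by blast
  have hom: "mhom (rad_inf \<Gamma>) \<sigma>"
    unfolding mhom_def
  proof (intro conjI ballI)
    fix x assume x: "x \<in> rad_inf \<Gamma>"
    then obtain m where m: "m \<ge> 1" "x ^ m \<in> \<Gamma>" "x \<noteq> 0" unfolding rad_inf_iff by blast
    have f: "finite (D (m * 1))" by (rule finD) (use m(1) in simp)
    have "(\<Prod>p\<in>D (m * 1). E p x) \<noteq> 0"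
      unfolding prod_zero_iff[OF f] using E_nonzero[OF prD x] by blast
    then show "\<sigma> x \<noteq> 0" unfolding \<sigma>[OF m(3,2,1) order_refl] using m(3) by (rule no_zero_divisors[rotated])
    fix y assume y: "y \<in> rad_inf \<Gamma>"
    then obtain l where l: "l \<ge> 1" "y ^ l \<in> \<Gamma>" "y \<noteq> 0" unfolding rad_inf_iff by blast
    have "(x * y) ^ (m * l) = (x ^ m) ^ l * (y ^ l) ^ m"
      unfolding power_mult_distrib power_mult[symmetric] mult.commute[of l m] by (rule refl)
    then have xy: "(x * y) ^ (m * l) \<in> \<Gamma>"
      using mgroup_mult[OF \<Gamma>(1) mgroup_power[OF \<Gamma>(1) m(2)] mgroup_power[OF \<Gamma>(1) l(2)]] by simp
    have nz: "x * y \<noteq> 0" and ml: "m * l \<ge> 1" using m l by auto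
    have "(\<Prod>p\<in>D (m * l). E p (x * y)) = (\<Prod>p\<in>D (m * l). E p x) * (\<Prod>p\<in>D (m * l). E p y)"
      unfolding prod.distrib[symmetric] by (rule prod.cong[OF refl]) (rule E_mult[OF prD x y])
    then show "\<sigma> (x * y) = \<sigma> x * \<sigma> y"
      using \<sigma>[OF nz xy ml order_refl] \<sigma>[OF m(3,2,1) l(1)] \<sigma>[OF l(3,2,1) m(1)]
      by (simp add: mult.commute[of l m])
  qed
  have loc: "\<sigma> x = \<omega> p x" if p: "Factorial_Ring.prime p" and x: "x \<in> rad_pinf p \<Gamma>" for p x
  proof -
    obtain j where j: "x \<noteq> 0" "x ^ (p ^ j) \<in> \<Gamma>" "j \<ge> 1" using x unfolding rad_pinf_iff by blast
    have pj: "p ^ j \<ge> 1" using prime_gt_0_nat[OF p] by simp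
    have D1: "D (p ^ j * 1) = {p}"
    proof (intro equalityI subsetI)
      fix q assume "q \<in> D (p ^ j * 1)"
      then have "Factorial_Ring.prime q" "q dvd p ^ j" unfolding D_def by auto
      then have "q dvd p" by (rule prime_dvd_power)
      then have "q = p" by (rule primes_dvd_imp_eq[OF \<open>Factorial_Ring.prime q\<close> p])
      then show "q \<in> {p}" by simp
    next
      fix q assume "q \<in> {p}"
      then show "q \<in> D (p ^ j * 1)" unfolding D_def using p j(3) by (auto intro: dvd_power)
    qed
    then show ?thesis using \<sigma>[OF j(1,2) pj order_refl] E_local[OF p x] unfolding D1 by simp
  qed
  have fixQ: "\<sigma> x = x" if "x \<in> rad_inf \<Gamma>" "x \<in> Qstar" for x
  proof -
    have "{p. Factorial_Ring.prime p \<and> E p x \<noteq> 1} = {}" using E_fix[OF _ that] by blast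
    then show ?thesis unfolding \<sigma>_def using that(1) by simp
  qed
  \<comment> \<open>An element sent to 1 is torsion. If \<open>p\<close> divides its exponent, a
    power of it lies in the \<open>p\<close>-part, where \<open>\<sigma>\<close> agrees with the
    injective \<open>\<omega> p\<close>; so the exponent can be lowered.\<close>
  have tors: "\<forall>x\<in>rad_inf \<Gamma>. x ^ m = 1 \<longrightarrow> m \<ge> 1 \<longrightarrow> \<sigma> x = 1 \<longrightarrow> x = 1" for m
  proof (induction m rule: less_induct)
    case (less m)
    show ?case
    proof (intro ballI impI)
      fix x assume x: "x \<in> rad_inf \<Gamma>" "x ^ m = 1" "m \<ge> 1" "\<sigma> x = 1"
      show "x = 1"
      proof (cases "m = 1")
        case True then show ?thesis using x(2) by simp
      next
        case False
        then obtain p where p: "Factorial_Ring.prime p" "p dvd m" using prime_factor_nat by blast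
        then obtain k where k: "m = p * k" by blast
        have k1: "k \<ge> 1" using k x(3) by (cases k) auto
        have "k < m" using k k1 prime_gt_1_nat[OF p(1)] by simp
        have "(x ^ k) ^ p = 1" using x(2) unfolding k by (simp add: power_mult[symmetric] mult.commute)
        then have "(x ^ k) ^ (p ^ 1) \<in> \<Gamma>" using mgroup_one[OF \<Gamma>(1)] by simp
        moreover have "x \<noteq> 0" using mgroup_nonzero[OF M x(1)] .
        ultimately have xk: "x ^ k \<in> rad_pinf p \<Gamma>" by (intro rad_pinfI[of _ 1]) auto
        have "\<omega> p (x ^ k) = 1" using loc[OF p(1) xk] mhom_power[OF M hom x(1)] x(4) by simp
        then have "x ^ k = 1" by (rule AutQ_inj[OF wp[OF p(1)] Mp xk])
        then show ?thesis using less.IH[OF \<open>k < m\<close>] x(1,4) k1 by blast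
      qed
    qed
  qed
  have "\<sigma> \<in> carrier (AutQ (rad_inf \<Gamma>))"
  proof (rule AutQ_I[OF radical_group_rad_inf[OF \<Gamma>] hom _ fixQ])
    show "\<sigma> \<in> extensional (rad_inf \<Gamma>)" unfolding \<sigma>_def by simp
    fix x assume x: "x \<in> rad_inf \<Gamma>" "\<sigma> x = 1"
    obtain m where m: "m \<ge> 1" "x ^ m \<in> \<Gamma>" using x(1) unfolding rad_inf_iff by blast
    have "\<sigma> (x ^ m) = x ^ m" by (rule fixQ) (use m \<Gamma>(2) rad_inf_superset[OF \<Gamma>(1)] in auto)
    then have "x ^ m = 1" using mhom_power[OF M hom x(1)] x(2) by simp
    then show "x = 1" using tors m(1) x by blast
  qed
  moreover have "A_to_prod \<Gamma> \<sigma> = \<omega>"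
  proof (rule extensionalityI[of _ "{p. Factorial_Ring.prime p}"])
    show "A_to_prod \<Gamma> \<sigma> \<in> extensional {p. Factorial_Ring.prime p}" unfolding A_to_prod_def by simp
    show "\<omega> \<in> extensional {p. Factorial_Ring.prime p}" using \<omega> by (simp add: PiE_def)
    fix p :: nat assume "p \<in> {p. Factorial_Ring.prime p}"
    then have p: "Factorial_Ring.prime p" by simp
    have "restrict \<sigma> (rad_pinf p \<Gamma>) = \<omega> p"
      by (rule extensionalityI[OF restrict_extensional AutQ_ext[OF wp[OF p]]]) (simp add: loc[OF p])
    then show "A_to_prod \<Gamma> \<sigma> p = \<omega> p" using p unfolding A_to_prod_def by simp
  qed
  ultimately show ?thesis unfolding A_group_def by blast
qed

lemma A_to_prod_bij:
  "bij_betw (A_to_prod \<Gamma>) (carrier (A_group \<Gamma>)) (\<Pi>\<^sub>E p\<in>{p. Factorial_Ring.prime p}. carrier (Ap_group \<Gamma> p))"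
  unfolding bij_betw_def using A_to_prod_inj A_to_prod_mem A_to_prod_surj by blast

end

section \<open>Haar measures\<close>

text \<open>Bounded by the sum over all integers between \<open>B\<close> and \<open>N\<close>,
  which telescopes.\<close>

lemma sum_reciprocal_tail:
  assumes "J \<subseteq> {B<..N}" "B \<ge> (1::nat)"
  shows "(\<Sum>p\<in>J. 1 / (real p * (real p - 1))) \<le> 1 / real B"
proof -
  have pos: "0 \<le> 1 / (real p * (real p - 1))" if "p \<in> {B<..N}" for p using that assms(2) by simp
  have "(\<Sum>p\<in>J. 1 / (real p * (real p - 1))) \<le> (\<Sum>p\<in>{B<..N}. 1 / (real p * (real p - 1)))"
    by (rule sum_mono2[OF _ assms(1)]) (use pos in auto)
  also have "\<dots> \<le> 1 / real B"
  proof (cases "B \<le> N")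
    case True
    have "(\<Sum>p\<in>{B<..N}. 1 / (real p * (real p - 1))) = 1 / real B - 1 / real N"
      using True
    proof (induction N rule: dec_induct)
      case base show ?case by simp
    next
      case (step N)
      have ins: "{B<..Suc N} = insert (Suc N) {B<..N}" using step(1) by auto
      have "(\<Sum>p\<in>{B<..Suc N}. 1 / (real p * (real p - 1))) =
          1 / (real (Suc N) * real N) + (1 / real B - 1 / real N)"
        unfolding ins using step by simp
      also have "1 / (real (Suc N) * real N) = 1 / real N - 1 / real (Suc N)"
        using step(1) assms(2) by (simp add: field_simps)
      finally show ?case by simp
    qed
    then show ?thesis by simp
  qed simp
  finally show ?thesis .
qed

text \<open>Continuity from above reduces to finitely many factors. Those up to \<open>B\<close>
  contribute the fixed positive \<open>d\<close>; by the Weierstrass product inequality the others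
  contribute at least 1 minus the sum of the defects, which is at least 1/2 because
  \<open>c / B\<close> is at most 1/2.\<close>

lemma PiM_box_positive:
  fixes M :: "nat \<Rightarrow> 'a measure"
  assumes prob: "\<And>i. i \<in> P \<Longrightarrow> prob_space (M i)"
    and V: "\<And>i. i \<in> P \<Longrightarrow> V i \<in> sets (M i)" "\<And>i. i \<in> P \<Longrightarrow> measure (M i) (V i) > 0"
    and tail: "\<And>i. i \<in> P \<Longrightarrow> i > B \<Longrightarrow> measure (M i) (V i) \<ge> 1 - c / (real i * (real i - 1))"
    and B: "B \<ge> 1" and c: "0 \<le> c" "c \<le> real B / 2"
  shows "Pi\<^sub>E P V \<in> sets (PiM P M)" "measure (PiM P M) (Pi\<^sub>E P V) > 0"
proof -
  interpret Q: prob_space "PiM P M" by (rule prob_space_PiM) (rule prob)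
  define W where "W N = prod_emb P M (P \<inter> {..N}) (Pi\<^sub>E (P \<inter> {..N}) V)" for N
  have Wset: "W N \<in> sets (PiM P M)" for N
    unfolding W_def by (rule sets_PiM_I) (use V in auto)
  have Weq: "W N = {\<omega> \<in> space (PiM P M). \<forall>i\<in>P. i \<le> N \<longrightarrow> \<omega> i \<in> V i}" for N
    unfolding W_def prod_emb_def space_PiM by (auto simp: PiE_def Pi_def restrict_def extensional_def)
  have inter: "Pi\<^sub>E P V = (\<Inter>N. W N)"
  proof (intro equalityI subsetI)
    fix \<omega> assume w: "\<omega> \<in> Pi\<^sub>E P V"
    then have "\<omega> \<in> space (PiM P M)"
      unfolding space_PiM using V(1)[THEN sets.sets_into_space] by (auto simp: PiE_def Pi_def)
    then show "\<omega> \<in> (\<Inter>N. W N)" unfolding Weq using w by (auto simp: PiE_def Pi_def)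
  next
    fix \<omega> assume w: "\<omega> \<in> (\<Inter>N. W N)"
    have "\<omega> \<in> space (PiM P M)" using w unfolding Weq by blast
    moreover have "\<omega> i \<in> V i" if "i \<in> P" for i using w that unfolding Weq by blast
    ultimately show "\<omega> \<in> Pi\<^sub>E P V" unfolding space_PiM by (auto simp: PiE_def Pi_def)
  qed
  have dec: "decseq W" unfolding decseq_def Weq by (auto intro: order_trans)
  show "Pi\<^sub>E P V \<in> sets (PiM P M)" unfolding inter using Wset by (intro sets.countable_INT) auto
  define d where "d = (\<Prod>i\<in>P \<inter> {..B}. measure (M i) (V i))"
  have d: "d > 0" unfolding d_def by (rule prod_pos) (use V(2) in blast)
  have le1: "measure (M i) (V i) \<le> 1" if "i \<in> P" for i
    by (rule prob_space.prob_le_1[OF prob[OF that]])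
  have bound: "d / 2 \<le> measure (PiM P M) (W N)" if N: "N \<ge> B" for N
  proof -
    have "emeasure (PiM P M) (W N) = (\<Prod>i\<in>P \<inter> {..N}. emeasure (M i) (V i))"
      unfolding W_def by (rule emeasure_PiM_emb) (use V prob in auto)
    also have "\<dots> = (\<Prod>i\<in>P \<inter> {..N}. ennreal (measure (M i) (V i)))"
      by (rule prod.cong[OF refl])
         (metis IntD1 prob finite_measure.emeasure_eq_measure prob_space.finite_measure)
    also have "\<dots> = ennreal (\<Prod>i\<in>P \<inter> {..N}. measure (M i) (V i))"
      by (rule prod_ennreal) simp
    finally have "measure (PiM P M) (W N) = (\<Prod>i\<in>P \<inter> {..N}. measure (M i) (V i))"
      unfolding measure_def[of "PiM P M"] by (simp add: prod_nonneg)
    also have "P \<inter> {..N} = (P \<inter> {..B}) \<union> (P \<inter> {B<..N})" using N by auto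
    also have "(\<Prod>i\<in>(P \<inter> {..B}) \<union> (P \<inter> {B<..N}). measure (M i) (V i)) =
        d * (\<Prod>i\<in>P \<inter> {B<..N}. measure (M i) (V i))"
      unfolding d_def by (rule prod.union_disjoint) auto
    finally have eq: "measure (PiM P M) (W N) = d * (\<Prod>i\<in>P \<inter> {B<..N}. measure (M i) (V i))" .
    define f where "f i = 1 - measure (M i) (V i)" for i
    have "1 - sum f (P \<inter> {B<..N}) \<le> (\<Prod>i\<in>P \<inter> {B<..N}. 1 - f i)"
      by (rule Weierstrass_prod_ineq) (use le1 in \<open>auto simp: f_def\<close>)
    moreover have "sum f (P \<inter> {B<..N}) \<le> 1 / 2"
    proof -
      have "sum f (P \<inter> {B<..N}) \<le> (\<Sum>i\<in>P \<inter> {B<..N}. c * (1 / (real i * (real i - 1))))"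
        by (rule sum_mono) (use tail in \<open>auto simp: f_def algebra_simps\<close>)
      also have "\<dots> = c * (\<Sum>i\<in>P \<inter> {B<..N}. 1 / (real i * (real i - 1)))" by (rule sum_distrib_left[symmetric])
      also have "\<dots> \<le> c * (1 / real B)" by (rule mult_left_mono[OF sum_reciprocal_tail[OF _ B] c(1)]) blast
      also have "\<dots> \<le> 1 / 2" using c(2) B by (simp add: field_simps)
      finally show ?thesis .
    qed
    ultimately have "1 / 2 \<le> (\<Prod>i\<in>P \<inter> {B<..N}. measure (M i) (V i))" unfolding f_def by simp
    then show ?thesis unfolding eq using d by (simp add: field_simps)
  qed
  have "(\<lambda>N. measure (PiM P M) (W N)) \<longlonglongrightarrow> measure (PiM P M) (\<Inter>N. W N)"
    by (rule Q.finite_Lim_measure_decseq) (use Wset dec in auto)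
  then have "d / 2 \<le> measure (PiM P M) (\<Inter>N. W N)"
    by (rule LIMSEQ_le_const) (use bound in blast)
  then show "measure (PiM P M) (Pi\<^sub>E P V) > 0" unfolding inter using d by simp
qed

section \<open>Haar measure of cylinders\<close>

lemma space_haar:
  assumes "normalized_haar (AutQ M) (AutQ_topology M) N"
  shows "space N = carrier (AutQ M)"
  using assms sets_eq_imp_space_eq space_borel_AutQ unfolding normalized_haar_def by metis

lemma sets_haar:
  assumes "normalized_haar (AutQ M) (AutQ_topology M) N"
  shows "sets N = sets (borel_of (AutQ_topology M))"
  using assms unfolding normalized_haar_def by blast

lemma prob_space_haar:
  assumes "normalized_haar (AutQ M) (AutQ_topology M) N"
  shows "prob_space N"
  by (rule prob_spaceI) (use assms space_haar[OF assms] in \<open>simp add: normalized_haar_def\<close>)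

lemma cylinder_measurable:
  assumes "finite F" "F \<subseteq> M"
  shows "{\<tau> \<in> carrier (AutQ M). \<forall>x\<in>F. \<tau> x = \<rho> x} \<in> sets (borel_of (AutQ_topology M))"
proof -
  have m: "{\<tau> \<in> space (borel_of (AutQ_topology M)). \<tau> x = \<rho> x} \<in> sets (borel_of (AutQ_topology M))" if "x \<in> F" for x
  proof -
    have "x \<in> M" using that assms by blast
    from sets_borel_AutQ_open[OF openin_AutQ_evaluation[OF this, of "{\<rho> x}"]]
    show ?thesis unfolding space_borel_AutQ by simp
  qed
  show ?thesis using sets.sets_Collect_finite_All[OF m assms(1)] unfolding space_borel_AutQ .
qed

text \<open>A cylinder through \<open>\<rho>\<close> is a left coset of the pointwise stabilizer of
  \<open>F\<close>, which is the form to which left invariance applies.\<close>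

lemma cylinder_coset:
  assumes M: "mgroup M" and \<rho>: "\<rho> \<in> carrier (AutQ M)" and F: "F \<subseteq> M"
  shows "{\<tau> \<in> carrier (AutQ M). \<forall>x\<in>F. \<tau> x = \<rho> x} =
    l_coset (AutQ M) \<rho> {\<tau> \<in> carrier (AutQ M). \<forall>x\<in>F. \<tau> x = x}" (is "?L = l_coset _ _ ?K")
proof (intro equalityI subsetI)
  fix \<tau> assume "\<tau> \<in> ?L"
  then have t: "\<tau> \<in> carrier (AutQ M)" and tF: "\<And>x. x \<in> F \<Longrightarrow> \<tau> x = \<rho> x" by blast+
  note br = AutQ_bij[OF \<rho>] and bt = AutQ_bij[OF t]
  note hr = AutQ_mhom[OF \<rho> M] and ht = AutQ_mhom[OF t M]
  define h where "h = (\<lambda>x\<in>M. inv_into M \<rho> (\<tau> x))"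
  have hx: "h x \<in> M" "\<rho> (h x) = \<tau> x" if "x \<in> M" for x
  proof -
    have "\<tau> x \<in> \<rho> ` M" using AutQ_mem[OF t that] br by (simp add: bij_betw_def)
    then show "h x \<in> M" "\<rho> (h x) = \<tau> x" unfolding h_def using that by (simp_all add: inv_into_into f_inv_into_f)
  qed
  have inj: "x = y" if "x \<in> M" "y \<in> M" "\<rho> x = \<rho> y" for x y
    using br that unfolding bij_betw_def inj_on_def by blast
  have fixh: "h x = x" if "x \<in> M" "\<tau> x = \<rho> x" for x
    by (rule inj[OF hx(1)[OF that(1)] that(1)]) (simp only: hx(2)[OF that(1)] that(2))
  have "h \<in> carrier (AutQ M)" unfolding AutQ_iff
  proof (intro conjI ballI)
    show "h \<in> extensional M" unfolding h_def by simp
    have "bij_betw (inv_into M \<rho> \<circ> \<tau>) M M" by (rule bij_betw_trans[OF bt bij_betw_inv_into[OF br]])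
    then show "bij_betw h M M" unfolding h_def by (rule bij_betw_cong[THEN iffD1, rotated]) simp
    fix x y assume x: "x \<in> M" and y: "y \<in> M"
    show "h (x * y) = h x * h y"
    proof (rule inj[OF hx(1)[OF mgroup_mult[OF M x y]] mgroup_mult[OF M hx(1)[OF x] hx(1)[OF y]]])
      show "\<rho> (h (x * y)) = \<rho> (h x * h y)"
        unfolding hx(2)[OF mgroup_mult[OF M x y]] mhom_mult[OF M hr hx(1)[OF x] hx(1)[OF y]] hx(2)[OF x] hx(2)[OF y]
        by (rule mhom_mult[OF M ht x y])
    qed
  next
    fix x assume "x \<in> M \<inter> Qstar"
    then have x: "x \<in> M" "x \<in> Qstar" by blast+
    show "h x = x" by (rule fixh[OF x(1)]) (simp only: AutQ_fix[OF t x] AutQ_fix[OF \<rho> x])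
  qed
  moreover have "\<forall>x\<in>F. h x = x" using fixh tF F by blast
  ultimately have hK: "h \<in> ?K" by blast
  have "\<rho> \<otimes>\<^bsub>AutQ M\<^esub> h = \<tau>"
    unfolding mult_AutQ[OF \<rho> \<open>h \<in> carrier (AutQ M)\<close>]
    by (rule extensionalityI[OF restrict_extensional AutQ_ext[OF t]]) (simp add: hx)
  then show "\<tau> \<in> l_coset (AutQ M) \<rho> ?K" using hK unfolding l_coset_def by blast
next
  fix \<tau> assume "\<tau> \<in> l_coset (AutQ M) \<rho> ?K"
  then obtain h where h: "h \<in> carrier (AutQ M)" "\<forall>x\<in>F. h x = x" "\<tau> = \<rho> \<otimes>\<^bsub>AutQ M\<^esub> h" unfolding l_coset_def by blast
  have teq: "\<tau> = (\<lambda>x\<in>M. \<rho> (h x))" using h(3) mult_AutQ[OF \<rho> h(1)] by simp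
  have "\<tau> \<in> carrier (AutQ M)" unfolding AutQ_iff
  proof (intro conjI ballI)
    show "\<tau> \<in> extensional M" unfolding teq by simp
    have "bij_betw (\<rho> \<circ> h) M M" by (rule bij_betw_trans[OF AutQ_bij[OF h(1)] AutQ_bij[OF \<rho>]])
    then show "bij_betw \<tau> M M" unfolding teq by (rule bij_betw_cong[THEN iffD1, rotated]) simp
    fix x y assume x: "x \<in> M" and y: "y \<in> M"
    show "\<tau> (x * y) = \<tau> x * \<tau> y" unfolding teq
      using x y mgroup_mult[OF M x y] mhom_mult[OF M AutQ_mhom[OF h(1) M] x y]
        mhom_mult[OF M AutQ_mhom[OF \<rho> M] AutQ_mem[OF h(1) x] AutQ_mem[OF h(1) y]] by simp
  next
    fix x assume "x \<in> M \<inter> Qstar"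
    then have x: "x \<in> M" "x \<in> Qstar" by blast+
    show "\<tau> x = x" unfolding teq using x(1) AutQ_fix[OF h(1) x] AutQ_fix[OF \<rho> x] by simp
  qed
  moreover have "\<forall>x\<in>F. \<tau> x = \<rho> x" unfolding teq using F h(2) by auto
  ultimately show "\<tau> \<in> ?L" by blast
qed

lemma haar_cylinder:
  assumes M: "mgroup M" and N: "normalized_haar (AutQ M) (AutQ_topology M) N"
    and F: "finite F" "F \<subseteq> M" and \<rho>: "\<rho> \<in> carrier (AutQ M)"
  shows "measure N {\<tau> \<in> carrier (AutQ M). \<forall>x\<in>F. \<tau> x = \<rho> x} = measure N {\<tau> \<in> carrier (AutQ M). \<forall>x\<in>F. \<tau> x = x}"
  unfolding cylinder_coset[OF M \<rho> F(2)] measure_def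
  using N cylinder_measurable[OF F, of "\<lambda>x. x"] \<rho> unfolding normalized_haar_def by simp

text \<open>Every \<open>\<tau>\<close> sends \<open>x\<close> to one of the finitely many roots of
  \<open>y ^ e x = x ^ e x\<close>, so finitely many cylinders over \<open>F\<close> cover the
  group. The nonempty ones have equal measure, hence none is null.\<close>

lemma haar_cylinder_positive:
  assumes M: "radical_group M" and N: "normalized_haar (AutQ M) (AutQ_topology M) N"
    and F: "finite F" "F \<subseteq> M" and \<rho>: "\<rho> \<in> carrier (AutQ M)"
  shows "measure N {\<tau> \<in> carrier (AutQ M). \<forall>x\<in>F. \<tau> x = \<rho> x} > 0"
proof (rule ccontr)
  note M' = radical_group_mgroup[OF M]
  interpret N: prob_space N by (rule prob_space_haar[OF N])
  define C where "C f = {\<tau> \<in> carrier (AutQ M). \<forall>x\<in>F. \<tau> x = f x}" for f :: "complex \<Rightarrow> complex"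
  assume "\<not> measure N {\<tau> \<in> carrier (AutQ M). \<forall>x\<in>F. \<tau> x = \<rho> x} > 0"
  then have "measure N {\<tau> \<in> carrier (AutQ M). \<forall>x\<in>F. \<tau> x = \<rho> x} = 0" using measure_nonneg[of N] by (simp add: not_less antisym)
  then have z: "measure N {\<tau> \<in> carrier (AutQ M). \<forall>x\<in>F. \<tau> x = x} = 0"
    unfolding haar_cylinder[OF M' N F \<rho>] .
  have "\<forall>x\<in>M. \<exists>m\<ge>1. x ^ m \<in> Qstar" using radical_group_root[OF M] by blast
  then obtain e where e: "\<And>x. x \<in> M \<Longrightarrow> e x \<ge> 1 \<and> x ^ e x \<in> Qstar" by metis
  define T where "T = (\<Pi>\<^sub>E x\<in>F. {y. y ^ e x = x ^ e x})"
  have finT: "finite T" unfolding T_def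
  proof (rule finite_PiE[OF F(1)])
    fix x assume "x \<in> F"
    then have "e x > 0" using e F(2) by (simp add: Suc_le_eq subset_iff)
    then show "finite {y. y ^ e x = x ^ e x}" by (rule finite_nth_roots)
  qed
  have cover: "carrier (AutQ M) \<subseteq> (\<Union>f\<in>T. C f)"
  proof
    fix \<tau> assume t: "\<tau> \<in> carrier (AutQ M)"
    have "\<tau> x ^ e x = x ^ e x" if "x \<in> F" for x
    proof -
      have x: "x \<in> M" using that F(2) by blast
      have "\<tau> x ^ e x = \<tau> (x ^ e x)" using mhom_power[OF M' AutQ_mhom[OF t M'] x] by simp
      also have "\<dots> = x ^ e x" by (rule AutQ_fix[OF t mgroup_power[OF M' x]]) (use e[OF x] in blast)
      finally show ?thesis .
    qed
    then have "restrict \<tau> F \<in> T" unfolding T_def by auto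
    moreover have "\<tau> \<in> C (restrict \<tau> F)" unfolding C_def using t by simp
    ultimately show "\<tau> \<in> (\<Union>f\<in>T. C f)" by blast
  qed
  have "measure N (C f) = 0" for f
  proof (cases "C f = {}")
    case False
    then obtain \<tau> where t: "\<tau> \<in> carrier (AutQ M)" "\<forall>x\<in>F. \<tau> x = f x" unfolding C_def by blast
    then have "C f = {\<sigma> \<in> carrier (AutQ M). \<forall>x\<in>F. \<sigma> x = \<tau> x}" unfolding C_def by auto
    then show ?thesis using haar_cylinder[OF M' N F t(1)] z by simp
  qed simp
  moreover have Cm: "C f \<in> sets N" for f unfolding C_def sets_haar[OF N] by (rule cylinder_measurable[OF F])
  ultimately have "measure N (\<Union>f\<in>T. C f) \<le> 0"
    using measure_UNION_le[OF finT, of C N] by simp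
  moreover have "measure N (carrier (AutQ M)) \<le> measure N (\<Union>f\<in>T. C f)"
    by (rule N.finite_measure_mono[OF cover]) (use finT Cm in blast)
  moreover have "measure N (carrier (AutQ M)) = 1" using N.prob_space unfolding space_haar[OF N] .
  ultimately show False by linarith
qed

text \<open>In lowest terms the numerator and denominator of a \<open>p\<close>-th power are
  \<open>p\<close>-th powers up to sign, hence 0, 1 or at least \<open>2 ^ p\<close> in absolute
  value. Excluding 1 and -1 is what bounds \<open>p\<close>.\<close>

lemma not_powers_large:
  assumes "x \<in> Qstar - {1, -1}" shows "\<exists>N. \<forall>p. Factorial_Ring.prime p \<longrightarrow> p > N \<longrightarrow> x \<notin> powers p"
proof -
  have "x \<in> \<rat>" using assms unfolding Qstar_def by blast
  then obtain r e where e: "e > 0" "coprime r e" "x = of_int r / of_int e" by (rule Rats_cases')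
  have r0: "r \<noteq> 0" using e(3) assms unfolding Qstar_def by auto
  have "x \<notin> powers p" if p: "Factorial_Ring.prime p" "p > nat \<bar>r\<bar> + nat e" for p
  proof
    assume "x \<in> powers p"
    then obtain y where y: "y \<in> Qstar" "x = y ^ p" unfolding powers_def by blast
    have "y \<in> \<rat>" using y(1) unfolding Qstar_def by blast
    then obtain s d where d: "d > 0" "coprime s d" "y = of_int s / of_int d" by (rule Rats_cases')
    have "(of_int (r * d ^ p) :: complex) = of_int (s ^ p * e)"
      using y(2) unfolding e(3) d(3) using d(1) e(1) by (simp add: field_simps power_divide)
    then have eq: "r * d ^ p = s ^ p * e" by (simp only: of_int_eq_iff)
    have c: "coprime (s ^ p) (d ^ p)" using d(2) by simp
    have "s ^ p dvd r * d ^ p" unfolding eq by simp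
    then have "s ^ p dvd r" using c by (simp add: coprime_dvd_mult_left_iff)
    then have s: "\<bar>s\<bar> ^ p \<le> \<bar>r\<bar>" using r0 dvd_imp_le_int[of r "s ^ p"] by (simp add: power_abs)
    have "d ^ p dvd s ^ p * e" unfolding eq[symmetric] by simp
    then have "d ^ p dvd e" using c by (simp add: coprime_dvd_mult_right_iff coprime_commute)
    then have d': "d ^ p \<le> e" using e(1) by (simp add: zdvd_imp_le)
    have big: "\<not> t ^ p \<le> \<bar>r\<bar> + e" if "t \<ge> 2" for t :: int
    proof -
      have "int p < 2 ^ p" using of_nat_less_two_power[of p] by simp
      also have "(2::int) ^ p \<le> t ^ p" by (rule power_mono) (use that in auto)
      finally show ?thesis using p(2) e(1) by linarith
    qed
    have "\<not> \<bar>s\<bar> \<ge> 2" using big[of "\<bar>s\<bar>"] s e(1) by linarith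
    moreover have "\<not> d \<ge> 2" using big[of d] d' by linarith
    moreover have "s \<noteq> 0" using y(1) d(3) unfolding Qstar_def by auto
    ultimately have "d = 1" "s = 1 \<or> s = -1" using d(1) by linarith+
    then have "y = 1 \<or> y = -1" using d(3) by auto
    then have "x = 1 \<or> x = -1" using y(2) by (cases "even p") auto
    then show False using assms by blast
  qed
  then show ?thesis by blast
qed

section \<open>Measurability of the Galois group and of S\<close>

lemma moving_measurable:
  assumes "countable R" "R \<subseteq> M"
  shows "{\<sigma> \<in> space (borel_of (AutQ_topology M)). \<exists>x\<in>R. \<sigma> x \<noteq> x} \<in> sets (borel_of (AutQ_topology M))"
proof (rule sets.sets_Collect_countable_Ex'[OF _ assms(1)])
  fix x assume "x \<in> R"
  then have "x \<in> M" using assms by blast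
  from sets_borel_AutQ_open[OF openin_AutQ_evaluation[OF this, of "- {x}"]]
  show "{\<sigma> \<in> space (borel_of (AutQ_topology M)). \<sigma> x \<noteq> x} \<in> sets (borel_of (AutQ_topology M))"
    unfolding space_borel_AutQ by simp
qed

lemma lcomb_measurable:
  "l \<in> lists (UNIV \<times> M) \<Longrightarrow> (\<lambda>\<sigma>. lcomb \<sigma> l) \<in> borel_measurable (borel_of (AutQ_topology M))"
proof (induction l)
  case (Cons p l)
  then have "snd p \<in> M" "l \<in> lists (UNIV \<times> M)" by auto
  then show ?case unfolding lcomb_Cons
    by (intro borel_measurable_add borel_measurable_times borel_measurable_const evaluation_measurable Cons.IH)
qed simp

text \<open>Rational coefficients and countably many radicals give countably many relations, each a
  measurable condition on finitely many values.\<close>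

lemma preserves_relations_measurable:
  assumes "countable M"
  shows "{\<sigma> \<in> carrier (AutQ M). preserves_relations M \<sigma>} \<in> sets (borel_of (AutQ_topology M))"
proof -
  let ?B = "borel_of (AutQ_topology M)"
  define L where "L = {l \<in> lists (UNIV \<times> M). lcomb (\<lambda>x. x) l = 0}"
  have L: "countable L"
    by (rule countable_subset[of _ "lists (UNIV \<times> M)"]) (auto simp: L_def intro!: countable_lists assms)
  have "{\<sigma> \<in> space ?B. \<forall>l\<in>L. lcomb \<sigma> l = 0} \<in> sets ?B"
  proof (rule sets.sets_Collect_countable_All'[OF _ L])
    fix l assume "l \<in> L"
    then have "l \<in> lists (UNIV \<times> M)" unfolding L_def by blast
    from measurable_sets[OF lcomb_measurable[OF this], of "{0}"]
    have "(\<lambda>\<sigma>. lcomb \<sigma> l) -` {0} \<inter> space ?B \<in> sets ?B" by simp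
    also have "(\<lambda>\<sigma>. lcomb \<sigma> l) -` {0} \<inter> space ?B = {\<sigma> \<in> space ?B. lcomb \<sigma> l = 0}" by blast
    finally show "{\<sigma> \<in> space ?B. lcomb \<sigma> l = 0} \<in> sets ?B" .
  qed
  also have "{\<sigma> \<in> space ?B. \<forall>l\<in>L. lcomb \<sigma> l = 0} = {\<sigma> \<in> carrier (AutQ M). preserves_relations M \<sigma>}"
    unfolding space_borel_AutQ preserves_relations_def L_def by blast
  finally show ?thesis .
qed

context
  fixes n :: nat and a :: "nat \<Rightarrow> complex"
  assumes a: "\<And>i. i \<in> {1..n} \<Longrightarrow> a i \<in> Qstar"
begin

lemma Gam_props: "mgroup (Gam n a)" "Gam n a \<subseteq> Qstar"
  using Gam_group[of n a] a by blast+

lemma S_set_iff: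
  "\<sigma> \<in> S_set n a \<longleftrightarrow> \<sigma> \<in> carrier (AutQ (rad_inf (Gam n a))) \<and>
     (\<forall>p. Factorial_Ring.prime p \<longrightarrow> (\<forall>i\<in>{1..n}. \<exists>x\<in>rad p (generate Cstar {a i}). \<sigma> x \<noteq> x))"
proof (cases "\<sigma> \<in> carrier (AutQ (rad_inf (Gam n a)))")
  case True
  have "restrict \<sigma> (rad_pinf p (Gam n a)) \<in> Sp_set n a p \<longleftrightarrow>
      (\<forall>i\<in>{1..n}. \<exists>x\<in>rad p (generate Cstar {a i}). \<sigma> x \<noteq> x)" if p: "Factorial_Ring.prime p" for p
  proof -
    have "restrict \<sigma> (rad_pinf p (Gam n a)) \<in> carrier (AutQ (rad_pinf p (Gam n a)))"
      by (rule restrict_AutQ[OF radical_group_rad_inf[OF Gam_props] radical_group_rad_pinf[OF Gam_props prime_ge_1_nat[OF p]]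
            rad_pinf_prime_subset[OF Gam_props p] True])
    moreover have "(\<exists>x\<in>rad p (generate Cstar {a i}). restrict \<sigma> (rad_pinf p (Gam n a)) x \<noteq> x) \<longleftrightarrow>
        (\<exists>x\<in>rad p (generate Cstar {a i}). \<sigma> x \<noteq> x)" if i: "i \<in> {1..n}" for i
    proof -
      have "restrict \<sigma> (rad_pinf p (Gam n a)) x = \<sigma> x" if "x \<in> rad p (generate Cstar {a i})" for x
        using rad_single_subset[of n a i p] a i that by auto
      then show ?thesis by auto
    qed
    ultimately show ?thesis unfolding Sp_set_iff by blast
  qed
  then show ?thesis unfolding S_set_def A_group_def using True by blast
qed (simp add: S_set_def A_group_def)

lemma countable_rad_single:
  assumes "i \<in> {1..n}" "Factorial_Ring.prime p"
  shows "countable (rad p (generate Cstar {a i}))"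
    "rad p (generate Cstar {a i}) \<subseteq> rad_pinf p (Gam n a)" "rad p (generate Cstar {a i}) \<subseteq> rad_inf (Gam n a)"
proof -
  show 1: "rad p (generate Cstar {a i}) \<subseteq> rad_pinf p (Gam n a)"
    using rad_single_subset[of n a i p] a assms(1) by blast
  then show 2: "rad p (generate Cstar {a i}) \<subseteq> rad_inf (Gam n a)"
    using rad_pinf_prime_subset[OF Gam_props assms(2)] by blast
  show "countable (rad p (generate Cstar {a i}))"
    by (rule countable_subset[OF 2 countable_rad_inf[OF Gam_props(2)]])
qed

lemma S_set_measurable: "S_set n a \<in> sets (borel_of (AutQ_topology (rad_inf (Gam n a))))"
proof -
  let ?B = "borel_of (AutQ_topology (rad_inf (Gam n a)))"
  have "{\<sigma> \<in> space ?B. \<forall>p\<in>{p. Factorial_Ring.prime p}. \<forall>i\<in>{1..n}. \<exists>x\<in>rad p (generate Cstar {a i}). \<sigma> x \<noteq> x} \<in> sets ?B"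
  proof (rule sets.sets_Collect_countable_All', rule sets.sets_Collect_countable_All')
    fix p :: nat and i assume p: "p \<in> {p. Factorial_Ring.prime p}" and i: "i \<in> {1..n}"
    then have p: "Factorial_Ring.prime p" by simp
    show "{\<sigma> \<in> space ?B. \<exists>x\<in>rad p (generate Cstar {a i}). \<sigma> x \<noteq> x} \<in> sets ?B"
      by (rule moving_measurable[OF countable_rad_single(1)[OF i p] countable_rad_single(3)[OF i p]])
  qed auto
  also have "{\<sigma> \<in> space ?B. \<forall>p\<in>{p. Factorial_Ring.prime p}. \<forall>i\<in>{1..n}. \<exists>x\<in>rad p (generate Cstar {a i}). \<sigma> x \<noteq> x} = S_set n a"
    unfolding space_borel_AutQ by (rule Set.set_eqI) (simp add: S_set_iff)
  finally show ?thesis .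
qed

lemma Sp_set_measurable:
  assumes p: "Factorial_Ring.prime p"
  shows "Sp_set n a p \<in> sets (borel_of (AutQ_topology (rad_pinf p (Gam n a))))"
proof -
  let ?B = "borel_of (AutQ_topology (rad_pinf p (Gam n a)))"
  have "{\<sigma> \<in> space ?B. \<forall>i\<in>{1..n}. \<exists>x\<in>rad p (generate Cstar {a i}). \<sigma> x \<noteq> x} \<in> sets ?B"
  proof (rule sets.sets_Collect_countable_All')
    fix i assume i: "i \<in> {1..n}"
    show "{\<sigma> \<in> space ?B. \<exists>x\<in>rad p (generate Cstar {a i}). \<sigma> x \<noteq> x} \<in> sets ?B"
      by (rule moving_measurable[OF countable_rad_single(1)[OF i p] countable_rad_single(2)[OF i p]])
  qed auto
  also have "{\<sigma> \<in> space ?B. \<forall>i\<in>{1..n}. \<exists>x\<in>rad p (generate Cstar {a i}). \<sigma> x \<noteq> x} = Sp_set n a p"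
    unfolding space_borel_AutQ by (rule Set.set_eqI) (simp add: Sp_set_iff)
  finally show ?thesis .
qed

lemma Gal_group_measurable: "Gal_group (Gam n a) \<in> sets (borel_of (AutQ_topology (rad_inf (Gam n a))))"
  unfolding Gal_group_eq[OF Gam_props] A_group_def
  by (rule preserves_relations_measurable[OF countable_rad_inf[OF Gam_props(2)]])

end

text \<open>By \<open>local_kummer\<close> the stabilizer of \<open>z\<close> and \<open>x\<close>
  has at least \<open>p * (p - 1)\<close> distinct cosets, one for each pair of images
  \<open>z ^ u\<close> and \<open>z ^ k * x\<close> with \<open>u\<close> prime to \<open>p\<close>;
  they are disjoint, of equal measure, inside a probability space.\<close>

lemma haar_Kummer_stabilizer:
  assumes \<Gamma>: "mgroup \<Gamma>" "\<Gamma> \<subseteq> Qstar" and p: "Factorial_Ring.prime p" "odd p"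
    and N: "normalized_haar (AutQ (rad_pinf p \<Gamma>)) (AutQ_topology (rad_pinf p \<Gamma>)) N"
    and z: "z ^ p = 1" "\<And>k. 0 < k \<and> k < p \<Longrightarrow> z ^ k \<noteq> 1" and x: "x ^ p \<in> \<Gamma>" "x ^ p \<notin> powers p"
  shows "measure N {\<tau> \<in> carrier (AutQ (rad_pinf p \<Gamma>)). \<forall>y\<in>{z, x}. \<tau> y = y} \<le> 1 / (real p * (real p - 1))"
proof -
  define M where "M = rad_pinf p \<Gamma>"
  define c where "c = measure N {\<tau> \<in> carrier (AutQ M). \<forall>y\<in>{z, x}. \<tau> y = y}"
  have p1: "p > 1" "p > 0" using prime_gt_1_nat[OF p(1)] by auto
  have M: "mgroup M" unfolding M_def by (rule mgroup_rad_pinf[OF \<Gamma>(1)])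
  interpret N: prob_space N by (rule prob_space_haar[OF N])
  have x0: "x \<noteq> 0" using x(1) mgroup_nonzero[OF \<Gamma>(1) x(1)] p1 by auto
  have z0: "z \<noteq> 0" using z(1) p1 by (auto simp: power_0_left)
  have z1: "z \<noteq> 1" using z(2)[of 1] p1 by auto
  have zM: "z \<in> M" unfolding M_def using z(1) z0 mgroup_one[OF \<Gamma>(1)] by (intro rad_pinfI[of _ 1]) auto
  have xM: "x \<in> M" unfolding M_def using x(1) x0 by (intro rad_pinfI[of _ 1]) auto
  have inj: "k = l" if "k < p" "l < p" "z ^ k = z ^ l" for k l
  proof -
    have *: "\<not> k < l" if "l < p" "z ^ k = z ^ l" for k l
    proof
      assume kl: "k < l"
      have "z ^ l = z ^ k * z ^ (l - k)" using kl by (simp flip: power_add)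
      then have "z ^ (l - k) = 1" using that(2) z0 by simp
      moreover have "0 < l - k \<and> l - k < p" using kl that(1) by simp
      ultimately show False using z(2) by blast
    qed
    show ?thesis using *[OF that(2,3)] *[OF that(1) that(3)[symmetric]] by simp
  qed
  define D where "D = (\<lambda>(u, k). {\<tau> \<in> carrier (AutQ M). \<tau> z = z ^ u \<and> \<tau> x = z ^ k * x})"
  define J where "J = {1..<p} \<times> {..<p}"
  have Dm: "D j \<in> sets N \<and> measure N (D j) = c" if "j \<in> J" for j
  proof -
    obtain u k where uk: "j = (u, k)" "1 \<le> u" "u < p" using \<open>j \<in> J\<close> unfolding J_def by auto
    have "\<not> p dvd u" using uk(2,3) by (simp add: nat_dvd_not_less)
    then have "\<exists>\<sigma>\<in>carrier (AutQ (rad_pinf p \<Gamma>)). \<sigma> z = z ^ u \<and> \<sigma> x = z ^ k * x"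
      using local_kummer[OF \<Gamma> p(1) z(1) z1 _ p(2) x] by blast
    then obtain \<sigma> where s: "\<sigma> \<in> carrier (AutQ M)" "\<sigma> z = z ^ u" "\<sigma> x = z ^ k * x" unfolding M_def by blast
    have eq: "D j = {\<tau> \<in> carrier (AutQ M). \<forall>y\<in>{z, x}. \<tau> y = \<sigma> y}" unfolding D_def uk(1) using s by auto
    have F: "finite {z, x}" "{z, x} \<subseteq> M" using zM xM by auto
    show ?thesis unfolding eq c_def
      using haar_cylinder[OF M N[folded M_def] F s(1)] cylinder_measurable[OF F, of \<sigma>] sets_haar[OF N] by (simp add: M_def)
  qed
  have disj: "disjoint_family_on D J"
  proof (unfold disjoint_family_on_def, intro ballI impI)
    fix i j assume ij: "i \<in> J" "j \<in> J" "i \<noteq> j"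
    obtain u k where uk: "i = (u, k)" "u < p" "k < p" using ij(1) unfolding J_def by auto
    obtain v l where vl: "j = (v, l)" "v < p" "l < p" using ij(2) unfolding J_def by auto
    have False if t: "\<tau> \<in> D i" "\<tau> \<in> D j" for \<tau>
    proof -
      have "z ^ u = z ^ v" "z ^ k * x = z ^ l * x" using t unfolding D_def uk(1) vl(1) by auto
      then have "u = v" "k = l" using inj[OF uk(2) vl(2)] inj[OF uk(3) vl(3)] x0 by auto
      then show False using ij(3) uk(1) vl(1) by blast
    qed
    then show "D i \<inter> D j = {}" by blast
  qed
  have finJ: "finite J" unfolding J_def by simp
  have "real (card J) * c = (\<Sum>j\<in>J. measure N (D j))" using Dm by simp
  also have "\<dots> = measure N (\<Union>j\<in>J. D j)"
    by (rule N.finite_measure_finite_Union[symmetric, OF finJ _ disj]) (use Dm in blast)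
  also have "\<dots> \<le> 1" by (rule N.prob_le_1)
  finally have "real (card J) * c \<le> 1" .
  moreover have "real (card J) = real p * (real p - 1)" unfolding J_def using p1 by (simp add: card_cartesian_product of_nat_diff)
  moreover have "real p * (real p - 1) > 0" using p1 by simp
  ultimately show ?thesis unfolding c_def M_def by (simp add: field_simps)
qed

text \<open>An automorphism outside \<open>S_p\<close> acts trivially on the \<open>p\<close>-th
  roots belonging to some \<open>a i\<close>, so it fixes both \<open>z\<close> and a root
  \<open>x i\<close>. This happens with probability at most \<open>1 / (p * (p - 1))\<close> for
  each of the \<open>n\<close> indices.\<close>

lemma Sp_set_measure_ge:
  assumes a: "\<And>i. i \<in> {1..n} \<Longrightarrow> a i \<in> Qstar" and p: "Factorial_Ring.prime p" "odd p"
    and N: "normalized_haar (AutQ (rad_pinf p (Gam n a))) (AutQ_topology (rad_pinf p (Gam n a))) N"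
    and np: "\<And>i. i \<in> {1..n} \<Longrightarrow> a i \<notin> powers p"
  shows "measure N (Sp_set n a p) \<ge> 1 - real n / (real p * (real p - 1))"
proof -
  note \<Gamma> = Gam_props[of n a, OF a]
  define M where "M = rad_pinf p (Gam n a)"
  note N' = N[folded M_def]
  interpret N: prob_space N by (rule prob_space_haar[OF N])
  have M: "mgroup M" unfolding M_def by (rule mgroup_rad_pinf[OF \<Gamma>(1)])
  have p1: "p \<ge> 1" "p > 0" using prime_ge_1_nat[OF p(1)] by auto
  obtain z :: complex where z: "z ^ p = 1" "\<forall>k. 0 < k \<and> k < p \<longrightarrow> z ^ k \<noteq> 1"
    using primitive_root_of_unity[OF p1(1)] by blast
  have a0: "a i \<noteq> 0" if "i \<in> {1..n}" for i using a[OF that] unfolding Qstar_def by blast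
  have "\<forall>i\<in>{1..n}. \<exists>y. y ^ p = a i" using complex_root_exists[OF p1(2) a0] by blast
  then obtain x where x: "\<And>i. i \<in> {1..n} \<Longrightarrow> x i ^ p = a i" by metis
  define C where "C i = {\<tau> \<in> carrier (AutQ M). \<forall>y\<in>{z, x i}. \<tau> y = y}" for i
  have single: "z \<in> rad p (generate Cstar {a i})" "x i \<in> rad p (generate Cstar {a i})" if i: "i \<in> {1..n}" for i
    using rad_single_root_of_unity[of n a i z p] rad_single_root[of n a i "x i" p] a i z(1) x[OF i] p1(1) by blast+
  have sub: "rad p (generate Cstar {a i}) \<subseteq> M" if "i \<in> {1..n}" for i
    unfolding M_def using rad_single_subset[of n a i p] a that by blast
  have C: "C i \<in> sets N \<and> measure N (C i) \<le> 1 / (real p * (real p - 1))" if i: "i \<in> {1..n}" for i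
  proof
    show "C i \<in> sets N" unfolding C_def sets_haar[OF N']
      by (rule cylinder_measurable) (use single[OF i] sub[OF i] in auto)
    have g: "x i ^ p \<in> Gam n a" "x i ^ p \<notin> powers p" unfolding x[OF i] using Gam_generator[of n a i] a i np[OF i] by blast+
    show "measure N (C i) \<le> 1 / (real p * (real p - 1))"
      unfolding C_def M_def by (rule haar_Kummer_stabilizer[OF \<Gamma> p N z(1) z(2)[rule_format] g])
  qed
  have S: "Sp_set n a p \<in> sets N" unfolding sets_haar[OF N] by (rule Sp_set_measurable[OF a p(1)])
  have "carrier (AutQ M) \<subseteq> Sp_set n a p \<union> (\<Union>i\<in>{1..n}. C i)"
  proof
    fix \<tau> assume t: "\<tau> \<in> carrier (AutQ M)"
    show "\<tau> \<in> Sp_set n a p \<union> (\<Union>i\<in>{1..n}. C i)"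
    proof (cases "\<tau> \<in> Sp_set n a p")
      case False
      then obtain i where i: "i \<in> {1..n}" "\<forall>y\<in>rad p (generate Cstar {a i}). \<tau> y = y"
        using t unfolding Sp_set_iff M_def by blast
      then have "\<tau> \<in> C i" unfolding C_def using t single[OF i(1)] by blast
      then show ?thesis using i(1) by blast
    qed blast
  qed
  then have "measure N (carrier (AutQ M)) \<le> measure N (Sp_set n a p \<union> (\<Union>i\<in>{1..n}. C i))"
    by (rule N.finite_measure_mono) (use S C in \<open>intro sets.Un sets.finite_UN, auto\<close>)
  also have "\<dots> \<le> measure N (Sp_set n a p) + measure N (\<Union>i\<in>{1..n}. C i)"
    by (rule measure_Un_le) (use S C in \<open>auto\<close>)
  also have "measure N (\<Union>i\<in>{1..n}. C i) \<le> (\<Sum>i\<in>{1..n}. measure N (C i))"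
    by (rule measure_UNION_le) (use C in auto)
  also have "\<dots> \<le> (\<Sum>i\<in>{1..n}. 1 / (real p * (real p - 1)))" by (rule sum_mono) (use C in blast)
  also have "\<dots> = real n / (real p * (real p - 1))" by simp
  finally have "measure N (carrier (AutQ M)) \<le> measure N (Sp_set n a p) + real n / (real p * (real p - 1))" by simp
  moreover have "measure N (carrier (AutQ M)) = 1" using N.prob_space unfolding space_haar[OF N'] .
  ultimately show ?thesis by linarith
qed

lemma inv_A_to_prod:
  assumes \<Gamma>: "mgroup \<Gamma>" "\<Gamma> \<subseteq> Qstar" and \<omega>: "\<omega> \<in> (\<Pi>\<^sub>E p\<in>{p. Factorial_Ring.prime p}. carrier (Ap_group \<Gamma> p))"
  defines "\<sigma> \<equiv> inv_into (carrier (A_group \<Gamma>)) (A_to_prod \<Gamma>) \<omega>"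
  shows "\<sigma> \<in> carrier (AutQ (rad_inf \<Gamma>))"
    "\<And>p x. Factorial_Ring.prime p \<Longrightarrow> x \<in> rad_pinf p \<Gamma> \<Longrightarrow> \<sigma> x = \<omega> p x"
proof -
  have im: "\<omega> \<in> A_to_prod \<Gamma> ` carrier (A_group \<Gamma>)"
    using A_to_prod_bij[OF \<Gamma>] \<omega> unfolding bij_betw_def by simp
  show "\<sigma> \<in> carrier (AutQ (rad_inf \<Gamma>))" unfolding \<sigma>_def using inv_into_into[OF im] by (simp add: A_group_def)
  fix p x assume px: "Factorial_Ring.prime (p::nat)" "x \<in> rad_pinf p \<Gamma>"
  have "A_to_prod \<Gamma> \<sigma> = \<omega>" unfolding \<sigma>_def by (rule f_inv_into_f[OF im])
  then have "A_to_prod \<Gamma> \<sigma> p x = \<omega> p x" by simp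
  then show "\<sigma> x = \<omega> p x" using px unfolding A_to_prod_def by simp
qed

text \<open>Evaluations determine measurability. By \<open>rad_inf_induct\<close> it is enough to
  treat a radical in a single \<open>p\<close>-part, where the evaluation depends on the coordinate
  \<open>p\<close> alone.\<close>

lemma inv_A_to_prod_measurable:
  assumes \<Gamma>: "mgroup \<Gamma>" "\<Gamma> \<subseteq> Qstar"
    and N: "\<And>p. Factorial_Ring.prime p \<Longrightarrow> normalized_haar (Ap_group \<Gamma> p) (AutQ_topology (rad_pinf p \<Gamma>)) (N p)"
  shows "space (PiM {p. Factorial_Ring.prime p} N) = (\<Pi>\<^sub>E p\<in>{p. Factorial_Ring.prime p}. carrier (Ap_group \<Gamma> p))"
    "inv_into (carrier (A_group \<Gamma>)) (A_to_prod \<Gamma>) \<in>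
       measurable (PiM {p. Factorial_Ring.prime p} N) (borel_of (AutQ_topology (rad_inf \<Gamma>)))"
proof -
  let ?P = "PiM {p. Factorial_Ring.prime p} N"
  let ?g = "inv_into (carrier (A_group \<Gamma>)) (A_to_prod \<Gamma>)"
  note N = N[unfolded Ap_group_def]
  show sp: "space ?P = (\<Pi>\<^sub>E p\<in>{p. Factorial_Ring.prime p}. carrier (Ap_group \<Gamma> p))"
    unfolding space_PiM Ap_group_def by (rule PiE_cong) (use space_haar[OF N] in simp)
  note inv = inv_A_to_prod[OF \<Gamma>, folded sp]
  show "?g \<in> measurable ?P (borel_of (AutQ_topology (rad_inf \<Gamma>)))"
  proof (rule measurable_into_AutQ[OF countable_rad_inf[OF \<Gamma>(2)] inv(1)])
    fix x assume "x \<in> rad_inf \<Gamma>"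
    then show "(\<lambda>\<omega>. ?g \<omega> x) \<in> borel_measurable ?P"
    proof (rule rad_inf_induct[OF \<Gamma>(1)])
      fix p :: nat and x assume p: "Factorial_Ring.prime p" and x: "x \<in> rad_pinf p \<Gamma>"
      have "(\<lambda>\<sigma>. \<sigma> x) \<in> borel_measurable (N p)"
        using evaluation_measurable[OF x] measurable_cong_sets[OF sets_haar[OF N[OF p]] refl] by blast
      then have "(\<lambda>\<sigma>. \<sigma> x) \<circ> (\<lambda>\<omega>. \<omega> p) \<in> borel_measurable ?P"
        using measurable_comp[OF measurable_component_singleton] p by simp
      moreover have "((\<lambda>\<sigma>. \<sigma> x) \<circ> (\<lambda>\<omega>. \<omega> p)) \<omega> = ?g \<omega> x" if "\<omega> \<in> space ?P" for \<omega>
        using inv(2)[OF that p x] by simp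
      ultimately show "(\<lambda>\<omega>. ?g \<omega> x) \<in> borel_measurable ?P"
        using measurable_cong[of ?P "(\<lambda>\<sigma>. \<sigma> x) \<circ> (\<lambda>\<omega>. \<omega> p)" "\<lambda>\<omega>. ?g \<omega> x"] by blast
    next
      fix x y assume x: "x \<in> rad_inf \<Gamma>" and y: "y \<in> rad_inf \<Gamma>"
        and m: "(\<lambda>\<omega>. ?g \<omega> x) \<in> borel_measurable ?P" "(\<lambda>\<omega>. ?g \<omega> y) \<in> borel_measurable ?P"
      note M = mgroup_rad_inf[OF \<Gamma>(1)]
      have "?g \<omega> x * ?g \<omega> y = ?g \<omega> (x * y)" if "\<omega> \<in> space ?P" for \<omega>
        using mhom_mult[OF M AutQ_mhom[OF inv(1)[OF that] M] x y] by simp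
      moreover have "(\<lambda>\<omega>. ?g \<omega> x * ?g \<omega> y) \<in> borel_measurable ?P" using m by (rule borel_measurable_times)
      ultimately show "(\<lambda>\<omega>. ?g \<omega> (x * y)) \<in> borel_measurable ?P"
        using measurable_cong[of ?P "\<lambda>\<omega>. ?g \<omega> x * ?g \<omega> y" "\<lambda>\<omega>. ?g \<omega> (x * y)"] by blast
    qed
  qed
qed

text \<open>A box of local conditions with positive measure is mapped into
  \<open>G \<inter> S\<close>: \<open>S\<close> is checked prime by prime, \<open>G\<close> by
  \<open>Gal_criterion\<close>, which asks only for the primes up to \<open>B\<close>.\<close>

lemma Gal_S_positive:
  assumes a: "\<And>i. i \<in> {1..n} \<Longrightarrow> a i \<in> Qstar - {1, -1}"
    and N: "\<And>p. Factorial_Ring.prime p \<Longrightarrow>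
      normalized_haar (Ap_group (Gam n a) p) (AutQ_topology (rad_pinf p (Gam n a))) (N p)"
    and w: "mhom Qstar w" "\<And>x. x \<in> Qstar \<Longrightarrow> w x = 1 \<or> w x = - 1" "\<And>i. i \<in> {1..n} \<Longrightarrow> w (a i) = - 1"
    and f: "w (-3) = 1 \<Longrightarrow> mhom (Gam n a) f \<and> (\<forall>x\<in>Gam n a. x \<in> powers 3 \<longrightarrow> f x = 1) \<and> (\<forall>i\<in>{1..n}. f (a i) \<noteq> 1)"
  shows "measure (prod_measure (Gam n a) N) (Gal_group (Gam n a) \<inter> S_set n a) > 0"
    "measure (prod_measure (Gam n a) N) (Gal_group (Gam n a)) > 0"
proof -
  define \<Gamma> where "\<Gamma> = Gam n a"
  define P where "P = {p::nat. Factorial_Ring.prime p}"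
  have aQ: "\<And>i. i \<in> {1..n} \<Longrightarrow> a i \<in> Qstar" using a by blast
  have G: "mgroup \<Gamma>" "\<Gamma> \<subseteq> Qstar" unfolding \<Gamma>_def using Gam_props[of n a] aQ by blast+
  have S_iff: "\<tau> \<in> S_set n a \<longleftrightarrow> \<tau> \<in> carrier (AutQ (rad_inf \<Gamma>)) \<and>
     (\<forall>p. Factorial_Ring.prime p \<longrightarrow> (\<forall>i\<in>{1..n}. \<exists>x\<in>rad p (generate Cstar {a i}). \<tau> x \<noteq> x))" for \<tau>
    unfolding \<Gamma>_def by (rule S_set_iff) (rule aQ)
  note N\<Gamma> = N[folded \<Gamma>_def]
  have NQ: "normalized_haar (AutQ (rad_pinf p (Gam n a))) (AutQ_topology (rad_pinf p (Gam n a))) (N p)"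
    if "Factorial_Ring.prime p" for p using N[OF that] unfolding Ap_group_def .
  note NQ\<Gamma> = NQ[folded \<Gamma>_def]
  have "\<exists>B. a ` {1..n} \<subseteq> smooth B" using smooth_exists[of "a ` {1..n}"] aQ by blast
  then obtain B0 where B0: "a ` {1..n} \<subseteq> smooth B0" by blast
  have "\<forall>i\<in>{1..n}. \<exists>K. \<forall>p. Factorial_Ring.prime p \<longrightarrow> p > K \<longrightarrow> a i \<notin> powers p"
    using not_powers_large[OF a] by blast
  then obtain K where K: "\<And>i p. i \<in> {1..n} \<Longrightarrow> Factorial_Ring.prime p \<Longrightarrow> p > K i \<Longrightarrow> a i \<notin> powers p" by metis
  \<comment> \<open>\<open>B0\<close> bounds the primes in the \<open>a i\<close>, the sum of the
    \<open>K i\<close> ensures that no \<open>a i\<close> is a \<open>p\<close>-th power for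
    \<open>p > B\<close>, \<open>2 * n\<close> gives the factor 1/2 needed for the tail, and 2 puts
    the prime 2 among the controlled ones.\<close>
  define B where "B = B0 + 2 * n + 2 + (\<Sum>i\<in>{1..n}. K i)"
  have B: "a ` {1..n} \<subseteq> smooth B" using B0 smooth_mono[of B0 B] unfolding B_def by auto
  have KB: "K i \<le> B" if "i \<in> {1..n}" for i
    using member_le_sum[of i "{1..n}" K] that unfolding B_def by simp
  have np: "a i \<notin> powers p" if "i \<in> {1..n}" "Factorial_Ring.prime p" "p > B" for i p
    using K[OF that(1,2)] KB[OF that(1)] that(3) by simp
  have m1: "- 1 \<in> Qstar" "2 \<in> Qstar" unfolding Qstar_def by auto
  have "w 2 \<in> {1, - 1}" "w (- 1) \<in> {1, - 1}" using w(2)[OF m1(1)] w(2)[OF m1(2)] by auto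
  then obtain u where u: "\<i> ^ u = w (- 1) * \<i>" "zeta8 ^ u + inverse (zeta8 ^ u) = w 2 * complex_of_real (sqrt 2)"
    using sqrt_two_sign by blast
  have "\<exists>\<sigma> F. \<sigma> \<in> Sp_set n a 2 \<and> finite F \<and> F \<subseteq> rad_pinf 2 \<Gamma> \<and>
    (\<forall>\<tau>\<in>carrier (AutQ (rad_pinf 2 \<Gamma>)). (\<forall>x\<in>F. \<tau> x = \<sigma> x) \<longrightarrow>
        \<tau> \<in> Sp_set n a 2 \<and> \<tau> zeta8 = zeta8 ^ u \<and>
        (\<forall>x\<in>rad_pinf 2 \<Gamma>. x ^ 2 \<in> Qstar \<longrightarrow> \<tau> x = w (x ^ 2) * x))"
    unfolding \<Gamma>_def by (rule local_two_data[OF aQ w B u(1)])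
  then obtain \<sigma>2 F2 where two: "\<sigma>2 \<in> Sp_set n a 2" "finite F2" "F2 \<subseteq> rad_pinf 2 \<Gamma>"
    "\<forall>\<tau>\<in>carrier (AutQ (rad_pinf 2 \<Gamma>)). (\<forall>x\<in>F2. \<tau> x = \<sigma>2 x) \<longrightarrow>
        \<tau> \<in> Sp_set n a 2 \<and> \<tau> zeta8 = zeta8 ^ u \<and>
        (\<forall>x\<in>rad_pinf 2 \<Gamma>. x ^ 2 \<in> Qstar \<longrightarrow> \<tau> x = w (x ^ 2) * x)"
    by (elim exE conjE)
  define Q where "Q p \<sigma> F \<longleftrightarrow> \<sigma> \<in> Sp_set n a p \<and> finite F \<and> F \<subseteq> rad_pinf p \<Gamma> \<and>
    (\<forall>\<tau>\<in>carrier (AutQ (rad_pinf p \<Gamma>)). (\<forall>x\<in>F. \<tau> x = \<sigma> x) \<longrightarrow> \<tau> \<in> Sp_set n a p) \<and>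
    (\<forall>\<tau> \<theta>. (\<forall>x\<in>F. \<tau> x = \<sigma> x) \<longrightarrow> embedding (qspan runity) \<theta> \<longrightarrow> (\<forall>x\<in>runity. \<theta> x = \<tau> x) \<longrightarrow> \<theta> \<i> = w (- 1) * \<i> \<longrightarrow>
       complex_of_real (sqrt p) \<in> qspan runity \<and> \<theta> (complex_of_real (sqrt p)) = w (of_nat p) * complex_of_real (sqrt p))"
    for p :: nat and \<sigma> :: "complex \<Rightarrow> complex" and F :: "complex set"
  have "\<forall>p. Factorial_Ring.prime p \<and> p \<ge> 3 \<longrightarrow> (\<exists>\<sigma> F. Q p \<sigma> F)"
    unfolding Q_def \<Gamma>_def by (intro allI impI, elim conjE) (rule local_odd_data[of n a w f, OF aQ w(1,2) f])
  then have "\<forall>p. \<exists>\<sigma>. \<exists>F. Factorial_Ring.prime p \<and> p \<ge> 3 \<longrightarrow> Q p \<sigma> F" by blast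
  then have "\<exists>s. \<forall>p. \<exists>F. Factorial_Ring.prime p \<and> p \<ge> 3 \<longrightarrow> Q p (s p) F" by (rule choice)
  then obtain s where "\<forall>p. \<exists>F. Factorial_Ring.prime p \<and> p \<ge> 3 \<longrightarrow> Q p (s p) F" by (rule exE)
  then have "\<exists>F. \<forall>p. Factorial_Ring.prime p \<and> p \<ge> 3 \<longrightarrow> Q p (s p) (F p)" by (rule choice)
  then obtain \<sigma>' F' where odd: "\<And>p. Factorial_Ring.prime p \<Longrightarrow> p \<ge> 3 \<Longrightarrow> Q p (\<sigma>' p) (F' p)" by blast
  define \<sigma> where "\<sigma> p = (if p = 2 then \<sigma>2 else \<sigma>' p)" for p
  define F where "F p = (if p = 2 then F2 else F' p)" for p
  have ge3: "p \<ge> 3" if "Factorial_Ring.prime p" "p \<noteq> 2" for p :: nat using prime_ge_2_nat[OF that(1)] that(2) by simp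
  have loc: "\<sigma> p \<in> Sp_set n a p \<and> finite (F p) \<and> F p \<subseteq> rad_pinf p \<Gamma> \<and>
    (\<forall>\<tau>\<in>carrier (AutQ (rad_pinf p \<Gamma>)). (\<forall>x\<in>F p. \<tau> x = \<sigma> p x) \<longrightarrow> \<tau> \<in> Sp_set n a p)"
    if p: "Factorial_Ring.prime p" for p
  proof (cases "p = 2")
    case True then show ?thesis using two unfolding \<sigma>_def F_def by auto
  next
    case False then show ?thesis using odd[OF p ge3[OF p False]] unfolding Q_def \<sigma>_def F_def by simp
  qed
  \<comment> \<open>Up to \<open>B\<close> the cylinders impose membership in \<open>S_p\<close>
    together with the signs that \<open>G\<close> requires; beyond \<open>B\<close> membership in
    \<open>S_p\<close> is the only condition, and its measure tends to 1 fast enough.\<close>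
  define V where "V p = (if p \<le> B then {\<tau> \<in> carrier (AutQ (rad_pinf p \<Gamma>)). \<forall>x\<in>F p. \<tau> x = \<sigma> p x} else Sp_set n a p)" for p
  have VS: "V p \<subseteq> Sp_set n a p" if "Factorial_Ring.prime p" for p using loc[OF that] unfolding V_def by auto
  have Vsets: "V p \<in> sets (N p)" if p: "Factorial_Ring.prime p" for p
  proof (cases "p \<le> B")
    case True
    then show ?thesis unfolding V_def sets_haar[OF NQ\<Gamma>[OF p]] using cylinder_measurable[of "F p" "rad_pinf p \<Gamma>" "\<sigma> p"] loc[OF p] by simp
  next
    case False
    then show ?thesis unfolding V_def sets_haar[OF NQ\<Gamma>[OF p]] using Sp_set_measurable[of n a p, OF aQ p] by (simp add: \<Gamma>_def)
  qed
  have tail: "measure (N p) (V p) \<ge> 1 - real n / (real p * (real p - 1))" if p: "Factorial_Ring.prime p" "p > B" for p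
  proof -
    have o: "odd p" using prime_odd_nat[OF p(1)] p(2) unfolding B_def by simp
    show ?thesis using Sp_set_measure_ge[of n a p "N p", OF aQ p(1) o NQ[OF p(1)] np[OF _ p]] p(2) unfolding V_def by simp
  qed
  have pos: "measure (N p) (V p) > 0" if p: "Factorial_Ring.prime p" for p
  proof (cases "p \<le> B")
    case True
    have "\<sigma> p \<in> carrier (AutQ (rad_pinf p \<Gamma>))" using loc[OF p] unfolding Sp_set_iff \<Gamma>_def by blast
    then show ?thesis using haar_cylinder_positive[OF radical_group_rad_pinf[OF G prime_ge_1_nat[OF p]] NQ\<Gamma>[OF p], of "F p" "\<sigma> p"]
        loc[OF p] True unfolding V_def by simp
  next
    case False
    then have pB: "p > B" by simp
    then have "real p \<ge> 2 * real n + 2" "real p - 1 \<ge> 1" unfolding B_def by linarith+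
    then have "real p * (real p - 1) \<ge> (2 * real n + 2) * 1" by (intro mult_mono) auto
    then have "real n / (real p * (real p - 1)) < 1" by (simp add: divide_less_eq_1)
    then show ?thesis using tail[OF p pB] by linarith
  qed
  have B1: "B \<ge> 1" and "2 * n \<le> B" unfolding B_def by simp_all
  then have "real (2 * n) \<le> real B" by (simp only: of_nat_le_iff)
  then have nB: "real n \<le> real B / 2" by simp
  have box: "Pi\<^sub>E P V \<in> sets (PiM P N)" "measure (PiM P N) (Pi\<^sub>E P V) > 0"
    using PiM_box_positive[of P N V B "real n", OF prob_space_haar[OF NQ] _ _ _ B1 _ nB] Vsets pos tail
    unfolding P_def by auto
  interpret prob_space "PiM P N" by (rule prob_space_PiM) (use prob_space_haar[OF NQ] in \<open>simp add: P_def\<close>)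
  let ?g = "inv_into (carrier (A_group \<Gamma>)) (A_to_prod \<Gamma>)"
  have gm: "space (PiM P N) = (\<Pi>\<^sub>E p\<in>P. carrier (Ap_group \<Gamma> p))"
    "?g \<in> measurable (PiM P N) (borel_of (AutQ_topology (rad_inf \<Gamma>)))"
    unfolding P_def by (rule inv_A_to_prod_measurable[OF G], rule N\<Gamma>, assumption)+
  note inv = inv_A_to_prod[OF G, folded P_def, folded gm(1)]
  have sub: "?g \<omega> \<in> Gal_group \<Gamma> \<inter> S_set n a" if w': "\<omega> \<in> Pi\<^sub>E P V" for \<omega>
  proof -
    have sp: "\<omega> \<in> space (PiM P N)" using sets.sets_into_space[OF box(1)] w' by blast
    define \<tau> where "\<tau> = ?g \<omega>"
    have t: "\<tau> \<in> carrier (AutQ (rad_inf \<Gamma>))" unfolding \<tau>_def by (rule inv(1)[OF sp])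
    have tl: "\<tau> x = \<omega> p x" if "Factorial_Ring.prime p" "x \<in> rad_pinf p \<Gamma>" for p x
      unfolding \<tau>_def by (rule inv(2)[OF sp that])
    have wV: "\<omega> p \<in> V p" if "Factorial_Ring.prime p" for p using w' that unfolding P_def by (auto simp: PiE_def Pi_def)
    have wS: "\<omega> p \<in> Sp_set n a p" if "Factorial_Ring.prime p" for p using wV[OF that] VS[OF that] by blast
    have "\<tau> \<in> S_set n a"
      unfolding S_iff
    proof (intro conjI allI impI ballI)
      show "\<tau> \<in> carrier (AutQ (rad_inf \<Gamma>))" by (rule t)
      fix p :: nat and i assume p: "Factorial_Ring.prime p" and i: "i \<in> {1..n}"
      from wS[OF p] i obtain x where x: "x \<in> rad p (generate Cstar {a i})" "\<omega> p x \<noteq> x" unfolding Sp_set_iff by blast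
      have "x \<in> rad_pinf p \<Gamma>" using countable_rad_single(2)[of n a i p, OF aQ i p] x(1) unfolding \<Gamma>_def by blast
      then have "\<tau> x \<noteq> x" using tl[OF p] x(2) by simp
      then show "\<exists>x\<in>rad p (generate Cstar {a i}). \<tau> x \<noteq> x" using x(1) by blast
    qed
    moreover have "\<tau> \<in> Gal_group (Gam n a)"
    proof (rule Gal_criterion[of n a w B \<tau> u, OF aQ w(1,2) B])
      show "\<tau> \<in> carrier (A_group (Gam n a))" using t unfolding \<Gamma>_def A_group_def .
      have w2: "\<omega> 2 \<in> carrier (AutQ (rad_pinf 2 \<Gamma>))" using wS[OF two_is_prime_nat] unfolding Sp_set_iff \<Gamma>_def by blast
      have "2 \<le> B" unfolding B_def by simp
      then have "\<forall>x\<in>F2. \<omega> 2 x = \<sigma>2 x" using wV[OF two_is_prime_nat] unfolding V_def F_def \<sigma>_def by simp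
      then have t2: "\<omega> 2 zeta8 = zeta8 ^ u" "\<forall>x\<in>rad_pinf 2 \<Gamma>. x ^ 2 \<in> Qstar \<longrightarrow> \<omega> 2 x = w (x ^ 2) * x"
        using two(4) w2 by blast+
      have "zeta8 \<noteq> 0" unfolding zeta8_def by simp
      then have "zeta8 \<in> rad_pinf 2 \<Gamma>" using zeta8(2) mgroup_one[OF G(1)] by (intro rad_pinfI[of zeta8 3]) auto
      then show "\<tau> zeta8 = zeta8 ^ u" using tl[OF two_is_prime_nat] t2(1) by simp
      show "\<i> ^ u = w (- 1) * \<i>" by (rule u(1))
      show "zeta8 ^ u + inverse (zeta8 ^ u) = w 2 * complex_of_real (sqrt 2)" by (rule u(2))
      show "\<tau> x = w (x ^ 2) * x" if "x \<in> rad_pinf 2 (Gam n a)" "x ^ 2 \<in> Qstar" for x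
        using that tl[OF two_is_prime_nat, of x] t2(2) unfolding \<Gamma>_def by simp
      fix p :: nat and \<theta> assume p: "Factorial_Ring.prime p" "p \<ge> 3" "p \<le> B" and th: "embedding (qspan runity) \<theta>"
        "\<forall>x\<in>runity. \<theta> x = \<tau> x" "\<theta> \<i> = w (- 1) * \<i>"
      have q: "Q p (\<sigma> p) (F p)" using odd[OF p(1,2)] p(2) unfolding \<sigma>_def F_def by simp
      then have "\<forall>x\<in>F p. \<tau> x = \<sigma> p x" using wV[OF p(1)] p(3) tl[OF p(1)] unfolding V_def Q_def by auto
      then show "complex_of_real (sqrt p) \<in> qspan runity \<and> \<theta> (complex_of_real (sqrt p)) = w (of_nat p) * complex_of_real (sqrt p)"
        using q th unfolding Q_def by blast
    qed
    ultimately show ?thesis unfolding \<tau>_def \<Gamma>_def by blast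
  qed
  have meas: "measure (prod_measure \<Gamma> N) Y = measure (PiM P N) (?g -` Y \<inter> space (PiM P N))"
    if "Y \<in> sets (borel_of (AutQ_topology (rad_inf \<Gamma>)))" for Y
    unfolding prod_measure_def P_def[symmetric] by (rule measure_distr[OF gm(2) that])
  have Gs: "Gal_group \<Gamma> \<in> sets (borel_of (AutQ_topology (rad_inf \<Gamma>)))"
    unfolding \<Gamma>_def by (rule Gal_group_measurable) (rule aQ)
  have Ss: "S_set n a \<in> sets (borel_of (AutQ_topology (rad_inf \<Gamma>)))"
    unfolding \<Gamma>_def by (rule S_set_measurable) (rule aQ)
  \<comment> \<open>Stated for any measurable superset, so that numerator and denominator are both
    covered.\<close>
  have lower: "measure (prod_measure \<Gamma> N) Y > 0"
    if "Y \<in> sets (borel_of (AutQ_topology (rad_inf \<Gamma>)))" "Gal_group \<Gamma> \<inter> S_set n a \<subseteq> Y" for Y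
  proof -
    have "Pi\<^sub>E P V \<subseteq> ?g -` Y \<inter> space (PiM P N)" using sub that(2) sets.sets_into_space[OF box(1)] by blast
    then have "measure (PiM P N) (Pi\<^sub>E P V) \<le> measure (PiM P N) (?g -` Y \<inter> space (PiM P N))"
      by (rule finite_measure_mono) (rule measurable_sets[OF gm(2) that(1)])
    then show ?thesis using box(2) unfolding meas[OF that(1)] by linarith
  qed
  show "measure (prod_measure (Gam n a) N) (Gal_group (Gam n a) \<inter> S_set n a) > 0"
    using lower[OF sets.Int[OF Gs Ss]] unfolding \<Gamma>_def by blast
  show "measure (prod_measure (Gam n a) N) (Gal_group (Gam n a)) > 0"
    using lower[OF Gs] unfolding \<Gamma>_def by blast
qed

section \<open>The two implications\<close>

text \<open>Once the \<open>p\<close>-th roots of unity are fixed, \<open>\<sigma> x / x\<close>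
  depends only on \<open>x ^ p\<close>, since another root differs by a fixed factor. Elements of
  Gamma are fixed, so the values are \<open>p\<close>-th roots of unity.\<close>

lemma Kummer_character:
  assumes \<Gamma>: "mgroup \<Gamma>" "\<Gamma> \<subseteq> Qstar" and \<sigma>: "\<sigma> \<in> carrier (AutQ (rad_inf \<Gamma>))" and p: "p \<ge> (1::nat)"
    and fixz: "\<And>z. z ^ p = 1 \<Longrightarrow> \<sigma> z = z"
  shows "\<exists>K. mhom \<Gamma> K \<and> (\<forall>x\<in>\<Gamma>. K x ^ p = 1) \<and> (\<forall>x\<in>\<Gamma>. x \<in> powers p \<longrightarrow> K x = 1) \<and>
    (\<forall>x. x ^ p \<in> \<Gamma> \<longrightarrow> \<sigma> x = K (x ^ p) * x)"
proof -
  note M = mgroup_rad_inf[OF \<Gamma>(1)]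
  note h = AutQ_mhom[OF \<sigma> M]
  have p0: "p > 0" using p by simp
  have "\<forall>x\<in>\<Gamma>. \<exists>y. y ^ p = x" using complex_root_exists[OF p0] mgroup_nonzero[OF \<Gamma>(1)] by blast
  then obtain r where r: "\<And>x. x \<in> \<Gamma> \<Longrightarrow> r x ^ p = x" by metis
  define K where "K x = \<sigma> (r x) / r x" for x
  have nz: "x \<noteq> 0" if "x ^ p \<in> \<Gamma>" for x using mgroup_nonzero[OF \<Gamma>(1) that] p0 by auto
  have mem: "x \<in> rad_inf \<Gamma>" if "x ^ p \<in> \<Gamma>" for x by (rule rad_infI[OF nz[OF that] p that])
  have K: "\<sigma> x = K (x ^ p) * x" if x: "x ^ p \<in> \<Gamma>" for x
  proof -
    define y where "y = r (x ^ p)"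
    have y: "y ^ p = x ^ p" unfolding y_def by (rule r[OF x])
    have ym: "y ^ p \<in> \<Gamma>" unfolding y by (rule x)
    have "(x / y) ^ p = 1" using y nz[OF x] by (simp add: power_divide)
    then have z: "\<sigma> (x / y) = x / y" by (rule fixz)
    have "\<sigma> x / \<sigma> y = x / y" using mhom_divide[OF M h mem[OF x] mem[OF ym]] z by simp
    moreover have "\<sigma> y \<noteq> 0" by (rule mhom_nonzero[OF M h mem[OF ym]])
    ultimately show ?thesis unfolding K_def y_def[symmetric] using nz[OF ym] by (simp add: field_simps)
  qed
  have rm: "r x ^ p \<in> \<Gamma>" if "x \<in> \<Gamma>" for x using r[OF that] that by simp
  have "mhom \<Gamma> K" unfolding mhom_def
  proof (intro conjI ballI)
    fix x assume x: "x \<in> \<Gamma>"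
    show "K x \<noteq> 0" unfolding K_def using nz[OF rm[OF x]] mhom_nonzero[OF M h mem[OF rm[OF x]]] by simp
    fix y assume y: "y \<in> \<Gamma>"
    have e: "(r x * r y) ^ p = x * y" using r x y by (simp add: power_mult_distrib)
    have "\<sigma> (r x * r y) = K (x * y) * (r x * r y)"
      using K[of "r x * r y"] mgroup_mult[OF \<Gamma>(1) x y] unfolding e by blast
    moreover have "\<sigma> (r x * r y) = \<sigma> (r x) * \<sigma> (r y)" by (rule mhom_mult[OF M h mem[OF rm[OF x]] mem[OF rm[OF y]]])
    ultimately show "K (x * y) = K x * K y" unfolding K_def[of x] K_def[of y]
      using nz[OF rm[OF x]] nz[OF rm[OF y]] by (simp add: field_simps)
  qed
  moreover have "K x ^ p = 1" if x: "x \<in> \<Gamma>" for x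
  proof -
    have "\<sigma> (r x) ^ p = \<sigma> (r x ^ p)" using mhom_power[OF M h mem[OF rm[OF x]]] by simp
    also have "\<dots> = x" unfolding r[OF x] by (rule AutQ_fix[OF \<sigma>]) (use x \<Gamma>(2) rad_inf_superset[OF \<Gamma>(1)] in auto)
    finally show ?thesis unfolding K_def using r[OF x] mgroup_nonzero[OF \<Gamma>(1) x] by (simp add: power_divide)
  qed
  moreover have "K x = 1" if x: "x \<in> \<Gamma>" "x \<in> powers p" for x
  proof -
    obtain y where y: "y \<in> Qstar" "x = y ^ p" using x(2) unfolding powers_def by blast
    have ym: "y ^ p \<in> \<Gamma>" using x(1) y(2) by simp
    have "\<sigma> y = y" by (rule AutQ_fix[OF \<sigma> mem[OF ym] y(1)])
    then show ?thesis using K[OF ym] nz[OF ym] y(2) by simp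
  qed
  ultimately show ?thesis using K by blast
qed

lemma Gal_S_empty:
  assumes a: "\<And>i. i \<in> {1..n} \<Longrightarrow> a i \<in> Qstar"
    and 2: "cls 2 (-3) \<in> kernel (Gbar (Gam n a) 2) (mu 2) (w2 n a)"
    and 3: "\<forall>\<psi> \<in> hom (Gbar (Gam n a) 3) (mu 3). \<exists>i\<in>{1..n}. cls 3 (a i) \<in> kernel (Gbar (Gam n a) 3) (mu 3) \<psi>"
  shows "Gal_group (Gam n a) \<inter> S_set n a = {}"
proof (rule ccontr)
  assume "Gal_group (Gam n a) \<inter> S_set n a \<noteq> {}"
  then obtain \<sigma> where \<sigma>: "\<sigma> \<in> Gal_group (Gam n a)" "\<sigma> \<in> S_set n a" by blast
  define \<Gamma> where "\<Gamma> = Gam n a"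
  have G: "mgroup \<Gamma>" "\<Gamma> \<subseteq> Qstar" unfolding \<Gamma>_def using Gam_props[of n a] a by blast+
  have aG: "a i \<in> \<Gamma>" if "i \<in> {1..n}" for i unfolding \<Gamma>_def using Gam_generator[of n a i] a that by blast
  have s: "\<sigma> \<in> carrier (AutQ (rad_inf \<Gamma>))" "preserves_relations (rad_inf \<Gamma>) \<sigma>"
    using \<sigma>(1) unfolding \<Gamma>_def[symmetric] Gal_group_eq[OF G] A_group_def by blast+
  have moves: "\<exists>x\<in>rad p (generate Cstar {a i}). \<sigma> x \<noteq> x" if "Factorial_Ring.prime p" "i \<in> {1..n}" for p i
    using \<sigma>(2) S_set_iff[of n a \<sigma>] a that by blast
  note M = mgroup_rad_inf[OF G(1)]
  \<comment> \<open>If \<open>K (a i) = 1\<close>, then \<open>K\<close> is 1 on the group generated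
    by \<open>a i\<close>, so \<open>\<sigma>\<close> fixes all \<open>p\<close>-th roots of its
    elements, against membership in \<open>S\<close>.\<close>
  have nontrivial: "K (a i) \<noteq> 1"
    if p: "Factorial_Ring.prime p" and K: "mhom \<Gamma> K" "\<forall>x. x ^ p \<in> \<Gamma> \<longrightarrow> \<sigma> x = K (x ^ p) * x" and i: "i \<in> {1..n}" for K p i
  proof
    assume K1: "K (a i) = 1"
    have "mgroup {x \<in> \<Gamma>. K x = 1}"
      using mgroup_one[OF G(1)] mgroup_nonzero[OF G(1)] mgroup_mult[OF G(1)] mgroup_inverse[OF G(1)]
        mhom_one[OF G(1) K(1)] mhom_mult[OF G(1) K(1)] mhom_inverse[OF G(1) K(1)]
      unfolding mgroup_def by auto
    then have sub: "generate Cstar {a i} \<subseteq> {x \<in> \<Gamma>. K x = 1}"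
      by (rule generate_minimal) (use K1 aG[OF i] in simp)
    obtain x where x: "x \<in> rad p (generate Cstar {a i})" "\<sigma> x \<noteq> x" using moves[OF p i] by blast
    then have "x ^ p \<in> generate Cstar {a i}" unfolding rad_iff by blast
    then have "x ^ p \<in> \<Gamma>" "K (x ^ p) = 1" using sub by blast+
    then show False using K(2) x(2) by simp
  qed
  have fix2: "\<sigma> z = z" if "z ^ 2 = 1" for z
  proof -
    have "z = 1 \<or> z = -1" using that by (simp add: power2_eq_1_iff)
    then have "z \<in> Qstar" unfolding Qstar_def by auto
    moreover have "z \<in> rad_inf \<Gamma>" using runity_subset[OF G(1)] runity_mem[of 2 z] that by auto
    ultimately show ?thesis using AutQ_fix[OF s(1)] by blast
  qed
  obtain K where K: "mhom \<Gamma> K" "\<forall>x\<in>\<Gamma>. K x ^ 2 = 1" "\<forall>x\<in>\<Gamma>. x \<in> powers 2 \<longrightarrow> K x = 1"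
    "\<forall>x. x ^ 2 \<in> \<Gamma> \<longrightarrow> \<sigma> x = K (x ^ 2) * x"
    using Kummer_character[OF G s(1), of 2] fix2 by auto
  have Ka: "K (a i) = - 1" if i: "i \<in> {1..n}" for i
    using nontrivial[OF two_is_prime_nat K(1,4) i] K(2) aG[OF i] by (auto simp: power2_eq_1_iff)
  have w2K: "w2 n a (cls 2 x) = K x" if "x \<in> \<Gamma>" for x
    by (rule w2_props) (use a K Ka that in \<open>auto simp: \<Gamma>_def\<close>)
  have k2: "cls 2 (-3) \<in> cls 2 ` \<Gamma>" "w2 n a (cls 2 (-3)) = 1"
    using 2 unfolding kernel_def carrier_Gbar one_mu \<Gamma>_def by blast+
  then obtain g where g: "g \<in> \<Gamma>" "cls 2 (-3) = cls 2 g" by blast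
  have Kg: "K g = 1" using w2K[OF g(1)] k2(2) g(2) by simp
  have "-3 / g \<in> powers 2" using g(2) cls_eq_iff[of "-3" 2 g] by simp
  then obtain c where c: "c \<in> Qstar" "-3 / g = c ^ 2" unfolding powers_def by blast
  have g0: "g \<noteq> 0" by (rule mgroup_nonzero[OF G(1) g(1)])
  have fix3: "\<sigma> z = z" if z: "z ^ 3 = 1" for z
  proof (cases "z = 1")
    case True then show ?thesis using mhom_one[OF M AutQ_mhom[OF s(1) M]] by simp
  next
    case False
    have "(z - 1) * (z ^ 2 + z + 1) = z ^ 3 - 1" by (simp add: algebra_simps power2_eq_square power3_eq_cube)
    then have z2: "z ^ 2 + z + 1 = 0" using z False by simp
    have "(2 * z + 1) ^ 2 = 4 * (z ^ 2 + z + 1) - 3" by (simp add: algebra_simps power2_eq_square)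
    then have sq: "(2 * z + 1) ^ 2 = -3" unfolding z2 by simp
    have c0: "c \<noteq> 0" "c \<in> \<rat>" using c(1) unfolding Qstar_def by auto
    then obtain q where q: "c = of_rat q" unfolding Rats_def by blast
    \<comment> \<open>\<open>2 * z + 1\<close> is a square root of -3, hence \<open>y\<close> is a
      square root of \<open>g\<close>, fixed by \<open>\<sigma>\<close> because
      \<open>K g = 1\<close>. The relation between \<open>z\<close>, 1 and \<open>y\<close> below
      then forces \<open>\<sigma> z = z\<close>: the one place where membership in the Galois group,
      and not just in \<open>A\<close>, is used.\<close>
    define y where "y = (2 * z + 1) / c"
    have "y ^ 2 = g" unfolding y_def power_divide sq c(2)[symmetric] using g0 by (simp add: field_simps)
    then have y2: "y ^ 2 \<in> \<Gamma>" and sy: "\<sigma> y = y" using g(1) K(4) Kg by auto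
    have y0: "y \<noteq> 0" using \<open>y ^ 2 = g\<close> g0 by auto
    have yM: "y \<in> rad_inf \<Gamma>" by (rule rad_infI[OF y0 _ y2]) simp
    have zM: "z \<in> rad_inf \<Gamma>" using runity_subset[OF G(1)] runity_mem[of 3 z] z by auto
    let ?l = "[(2, z), (1, 1), (- q, y)]"
    have "?l \<in> lists (UNIV \<times> rad_inf \<Gamma>)" using yM zM mgroup_one[OF M] by simp
    moreover have "lcomb (\<lambda>x. x) ?l = 0" unfolding y_def using c0(1) by (simp add: q of_rat_minus)
    ultimately have "lcomb \<sigma> ?l = 0" using s(2) unfolding preserves_relations_def by blast
    then have "2 * \<sigma> z + (1 - c * y) = 0"
      unfolding lcomb_Cons lcomb_Nil fst_conv snd_conv sy mhom_one[OF M AutQ_mhom[OF s(1) M]] by (simp add: q of_rat_minus del: diff_eq_eq eq_diff_eq)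
    moreover have "c * y = 2 * z + 1" unfolding y_def using c0(1) by simp
    ultimately show ?thesis by simp
  qed
  obtain f where f: "mhom \<Gamma> f" "\<forall>x\<in>\<Gamma>. f x ^ 3 = 1" "\<forall>x\<in>\<Gamma>. x \<in> powers 3 \<longrightarrow> f x = 1"
    "\<forall>x. x ^ 3 \<in> \<Gamma> \<longrightarrow> \<sigma> x = f (x ^ 3) * x"
    using Kummer_character[OF G s(1), of 3] fix3 by auto
  have "\<exists>\<psi>\<in>hom (Gbar \<Gamma> 3) (mu 3) \<inter> extensional (carrier (Gbar \<Gamma> 3)). \<forall>x\<in>\<Gamma>. \<psi> (cls 3 x) = f x"
    by (rule mhom_hom_Gbar[OF G f(1)]) (use f in auto)
  then obtain \<psi> where \<psi>: "\<psi> \<in> hom (Gbar \<Gamma> 3) (mu 3)" "\<forall>x\<in>\<Gamma>. \<psi> (cls 3 x) = f x" by blast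
  obtain i where i: "i \<in> {1..n}" "cls 3 (a i) \<in> kernel (Gbar \<Gamma> 3) (mu 3) \<psi>"
    using 3 \<psi>(1) unfolding \<Gamma>_def by blast
  have "f (a i) = 1" using i(2) \<psi>(2) aG[OF i(1)] unfolding kernel_def one_mu by simp
  moreover have "Factorial_Ring.prime (3::nat)" by simp
  ultimately show False using nontrivial[OF _ f(1,4) i(1)] by blast
qed

section \<open>The rank modulo cubes\<close>

context
  fixes \<Gamma> :: "complex set" and p :: nat
  assumes \<Gamma>: "mgroup \<Gamma>" "\<Gamma> \<subseteq> Qstar" and p: "Factorial_Ring.prime p"
begin

lemma one_Gbar: "one (Gbar \<Gamma> p) = cls p 1"
  by (simp add: Gbar_def FactGroup_def cls_eq)

lemma cls_powers: "h \<in> powers p \<Longrightarrow> x \<in> Qstar \<Longrightarrow> cls p (h * x) = cls p x"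
  using cls_eq_iff[of "h * x" p x] powers_subset[of p] unfolding Qstar_def by auto

lemma cls_power_mod: assumes "x \<in> Qstar" shows "cls p (x ^ (m mod p)) = cls p (x ^ m)"
proof -
  have "x ^ (m div p * p + m mod p) = (x ^ (m div p)) ^ p * x ^ (m mod p)" unfolding power_add power_mult by (rule refl)
  then have e: "x ^ m = (x ^ (m div p)) ^ p * x ^ (m mod p)" unfolding div_mult_mod_eq .
  have "(x ^ (m div p)) ^ p \<in> powers p" unfolding powers_def using mgroup_power[OF mgroup_Qstar assms] by blast
  from cls_powers[OF this mgroup_power[OF mgroup_Qstar assms]] show ?thesis unfolding e by simp
qed

lemma pow_Gbar: "cls p x [^]\<^bsub>Gbar \<Gamma> p\<^esub> (m::nat) = cls p (x ^ m)"
  by (induction m) (simp_all add: one_Gbar mult_Gbar mult.commute)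

lemma smult_Fp_space: "k \<ge> 0 \<Longrightarrow> k \<odot>\<^bsub>Fp_space (Gbar \<Gamma> p)\<^esub> cls p x = cls p (x ^ nat k)"
  using pow_Gbar[of x "nat k"] int_pow_int[of "Gbar \<Gamma> p" "cls p x" "nat k"] by (simp add: Fp_space_def)

lemma Fp_space_simps: "carrier (Fp_space (Gbar \<Gamma> p)) = cls p ` \<Gamma>"
  "add (Fp_space (Gbar \<Gamma> p)) (cls p x) (cls p y) = cls p (x * y)" "ring.zero (Fp_space (Gbar \<Gamma> p)) = cls p 1"
  by (simp_all add: Fp_space_def carrier_Gbar mult_Gbar one_Gbar)

lemma cls_inverse: assumes "x \<in> Qstar" shows "cls p (inverse x) = cls p (x ^ (p - 1))"
proof -
  have x0: "x \<noteq> 0" using assms unfolding Qstar_def by blast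
  have "x ^ p = x ^ (p - 1) * x" using prime_gt_0_nat[OF p] power_minus_mult[of p x] by simp
  then have e: "x ^ (p - 1) = x ^ p * inverse x" using x0 by (simp add: field_simps)
  have "x ^ p \<in> powers p" unfolding powers_def using assms by blast
  from cls_powers[OF this mgroup_inverse[OF mgroup_Qstar assms]] show ?thesis unfolding e by simp
qed

lemma residue_ring_simps: "carrier (residue_ring (int p)) = {0..int p - 1}" "one (residue_ring (int p)) = 1"
  "add (residue_ring (int p)) j k = (j + k) mod int p" "monoid.mult (residue_ring (int p)) j k = (j * k) mod int p"
  by (simp_all add: residue_ring_def)

text \<open>Scalars are the representatives from 0 to \<open>p - 1\<close>, acting as exponents. The
  module laws compare a reduced sum or product of exponents with the unreduced one, and the classes
  agree by \<open>cls_power_mod\<close>.\<close>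

lemma vectorspace_Fp_space: "vectorspace (residue_ring (int p)) (Fp_space (Gbar \<Gamma> p))"
proof -
  let ?V = "Fp_space (Gbar \<Gamma> p)"
  have F: "Ring.field (residue_ring (int p))"
    by (rule residues_prime.is_field) (rule residues_prime.intro[OF p])
  have cQ: "x \<in> Qstar" if "x \<in> \<Gamma>" for x using that \<Gamma>(2) by blast
  have mod_nat: "nat (k mod int p) = nat k mod p" if "k \<ge> 0" for k using that nat_mod_distrib[of k "int p"] by simp
  have A: "abelian_group ?V"
  proof (rule abelian_groupI)
    fix u assume u: "u \<in> carrier ?V"
    then obtain x where x: "x \<in> \<Gamma>" "u = cls p x" unfolding Fp_space_simps by blast
    show "\<zero>\<^bsub>?V\<^esub> \<oplus>\<^bsub>?V\<^esub> u = u" unfolding x(2) Fp_space_simps by simp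
    have "cls p (inverse x) \<oplus>\<^bsub>?V\<^esub> u = \<zero>\<^bsub>?V\<^esub>" unfolding x(2) Fp_space_simps using mgroup_nonzero[OF \<Gamma>(1) x(1)] by simp
    moreover have "cls p (inverse x) \<in> carrier ?V" unfolding Fp_space_simps using mgroup_inverse[OF \<Gamma>(1) x(1)] by blast
    ultimately show "\<exists>v\<in>carrier ?V. v \<oplus>\<^bsub>?V\<^esub> u = \<zero>\<^bsub>?V\<^esub>" by blast
    fix v assume v: "v \<in> carrier ?V"
    then obtain y where y: "y \<in> \<Gamma>" "v = cls p y" unfolding Fp_space_simps by blast
    show "u \<oplus>\<^bsub>?V\<^esub> v \<in> carrier ?V" unfolding x(2) y(2) Fp_space_simps using mgroup_mult[OF \<Gamma>(1) x(1) y(1)] by blast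
    show "u \<oplus>\<^bsub>?V\<^esub> v = v \<oplus>\<^bsub>?V\<^esub> u" unfolding x(2) y(2) Fp_space_simps by (simp add: mult.commute)
    fix w assume "w \<in> carrier ?V"
    then obtain z where z: "z \<in> \<Gamma>" "w = cls p z" unfolding Fp_space_simps by blast
    show "u \<oplus>\<^bsub>?V\<^esub> v \<oplus>\<^bsub>?V\<^esub> w = u \<oplus>\<^bsub>?V\<^esub> (v \<oplus>\<^bsub>?V\<^esub> w)" unfolding x(2) y(2) z(2) Fp_space_simps by (simp add: mult.assoc)
  next
    show "\<zero>\<^bsub>?V\<^esub> \<in> carrier ?V" unfolding Fp_space_simps using mgroup_one[OF \<Gamma>(1)] by blast
  qed
  have "Module.module (residue_ring (int p)) ?V"
  proof (rule moduleI)
    show "cring (residue_ring (int p))" using F by (rule fieldE(1))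
    show "abelian_group ?V" by (rule A)
    fix k u assume k: "k \<in> carrier (residue_ring (int p))" and u: "u \<in> carrier ?V"
    then obtain x where x: "x \<in> \<Gamma>" "u = cls p x" unfolding Fp_space_simps by blast
    have k0: "k \<ge> 0" using k unfolding residue_ring_simps by simp
    show "k \<odot>\<^bsub>?V\<^esub> u \<in> carrier ?V" unfolding x(2) smult_Fp_space[OF k0] Fp_space_simps using mgroup_power[OF \<Gamma>(1) x(1)] by blast
    fix v assume v: "v \<in> carrier ?V"
    then obtain y where y: "y \<in> \<Gamma>" "v = cls p y" unfolding Fp_space_simps by blast
    show "k \<odot>\<^bsub>?V\<^esub> (u \<oplus>\<^bsub>?V\<^esub> v) = (k \<odot>\<^bsub>?V\<^esub> u) \<oplus>\<^bsub>?V\<^esub> (k \<odot>\<^bsub>?V\<^esub> v)"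
      unfolding x(2) y(2) Fp_space_simps smult_Fp_space[OF k0] by (simp add: power_mult_distrib)
  next
    fix j k u assume jk: "j \<in> carrier (residue_ring (int p))" "k \<in> carrier (residue_ring (int p))" and u: "u \<in> carrier ?V"
    then obtain x where x: "x \<in> \<Gamma>" "u = cls p x" unfolding Fp_space_simps by blast
    have j0: "j \<ge> 0" and k0: "k \<ge> 0" using jk unfolding residue_ring_simps by simp_all
    have p0: "int p > 0" using prime_gt_0_nat[OF p] by simp
    have s: "(j + k) mod int p \<ge> 0" "(j * k) mod int p \<ge> 0" using p0 by simp_all
    show "(j \<oplus>\<^bsub>residue_ring (int p)\<^esub> k) \<odot>\<^bsub>?V\<^esub> u = (j \<odot>\<^bsub>?V\<^esub> u) \<oplus>\<^bsub>?V\<^esub> (k \<odot>\<^bsub>?V\<^esub> u)"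
      unfolding x(2) residue_ring_simps smult_Fp_space[OF s(1)] smult_Fp_space[OF j0] smult_Fp_space[OF k0] Fp_space_simps
        mod_nat[OF add_nonneg_nonneg[OF j0 k0]] cls_power_mod[OF cQ[OF x(1)]]
      using j0 k0 by (simp add: nat_add_distrib power_add)
    show "(j \<otimes>\<^bsub>residue_ring (int p)\<^esub> k) \<odot>\<^bsub>?V\<^esub> u = j \<odot>\<^bsub>?V\<^esub> (k \<odot>\<^bsub>?V\<^esub> u)"
      unfolding x(2) residue_ring_simps smult_Fp_space[OF s(2)] smult_Fp_space[OF j0] smult_Fp_space[OF k0]
        mod_nat[OF mult_nonneg_nonneg[OF j0 k0]] cls_power_mod[OF cQ[OF x(1)]]
      using j0 k0 by (simp add: nat_mult_distrib power_mult[symmetric] mult.commute)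
  next
    fix u assume "u \<in> carrier ?V"
    then obtain x where x: "x \<in> \<Gamma>" "u = cls p x" unfolding Fp_space_simps by blast
    show "\<one>\<^bsub>residue_ring (int p)\<^esub> \<odot>\<^bsub>?V\<^esub> u = u" unfolding x(2) residue_ring_simps using smult_Fp_space[of 1 x] by simp
  qed
  then show ?thesis using F by (rule vectorspace.intro)
qed

lemma Fp_rank_least:
  "Fp_rank p (Gbar \<Gamma> p) = (LEAST m. \<exists>A. finite A \<and> card A = m \<and> A \<subseteq> cls p ` \<Gamma> \<and>
     LinearCombinations.module.span (residue_ring (int p)) (Fp_space (Gbar \<Gamma> p)) A = cls p ` \<Gamma>)"
  unfolding Fp_rank_def vectorspace.dim_def[OF vectorspace_Fp_space] Fp_space_simps ..

text \<open>The elements whose class lies in the span form a group containing \<open>A\<close> and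
  the \<open>p\<close>-th powers, hence all of Gamma; the exponent \<open>p - 1\<close> supplies
  inverses.\<close>

lemma span_generates:
  assumes A: "A \<subseteq> \<Gamma>" "\<Gamma> \<subseteq> generate Cstar (A \<union> powers p)"
  shows "LinearCombinations.module.span (residue_ring (int p)) (Fp_space (Gbar \<Gamma> p)) (cls p ` A) = cls p ` \<Gamma>"
proof -
  let ?V = "Fp_space (Gbar \<Gamma> p)"
  note mod = vectorspace.axioms(1)[OF vectorspace_Fp_space]
  define S where "S = LinearCombinations.module.span (residue_ring (int p)) ?V (cls p ` A)"
  have sub: "cls p ` A \<subseteq> carrier ?V" unfolding Fp_space_simps using A(1) by blast
  have S: "LinearCombinations.submodule (residue_ring (int p)) S ?V" unfolding S_def by (rule LinearCombinations.module.span_is_submodule[OF mod sub])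
  have own: "cls p ` A \<subseteq> S" unfolding S_def by (rule LinearCombinations.module.in_own_span[OF mod sub])
  have one: "cls p 1 \<in> S" using LinearCombinations.submodule.zero_closed[OF S] unfolding Fp_space_simps .
  have p1: "p \<ge> 1" by (rule prime_ge_1_nat[OF p])
  have "mgroup {x \<in> Qstar. cls p x \<in> S}"
    unfolding mgroup_def
  proof (intro conjI ballI)
    show "1 \<in> {x \<in> Qstar. cls p x \<in> S}" using one mgroup_one[OF mgroup_Qstar] by blast
    show "0 \<notin> {x \<in> Qstar. cls p x \<in> S}" unfolding Qstar_def by blast
    fix x assume x: "x \<in> {x \<in> Qstar. cls p x \<in> S}"
    have "int (p - 1) \<odot>\<^bsub>?V\<^esub> cls p x \<in> S"
      by (rule LinearCombinations.submodule.smult_closed[OF S]) (use x p1 in \<open>auto simp: residue_ring_simps\<close>)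
    then show "inverse x \<in> {x \<in> Qstar. cls p x \<in> S}"
      using x cls_inverse[of x] mgroup_inverse[OF mgroup_Qstar] smult_Fp_space[of "int (p - 1)" x] by simp
    fix y assume y: "y \<in> {x \<in> Qstar. cls p x \<in> S}"
    have "add ?V (cls p x) (cls p y) \<in> S" by (rule LinearCombinations.submodule.m_closed[OF S]) (use x y in auto)
    then show "x * y \<in> {x \<in> Qstar. cls p x \<in> S}" unfolding Fp_space_simps using x y mgroup_mult[OF mgroup_Qstar] by blast
  qed
  moreover have "A \<union> powers p \<subseteq> {x \<in> Qstar. cls p x \<in> S}"
  proof
    fix x assume "x \<in> A \<union> powers p"
    then show "x \<in> {x \<in> Qstar. cls p x \<in> S}"
    proof
      assume "x \<in> A" then show ?thesis using A(1) \<Gamma>(2) own by blast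
    next
      assume "x \<in> powers p" then show ?thesis
        using one cls_powers[of x 1] powers_subset[of p] mgroup_one[OF mgroup_Qstar] by auto
    qed
  qed
  ultimately have "\<Gamma> \<subseteq> {x \<in> Qstar. cls p x \<in> S}" using generate_minimal A(2) by blast
  then have "cls p ` \<Gamma> \<subseteq> S" by blast
  moreover have "S \<subseteq> cls p ` \<Gamma>" using LinearCombinations.submodule.subset[OF S] unfolding Fp_space_simps .
  ultimately show ?thesis unfolding S_def by blast
qed

lemma Fp_rank_le:
  assumes "finite A" "A \<subseteq> \<Gamma>" "\<Gamma> \<subseteq> generate Cstar (A \<union> powers p)"
  shows "Fp_rank p (Gbar \<Gamma> p) \<le> card A"
proof -
  have "Fp_rank p (Gbar \<Gamma> p) \<le> card (cls p ` A)" unfolding Fp_rank_least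
    by (rule Least_le) (use assms span_generates[OF assms(2,3)] in blast)
  also have "\<dots> \<le> card A" by (rule card_image_le[OF assms(1)])
  finally show ?thesis .
qed

text \<open>A spanning set of least size is a single class, that of some \<open>g\<close>. The
  classes from Gamma inside the group generated by \<open>g\<close> and the \<open>p\<close>-th
  powers form a submodule containing it, hence exhaust all classes.\<close>

lemma Fp_rank_1_generator:
  assumes A: "finite A" "A \<subseteq> \<Gamma>" "\<Gamma> \<subseteq> generate Cstar (A \<union> powers p)" and 1: "Fp_rank p (Gbar \<Gamma> p) = 1"
  shows "\<exists>g\<in>\<Gamma>. \<Gamma> \<subseteq> generate Cstar ({g} \<union> powers p)"
proof -
  let ?V = "Fp_space (Gbar \<Gamma> p)"
  note mod = vectorspace.axioms(1)[OF vectorspace_Fp_space]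
  have "\<exists>m. \<exists>A. finite A \<and> card A = m \<and> A \<subseteq> cls p ` \<Gamma> \<and>
     LinearCombinations.module.span (residue_ring (int p)) ?V A = cls p ` \<Gamma>"
    using A(1,2) span_generates[OF A(2,3)] by blast
  from LeastI_ex[OF this, folded Fp_rank_least, unfolded 1] obtain C where C: "card C = 1" "C \<subseteq> cls p ` \<Gamma>"
     "LinearCombinations.module.span (residue_ring (int p)) ?V C = cls p ` \<Gamma>" by blast
  obtain c where "C = {c}" using C(1) by (rule card_1_singletonE)
  then obtain g where g: "g \<in> \<Gamma>" "C = {cls p g}" using C(2) by blast
  define W where "W = generate Cstar ({g} \<union> powers p)"
  have sub: "{g} \<union> powers p \<subseteq> Qstar" using g(1) \<Gamma>(2) powers_subset by blast
  have W: "mgroup W" unfolding W_def by (rule mgroup_generate) (use sub in \<open>auto simp: Qstar_def\<close>)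
  have Wsup: "{g} \<union> powers p \<subseteq> W" unfolding W_def by (blast intro: generate.incl)
  have "LinearCombinations.submodule (residue_ring (int p)) (cls p ` (\<Gamma> \<inter> W)) ?V"
  proof (rule LinearCombinations.submodule.intro[OF mod])
    show "cls p ` (\<Gamma> \<inter> W) \<subseteq> carrier ?V" unfolding Fp_space_simps by blast
    show "\<zero>\<^bsub>?V\<^esub> \<in> cls p ` (\<Gamma> \<inter> W)" unfolding Fp_space_simps using mgroup_one[OF W] mgroup_one[OF \<Gamma>(1)] by blast
    fix u assume "u \<in> cls p ` (\<Gamma> \<inter> W)"
    then obtain x where x: "x \<in> \<Gamma>" "x \<in> W" "u = cls p x" by blast
    show "k \<odot>\<^bsub>?V\<^esub> u \<in> cls p ` (\<Gamma> \<inter> W)" if "k \<in> carrier (residue_ring (int p))" for k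
    proof -
      have "k \<ge> 0" using that unfolding residue_ring_simps by simp
      then show ?thesis unfolding x(3) using smult_Fp_space mgroup_power[OF W x(2)] mgroup_power[OF \<Gamma>(1) x(1)] by simp
    qed
    fix v assume "v \<in> cls p ` (\<Gamma> \<inter> W)"
    then obtain y where y: "y \<in> \<Gamma>" "y \<in> W" "v = cls p y" by blast
    show "u \<oplus>\<^bsub>?V\<^esub> v \<in> cls p ` (\<Gamma> \<inter> W)" unfolding x(3) y(3) Fp_space_simps
      using mgroup_mult[OF W x(2) y(2)] mgroup_mult[OF \<Gamma>(1) x(1) y(1)] by blast
  qed
  moreover have "C \<subseteq> cls p ` (\<Gamma> \<inter> W)" unfolding g(2) using g(1) Wsup by blast
  ultimately have sp: "cls p ` \<Gamma> \<subseteq> cls p ` (\<Gamma> \<inter> W)"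
    using LinearCombinations.module.span_is_subset[OF mod, of C "cls p ` (\<Gamma> \<inter> W)"] C(3) by blast
  have "\<Gamma> \<subseteq> W"
  proof
    fix x assume x: "x \<in> \<Gamma>"
    then obtain y where y: "y \<in> W" "cls p x = cls p y" using sp by blast
    have x0: "x \<noteq> 0" "y \<noteq> 0" using mgroup_nonzero[OF \<Gamma>(1) x] mgroup_nonzero[OF W y(1)] by blast+
    have "x / y \<in> W" using cls_eq_iff[OF x0(1), of p y] y(2) Wsup by blast
    from mgroup_mult[OF W this y(1)] show "x \<in> W" using x0(2) by simp
  qed
  then show ?thesis unfolding W_def using g(1) by blast
qed

end

text \<open>The preimage in \<open>Qstar\<close> of the span of \<open>A\<close> modulo cubes.
  Linear algebra over the field with 3 elements is done with these subgroups rather than in the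
  quotient, so that homomorphisms can be extended along them.\<close>

definition cspan :: "complex set \<Rightarrow> complex set" where
  "cspan A = generate Cstar (A \<union> powers 3)"

lemma cspan_props:
  assumes "A \<subseteq> Qstar"
  shows "mgroup (cspan A)" "cspan A \<subseteq> Qstar" "A \<subseteq> cspan A" "powers 3 \<subseteq> cspan A"
proof -
  have s: "A \<union> powers 3 \<subseteq> Qstar" using assms powers_subset by blast
  then have "A \<union> powers 3 \<subseteq> carrier Cstar" unfolding Qstar_def by auto
  then show "mgroup (cspan A)" unfolding cspan_def by (rule mgroup_generate)
  show "cspan A \<subseteq> Qstar" unfolding cspan_def by (rule generate_minimal[OF mgroup_Qstar s])
  show "A \<subseteq> cspan A" "powers 3 \<subseteq> cspan A" unfolding cspan_def by (blast intro: generate.incl)+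
qed

lemma cspan_minimal: "mgroup H \<Longrightarrow> A \<subseteq> H \<Longrightarrow> powers 3 \<subseteq> H \<Longrightarrow> cspan A \<subseteq> H"
  unfolding cspan_def by (rule generate_minimal) blast+

lemma cspan_mono: "A \<subseteq> B \<Longrightarrow> B \<subseteq> Qstar \<Longrightarrow> cspan A \<subseteq> cspan B"
  using cspan_minimal[OF cspan_props(1), of B A] cspan_props(3,4)[of B] by blast

lemma cspan_empty: "cspan {} \<subseteq> powers 3"
proof (rule cspan_minimal)
  show "mgroup (powers 3)" unfolding mgroup_def
    using one_powers powers_mult powers_inverse powers_subset unfolding Qstar_def by blast
qed auto

lemma cube_mem_cspan: "A \<subseteq> Qstar \<Longrightarrow> x \<in> Qstar \<Longrightarrow> x ^ 3 \<in> cspan A"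
  using cspan_props(4) unfolding powers_def by blast

section \<open>Cubic characters nontrivial at given elements\<close>

definition cubic_character :: "(complex \<Rightarrow> complex) \<Rightarrow> bool" where
  "cubic_character f \<longleftrightarrow> mhom Qstar f \<and> (\<forall>x\<in>powers 3. f x = 1)"

text \<open>Outside the span, \<open>x\<close> has order 3 modulo it, so any cube root of unity may
  be prescribed at \<open>x\<close>.\<close>

lemma cubic_character_extend:
  assumes f: "cubic_character f" and A: "A \<subseteq> Qstar" and x: "x \<in> Qstar" "x \<notin> cspan A" and y: "y ^ 3 = 1"
  shows "\<exists>g. cubic_character g \<and> (\<forall>h\<in>cspan A. g h = f h) \<and> g x = y"
proof -
  note H = cspan_props[OF A]
  have p: "Factorial_Ring.prime (3::nat)" by simp
  have x3: "x ^ 3 \<in> powers 3" unfolding powers_def using x(1) by blast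
  have "y ^ 3 = f (x ^ 3)" using f x3 y unfolding cubic_character_def by simp
  moreover have "mhom (cspan A) f" using f mhom_mono[OF _ H(2)] unfolding cubic_character_def by blast
  ultimately obtain g where "mhom Qstar g" "\<forall>h\<in>cspan A. g h = f h" "g x = y"
    using mhom_extend_prime[OF H(1) mgroup_Qstar H(2) _ p x cube_mem_cspan[OF A x(1)]] by blast
  then show ?thesis using f H(4) unfolding cubic_character_def by (intro exI[of _ g]) auto
qed

lemma cubic_character_trivial: "cubic_character (\<lambda>_. 1)"
  unfolding cubic_character_def mhom_def by simp

lemma cube_root_of_unity_exists: "\<exists>z::complex. z ^ 3 = 1 \<and> z \<noteq> 1 \<and> z ^ 2 \<noteq> 1"
proof -
  obtain z :: complex where z: "z ^ 3 = 1" "\<forall>k. 0 < k \<and> k < 3 \<longrightarrow> z ^ k \<noteq> 1"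
    using primitive_root_of_unity[of 3] by auto
  have "z ^ 1 \<noteq> 1" "z ^ 2 \<noteq> 1" using z(2)[rule_format, of 1] z(2)[rule_format, of 2] by simp_all
  then show ?thesis using z(1) by (intro exI[of _ z]) simp
qed

lemma powi_eq_one_cube_root:
  assumes z: "(z::complex) ^ 3 = 1" "z \<noteq> 1" "z ^ 2 \<noteq> 1" and k: "z powi k = 1"
  shows "\<exists>j. k = 3 * j"
proof -
  have z0: "z \<noteq> 0"
  proof
    assume "z = 0" then show False using z(1) by simp
  qed
  have "z powi k = z powi (3 * (k div 3) + k mod 3)" by simp
  also have "\<dots> = (z powi 3) powi (k div 3) * z powi (k mod 3)"
    using z0 by (simp only: power_int_add power_int_mult simp_thms)
  also have "z powi 3 = 1" using z(1) by simp
  finally have r: "z powi (k mod 3) = 1" using k by simp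
  have "k mod 3 = 0 \<or> k mod 3 = 1 \<or> k mod 3 = 2" by presburger
  then have "k mod 3 = 0"
  proof (elim disjE)
    assume "k mod 3 = 1" then show ?thesis using r z(2) by simp
  next
    assume "k mod 3 = 2" then show ?thesis using r z(3) by simp
  qed
  then have "k = 3 * (k div 3)" by presburger
  then show ?thesis by blast
qed

lemma powi_triple_mem: assumes "x \<in> Qstar" shows "x powi (3 * j) \<in> powers 3"
proof -
  have "x powi (j * 3) = (x powi j) powi 3" by (rule power_int_mult)
  then have "x powi (3 * j) = (x powi j) ^ 3" by (simp add: mult.commute)
  then show ?thesis unfolding powers_def using mgroup_power_int[OF mgroup_Qstar assms] by blast
qed

lemma cspan_insert:
  assumes T: "T \<subseteq> Qstar" and x: "x \<in> Qstar" shows "cspan (insert x T) \<subseteq> mjoin (cspan T) x"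
proof (rule cspan_minimal)
  note H = cspan_props[OF T]
  have x0: "x \<noteq> 0" using x unfolding Qstar_def by blast
  show "mgroup (mjoin (cspan T) x)" by (rule mgroup_mjoin[OF H(1) x0])
  show "insert x T \<subseteq> mjoin (cspan T) x" using H(3) mjoin_superset[of "cspan T" x] mjoin_mem[OF H(1), of x] by blast
  show "powers 3 \<subseteq> mjoin (cspan T) x" using H(4) mjoin_superset[of "cspan T" x] by blast
qed

text \<open>The value at a new independent element may be \<open>z\<close> or \<open>z\<^sup>2\<close>; this choice is used to keep the
  value at \<open>c\<close> nontrivial at the moment \<open>c\<close> becomes dependent on the elements treated so far.\<close>

lemma cubic_character_independent:
  assumes "finite T" "T \<subseteq> Qstar" "\<And>t. t \<in> T \<Longrightarrow> t \<notin> cspan (T - {t})" and c: "c \<notin> powers 3"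
  shows "\<exists>f. cubic_character f \<and> (\<forall>t\<in>T. f t \<noteq> 1) \<and> (c \<in> cspan T \<longrightarrow> f c \<noteq> 1)"
  using assms(1-3)
proof (induction T rule: finite_induct)
  case empty
  show ?case using cubic_character_trivial cspan_empty c by (intro exI[of _ "\<lambda>_. 1"]) blast
next
  case (insert x T)
  have TQ: "T \<subseteq> Qstar" and xQ: "x \<in> Qstar" using insert.prems(1) by blast+
  have "insert x T - {x} = T" using insert.hyps(2) by blast
  then have xT: "x \<notin> cspan T" using insert.prems(2)[of x] by simp
  have "t \<notin> cspan (T - {t})" if "t \<in> T" for t
  proof -
    have "cspan (T - {t}) \<subseteq> cspan (insert x T - {t})" by (rule cspan_mono) (use insert.prems(1) in blast)+
    then show ?thesis using insert.prems(2)[of t] that by blast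
  qed
  then obtain f where f: "cubic_character f" "\<forall>t\<in>T. f t \<noteq> 1" "c \<in> cspan T \<longrightarrow> f c \<noteq> 1"
    using insert.IH[OF TQ] by blast
  obtain z :: complex where z: "z ^ 3 = 1" "z \<noteq> 1" "z ^ 2 \<noteq> 1" using cube_root_of_unity_exists by blast
  have "(z ^ 2) ^ 3 = (z ^ 3) ^ 2" unfolding power_mult[symmetric] by simp
  then have z23: "(z ^ 2) ^ 3 = 1" using z(1) by simp
  obtain g where g: "cubic_character g" "\<forall>h\<in>cspan T. g h = f h" "g x = z"
    using cubic_character_extend[OF f(1) TQ xQ xT z(1)] by blast
  obtain g' where g': "cubic_character g'" "\<forall>h\<in>cspan T. g' h = f h" "g' x = z ^ 2"
    using cubic_character_extend[OF f(1) TQ xQ xT z23] by blast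
  have T: "T \<subseteq> cspan T" by (rule cspan_props(3)[OF TQ])
  have nt: "\<forall>t\<in>insert x T. g t \<noteq> 1" "\<forall>t\<in>insert x T. g' t \<noteq> 1"
    using f(2) g(2,3) g'(2,3) z(2,3) T by auto
  show ?case
  proof (cases "c \<in> cspan (insert x T) \<and> g c = 1")
    case False
    then show ?thesis using g(1) nt(1) by blast
  next
    case True
    \<comment> \<open>If \<open>g\<close> and \<open>g'\<close> were both 1 at
      \<open>c = h * x powi k\<close>, then \<open>z powi k\<close> would equal its own square and
      so be 1. Then 3 divides \<open>k\<close>, so \<open>c\<close> already lies in the span of
      \<open>T\<close>, where \<open>f\<close> is not 1 at \<open>c\<close>.\<close>
    have "g' c \<noteq> 1"
    proof
      assume 1: "g' c = 1"
      note H = cspan_props[OF TQ]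
      obtain h k where hk: "h \<in> cspan T" "c = h * x powi k"
        using True cspan_insert[OF TQ xQ] unfolding mjoin_def by blast
      have m: "mhom Qstar g" "mhom Qstar g'" using g(1) g'(1) unfolding cubic_character_def by blast+
      have hQ: "h \<in> Qstar" using hk(1) H(2) by blast
      have fh: "f h \<noteq> 0" using mhom_nonzero[OF mgroup_Qstar m(1) hQ] g(2) hk(1) by simp
      have "g c = f h * z powi k" "g' c = f h * (z ^ 2) powi k"
        unfolding hk(2) mhom_mult[OF mgroup_Qstar m(1) hQ mgroup_power_int[OF mgroup_Qstar xQ]]
          mhom_mult[OF mgroup_Qstar m(2) hQ mgroup_power_int[OF mgroup_Qstar xQ]]
          mhom_power_int[OF mgroup_Qstar m(1) xQ] mhom_power_int[OF mgroup_Qstar m(2) xQ]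
        using g(2,3) g'(2,3) hk(1) by simp_all
      then have "f h * z powi k = f h * (z ^ 2) powi k" using 1 True by simp
      then have "z powi k = (z powi k) ^ 2"
        using fh by (simp add: power2_eq_square power_int_mult_distrib)
      moreover have "z powi k \<noteq> 0"
      proof
        assume "z powi k = 0"
        then show False using z(1) by (simp add: power_int_eq_0_iff)
      qed
      ultimately have "z powi k = 1" using mult_cancel_left1[of "z powi k" "z powi k"] unfolding power2_eq_square by blast
      then obtain j where j: "k = 3 * j" using powi_eq_one_cube_root[OF z] by blast
      have "x powi k \<in> powers 3" unfolding j by (rule powi_triple_mem[OF xQ])
      then have "c \<in> cspan T" unfolding hk(2) using mgroup_mult[OF H(1) hk(1)] H(4) by blast
      then show False using f(3) True g(2) by simp
    qed
    then show ?thesis using g'(1) nt(2) by blast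
  qed
qed

text \<open>A basis chosen from \<open>A\<close> itself: a generating subset of least cardinality is
  independent.\<close>

lemma minimal_generating_subset:
  assumes "finite A" "A \<subseteq> Qstar"
  shows "\<exists>T\<subseteq>A. A \<subseteq> cspan T \<and> (\<forall>t\<in>T. t \<notin> cspan (T - {t}))"
proof -
  define P where "P T \<longleftrightarrow> T \<subseteq> A \<and> A \<subseteq> cspan T" for T
  have "P A" unfolding P_def using cspan_props(3)[OF assms(2)] by blast
  then obtain T where T: "P T" "\<And>S. P S \<Longrightarrow> card T \<le> card S"
    using ex_has_least_nat[of P A card] by blast
  have TQ: "T \<subseteq> Qstar" using T(1) assms(2) unfolding P_def by blast
  have "t \<notin> cspan (T - {t})" if t: "t \<in> T" for t
  proof
    assume c: "t \<in> cspan (T - {t})"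
    have Q: "T - {t} \<subseteq> Qstar" using TQ by blast
    have "T \<subseteq> cspan (T - {t})" using c cspan_props(3)[OF Q] by blast
    then have "cspan T \<subseteq> cspan (T - {t})" by (rule cspan_minimal[OF cspan_props(1)[OF Q] _ cspan_props(4)[OF Q]])
    then have "P (T - {t})" using T(1) unfolding P_def by blast
    then have le: "card T \<le> card (T - {t})" by (rule T(2))
    have "finite T" using T(1) assms(1) finite_subset unfolding P_def by blast
    then have "card (T - {t}) < card T" using t by (rule card_Diff1_less)
    then show False using le by linarith
  qed
  then show ?thesis using T(1) unfolding P_def by blast
qed

text \<open>Let \<open>f\<close> take a primitive cube root of unity at \<open>g\<close>. An element
  \<open>h * g powi k\<close> with \<open>h\<close> a cube has value 1 only if 3 divides
  \<open>k\<close>, and then it is a cube itself.\<close>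

lemma cubic_character_rank_one:
  assumes g: "g \<in> Qstar" and A: "A \<subseteq> cspan {g}" "A \<inter> powers 3 = {}"
  shows "\<exists>f. cubic_character f \<and> (\<forall>x\<in>A. f x \<noteq> 1)"
proof (cases "g \<in> powers 3")
  case True
  then have "cspan {g} \<subseteq> cspan {}" using cspan_props[of "{}"] by (intro cspan_minimal) auto
  then have "A = {}" using A cspan_empty by blast
  then show ?thesis using cubic_character_trivial by blast
next
  case False
  then have ge: "g \<notin> cspan {}" using cspan_empty by blast
  obtain z :: complex where z: "z ^ 3 = 1" "z \<noteq> 1" "z ^ 2 \<noteq> 1" using cube_root_of_unity_exists by blast
  obtain f where f: "cubic_character f" "f g = z"
    using cubic_character_extend[OF cubic_character_trivial empty_subsetI g ge z(1)] by blast
  note Q = mgroup_Qstar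
  have m: "mhom Qstar f" using f(1) unfolding cubic_character_def by blast
  have "f x \<noteq> 1" if x: "x \<in> A" for x
  proof
    assume fx: "f x = 1"
    have "x \<in> mjoin (cspan {}) g" using x A(1) cspan_insert[OF empty_subsetI g] by blast
    then obtain h k where hk: "h \<in> cspan {}" "x = h * g powi k" unfolding mjoin_def by blast
    have h3: "h \<in> powers 3" using hk(1) cspan_empty by blast
    then have hQ: "h \<in> Qstar" "f h = 1" using powers_subset f(1) unfolding cubic_character_def by blast+
    have "z powi k = 1"
      using fx unfolding hk(2) mhom_mult[OF Q m hQ(1) mgroup_power_int[OF Q g]] mhom_power_int[OF Q m g] f(2) hQ(2) by simp
    then obtain j where j: "k = 3 * j" using powi_eq_one_cube_root[OF z] by blast
    have "g powi k \<in> powers 3" unfolding j by (rule powi_triple_mem[OF g])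
    then have "x \<in> powers 3" unfolding hk(2) by (rule powers_mult[OF h3])
    then show False using A(2) x by blast
  qed
  then show ?thesis using f(1) by blast
qed

text \<open>Let \<open>T\<close> be a basis drawn from the \<open>a i\<close>; it has at least as
  many elements as the rank. With at least \<open>n - 1\<close> of them at most one
  \<open>a i\<close> remains, which is the \<open>c\<close> of
  \<open>cubic_character_independent\<close>. Otherwise everything lies in the span of one element:
  by rank 1, or because \<open>n \<le> 3\<close> leaves at most one basis element.\<close>

lemma noncube_character:
  assumes a: "\<And>i. i \<in> {1..n} \<Longrightarrow> a i \<in> Qstar" "\<And>i. i \<in> {1..n} \<Longrightarrow> a i \<notin> powers 3"
    and rank: "n \<le> 3 \<or> Fp_rank 3 (Gbar (Gam n a) 3) = 1 \<or> Fp_rank 3 (Gbar (Gam n a) 3) \<ge> n - 1"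
  shows "\<exists>f. cubic_character f \<and> (\<forall>i\<in>{1..n}. f (a i) \<noteq> 1)"
proof -
  define A where "A = a ` {1..n}"
  have A: "finite A" "A \<subseteq> Qstar" "A \<inter> powers 3 = {}" unfolding A_def using a by auto
  have G: "mgroup (Gam n a)" "Gam n a \<subseteq> Qstar" using Gam_props[of n a] a(1) by blast+
  have p3: "Factorial_Ring.prime (3::nat)" by simp
  have AG: "A \<subseteq> Gam n a" unfolding A_def Gam_def by (blast intro: generate.incl)
  obtain T where T: "T \<subseteq> A" "A \<subseteq> cspan T" "\<forall>t\<in>T. t \<notin> cspan (T - {t})"
    using minimal_generating_subset[OF A(1,2)] by blast
  have TQ: "T \<subseteq> Qstar" and finT: "finite T" using T(1) A finite_subset by blast+
  have cT: "Gam n a \<subseteq> cspan T"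
    unfolding Gam_def A_def[symmetric] by (rule generate_minimal[OF cspan_props(1)[OF TQ] T(2)])
  have TG: "T \<subseteq> Gam n a" using T(1) AG by blast
  have le: "Fp_rank 3 (Gbar (Gam n a) 3) \<le> card T"
    by (rule Fp_rank_le[OF G p3 finT TG]) (use cT in \<open>simp add: cspan_def\<close>)
  have "\<exists>f. cubic_character f \<and> (\<forall>x\<in>A. f x \<noteq> 1)"
  proof (cases "A = {}")
    case True
    then show ?thesis using cubic_character_trivial by blast
  next
    case ne: False
    show ?thesis
    proof (cases "card T \<ge> n - 1")
      case True
      have "card A \<le> n" unfolding A_def using card_image_le[of "{1..n}" a] by simp
      moreover have "card (A - T) = card A - card T" by (rule card_Diff_subset[OF finT T(1)])
      ultimately have 1: "card (A - T) \<le> 1" using True by simp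
      have "\<exists>c\<in>A. A \<subseteq> insert c T"
      proof (cases "A - T = {}")
        case True then show ?thesis using ne by blast
      next
        case False
        then have "card (A - T) \<noteq> 0" using A(1) by simp
        then have "card (A - T) = 1" using 1 by linarith
        then obtain c where "A - T = {c}" by (rule card_1_singletonE)
        then show ?thesis by blast
      qed
      then obtain c where c: "c \<in> A" "A \<subseteq> insert c T" by blast
      have "c \<notin> powers 3" using c(1) A(3) by blast
      then obtain f where "cubic_character f" "\<forall>t\<in>T. f t \<noteq> 1" "c \<in> cspan T \<longrightarrow> f c \<noteq> 1"
        using cubic_character_independent[OF finT TQ] T(3) by blast
      then show ?thesis using c T(2) by blast
    next
      case False
      have "\<exists>g\<in>Qstar. A \<subseteq> cspan {g}"
      proof (cases "Fp_rank 3 (Gbar (Gam n a) 3) = 1")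
        case True
        then obtain g where "g \<in> Gam n a" "Gam n a \<subseteq> cspan {g}"
          using Fp_rank_1_generator[OF G p3 finT TG] cT unfolding cspan_def by blast
        then show ?thesis using AG G(2) by blast
      next
        case no: False
        then have "n \<le> 3" using rank le False by linarith
        then have "card T = 0 \<or> card T = 1" using False by linarith
        then show ?thesis
        proof
          assume "card T = 0"
          then have "T = {}" using finT by simp
          then have "A \<subseteq> powers 3" using T(2) cspan_empty by blast
          then show ?thesis using A(3) ne by blast
        next
          assume "card T = 1"
          then obtain g where "T = {g}" by (rule card_1_singletonE)
          then show ?thesis using T(2) TQ by blast
        qed
      qed
      then show ?thesis using cubic_character_rank_one A(3) by blast
    qed
  qed
  then show ?thesis unfolding A_def by blast
qed

theorem theorem6p2:
  fixes n :: nat and a :: "nat \<Rightarrow> complex"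
    and \<nu>p :: "nat \<Rightarrow> (complex \<Rightarrow> complex) measure"
  assumes "n \<ge> 1"
    and "\<And>i. i \<in> {1..n} \<Longrightarrow> a i \<in> Qstar - {1, -1}"
    and "\<And>p. Factorial_Ring.prime p \<Longrightarrow>
           normalized_haar (Ap_group (Gam n a) p) (AutQ_topology (rad_pinf p (Gam n a))) (\<nu>p p)"
    and "\<not> (\<exists>I \<subseteq> {1..n}. odd (card I) \<and> (\<exists>y \<in> Qstar. (\<Prod>i\<in>I. a i) = y ^ 2))"
  shows "(measure (prod_measure (Gam n a) \<nu>p) (Gal_group (Gam n a) \<inter> S_set n a)
            / measure (prod_measure (Gam n a) \<nu>p) (Gal_group (Gam n a)) = 0
          \<longleftrightarrow>
            cls 2 (-3) \<in> kernel (Gbar (Gam n a) 2) (mu 2) (w2 n a)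
            \<and> (\<forall>\<psi> \<in> hom (Gbar (Gam n a) 3) (mu 3).
                 \<exists>i\<in>{1..n}. cls 3 (a i) \<in> kernel (Gbar (Gam n a) 3) (mu 3) \<psi>))
       \<and> ((\<forall>i\<in>{1..n}. \<not> (\<exists>y \<in> Qstar. a i = y ^ 3)) \<longrightarrow>
            n \<le> 3 \<or> Fp_rank 3 (Gbar (Gam n a) 3) = 1 \<or> Fp_rank 3 (Gbar (Gam n a) 3) \<ge> n - 1 \<longrightarrow>
            \<not> (\<forall>\<psi> \<in> hom (Gbar (Gam n a) 3) (mu 3).
                 \<exists>i\<in>{1..n}. cls 3 (a i) \<in> kernel (Gbar (Gam n a) 3) (mu 3) \<psi>))"
    (is "(?q = 0 \<longleftrightarrow> ?A \<and> ?B) \<and> (?C \<longrightarrow> ?D \<longrightarrow> \<not> ?B)")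
proof (intro conjI iffI impI)
  have aQ: "a i \<in> Qstar" if "i \<in> {1..n}" for i using assms(2)[OF that] by blast
  have G: "mgroup (Gam n a)" "Gam n a \<subseteq> Qstar" using Gam_props[of n a] aQ by blast+
  have aG: "a i \<in> Gam n a" if "i \<in> {1..n}" for i using Gam_generator[of n a i] aQ that by blast
  have ker: "cls 3 (a i) \<in> kernel (Gbar (Gam n a) 3) (mu 3) \<psi> \<longleftrightarrow> \<psi> (cls 3 (a i)) = 1" if "i \<in> {1..n}" for i \<psi>
    using aG[OF that] unfolding kernel_def carrier_Gbar one_mu by blast
  show "?q = 0" if AB: "?A \<and> ?B"
  proof -
    have "Gal_group (Gam n a) \<inter> S_set n a = {}"
      using Gal_S_empty[of n a] aQ AB by blast
    then show ?thesis by simp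
  qed
  obtain w where w: "mhom Qstar w" "\<forall>x\<in>Qstar. w x = 1 \<or> w x = - 1" "\<forall>i\<in>{1..n}. w (a i) = - 1"
    "\<not> ?A \<longrightarrow> w (-3) = - 1"
    using sign_character_exists[of n a, OF aQ assms(4)] by blast
  \<comment> \<open>Serves both conditions. If (a) fails, \<open>w (-3) = -1\<close> contradicts the
    premise under which \<open>f\<close> is examined; if (b) fails, \<open>f\<close> is the
    character \<open>\<psi>\<close> that is nontrivial on all \<open>a i\<close>.\<close>
  have pos: "?q \<noteq> 0"
    if f: "w (-3) = 1 \<Longrightarrow> mhom (Gam n a) f \<and> (\<forall>x\<in>Gam n a. x \<in> powers 3 \<longrightarrow> f x = 1) \<and> (\<forall>i\<in>{1..n}. f (a i) \<noteq> 1)" for f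
  proof -
    note P = Gal_S_positive[of n a \<nu>p w f, OF assms(2,3) w(1) w(2)[rule_format] w(3)[rule_format] f]
    have "measure (prod_measure (Gam n a) \<nu>p) (Gal_group (Gam n a) \<inter> S_set n a) > 0"
      "measure (prod_measure (Gam n a) \<nu>p) (Gal_group (Gam n a)) > 0" by (rule P; assumption)+
    then show ?thesis by simp
  qed
  show ?A if q: "?q = 0"
  proof (rule ccontr)
    assume "\<not> ?A"
    then have "w (-3) = - 1" using w(4) by blast
    then have "w (-3) \<noteq> 1" by simp
    then show False using pos q by blast
  qed
  show ?B if q: "?q = 0"
  proof (rule ccontr)
    assume "\<not> ?B"
    then obtain \<psi> where \<psi>: "\<psi> \<in> hom (Gbar (Gam n a) 3) (mu 3)" "\<forall>i\<in>{1..n}. \<psi> (cls 3 (a i)) \<noteq> 1"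
      using ker by blast
    have three: "(3::nat) \<ge> 1" by simp
    show False using pos[of "\<lambda>x. \<psi> (cls 3 x)"] q \<psi>(2) hom_Gbar_mhom[OF G three \<psi>(1)] by blast
  qed
  show "\<not> ?B" if C: ?C and D: ?D
  proof
    assume B: ?B
    have "a i \<notin> powers 3" if "i \<in> {1..n}" for i using C that unfolding powers_def by blast
    then obtain f where f: "cubic_character f" "\<forall>i\<in>{1..n}. f (a i) \<noteq> 1"
      using noncube_character[of n a] aQ D by blast
    have m: "mhom Qstar f" using f(1) unfolding cubic_character_def by blast
    have f3: "f x ^ 3 = 1" if x: "x \<in> Gam n a" for x
    proof -
      have xQ: "x \<in> Qstar" using x G(2) by blast
      then have "f (x ^ 3) = 1" using f(1) unfolding cubic_character_def powers_def by blast
      then show ?thesis using mhom_power[OF mgroup_Qstar m xQ, of 3] by simp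
    qed
    have f1: "f x = 1" if "x \<in> Gam n a" "x \<in> powers 3" for x using f(1) that unfolding cubic_character_def by blast
    obtain \<psi> where \<psi>: "\<psi> \<in> hom (Gbar (Gam n a) 3) (mu 3)" "\<forall>x\<in>Gam n a. \<psi> (cls 3 x) = f x"
      using mhom_hom_Gbar[of "Gam n a" f 3, OF G mhom_mono[OF m G(2)] f3 f1] by blast
    then obtain i where i: "i \<in> {1..n}" "cls 3 (a i) \<in> kernel (Gbar (Gam n a) 3) (mu 3) \<psi>" using B by blast
    then have "f (a i) = 1" using ker[OF i(1)] \<psi>(2) aG[OF i(1)] by simp
    then show False using f(2) i(1) by blast
  qed
qed

end
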